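(* Let $(X_n)_{n\ge 1}$ be independent identically distributed real random variables with $\mathbf{E}X_1=0$, $\mathbf{E}X_1^2=1$, and let $S_n=(X_1+\dots+X_n)/\sqrt n$. Let $\mathbf{E}|X_1|^s<+\infty$ for some real $s\ge 2$, and put $m=[s]$. Let $c$ denote an arbitrary number with $0<c<1$. Suppose that for $n$ large enough $S_n$ have absolutely continuous distributions with densities $\rho_n$. Then, for some probability densities $\widetilde\rho_n$, the following hold. a) As $n\to\infty$, uniformly for all $x\in\mathbf{R}$, $$(1+|x|^m)\,\big(\widetilde\rho_n(x)-\varphi_m(x)\big)=o\big(n^{-(s-2)/2}\big),$$ and $$(1+|x|^s)\big(\widetilde\rho_n(x)-\varphi_m(x)\big)=o\big(n^{-(s-2)/2}\big)+\left(1+|x|^{s-m}\right)\big(O(n^{-(m-1)/2})+o(n^{-(s-2)})\big).$$ b) $\int_{-\infty}^{+\infty}|\widetilde\rho_n(x)-\rho_n(x)|\,dx<c^n$ for all $n$ large enough. c) $\widetilde\rho_n(x)=\rho_n(x)$ almost everywhere, if $\rho_n$ is bounded (a.e.).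
   Context: $[s]$ denotes the integer part of $s$. The cumulants of $X_1$ are $\gamma_k=i^{-k}\frac{d^k}{dt^k}\log \mathbf{E}e^{itX_1}\big|_{t=0}$, $k=1,\dots,m$ (principal branch of the logarithm near $t=0$). Let $\varphi(x)=\frac1{\sqrt{2\pi}}e^{-x^2/2}$ and let $H_k$ be the Chebyshev–Hermite polynomials, $H_k(x)=(-1)^k e^{x^2/2}\frac{d^k}{dx^k}e^{-x^2/2}$. For $1\le k\le m-2$, $$q_k(x)=\varphi(x)\sum H_{k+2j}(x)\,\frac{1}{p_1!\cdots p_k!}\Big(\frac{\gamma_3}{3!}\Big)^{p_1}\cdots\Big(\frac{\gamma_{k+2}}{(k+2)!}\Big)^{p_k},$$ where the sum runs over all non-negative integer solutions $(p_1,\dots,p_k)$ of $p_1+2p_2+\dots+kp_k=k$, and $j=p_1+\dots+p_k$. The approximating function (depending on $n$) is $$\varphi_m(x)=\varphi(x)+\sum_{k=1}^{m-2}q_k(x)\,n^{-k/2}$$ (so $\varphi_2=\varphi$). *)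

theory Defs
  imports "HOL-Probability.Probability" "HOL-Library.Landau_Symbols"
begin

definition normalized_sum :: "(nat \<Rightarrow> 'a \<Rightarrow> real) \<Rightarrow> nat \<Rightarrow> 'a \<Rightarrow> real" where
  "normalized_sum X n \<omega> = (\<Sum>i=1..n. X i \<omega>) / sqrt (real n)"

definition prob_density :: "(real \<Rightarrow> real) \<Rightarrow> bool" where
  "prob_density f \<longleftrightarrow>
     f \<in> borel_measurable lborel \<and> (\<forall>x. 0 \<le> f x) \<and> (\<integral>\<^sup>+x. ennreal (f x) \<partial>lborel) = 1"

text \<open>Cumulants of a law \<open>\<mu>\<close> on the real line. The number \<open>\<i>\<^sup>-\<^sup>k (log char)\<^sup>(\<^sup>k\<^sup>) (0)\<close> is real
  whenever \<open>\<mu>\<close> has a finite absolute moment of order \<open>k\<close>; taking the real part only changes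
  its type.\<close>

definition cumulant :: "real measure \<Rightarrow> nat \<Rightarrow> real" where
  "cumulant \<mu> k =
     Re (inverse (\<i> ^ k) *
       ((\<lambda>f t. vector_derivative f (at t)) ^^ k) (\<lambda>t::real. Ln (char \<mu> t)) 0)"

definition hermite :: "nat \<Rightarrow> real \<Rightarrow> real" where
  "hermite k x = (-1) ^ k * exp (x\<^sup>2 / 2) * (deriv ^^ k) (\<lambda>y. exp (- y\<^sup>2 / 2)) x"

text \<open>Tuples \<open>(p\<^sub>1, \<dots>, p\<^sub>k)\<close> are encoded as extensional functions on \<open>{1..k}\<close>.\<close>

definition weight_solutions :: "nat \<Rightarrow> (nat \<Rightarrow> nat) set" where
  "weight_solutions k = {p \<in> {1..k} \<rightarrow>\<^sub>E UNIV. (\<Sum>i=1..k. i * p i) = k}"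

definition edgeworth_term :: "real measure \<Rightarrow> nat \<Rightarrow> real \<Rightarrow> real" where
  "edgeworth_term \<mu> k x =
     std_normal_density x *
     (\<Sum>p\<in>weight_solutions k.
        hermite (k + 2 * (\<Sum>i=1..k. p i)) x *
        (1 / (\<Prod>i=1..k. fact (p i))) *
        (\<Prod>i=1..k. (cumulant \<mu> (i + 2) / fact (i + 2)) ^ p i))"

definition edgeworth_approx :: "real measure \<Rightarrow> nat \<Rightarrow> nat \<Rightarrow> real \<Rightarrow> real" where
  "edgeworth_approx \<mu> m n x =
     std_normal_density x +
     (\<Sum>k=1..m - 2. edgeworth_term \<mu> k x * real n powr (- real k / 2))"

text \<open>Landau symbols as \<open>n \<rightarrow> \<infinity>\<close>, uniformly in the real argument \<open>x\<close>, are taken with respect to the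
  following filter: a property holds eventually iff for all large \<open>n\<close> it holds for every \<open>x\<close>.\<close>

abbreviation uniformly_in_x :: "(nat \<times> real) filter" where
  "uniformly_in_x \<equiv> sequentially \<times>\<^sub>F top"

lemma eventually_uniformly_in_x:
  "eventually P uniformly_in_x \<longleftrightarrow> (\<forall>\<^sub>F n in sequentially. \<forall>x. P (n, x))"
  by (auto simp: eventually_prod_filter elim: eventually_mono)

end

(*
Group the n summands into K blocks of N summands (N large enough for S_N to have a density) and one last,
longer block; rescale by sqrt n. The density p of a block is split into a tail part (|x| > 1), whose mass with
weight (1 + |x|)^s is o(n^(-s/2)) by the moment assumption, a part on [-1, 1] capped at a level L, and an
excess of arbitrarily small mass. Expand the K-fold convolution binomially. Terms containing the capped part
twice have integrable Fourier transforms, by Plancherel; tilting by exp (x) and exp (-x), that is, working with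
the Laplace transform on the lines Re w = 1 and Re w = -1, turns bounds for the transforms into bounds with
weight exp |x|. Terms without tails are compared with the transform of the Edgeworth approximation, terms with
tails cost a factor K o(n^(-s/2)) each, and all remaining terms together have mass less than c^n / 4: dropping
them and renormalising gives the new density. If some density is bounded, it has no excess, and the remaining
terms contain two tails, so they are bounded functions and nothing need be dropped. The Edgeworth polynomials
arise from exp (n Lambda (w / sqrt n)), where Lambda is the cumulant polynomial; truncation to [-1, 1] makes the
Laplace transform of a block as smooth as needed.
*)
theory Submission
  imports Defs "HOL-Probability.Probability" "HOL-Complex_Analysis.Complex_Analysis" "HOL-Real_Asymp.Real_Asymp"
begin

section \<open>Measures with a density and an atom at zero\<close>

text \<open>The obstacle is that the given densities may be unbounded for every n, so no power of
  the characteristic function need be integrable and a pointwise expansion can hold only after a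
  modification. Exponential weights replace the usual differentiation of transforms: a moment of
  non-integer order s corresponds to no derivative, whereas a truncated block has an entire
  transform and exp |x| dominates every power of |x|. Tails cannot be treated in this way; they
  enter only through weighted masses, and these multiply because (1 + |x|)^s is submultiplicative.
  Cutting at |x| = 1 after rescaling, that is at sqrt n, gives the Taylor error of a block and its
  tail mass the same order o(n^(-s/2)); at most n such errors add up to the rate of the theorem. The
  expansion is cut at K/2 tails: up to there enough central factors remain for Fourier decay, beyond
  it the tail masses alone beat the binomial coefficients. The number c enters the construction only
  through the cap L, which is set so high that the excess has mass at most (c^N/16)^4. The outcome
  is one estimate with weight (1 + |x|)^s and error o(n^(-(s-2)/2)), from which both formulas of a)
  are read off.\<close>

text \<open>A pair \<open>(a, f)\<close> stands for the measure \<open>a\<close> times the unit mass at \<open>0\<close> plus the measure with density \<open>f\<close>;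
  the atom provides the unit of convolution.\<close>

typedef adens = "{p :: ennreal \<times> (real \<Rightarrow> ennreal). snd p \<in> borel_measurable borel}"
  by (rule exI[of _ "(0, \<lambda>_. 0)"]) simp

setup_lifting type_definition_adens

lift_definition atom :: "adens \<Rightarrow> ennreal" is fst .

lift_definition dens :: "adens \<Rightarrow> real \<Rightarrow> ennreal" is snd .

text \<open>Junk value: a non-measurable function is sent to 0, which keeps the embedding
  total.\<close>

lift_definition of_dens :: "(real \<Rightarrow> ennreal) \<Rightarrow> adens" is
  "\<lambda>f. (0, if f \<in> borel_measurable borel then f else (\<lambda>_. 0))"
  by auto

lemma dens_measurable [measurable]: "dens x \<in> borel_measurable borel"
  by transfer simp

lemma adens_eqI: "atom x = atom y \<Longrightarrow> (\<And>t. dens x t = dens y t) \<Longrightarrow> x = y"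
  by transfer (auto simp: prod_eq_iff)

lemma atom_of_dens [simp]: "atom (of_dens f) = 0"
  by transfer simp

lemma dens_of_dens [simp]: "f \<in> borel_measurable borel \<Longrightarrow> dens (of_dens f) = f"
  by transfer simp

section \<open>Convolution of nonnegative functions\<close>

definition convol :: "(real \<Rightarrow> ennreal) \<Rightarrow> (real \<Rightarrow> ennreal) \<Rightarrow> real \<Rightarrow> ennreal" where
  "convol f g x = (\<integral>\<^sup>+y. f y * g (x - y) \<partial>lborel)"

lemma convol_measurable [measurable]:
  assumes [measurable]: "f \<in> borel_measurable borel" "g \<in> borel_measurable borel"
  shows "convol f g \<in> borel_measurable borel"
  unfolding convol_def[abs_def] by measurable

lemma convol_commute:
  assumes [measurable]: "f \<in> borel_measurable borel" "g \<in> borel_measurable borel"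
  shows "convol f g x = convol g f x"
  unfolding convol_def
  by (subst nn_integral_real_affine[where c = "-1" and t = x]) (simp_all add: mult.commute)

lemma convol_assoc:
  assumes [measurable]: "f \<in> borel_measurable borel" "g \<in> borel_measurable borel"
    "h \<in> borel_measurable borel"
  shows "convol (convol f g) h x = convol f (convol g h) x"
proof -
  have "convol (convol f g) h x = (\<integral>\<^sup>+y. (\<integral>\<^sup>+z. f z * g (y - z) * h (x - y) \<partial>lborel) \<partial>lborel)"
    unfolding convol_def by (simp add: nn_integral_multc)
  also have "\<dots> = (\<integral>\<^sup>+z. (\<integral>\<^sup>+y. f z * g (y - z) * h (x - y) \<partial>lborel) \<partial>lborel)"
    by (rule lborel_pair.Fubini') measurable
  also have "\<dots> = (\<integral>\<^sup>+z. f z * (\<integral>\<^sup>+y. g (y - z) * h (x - y) \<partial>lborel) \<partial>lborel)"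
    by (simp add: nn_integral_cmult mult.assoc)
  also have "\<dots> = (\<integral>\<^sup>+z. f z * (\<integral>\<^sup>+u. g u * h ((x - z) - u) \<partial>lborel) \<partial>lborel)"
  proof -
    have "(\<integral>\<^sup>+y. g (y - z) * h (x - y) \<partial>lborel) = (\<integral>\<^sup>+u. g u * h ((x - z) - u) \<partial>lborel)" for z
      by (subst nn_integral_real_affine[where c = 1 and t = z]) (simp_all add: algebra_simps)
    then show ?thesis by simp
  qed
  finally show ?thesis by (simp add: convol_def)
qed

lemma convol_add_left:
  assumes [measurable]: "f \<in> borel_measurable borel" "g \<in> borel_measurable borel"
    "h \<in> borel_measurable borel"
  shows "convol (\<lambda>t. f t + g t) h x = convol f h x + convol g h x"
  unfolding convol_def by (simp add: distrib_right nn_integral_add)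

lemma convol_cmult_left:
  assumes [measurable]: "f \<in> borel_measurable borel" "h \<in> borel_measurable borel"
  shows "convol (\<lambda>t. c * f t) h x = c * convol f h x"
  unfolding convol_def by (simp add: mult.assoc nn_integral_cmult)

lemma convol_add_right:
  assumes [measurable]: "f \<in> borel_measurable borel" "g \<in> borel_measurable borel"
    "h \<in> borel_measurable borel"
  shows "convol h (\<lambda>t. f t + g t) x = convol h f x + convol h g x"
  by (simp add: convol_commute[of h] convol_add_left)

lemma convol_cmult_right:
  assumes [measurable]: "f \<in> borel_measurable borel" "h \<in> borel_measurable borel"
  shows "convol h (\<lambda>t. c * f t) x = c * convol h f x"
  by (simp add: convol_commute[of h] convol_cmult_left)

text \<open>Tonelli and the translation x = y + u. Weight 1 gives multiplicativity of the mass; a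
  weight with \<phi> (y + u) \<le> \<phi> y * \<phi> u gives submultiplicativity of the weighted
  mass.\<close>

lemma nn_integral_convol_weight:
  fixes \<phi> :: "real \<Rightarrow> ennreal"
  assumes [measurable]: "f \<in> borel_measurable borel" "g \<in> borel_measurable borel"
    "\<phi> \<in> borel_measurable borel"
  shows "(\<integral>\<^sup>+x. \<phi> x * convol f g x \<partial>lborel) = (\<integral>\<^sup>+y. (\<integral>\<^sup>+u. \<phi> (y + u) * (f y * g u) \<partial>lborel) \<partial>lborel)"
proof -
  have "(\<integral>\<^sup>+x. \<phi> x * convol f g x \<partial>lborel)
      = (\<integral>\<^sup>+x. (\<integral>\<^sup>+y. \<phi> x * (f y * g (x - y)) \<partial>lborel) \<partial>lborel)"
    unfolding convol_def by (simp add: nn_integral_cmult)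
  also have "\<dots> = (\<integral>\<^sup>+y. (\<integral>\<^sup>+x. \<phi> x * (f y * g (x - y)) \<partial>lborel) \<partial>lborel)"
    by (rule lborel_pair.Fubini') measurable
  also have "\<dots> = (\<integral>\<^sup>+y. (\<integral>\<^sup>+u. \<phi> (y + u) * (f y * g u) \<partial>lborel) \<partial>lborel)"
  proof (rule nn_integral_cong)
    fix y
    show "(\<integral>\<^sup>+x. \<phi> x * (f y * g (x - y)) \<partial>lborel) = (\<integral>\<^sup>+u. \<phi> (y + u) * (f y * g u) \<partial>lborel)"
      by (subst nn_integral_real_affine[where c = 1 and t = y]) simp_all
  qed
  finally show ?thesis .
qed

text \<open>Values in \<open>ennreal\<close> keep all convolutions defined, so the semiring laws
  hold without integrability conditions. The purpose of the instance is to apply the binomial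
  theorem to convolution powers. There is no subtraction, so every later decomposition is a sum of
  nonnegative terms.\<close>

instantiation adens :: comm_semiring_1
begin

lift_definition zero_adens :: adens is "(0, \<lambda>_. 0)" by simp

lift_definition one_adens :: adens is "(1, \<lambda>_. 0)" by simp

lift_definition plus_adens :: "adens \<Rightarrow> adens \<Rightarrow> adens" is
  "\<lambda>p q. (fst p + fst q, \<lambda>t. snd p t + snd q t)" by simp

lift_definition times_adens :: "adens \<Rightarrow> adens \<Rightarrow> adens" is
  "\<lambda>p q. (fst p * fst q, \<lambda>t. fst p * snd q t + fst q * snd p t + convol (snd p) (snd q) t)" by simp

lemma atom_simps [simp]:
  "atom 0 = 0" "atom 1 = 1" "atom (x + y) = atom x + atom y" "atom (x * y) = atom x * atom y"
  by (transfer; simp)+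

lemma dens_simps:
  "dens 0 = (\<lambda>_. 0)" "dens 1 = (\<lambda>_. 0)" "dens (x + y) = (\<lambda>t. dens x t + dens y t)"
  "dens (x * y) = (\<lambda>t. atom x * dens y t + atom y * dens x t + convol (dens x) (dens y) t)"
  by (transfer; simp)+

instance
proof
  fix a b c :: adens
  show "a * b * c = a * (b * c)"
    by (rule adens_eqI)
       (simp_all add: dens_simps mult.assoc convol_add_left convol_cmult_left convol_add_right
          convol_cmult_right convol_assoc, simp add: algebra_simps)
  show "a * b = b * a"
    by (rule adens_eqI) (simp_all add: dens_simps convol_commute[of "dens a"] algebra_simps)
  show "(a + b) * c = a * c + b * c"
    by (rule adens_eqI) (simp_all add: dens_simps convol_add_left algebra_simps)
  show "1 * a = a" "0 * a = 0" "a * 0 = 0"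
    by (rule adens_eqI; simp add: dens_simps convol_def)+
  show "a + b + c = a + (b + c)" "a + b = b + a" "0 + a = a"
    by (rule adens_eqI; simp add: dens_simps algebra_simps)+
  have "atom 0 \<noteq> atom 1" by simp
  then show "(0::adens) \<noteq> 1" by metis
qed

end

section \<open>Mass, weighted mass and weighted sup bounds\<close>

definition mass :: "adens \<Rightarrow> ennreal" where
  "mass x = atom x + (\<integral>\<^sup>+t. dens x t \<partial>lborel)"

lemma mass_0 [simp]: "mass 0 = 0" and mass_1 [simp]: "mass 1 = 1"
  by (simp_all add: mass_def dens_simps)

lemma mass_add: "mass (x + y) = mass x + mass y"
  by (simp add: mass_def dens_simps nn_integral_add algebra_simps)

lemma mass_mult: "mass (x * y) = mass x * mass y"
proof -
  have "(\<integral>\<^sup>+t. convol (dens x) (dens y) t \<partial>lborel)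
      = (\<integral>\<^sup>+t. dens x t \<partial>lborel) * (\<integral>\<^sup>+t. dens y t \<partial>lborel)"
    using nn_integral_convol_weight[of "dens x" "dens y" "\<lambda>_. 1"]
    by (simp add: nn_integral_cmult nn_integral_multc)
  then show ?thesis
    by (simp add: mass_def dens_simps nn_integral_add nn_integral_cmult algebra_simps)
qed

lemma mass_power: "mass (x ^ k) = mass x ^ k"
  by (induction k) (simp_all add: mass_mult)

lemma mass_of_nat: "mass (of_nat k) = of_nat k"
  by (induction k) (simp_all add: mass_add)

lemma mass_sum: "mass (sum f A) = (\<Sum>i\<in>A. mass (f i))"
  by (induction A rule: infinite_finite_induct) (simp_all add: mass_add)

text \<open>The atom counts with factor 1, so that the unit has weighted mass 1; this is also the
  value at 0 of the polynomial weights used below.\<close>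

definition wmass :: "(real \<Rightarrow> real) \<Rightarrow> adens \<Rightarrow> ennreal" where
  "wmass \<phi> x = atom x + (\<integral>\<^sup>+t. ennreal (\<phi> t) * dens x t \<partial>lborel)"

text \<open>Such weights make the measures of finite weighted mass closed under convolution (a
  Beurling algebra). The instance in view is (1 + |x|)^s, through which all tails are
  controlled.\<close>

locale submult_weight =
  fixes \<phi> :: "real \<Rightarrow> real"
  assumes weight_measurable [measurable]: "\<phi> \<in> borel_measurable borel"
    and weight_ge_1: "1 \<le> \<phi> t"
    and weight_add: "\<phi> (t + u) \<le> \<phi> t * \<phi> u"
begin

lemma weight_nonneg: "0 \<le> \<phi> t"
  using weight_ge_1[of t] by linarith

lemma wmass_0 [simp]: "wmass \<phi> 0 = 0" and wmass_1 [simp]: "wmass \<phi> 1 = 1"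
  by (simp_all add: wmass_def dens_simps)

lemma wmass_add: "wmass \<phi> (x + y) = wmass \<phi> x + wmass \<phi> y"
  by (simp add: wmass_def dens_simps nn_integral_add algebra_simps)

lemma wmass_mult_le: "wmass \<phi> (x * y) \<le> wmass \<phi> x * wmass \<phi> y"
proof -
  have *: "ennreal (\<phi> (t + u)) * (dens x t * dens y u) \<le> (\<phi> t * dens x t) * (\<phi> u * dens y u)" for t u
  proof -
    have "ennreal (\<phi> (t + u)) \<le> ennreal (\<phi> t) * ennreal (\<phi> u)"
      using weight_add[of t u] weight_nonneg by (simp add: ennreal_mult'[symmetric] ennreal_leI)
    then have "ennreal (\<phi> (t + u)) * (dens x t * dens y u) \<le> ennreal (\<phi> t) * ennreal (\<phi> u) * (dens x t * dens y u)"
      by (rule mult_right_mono) simp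
    then show ?thesis by (simp add: algebra_simps)
  qed
  have "(\<integral>\<^sup>+t. \<phi> t * convol (dens x) (dens y) t \<partial>lborel)
      \<le> (\<integral>\<^sup>+t. (\<integral>\<^sup>+u. (\<phi> t * dens x t) * (\<phi> u * dens y u) \<partial>lborel) \<partial>lborel)"
    by (subst nn_integral_convol_weight) (auto intro!: nn_integral_mono *)
  also have "\<dots> = (\<integral>\<^sup>+t. \<phi> t * dens x t \<partial>lborel) * (\<integral>\<^sup>+u. \<phi> u * dens y u \<partial>lborel)"
    by (simp add: nn_integral_cmult nn_integral_multc)
  finally have le: "(\<integral>\<^sup>+t. \<phi> t * convol (dens x) (dens y) t \<partial>lborel) \<le> \<dots>" .
  have "wmass \<phi> (x * y) = atom x * atom y + (atom x * (\<integral>\<^sup>+t. \<phi> t * dens y t \<partial>lborel)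
      + atom y * (\<integral>\<^sup>+t. \<phi> t * dens x t \<partial>lborel)) + (\<integral>\<^sup>+t. \<phi> t * convol (dens x) (dens y) t \<partial>lborel)"
    unfolding wmass_def dens_simps
    by (simp add: distrib_left nn_integral_add nn_integral_cmult mult.left_commute[of "ennreal (\<phi> _)" "atom _"] add.assoc)
  also have "\<dots> \<le> wmass \<phi> x * wmass \<phi> y"
    unfolding wmass_def using le by (simp add: algebra_simps add_mono)
  finally show ?thesis .
qed

lemma wmass_of_nat [simp]: "wmass \<phi> (of_nat k) = of_nat k"
  by (induction k) (simp_all add: wmass_add)

lemma wmass_power_le: "wmass \<phi> (x ^ k) \<le> wmass \<phi> x ^ k"
proof (induction k)
  case (Suc k)
  show ?case
    using order_trans[OF wmass_mult_le[of x "x ^ k"] mult_left_mono[OF Suc]] by simp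
qed simp

lemma mass_le_wmass: "mass x \<le> wmass \<phi> x"
  unfolding mass_def wmass_def
  by (intro add_left_mono nn_integral_mono)
     (metis ennreal_1 ennreal_leI mult.left_neutral mult_right_mono weight_ge_1 zero_le)

definition wbounded :: "ennreal \<Rightarrow> adens \<Rightarrow> bool" where
  "wbounded C x \<longleftrightarrow> atom x = 0 \<and> (AE t in lborel. \<phi> t * dens x t \<le> C)"

lemma wbounded_0: "wbounded C 0"
  by (simp add: wbounded_def dens_simps)

lemma wbounded_mono: "wbounded C x \<Longrightarrow> C \<le> D \<Longrightarrow> wbounded D x"
  by (auto simp: wbounded_def elim!: eventually_mono intro: order_trans)

lemma wbounded_add: "wbounded C x \<Longrightarrow> wbounded D y \<Longrightarrow> wbounded (C + D) (x + y)"
  unfolding wbounded_def dens_simps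
  by (auto simp: distrib_left elim!: eventually_elim2 intro: add_mono)

lemma wbounded_sum: "(\<And>i. i \<in> A \<Longrightarrow> wbounded (C i) (f i)) \<Longrightarrow> wbounded (sum C A) (sum f A)"
  by (induction A rule: infinite_finite_induct) (simp_all add: wbounded_0 wbounded_add)

text \<open>Young's inequality for the exponents infinity and 1 in weighted form: the weight at t is
  at most \<phi> (t - u) * \<phi> u, the first factor goes to the bounded density and the second to
  the weighted mass. A single good factor thus bounds a long convolution pointwise.\<close>

lemma wbounded_mult:
  assumes "wbounded C x"
  shows "wbounded (C * wmass \<phi> y) (x * y)"
proof -
  from assms have 0: "atom x = 0" and ae: "AE t in lborel. \<phi> t * dens x t \<le> C"
    by (auto simp: wbounded_def)
  have conv: "\<phi> t * convol (dens x) (dens y) t \<le> C * (\<integral>\<^sup>+u. \<phi> u * dens y u \<partial>lborel)" for t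
  proof -
    have "\<phi> t * convol (dens x) (dens y) t = \<phi> t * convol (dens y) (dens x) t"
      by (simp add: convol_commute[of "dens x"])
    also have "\<dots> = (\<integral>\<^sup>+u. \<phi> t * (dens y u * dens x (t - u)) \<partial>lborel)"
      unfolding convol_def by (simp add: nn_integral_cmult)
    also have "\<dots> \<le> (\<integral>\<^sup>+u. C * (\<phi> u * dens y u) \<partial>lborel)"
    proof (rule nn_integral_mono_AE)
      \<comment> \<open>The exceptional null set is moved by u -> t - u, which preserves null
        sets.\<close>
      have "AE u in lborel. \<phi> (t + (-1) * u) * dens x (t + (-1) * u) \<le> C"
        by (rule AE_borel_affine[OF _ _ ae]) auto
      then show "AE u in lborel. \<phi> t * (dens y u * dens x (t - u)) \<le> C * (\<phi> u * dens y u)"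
      proof (rule eventually_mono)
        fix u assume u: "\<phi> (t + (-1) * u) * dens x (t + (-1) * u) \<le> C"
        have "ennreal (\<phi> t) \<le> \<phi> (t - u) * ennreal (\<phi> u)"
          using weight_add[of "t - u" u] weight_nonneg by (simp add: ennreal_mult'[symmetric] ennreal_leI)
        then have "\<phi> t * (dens y u * dens x (t - u)) \<le> \<phi> (t - u) * ennreal (\<phi> u) * (dens y u * dens x (t - u))"
          by (rule mult_right_mono) simp
        also have "\<dots> = (\<phi> (t - u) * dens x (t - u)) * (\<phi> u * dens y u)"
          by (simp add: algebra_simps)
        also have "\<dots> \<le> C * (\<phi> u * dens y u)"
          using u by (intro mult_right_mono) simp_all
        finally show "\<phi> t * (dens y u * dens x (t - u)) \<le> C * (\<phi> u * dens y u)" .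
      qed
    qed
    finally show ?thesis by (simp add: nn_integral_cmult)
  qed
  have "AE t in lborel. \<phi> t * dens (x * y) t \<le> C * wmass \<phi> y"
    using ae
  proof (rule eventually_mono)
    fix t assume t: "\<phi> t * dens x t \<le> C"
    have "\<phi> t * dens (x * y) t = atom y * (\<phi> t * dens x t) + \<phi> t * convol (dens x) (dens y) t"
      by (simp add: dens_simps 0 algebra_simps)
    also have "\<dots> \<le> atom y * C + C * (\<integral>\<^sup>+u. \<phi> u * dens y u \<partial>lborel)"
      by (intro add_mono conv mult_left_mono t) simp
    finally show "\<phi> t * dens (x * y) t \<le> C * wmass \<phi> y"
      by (simp add: wmass_def algebra_simps)
  qed
  then show ?thesis by (simp add: wbounded_def 0)
qed

end

section \<open>Exponential tilting\<close>

lift_definition tilt :: "real \<Rightarrow> adens \<Rightarrow> adens" is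
  "\<lambda>\<sigma> p. (fst p, \<lambda>t. ennreal (exp (\<sigma> * t)) * snd p t)" by simp

lemma atom_tilt [simp]: "atom (tilt \<sigma> x) = atom x"
  by transfer simp

lemma dens_tilt: "dens (tilt \<sigma> x) = (\<lambda>t. ennreal (exp (\<sigma> * t)) * dens x t)"
  by transfer simp

lemma tilt_0 [simp]: "tilt \<sigma> 0 = 0" and tilt_1 [simp]: "tilt \<sigma> 1 = 1"
  by (rule adens_eqI; simp add: dens_simps dens_tilt)+

lemma tilt_add: "tilt \<sigma> (x + y) = tilt \<sigma> x + tilt \<sigma> y"
  by (rule adens_eqI) (simp_all add: dens_simps dens_tilt algebra_simps)

text \<open>The exponential turns sums into products, exp (\<sigma> * t) = exp (\<sigma> * u) * exp
  (\<sigma> * (t - u)), so it passes through a convolution. Transforms on the line Re w = \<sigma>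
  therefore multiply like ordinary Fourier transforms.\<close>

lemma tilt_mult: "tilt \<sigma> (x * y) = tilt \<sigma> x * tilt \<sigma> y"
proof (rule adens_eqI)
  fix t
  have "exp (\<sigma> * t) * convol (dens x) (dens y) t = convol (dens (tilt \<sigma> x)) (dens (tilt \<sigma> y)) t"
    unfolding convol_def dens_tilt
  proof (subst nn_integral_cmult[symmetric], measurable, rule nn_integral_cong)
    fix u
    have "ennreal (exp (\<sigma> * t)) = ennreal (exp (\<sigma> * u)) * ennreal (exp (\<sigma> * (t - u)))"
      by (simp add: ennreal_mult'[symmetric] exp_add[symmetric] algebra_simps)
    then show "exp (\<sigma> * t) * (dens x u * dens y (t - u))
        = exp (\<sigma> * u) * dens x u * (exp (\<sigma> * (t - u)) * dens y (t - u))"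
      by (simp add: algebra_simps)
  qed
  then show "dens (tilt \<sigma> (x * y)) t = dens (tilt \<sigma> x * tilt \<sigma> y) t"
    by (simp add: dens_simps dens_tilt algebra_simps)
qed simp

lemma tilt_power: "tilt \<sigma> (x ^ k) = tilt \<sigma> x ^ k"
  by (induction k) (simp_all add: tilt_mult)

lemma tilt_of_nat [simp]: "tilt \<sigma> (of_nat k) = of_nat k"
  by (induction k) (simp_all add: tilt_add)

section \<open>Fourier transforms of measures with a density and an atom\<close>

lemma AE_finite_density:
  fixes f :: "real \<Rightarrow> ennreal"
  assumes [measurable]: "f \<in> borel_measurable borel" and "(\<integral>\<^sup>+y. f y \<partial>lborel) < \<infinity>"
  shows "AE y in lborel. f y = ennreal (enn2real (f y))"
proof -
  have "AE y in lborel. f y \<noteq> \<infinity>"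
    using assms(2) by (intro nn_integral_PInf_AE) auto
  then show ?thesis
    by (auto elim!: eventually_mono simp: less_top)
qed

lemma integrable_enn2real:
  fixes f :: "real \<Rightarrow> ennreal"
  assumes [measurable]: "f \<in> borel_measurable borel" and fin: "(\<integral>\<^sup>+y. f y \<partial>lborel) < \<infinity>"
  shows "integrable lborel (\<lambda>y. enn2real (f y))"
proof (rule integrableI_nonneg)
  have "(\<integral>\<^sup>+y. ennreal (enn2real (f y)) \<partial>lborel) = (\<integral>\<^sup>+y. f y \<partial>lborel)"
    using AE_finite_density[OF assms] by (intro nn_integral_cong_AE) (auto elim: eventually_mono)
  then show "(\<integral>\<^sup>+y. ennreal (enn2real (f y)) \<partial>lborel) < \<infinity>" using fin by simp
qed auto

lemma integrable_scaleR_iexp: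
  fixes h :: "real \<Rightarrow> real"
  assumes "integrable lborel h"
  shows "integrable lborel (\<lambda>y. h y *\<^sub>R iexp (t * y))"
  by (rule Bochner_Integration.integrable_bound[OF assms]) (use assms in auto)

lemma char_density:
  fixes f :: "real \<Rightarrow> ennreal"
  assumes [measurable]: "f \<in> borel_measurable borel" and fin: "(\<integral>\<^sup>+y. f y \<partial>lborel) < \<infinity>"
  shows "char (density lborel f) t = (\<integral>y. enn2real (f y) *\<^sub>R iexp (t * y) \<partial>lborel)"
proof -
  have "density lborel f = density lborel (\<lambda>y. ennreal (enn2real (f y)))"
    by (rule density_cong) (use AE_finite_density[OF assms] in auto)
  then show ?thesis
    unfolding char_def by (simp add: integral_density)
qed

lemma char_density_add:
  fixes f g :: "real \<Rightarrow> ennreal"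
  assumes [measurable]: "f \<in> borel_measurable borel" "g \<in> borel_measurable borel"
    and fin: "(\<integral>\<^sup>+y. f y \<partial>lborel) < \<infinity>" "(\<integral>\<^sup>+y. g y \<partial>lborel) < \<infinity>"
  shows "char (density lborel (\<lambda>y. f y + g y)) t = char (density lborel f) t + char (density lborel g) t"
proof -
  have "char (density lborel (\<lambda>y. f y + g y)) t = (\<integral>y. enn2real (f y + g y) *\<^sub>R iexp (t * y) \<partial>lborel)"
    by (rule char_density) (use fin in \<open>auto simp: nn_integral_add\<close>)
  also have "\<dots> = (\<integral>y. enn2real (f y) *\<^sub>R iexp (t * y) + enn2real (g y) *\<^sub>R iexp (t * y) \<partial>lborel)"
  proof (rule integral_cong_AE)
    show "AE y in lborel. enn2real (f y + g y) *\<^sub>R iexp (t * y)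
        = enn2real (f y) *\<^sub>R iexp (t * y) + enn2real (g y) *\<^sub>R iexp (t * y)"
      using AE_finite_density[OF assms(1) fin(1)] AE_finite_density[OF assms(2) fin(2)]
    proof eventually_elim
      case (elim y)
      have "enn2real (f y + g y) = enn2real (f y) + enn2real (g y)"
        by (subst elim(1), subst elim(2), subst ennreal_plus[symmetric]) (auto simp del: ennreal_plus)
      then show ?case by (simp add: scaleR_add_left)
    qed
  qed auto
  also have "\<dots> = char (density lborel f) t + char (density lborel g) t"
    unfolding char_density[OF assms(1) fin(1)] char_density[OF assms(2) fin(2)]
    by (intro Bochner_Integration.integral_add integrable_scaleR_iexp integrable_enn2real assms)
  finally show ?thesis .
qed

lemma char_density_cmult:
  fixes f :: "real \<Rightarrow> ennreal"
  assumes [measurable]: "f \<in> borel_measurable borel"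
    and fin: "(\<integral>\<^sup>+y. f y \<partial>lborel) < \<infinity>" and c: "c < \<infinity>"
  shows "char (density lborel (\<lambda>y. c * f y)) t = enn2real c * char (density lborel f) t"
proof -
  have "char (density lborel (\<lambda>y. c * f y)) t = (\<integral>y. enn2real (c * f y) *\<^sub>R iexp (t * y) \<partial>lborel)"
    by (rule char_density) (use fin c in \<open>auto simp: nn_integral_cmult ennreal_mult_less_top\<close>)
  then show ?thesis
    using fin by (simp add: char_density enn2real_mult scaleR_conv_of_real mult.assoc)
qed

lemma char_convolution:
  fixes M N :: "real measure"
  assumes M: "finite_measure M" and N: "finite_measure N" and [simp]: "sets M = sets borel" "sets N = sets borel"
  shows "char (M \<star> N) t = char M t * char N t"
proof -
  interpret M: finite_measure M by fact
  interpret N: finite_measure N by fact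
  interpret P: pair_sigma_finite M N ..
  have [measurable_cong]: "sets M = sets borel" "sets N = sets borel" by simp_all
  interpret MN: finite_measure "M \<Otimes>\<^sub>M N" by (rule finite_measure_pair_measure; fact)
  have "char (M \<star> N) t = (\<integral>z. iexp (t * (case z of (x, y) \<Rightarrow> x + y)) \<partial>(M \<Otimes>\<^sub>M N))"
    unfolding char_def convolution_def by (subst integral_distr) auto
  also have "\<dots> = (\<integral>z. (case z of (x, y) \<Rightarrow> iexp (t * x) * iexp (t * y)) \<partial>(M \<Otimes>\<^sub>M N))"
    by (intro Bochner_Integration.integral_cong) (auto simp: exp_add[symmetric] algebra_simps)
  also have "\<dots> = (\<integral>x. (\<integral>y. iexp (t * x) * iexp (t * y) \<partial>N) \<partial>M)"
    by (rule P.integral_fst[symmetric], rule MN.integrable_const_bound[where B = 1])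
       (auto simp: norm_mult)
  also have "\<dots> = char M t * char N t"
    unfolding char_def by simp
  finally show ?thesis .
qed

lemma finite_measure_density_lborel:
  fixes f :: "real \<Rightarrow> ennreal"
  assumes [measurable]: "f \<in> borel_measurable borel" and fin: "(\<integral>\<^sup>+y. f y \<partial>lborel) < \<infinity>"
  shows "finite_measure (density lborel f)"
  by (rule finite_measureI) (use fin in \<open>auto simp: emeasure_density\<close>)

lemma char_density_convol:
  fixes f g :: "real \<Rightarrow> ennreal"
  assumes [measurable]: "f \<in> borel_measurable borel" "g \<in> borel_measurable borel"
    and fin: "(\<integral>\<^sup>+y. f y \<partial>lborel) < \<infinity>" "(\<integral>\<^sup>+y. g y \<partial>lborel) < \<infinity>"
  shows "char (density lborel (convol f g)) t = char (density lborel f) t * char (density lborel g) t"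
proof -
  have "(\<lambda>x. \<integral>\<^sup>+y. f (x - y) * g y \<partial>lborel) = convol f g"
    by (rule ext, subst convol_commute) (simp_all add: convol_def mult.commute)
  then have "density lborel f \<star> density lborel g = density lborel (convol f g)"
    using fin by (subst convolution_density) (auto simp: finite_measure_density_lborel)
  then show ?thesis
    using char_convolution[of "density lborel f" "density lborel g" t] fin
    by (simp add: finite_measure_density_lborel)
qed

text \<open>The Fourier transform of the whole measure; the atom at 0 contributes a constant. The
  rules for sums and products ask for finite mass, because \<open>enn2real\<close> and the Bochner
  integral send infinite quantities to 0.\<close>

definition ch :: "adens \<Rightarrow> real \<Rightarrow> complex" where
  "ch x t = enn2real (atom x) + char (density lborel (dens x)) t"

lemma mass_finiteD:
  assumes "mass x < \<infinity>"
  shows "atom x < \<infinity>" "(\<integral>\<^sup>+t. dens x t \<partial>lborel) < \<infinity>"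
  using assms by (auto simp: mass_def)

lemma ch_0 [simp]: "ch 0 t = 0" and ch_1 [simp]: "ch 1 t = 1"
  by (simp_all add: ch_def dens_simps char_density)

lemma ch_add:
  assumes "mass x < \<infinity>" "mass y < \<infinity>"
  shows "ch (x + y) t = ch x t + ch y t"
  using mass_finiteD[OF assms(1)] mass_finiteD[OF assms(2)]
  by (simp add: ch_def dens_simps char_density_add enn2real_plus)

lemma ch_mult:
  assumes "mass x < \<infinity>" "mass y < \<infinity>"
  shows "ch (x * y) t = ch x t * ch y t"
proof -
  note x = mass_finiteD[OF assms(1)] and y = mass_finiteD[OF assms(2)]
  let ?c = "\<lambda>f. char (density lborel f) t"
  have fin: "(\<integral>\<^sup>+t. convol (dens x) (dens y) t \<partial>lborel) < \<infinity>"
    using x y nn_integral_convol_weight[of "dens x" "dens y" "\<lambda>_. 1"]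
    by (simp add: nn_integral_cmult nn_integral_multc ennreal_mult_less_top)
  have "?c (\<lambda>t. atom x * dens y t + atom y * dens x t + convol (dens x) (dens y) t)
      = ?c (\<lambda>t. atom x * dens y t) + ?c (\<lambda>t. atom y * dens x t) + ?c (convol (dens x) (dens y))"
    using x y fin by (simp add: char_density_add nn_integral_add nn_integral_cmult ennreal_mult_less_top)
  then show ?thesis
    using x y by (simp add: ch_def dens_simps char_density_cmult char_density_convol enn2real_mult algebra_simps)
qed

lemma mass_power_finite: "mass x < \<infinity> \<Longrightarrow> mass (x ^ k) < \<infinity>"
  by (induction k) (simp_all add: mass_mult ennreal_mult_less_top)

lemma ch_power: "mass x < \<infinity> \<Longrightarrow> ch (x ^ k) t = ch x t ^ k"
proof (induction k)
  case (Suc k)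
  then show ?case by (simp only: power_Suc ch_mult mass_power_finite)
qed simp

lemma ch_of_nat [simp]: "ch (of_nat k) t = of_nat k"
proof (induction k)
  case (Suc k)
  then show ?case by (simp add: ch_add mass_of_nat of_nat_less_top)
qed simp

lemma cmod_ch_le:
  assumes "mass x < \<infinity>"
  shows "cmod (ch x t) \<le> enn2real (mass x)"
proof -
  note x = mass_finiteD[OF assms]
  have "cmod (char (density lborel (dens x)) t) \<le> (\<integral>y. enn2real (dens x y) \<partial>lborel)"
    by (subst char_density, simp, rule x(2), rule order_trans[OF integral_norm_bound]) simp
  also have "\<dots> = enn2real (\<integral>\<^sup>+t. dens x t \<partial>lborel)"
  proof -
    have "(\<integral>\<^sup>+t. dens x t \<partial>lborel) = (\<integral>\<^sup>+t. ennreal (enn2real (dens x t)) \<partial>lborel)"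
      by (rule nn_integral_cong_AE, rule AE_finite_density) (use x in auto)
    also have "\<dots> = ennreal (\<integral>y. enn2real (dens x y) \<partial>lborel)"
      by (rule nn_integral_eq_integral, rule integrable_enn2real) (use x in auto)
    finally show ?thesis by (simp add: integral_nonneg_AE)
  qed
  finally show ?thesis
    using x norm_triangle_ineq[of "complex_of_real (enn2real (atom x))" "char (density lborel (dens x)) t"]
    by (simp add: ch_def mass_def enn2real_plus)
qed

section \<open>Fourier bounds\<close>

lemma gaussian_Fourier:
  fixes \<epsilon> u :: real
  assumes "\<epsilon> > 0"
  shows "(\<integral>t. exp (- (\<epsilon> * t)\<^sup>2 / 2) *\<^sub>R iexp (u * t) \<partial>lborel) = 2 * pi * normal_density 0 \<epsilon> u"
proof -
  have "complex_of_real (exp (- (u / \<epsilon>)\<^sup>2 / 2)) = (\<integral>x. std_normal_density x *\<^sub>R iexp (u / \<epsilon> * x) \<partial>lborel)"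
    using fun_cong[OF char_std_normal_distribution, of "u / \<epsilon>"]
    by (simp add: char_def integral_density normal_density_nonneg)
  also have "\<dots> = \<epsilon> *\<^sub>R (\<integral>t. std_normal_density (\<epsilon> * t) *\<^sub>R iexp (u * t) \<partial>lborel)"
    using assms by (subst lborel_integral_real_affine[where c = \<epsilon> and t = 0]) auto
  also have "(\<lambda>t. std_normal_density (\<epsilon> * t) *\<^sub>R iexp (u * t))
      = (\<lambda>t. (1 / sqrt (2 * pi)) *\<^sub>R (exp (- (\<epsilon> * t)\<^sup>2 / 2) *\<^sub>R iexp (u * t)))"
    by (auto simp: std_normal_density_def)
  finally have "complex_of_real (exp (- (u / \<epsilon>)\<^sup>2 / 2))
      = \<epsilon> *\<^sub>R ((1 / sqrt (2 * pi)) *\<^sub>R (\<integral>t. exp (- (\<epsilon> * t)\<^sup>2 / 2) *\<^sub>R iexp (u * t) \<partial>lborel))"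
    by (simp only: integral_scaleR_right)
  then have "(\<integral>t. exp (- (\<epsilon> * t)\<^sup>2 / 2) *\<^sub>R iexp (u * t) \<partial>lborel)
      = (sqrt (2 * pi) / \<epsilon>) *\<^sub>R complex_of_real (exp (- (u / \<epsilon>)\<^sup>2 / 2))"
    using assms by simp
  also have "\<dots> = complex_of_real (sqrt (2 * pi) / \<epsilon> * exp (- (u / \<epsilon>)\<^sup>2 / 2))"
    by (simp add: scaleR_conv_of_real)
  also have "sqrt (2 * pi) / \<epsilon> * exp (- (u / \<epsilon>)\<^sup>2 / 2) = 2 * pi * normal_density 0 \<epsilon> u"
    using assms
    by (simp add: normal_density_def real_sqrt_mult real_div_sqrt field_simps power_divide)
  finally show ?thesis .
qed

lemma integrable_gaussian:
  fixes \<epsilon> :: real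
  assumes "\<epsilon> > 0"
  shows "integrable lborel (\<lambda>t. exp (- (\<epsilon> * t)\<^sup>2 / 2))"
proof -
  have "integrable lborel (\<lambda>t. sqrt (2 * pi) / \<epsilon> * normal_density 0 (1 / \<epsilon>) t)"
    using assms by (intro integrable_mult_right integrable_normal_density) simp
  also have "(\<lambda>t. sqrt (2 * pi) / \<epsilon> * normal_density 0 (1 / \<epsilon>) t) = (\<lambda>t. exp (- (\<epsilon> * t)\<^sup>2 / 2))"
    using assms by (auto simp: normal_density_def real_sqrt_mult real_sqrt_divide power_mult_distrib field_simps)
  finally show ?thesis .
qed

lemma char_uminus: "char M (- t) = cnj (char M t)"
proof -
  have "(\<lambda>x. iexp (- t * x)) = (\<lambda>x. cnj (iexp (t * x)))"
    by (auto simp: exp_cnj)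
  then show ?thesis unfolding char_def by simp
qed

text \<open>The squared modulus is the characteristic function of the difference of two independent
  points.\<close>

lemma cmod_char_power2_eq:
  fixes M :: "real measure"
  assumes M: "finite_measure M" and [simp]: "sets M = sets borel"
  shows "of_real ((cmod (char M t))\<^sup>2) = (\<integral>z. iexp (t * (fst z - snd z)) \<partial>(M \<Otimes>\<^sub>M M))"
proof -
  interpret M: finite_measure M by fact
  interpret P: pair_sigma_finite M M ..
  have [measurable_cong]: "sets M = sets borel" by simp
  interpret MM: finite_measure "M \<Otimes>\<^sub>M M" by (rule finite_measure_pair_measure; fact)
  have "of_real ((cmod (char M t))\<^sup>2) = char M t * char M (- t)"
    by (simp only: complex_norm_square char_uminus)
  also have "\<dots> = (\<integral>x. (\<integral>y. iexp (t * x) * iexp (- t * y) \<partial>M) \<partial>M)"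
    unfolding char_def by simp
  also have "\<dots> = (\<integral>z. (case z of (x, y) \<Rightarrow> iexp (t * x) * iexp (- t * y)) \<partial>(M \<Otimes>\<^sub>M M))"
    by (rule P.integral_fst, rule MM.integrable_const_bound[where B = 1]) (auto simp: norm_mult)
  also have "\<dots> = (\<integral>z. iexp (t * (fst z - snd z)) \<partial>(M \<Otimes>\<^sub>M M))"
    by (intro Bochner_Integration.integral_cong) (auto simp: exp_add[symmetric] algebra_simps)
  finally show ?thesis .
qed

lemma ennreal_integral_le_nn_integral:
  fixes f :: "'a \<Rightarrow> real"
  assumes "\<And>x. 0 \<le> f x"
  shows "ennreal (integral\<^sup>L M f) \<le> (\<integral>\<^sup>+x. ennreal (f x) \<partial>M)"
proof (cases "integrable M f")
  case True
  then show ?thesis using assms by (simp add: nn_integral_eq_integral)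
qed (simp add: not_integrable_integral_eq)

text \<open>The Gaussian factor makes Fubini legitimate. Integrated against it, the squared modulus
  becomes 2 * pi times a normal density evaluated at the difference of two points; the bound B is
  applied to the density of one of them, in whose variable the normal density integrates to
  1.\<close>

lemma Plancherel_gaussian_le:
  fixes f :: "real \<Rightarrow> ennreal"
  assumes [measurable]: "f \<in> borel_measurable borel" and fin: "(\<integral>\<^sup>+y. f y \<partial>lborel) < \<infinity>"
    and bnd: "\<And>y. f y \<le> ennreal B" and "\<epsilon> > 0" and "0 \<le> B"
  shows "(\<integral>\<^sup>+t. ennreal ((cmod (char (density lborel f) t))\<^sup>2 * exp (- (\<epsilon> * t)\<^sup>2 / 2)) \<partial>lborel)
    \<le> ennreal (2 * pi * B) * (\<integral>\<^sup>+y. f y \<partial>lborel)"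
proof -
  define M where "M = density lborel f"
  define G where "G = density lborel (\<lambda>t. ennreal (exp (- (\<epsilon> * t)\<^sup>2 / 2)))"
  have M: "finite_measure M" unfolding M_def using fin by (simp add: finite_measure_density_lborel)
  have sM [measurable_cong]: "sets M = sets borel" by (simp add: M_def)
  have sG [measurable_cong]: "sets G = sets borel" by (simp add: G_def)
  have gfin: "(\<integral>\<^sup>+t. ennreal (exp (- (\<epsilon> * t)\<^sup>2 / 2)) \<partial>lborel) < \<infinity>"
    using integrable_gaussian[OF \<open>\<epsilon> > 0\<close>] by (simp add: integrable_iff_bounded)
  have G: "finite_measure G" unfolding G_def by (rule finite_measure_density_lborel[OF _ gfin]) simp
  interpret M: finite_measure M by fact
  interpret G: finite_measure G by fact
  have MM: "finite_measure (M \<Otimes>\<^sub>M M)" by (rule finite_measure_pair_measure; fact)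
  interpret MM: finite_measure "M \<Otimes>\<^sub>M M" by fact
  interpret P: pair_sigma_finite G "M \<Otimes>\<^sub>M M" ..
  interpret PP: finite_measure "G \<Otimes>\<^sub>M (M \<Otimes>\<^sub>M M)" by (rule finite_measure_pair_measure; fact)
  have charG: "char G u = 2 * pi * normal_density 0 \<epsilon> u" for u
    unfolding G_def using char_density[OF _ gfin, of u] gaussian_Fourier[OF \<open>\<epsilon> > 0\<close>, of u] by simp
  have charG': "(\<integral>t. iexp (t * u) \<partial>G) = 2 * pi * normal_density 0 \<epsilon> u" for u
    using charG[of u] by (simp only: char_def mult.commute[of u])
  have bd: "(cmod (char M t))\<^sup>2 \<le> (measure M (space M))\<^sup>2" for t
  proof (rule power_mono)
    have "cmod (char M t) \<le> (\<integral>x. 1 \<partial>M)"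
      unfolding char_def by (rule order_trans[OF integral_norm_bound]) simp
    then show "cmod (char M t) \<le> measure M (space M)" by simp
  qed simp
  have [measurable]: "char M \<in> borel_measurable borel"
    unfolding char_def[abs_def] by measurable
  have iG: "integrable G (\<lambda>t. (cmod (char M t))\<^sup>2)"
    using bd by (intro G.integrable_const_bound[where B = "(measure M (space M))\<^sup>2"]) auto
  have "of_real (\<integral>t. (cmod (char M t))\<^sup>2 \<partial>G) = (\<integral>t. complex_of_real ((cmod (char M t))\<^sup>2) \<partial>G)"
    by (rule integral_complex_of_real[symmetric])
  also have "\<dots> = (\<integral>t. (\<integral>z. iexp (t * (fst z - snd z)) \<partial>(M \<Otimes>\<^sub>M M)) \<partial>G)"
    by (simp only: cmod_char_power2_eq[OF M sM])
  also have "\<dots> = (\<integral>z. (\<integral>t. iexp (t * (fst z - snd z)) \<partial>G) \<partial>(M \<Otimes>\<^sub>M M))"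
    by (rule P.Fubini_integral[symmetric], rule PP.integrable_const_bound[where B = 1]) auto
  also have "\<dots> = (\<integral>z. complex_of_real (2 * pi * normal_density 0 \<epsilon> (fst z - snd z)) \<partial>(M \<Otimes>\<^sub>M M))"
    by (simp only: charG')
  also have "\<dots> = of_real (\<integral>z. 2 * pi * normal_density 0 \<epsilon> (fst z - snd z) \<partial>(M \<Otimes>\<^sub>M M))"
    by (rule integral_complex_of_real)
  finally have eq: "(\<integral>t. (cmod (char M t))\<^sup>2 \<partial>G) = (\<integral>z. 2 * pi * normal_density 0 \<epsilon> (fst z - snd z) \<partial>(M \<Otimes>\<^sub>M M))"
    by (simp only: of_real_eq_iff)
  have "(\<integral>\<^sup>+t. ennreal ((cmod (char M t))\<^sup>2 * exp (- (\<epsilon> * t)\<^sup>2 / 2)) \<partial>lborel) = (\<integral>\<^sup>+t. ennreal ((cmod (char M t))\<^sup>2) \<partial>G)"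
    unfolding G_def by (simp add: nn_integral_density ennreal_mult' mult.commute)
  also have "\<dots> = ennreal (\<integral>t. (cmod (char M t))\<^sup>2 \<partial>G)"
    by (rule nn_integral_eq_integral[OF iG]) simp
  also have "\<dots> \<le> (\<integral>\<^sup>+z. ennreal (2 * pi * normal_density 0 \<epsilon> (fst z - snd z)) \<partial>(M \<Otimes>\<^sub>M M))"
    unfolding eq by (rule ennreal_integral_le_nn_integral) (simp add: normal_density_nonneg)
  also have "\<dots> = (\<integral>\<^sup>+x. (\<integral>\<^sup>+y. ennreal (2 * pi * normal_density 0 \<epsilon> (x - y)) \<partial>M) \<partial>M)"
    by (subst M.nn_integral_fst[symmetric]) auto
  also have "\<dots> \<le> (\<integral>\<^sup>+x. ennreal (2 * pi * B) \<partial>M)"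
  proof (rule nn_integral_mono)
    fix x
    have "(\<integral>\<^sup>+y. ennreal (2 * pi * normal_density 0 \<epsilon> (x - y)) \<partial>M)
        = (\<integral>\<^sup>+y. f y * ennreal (2 * pi * normal_density 0 \<epsilon> (x - y)) \<partial>lborel)"
      unfolding M_def by (simp add: nn_integral_density)
    also have "\<dots> \<le> (\<integral>\<^sup>+y. ennreal (2 * pi * B) * ennreal (normal_density x \<epsilon> y) \<partial>lborel)"
    proof (rule nn_integral_mono)
      fix y
      have "f y * ennreal (2 * pi * normal_density 0 \<epsilon> (x - y)) \<le> ennreal B * ennreal (2 * pi * normal_density 0 \<epsilon> (x - y))"
        by (intro mult_right_mono bnd) simp
      also have "\<dots> = ennreal (2 * pi * B) * ennreal (normal_density x \<epsilon> y)"
        using \<open>0 \<le> B\<close> by (simp add: ennreal_mult'[symmetric] normal_density_def power2_commute algebra_simps)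
      finally show "f y * ennreal (2 * pi * normal_density 0 \<epsilon> (x - y)) \<le> \<dots>" .
    qed
    also have "\<dots> = ennreal (2 * pi * B) * (\<integral>\<^sup>+y. ennreal (normal_density x \<epsilon> y) \<partial>lborel)"
      by (simp add: nn_integral_cmult)
    also have "(\<integral>\<^sup>+y. ennreal (normal_density x \<epsilon> y) \<partial>lborel) = 1"
      using \<open>\<epsilon> > 0\<close> by (subst nn_integral_eq_integral) (auto simp: normal_density_nonneg)
    finally show "(\<integral>\<^sup>+y. ennreal (2 * pi * normal_density 0 \<epsilon> (x - y)) \<partial>M) \<le> ennreal (2 * pi * B)" by simp
  qed
  also have "\<dots> = ennreal (2 * pi * B) * (\<integral>\<^sup>+y. f y \<partial>lborel)"
    by (simp add: M_def emeasure_density)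
  finally show ?thesis by (simp add: M_def)
qed

text \<open>The Gaussian is flattened with \<epsilon> = 1 / (n + 1). Fatou's lemma passes to the
  limit without prior knowledge that the transform is square integrable.\<close>

lemma Plancherel_le:
  fixes f :: "real \<Rightarrow> ennreal"
  assumes [measurable]: "f \<in> borel_measurable borel" and fin: "(\<integral>\<^sup>+y. f y \<partial>lborel) < \<infinity>"
    and bnd: "\<And>y. f y \<le> ennreal B" and "0 \<le> B"
  shows "(\<integral>\<^sup>+t. ennreal ((cmod (char (density lborel f) t))\<^sup>2) \<partial>lborel)
    \<le> ennreal (2 * pi * B) * (\<integral>\<^sup>+y. f y \<partial>lborel)"
proof -
  let ?M = "density lborel f"
  let ?u = "\<lambda>n t. ennreal ((cmod (char ?M t))\<^sup>2 * exp (- (1 / real (Suc n) * t)\<^sup>2 / 2))"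
  interpret M: finite_measure ?M using fin by (simp add: finite_measure_density_lborel)
  have [measurable]: "char ?M \<in> borel_measurable borel"
    unfolding char_def[abs_def] by measurable
  have lim: "(\<lambda>n. ?u n t) \<longlonglongrightarrow> ennreal ((cmod (char ?M t))\<^sup>2)" for t
  proof (rule tendsto_ennrealI)
    have "(\<lambda>n. 1 / real (Suc n)) \<longlonglongrightarrow> 0"
      using LIMSEQ_inverse_real_of_nat by (simp add: inverse_eq_divide)
    then have "(\<lambda>n. (cmod (char ?M t))\<^sup>2 * exp (- (1 / real (Suc n) * t)\<^sup>2 / 2))
        \<longlonglongrightarrow> (cmod (char ?M t))\<^sup>2 * exp (- (0 * t)\<^sup>2 / 2)"
      by (intro tendsto_intros) auto
    then show "(\<lambda>n. (cmod (char ?M t))\<^sup>2 * exp (- (1 / real (Suc n) * t)\<^sup>2 / 2)) \<longlonglongrightarrow> (cmod (char ?M t))\<^sup>2"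
      by simp
  qed
  have "(\<integral>\<^sup>+t. ennreal ((cmod (char ?M t))\<^sup>2) \<partial>lborel) = (\<integral>\<^sup>+t. liminf (\<lambda>n. ?u n t) \<partial>lborel)"
    by (intro nn_integral_cong) (rule lim_imp_Liminf[symmetric, OF _ lim], simp)
  also have "\<dots> \<le> liminf (\<lambda>n. \<integral>\<^sup>+t. ?u n t \<partial>lborel)"
    by (rule nn_integral_liminf) measurable
  also have "\<dots> \<le> liminf (\<lambda>n::nat. ennreal (2 * pi * B) * (\<integral>\<^sup>+y. f y \<partial>lborel))"
    by (intro Liminf_mono always_eventually allI Plancherel_gaussian_le assms) simp
  finally show ?thesis by (simp add: Liminf_const)
qed

section \<open>Pointwise bounds from integrable transforms\<close>

lemma AE_abs_le_of_interval_integrals: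
  fixes h :: "real \<Rightarrow> real"
  assumes h: "integrable lborel h" and le: "\<And>a b. a \<le> b \<Longrightarrow> \<bar>\<integral>x\<in>{a<..b}. h x \<partial>lborel\<bar> \<le> B * (b - a)"
  shows "AE x in lborel. \<bar>h x\<bar> \<le> B"
proof -
  have si: "set_integrable lborel {a..b} h" for a b
    unfolding set_integrable_def using h by (intro integrable_mult_indicator) auto
  have int: "\<bar>integral {a..b} h\<bar> \<le> B * (b - a)" if "a \<le> b" for a b
    using le[OF that] set_borel_integral_eq_integral(2)[OF si[of a b]]
      interval_integral_Icc[OF that, of h] interval_integral_Ioc[OF that, of h] by simp
  have "h integrable_on cbox a b" for a b using set_borel_integral_eq_integral(1)[OF si] by simp
  \<comment> \<open>Lebesgue differentiation: outside a null set, \<open>h x\<close> is the limit of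
    the means over [x, x + u].\<close>
  then obtain N where N: "negligible N" "\<And>x e. x \<notin> N \<Longrightarrow> 0 < e \<Longrightarrow> \<exists>d>0. \<forall>u. 0 < u \<and> u < d \<longrightarrow>
      norm (integral (cbox x (x + u *\<^sub>R One)) h /\<^sub>R u ^ DIM(real) - h x) < e"
    using integrable_ccontinuous_explicit[of h] by blast
  have "\<bar>h x\<bar> \<le> B" if x: "x \<notin> N" for x
  proof (rule ccontr)
    assume "\<not> \<bar>h x\<bar> \<le> B"
    then obtain d where d: "0 < d" "\<And>u. 0 < u \<Longrightarrow> u < d \<Longrightarrow> \<bar>integral {x..x + u} h / u - h x\<bar> < \<bar>h x\<bar> - B"
      using N(2)[OF x, of "\<bar>h x\<bar> - B"] by (auto simp: divide_inverse mult.commute)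
    have "\<bar>integral {x..x + d / 2} h / (d / 2)\<bar> \<le> B"
      using int[of x "x + d / 2"] d(1) by (simp add: abs_divide divide_le_eq)
    then show False using d(2)[of "d / 2"] d(1) by linarith
  qed
  moreover have "AE x in lebesgue. x \<notin> N" using N(1) by (simp add: negligible_iff_null_sets AE_not_in)
  ultimately have "AE x in lebesgue. \<bar>h x\<bar> \<le> B" by (auto elim: eventually_mono)
  then show ?thesis using h by (simp add: AE_completion_iff)
qed

text \<open>The kernel is the integral of exp (- i t x) over [a, b]; at t = 0 division by zero gives
  the value 0.\<close>

lemma cmod_Levy_kernel_le:
  assumes "a \<le> b"
  shows "cmod ((iexp (- (t * a)) - iexp (- (t * b))) / (\<i> * t)) \<le> b - a"
proof (cases "t = 0")
  case False
  have "(iexp (- (t * a)) - iexp (- (t * b))) / (\<i> * t) = (iexp ((- t) * b) - iexp ((- t) * a)) / (\<i> * of_real (- t))"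
    using False by (simp add: field_simps)
  then show ?thesis using Levy_Inversion_aux2[OF assms, of "- t"] False by (simp only:)
qed (use assms in auto)

text \<open>Normalising p to a probability density brings it under Levy's inversion theorem; its
  condition on the endpoints holds because a law with a density has no atoms.\<close>

lemma Levy_inversion_density:
  fixes p :: "real \<Rightarrow> real"
  assumes p: "integrable lborel p" and pos: "\<And>x. 0 \<le> p x" and ab: "a \<le> b"
    and mass: "0 < (\<integral>x. p x \<partial>lborel)"
  shows "(\<lambda>T. 1 / (2 * pi) * (CLBINT t=-real T..real T. (iexp (-(t * a)) - iexp (-(t * b))) / (\<i> * t)
      * (\<integral>x. p x *\<^sub>R iexp (t * x) \<partial>lborel))) \<longlonglongrightarrow> complex_of_real (\<integral>x\<in>{a<..b}. p x \<partial>lborel)"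
proof -
  define c where "c = (\<integral>x. p x \<partial>lborel)"
  have c: "0 < c" using mass by (simp add: c_def)
  have [measurable]: "p \<in> borel_measurable borel" using p by auto
  define M where "M = density lborel (\<lambda>x. ennreal (p x / c))"
  have "emeasure M (space M) = ennreal (\<integral>x. p x / c \<partial>lborel)"
    unfolding M_def using p pos c by (simp add: emeasure_density nn_integral_eq_integral)
  then have "prob_space M"
    using c by (intro prob_spaceI) (simp add: c_def[symmetric])
  then interpret M: real_distribution M
    by (intro real_distribution.intro real_distribution_axioms.intro) (auto simp: M_def)
  have meas: "measure M A = (\<integral>x\<in>A. p x \<partial>lborel) / c" if [measurable]: "A \<in> sets borel" for A
  proof -
    have "emeasure M A = (\<integral>\<^sup>+x. ennreal (indicator A x * (p x / c)) \<partial>lborel)"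
      unfolding M_def by (auto simp: emeasure_density indicator_def intro!: nn_integral_cong)
    also have "\<dots> = ennreal (\<integral>x. indicator A x * (p x / c) \<partial>lborel)"
    proof (rule nn_integral_eq_integral)
      have "integrable lborel (\<lambda>x. indicat_real A x *\<^sub>R (p x / c))"
        using p by (intro integrable_mult_indicator) auto
      then show "integrable lborel (\<lambda>x. indicat_real A x * (p x / c))" by simp
    qed (use pos c in auto)
    finally show ?thesis
      using c pos by (simp add: measure_def set_lebesgue_integral_def integral_nonneg_AE)
  qed
  have pt: "measure M {x} = 0" for x
  proof -
    have "(\<integral>y. indicator {x} y * p y \<partial>lborel) = (\<integral>y. 0 \<partial>(lborel::real measure))"
      by (rule integral_cong_AE) (use AE_lborel_singleton[of x] in \<open>auto elim!: eventually_mono\<close>)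
    then show ?thesis by (simp add: meas set_lebesgue_integral_def)
  qed
  have ch: "(\<integral>x. p x *\<^sub>R iexp (t * x) \<partial>lborel) = c * char M t" for t
  proof -
    have "char M t = (\<integral>x. (p x / c) *\<^sub>R iexp (t * x) \<partial>lborel)"
      unfolding char_def M_def using pos c by (subst integral_density) auto
    also have "\<dots> = (\<integral>x. (1 / c) *\<^sub>R (p x *\<^sub>R iexp (t * x)) \<partial>lborel)" by simp
    also have "\<dots> = (1 / c) *\<^sub>R (\<integral>x. p x *\<^sub>R iexp (t * x) \<partial>lborel)" by (rule integral_scaleR_right)
    finally show ?thesis using c by (simp add: scaleR_conv_of_real)
  qed
  have "(\<lambda>T. 1 / (2 * pi) * (CLBINT t=-real T..real T. (iexp (-(t * a)) - iexp (-(t * b))) / (\<i> * t) * char M t))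
      \<longlonglongrightarrow> complex_of_real (measure M {a<..b})"
    using M.Levy_Inversion[OF ab pt pt] by simp
  from tendsto_mult_left[OF this, of "complex_of_real c"]
  have "(\<lambda>T. 1 / (2 * pi) * (complex_of_real c * (CLBINT t=-real T..real T. (iexp (-(t * a)) - iexp (-(t * b))) / (\<i> * t) * char M t)))
      \<longlonglongrightarrow> complex_of_real (\<integral>x\<in>{a<..b}. p x \<partial>lborel)"
    using c by (simp add: meas mult.left_commute)
  then show ?thesis
    unfolding ch by (simp add: mult.left_commute[of _ "complex_of_real c"] mult.assoc flip: interval_lebesgue_integral_mult_right)
qed

text \<open>Levy inversion recovers the integral of h over (a, b], and the kernel bound b - a
  estimates it by B * (b - a); differentiating these integrals bounds h itself. Working with
  intervals avoids any continuity of h.\<close>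

lemma AE_abs_le_Fourier:
  fixes h :: "real \<Rightarrow> real"
  assumes h: "integrable lborel h" and "0 \<le> B"
    and hat: "(\<integral>\<^sup>+t. ennreal (cmod (\<integral>x. h x *\<^sub>R iexp (t * x) \<partial>lborel)) \<partial>lborel) \<le> ennreal (2 * pi * B)"
  shows "AE x in lborel. \<bar>h x\<bar> \<le> B"
proof -
  have hm [measurable]: "h \<in> borel_measurable borel" using h by auto
  define H where "H t = (\<integral>x. h x *\<^sub>R iexp (t * x) \<partial>lborel)" for t
  have [measurable]: "H \<in> borel_measurable borel"
    unfolding H_def[abs_def] by measurable
  have iH: "integrable lborel H"
    using hat by (intro integrableI_bounded) (auto simp: H_def intro: le_less_trans)
  define K where "K a b t = (iexp (- (t * a)) - iexp (- (t * b))) / (\<i> * t)" for a b t :: real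
  have [measurable]: "K a b \<in> borel_measurable borel" for a b
    unfolding K_def[abs_def] by measurable
  have K: "cmod (K a b t) \<le> b - a" if "a \<le> b" for a b t
    unfolding K_def using cmod_Levy_kernel_le[OF that, of t] by simp
  \<comment> \<open>Positive and negative part are inverted separately. The normal density added to
    both guarantees positive mass and cancels in p - q = h.\<close>
  define p where "p x = max 0 (h x) + std_normal_density x" for x
  define q where "q x = max 0 (- h x) + std_normal_density x" for x
  have ip: "integrable lborel p" and iq: "integrable lborel q"
    unfolding p_def[abs_def] q_def[abs_def] using h
    by (auto intro!: Bochner_Integration.integrable_add integrable_max)
  have [measurable]: "p \<in> borel_measurable borel" "q \<in> borel_measurable borel" using ip iq by auto
  have pq0: "0 \<le> p x" "0 \<le> q x" for x
    by (auto simp: p_def q_def intro!: add_nonneg_nonneg normal_density_nonneg)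
  have "(\<integral>x. std_normal_density x \<partial>lborel) \<le> (\<integral>x. p x \<partial>lborel)"
    by (rule integral_mono[OF _ ip]) (auto simp: p_def)
  moreover have "(\<integral>x. std_normal_density x \<partial>lborel) \<le> (\<integral>x. q x \<partial>lborel)"
    by (rule integral_mono[OF _ iq]) (auto simp: q_def)
  ultimately have pos: "0 < (\<integral>x. p x \<partial>lborel)" "0 < (\<integral>x. q x \<partial>lborel)" by simp_all
  define P where "P t = (\<integral>x. p x *\<^sub>R iexp (t * x) \<partial>lborel)" for t
  define Q where "Q t = (\<integral>x. q x *\<^sub>R iexp (t * x) \<partial>lborel)" for t
  have [measurable]: "P \<in> borel_measurable borel" "Q \<in> borel_measurable borel"
    unfolding P_def[abs_def] Q_def[abs_def] by measurable
  have PQ: "H t = P t - Q t" for t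
  proof -
    have "P t - Q t = (\<integral>x. p x *\<^sub>R iexp (t * x) - q x *\<^sub>R iexp (t * x) \<partial>lborel)"
      unfolding P_def Q_def
      by (intro Bochner_Integration.integral_diff[symmetric] integrable_scaleR_iexp ip iq)
    also have "\<dots> = H t"
      unfolding H_def by (intro Bochner_Integration.integral_cong) (auto simp: p_def q_def max_def algebra_simps)
    finally show ?thesis by simp
  qed
  have PB: "cmod (P t) \<le> (\<integral>x. p x \<partial>lborel)" "cmod (Q t) \<le> (\<integral>x. q x \<partial>lborel)" for t
    unfolding P_def Q_def using pq0 by (auto intro!: order_trans[OF integral_norm_bound])
  have int_main: "complex_of_real (\<integral>x\<in>{a<..b}. h x \<partial>lborel) = 1 / (2 * pi) * (\<integral>t. K a b t * H t \<partial>lborel)"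
    if ab: "a \<le> b" for a b
  proof (rule LIMSEQ_unique)
    have iK: "interval_lebesgue_integrable lborel (- real T) (real T) (\<lambda>t. K a b t * R t)"
      if [measurable]: "R \<in> borel_measurable borel" and R: "\<And>t. cmod (R t) \<le> C" for R C and T :: nat
    proof -
      have "0 \<le> C" using R[of 0] norm_ge_zero order_trans by blast
      have "set_integrable lborel {- real T<..<real T} (\<lambda>t. K a b t * R t)"
        unfolding set_integrable_def
      proof (rule Bochner_Integration.integrable_bound)
        show "integrable lborel (\<lambda>t. indicator {- real T<..<real T} t * ((b - a) * C) :: real)"
          by (intro integrable_mult_left) simp
        show "AE t in lborel. norm (indicat_real {- real T<..<real T} t *\<^sub>R (K a b t * R t))
            \<le> norm (indicator {- real T<..<real T} t * ((b - a) * C) :: real)"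
          using mult_mono[OF K[OF ab] R] \<open>0 \<le> C\<close> ab
          by (intro AE_I2) (auto simp: indicator_def norm_mult abs_mult)
      qed measurable
      then show ?thesis
        by (simp add: interval_lebesgue_integrable_def)
    qed
    have eqT: "(CLBINT t=-real T..real T. K a b t * P t) - (CLBINT t=-real T..real T. K a b t * Q t)
        = (CLBINT t=-real T..real T. K a b t * H t)" for T :: nat
      unfolding PQ right_diff_distrib
      by (rule interval_lebesgue_integral_diff(2)[symmetric]; rule iK[OF _ PB(1)] iK[OF _ PB(2)]; measurable)
    have "(\<lambda>T. 1 / (2 * pi) * (CLBINT t=-real T..real T. K a b t * P t)
          - 1 / (2 * pi) * (CLBINT t=-real T..real T. K a b t * Q t))
        \<longlonglongrightarrow> complex_of_real (\<integral>x\<in>{a<..b}. p x \<partial>lborel) - complex_of_real (\<integral>x\<in>{a<..b}. q x \<partial>lborel)"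
      unfolding P_def Q_def K_def
      by (intro tendsto_diff Levy_inversion_density ip iq pq0 ab pos)
    also have "complex_of_real (\<integral>x\<in>{a<..b}. p x \<partial>lborel) - complex_of_real (\<integral>x\<in>{a<..b}. q x \<partial>lborel)
        = complex_of_real (\<integral>x\<in>{a<..b}. p x - q x \<partial>lborel)"
      unfolding of_real_diff[symmetric]
      by (subst set_integral_diff(2))
         (unfold set_integrable_def, (rule integrable_mult_indicator; simp add: ip iq)+, rule refl)
    also have "(\<lambda>x. p x - q x) = h"
      by (auto simp: p_def q_def)
    finally show "(\<lambda>T. 1 / (2 * pi) * (CLBINT t=-real T..real T. K a b t * H t))
        \<longlonglongrightarrow> complex_of_real (\<integral>x\<in>{a<..b}. h x \<partial>lborel)"
      by (simp only: eqT[symmetric] right_diff_distrib)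
    have "(\<lambda>T. \<integral>t. indicator {- real T<..<real T} t *\<^sub>R (K a b t * H t) \<partial>lborel) \<longlonglongrightarrow> (\<integral>t. K a b t * H t \<partial>lborel)"
    proof (rule integral_dominated_convergence)
      show "integrable lborel (\<lambda>t. (b - a) * cmod (H t))"
        using iH by (intro integrable_mult_right integrable_norm)
      show "AE t in lborel. (\<lambda>T. indicator {- real T<..<real T} t *\<^sub>R (K a b t * H t)) \<longlonglongrightarrow> K a b t * H t"
      proof (intro AE_I2 tendsto_eventually)
        fix t :: real
        obtain k :: nat where "\<bar>t\<bar> < real k" using reals_Archimedean2 by blast
        then show "\<forall>\<^sub>F T in sequentially. indicator {- real T<..<real T} t *\<^sub>R (K a b t * H t) = K a b t * H t"
          by (intro eventually_sequentiallyI[of k]) (auto simp: indicator_def)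
      qed
      show "AE t in lborel. norm (indicator {- real T<..<real T} t *\<^sub>R (K a b t * H t)) \<le> (b - a) * cmod (H t)" for T
        using mult_right_mono[OF K[OF ab]] ab by (intro AE_I2) (auto simp: indicator_def norm_mult)
    qed measurable
    then have "(\<lambda>T. CLBINT t=-real T..real T. K a b t * H t) \<longlonglongrightarrow> (\<integral>t. K a b t * H t \<partial>lborel)"
      by (simp add: interval_lebesgue_integral_def set_lebesgue_integral_def)
    then show "(\<lambda>T. 1 / (2 * pi) * (CLBINT t=-real T..real T. K a b t * H t))
        \<longlonglongrightarrow> 1 / (2 * pi) * (\<integral>t. K a b t * H t \<partial>lborel)"
      by (rule tendsto_mult_left)
  qed
  have "ennreal (\<integral>t. cmod (H t) \<partial>lborel) \<le> ennreal (2 * pi * B)"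
    using hat iH unfolding H_def[symmetric] by (subst nn_integral_eq_integral[symmetric]) auto
  then have HB: "(\<integral>t. cmod (H t) \<partial>lborel) \<le> 2 * pi * B"
    using \<open>0 \<le> B\<close> by (simp add: ennreal_le_iff)
  show ?thesis
  proof (rule AE_abs_le_of_interval_integrals[OF h])
    fix a b :: real assume ab: "a \<le> b"
    have "cmod (\<integral>t. K a b t * H t \<partial>lborel) \<le> (\<integral>t. (b - a) * cmod (H t) \<partial>lborel)"
      using mult_right_mono[OF K[OF ab]] ab iH
      by (intro order_trans[OF integral_norm_bound] integral_mono_AE') (auto simp: norm_mult)
    also have "\<dots> \<le> (b - a) * (2 * pi * B)" using HB ab by (simp add: mult_left_mono)
    finally have "cmod (1 / (2 * pi) * (\<integral>t. K a b t * H t \<partial>lborel)) \<le> B * (b - a)"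
      by (simp add: norm_mult norm_divide field_simps)
    then show "\<bar>\<integral>x\<in>{a<..b}. h x \<partial>lborel\<bar> \<le> B * (b - a)" unfolding int_main[OF ab, symmetric] by simp
  qed
qed

section \<open>Hermite functions\<close>

text \<open>Differentiating P(x) exp (- x^2 / 2) replaces P by P' - x P; the sign (-1)^k turns this
  into the recursion. The solutions are the monic (probabilists') Hermite polynomials.\<close>

fun hermite_poly :: "nat \<Rightarrow> real poly" where
  "hermite_poly 0 = 1"
| "hermite_poly (Suc k) = [:0, 1:] * hermite_poly k - pderiv (hermite_poly k)"

lemma has_field_derivative_hermite_poly_exp:
  "((\<lambda>y. (- 1) ^ k * poly (hermite_poly k) y * exp (- y\<^sup>2 / 2)) has_field_derivative
    (- 1) ^ Suc k * poly (hermite_poly (Suc k)) x * exp (- x\<^sup>2 / 2)) (at x)"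
  by (auto intro!: derivative_eq_intros simp: algebra_simps)

lemma hermite_eq_poly: "hermite k x = poly (hermite_poly k) x"
proof -
  have "(deriv ^^ k) (\<lambda>y::real. exp (- y\<^sup>2 / 2)) = (\<lambda>y. (- 1) ^ k * poly (hermite_poly k) y * exp (- y\<^sup>2 / 2))" for k
  proof (induction k)
    case (Suc k)
    show ?case
      unfolding funpow.simps comp_def Suc.IH
      by (rule ext, rule DERIV_imp_deriv[OF has_field_derivative_hermite_poly_exp])
  qed simp
  then show ?thesis
    by (simp add: hermite_def exp_minus field_simps flip: power_mult_distrib)
qed

lemma DERIV_normal_hermite:
  "((\<lambda>y. std_normal_density y * hermite k y) has_real_derivative - (std_normal_density x * hermite (Suc k) x)) (at x)"
  using DERIV_cmult[OF has_field_derivative_hermite_poly_exp, of "(- 1) ^ k / sqrt (2 * pi)" k x]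
  by (cases "even k") (simp_all add: std_normal_density_def hermite_eq_poly mult_ac del: hermite_poly.simps)

lemma continuous_on_hermite [continuous_intros]: "continuous_on A (hermite k)"
  unfolding hermite_eq_poly[abs_def] by (intro continuous_intros)

lemma hermite_measurable [measurable]: "hermite k \<in> borel_measurable borel"
  by (intro borel_measurable_continuous_onI continuous_on_hermite)

lemma poly_le_exp: "\<exists>C\<ge>0. \<exists>a\<ge>0. \<forall>x::real. \<bar>poly p x\<bar> \<le> C * exp (a * \<bar>x\<bar>)"
proof (induction p)
  case (pCons c p)
  then obtain C a where Ca: "C \<ge> 0" "a \<ge> 0" "\<And>x. \<bar>poly p x\<bar> \<le> C * exp (a * \<bar>x\<bar>)" by blast
  have "\<bar>poly (pCons c p) x\<bar> \<le> (\<bar>c\<bar> + C) * exp ((a + 1) * \<bar>x\<bar>)" for x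
  proof -
    have "\<bar>poly (pCons c p) x\<bar> \<le> \<bar>c\<bar> + \<bar>x\<bar> * \<bar>poly p x\<bar>"
      using abs_triangle_ineq[of c "x * poly p x"] by (simp add: abs_mult)
    also have "\<dots> \<le> \<bar>c\<bar> * exp ((a + 1) * \<bar>x\<bar>) + exp \<bar>x\<bar> * (C * exp (a * \<bar>x\<bar>))"
    proof (rule add_mono)
      show "\<bar>c\<bar> \<le> \<bar>c\<bar> * exp ((a + 1) * \<bar>x\<bar>)"
        using Ca by (simp add: mult_le_cancel_left1)
      have "\<bar>x\<bar> \<le> exp \<bar>x\<bar>" using exp_ge_add_one_self[of "\<bar>x\<bar>"] by linarith
      then show "\<bar>x\<bar> * \<bar>poly p x\<bar> \<le> exp \<bar>x\<bar> * (C * exp (a * \<bar>x\<bar>))"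
        by (intro mult_mono Ca) auto
    qed
    also have "\<dots> = (\<bar>c\<bar> + C) * exp ((a + 1) * \<bar>x\<bar>)"
      by (simp add: algebra_simps exp_add)
    finally show ?thesis .
  qed
  then show ?case using Ca by (intro exI[of _ "\<bar>c\<bar> + C"] exI[of _ "a + 1"] conjI) auto
qed (auto intro!: exI[of _ 0])

text \<open>Completing the square turns exp (b x) times the normal density into a multiple of a
  shifted normal density, and exp (a |x|) is at most exp (a x) + exp (- a x).\<close>

lemma integrable_exp_normal: "integrable lborel (\<lambda>x. exp (a * \<bar>x\<bar>) * std_normal_density x)"
proof -
  have eq: "exp (b * x) * std_normal_density x = exp (b\<^sup>2 / 2) * normal_density b 1 x" for b x :: real
    by (simp add: normal_density_def exp_add[symmetric] power2_eq_square algebra_simps add_divide_distrib diff_divide_distrib)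
  have "integrable lborel (\<lambda>x. exp (b * x) * std_normal_density x)" for b
    unfolding eq by (intro integrable_mult_right integrable_normal_density) simp
  from Bochner_Integration.integrable_add[OF this[of a] this[of "-a"]] show ?thesis
  proof (rule Bochner_Integration.integrable_bound)
    show "AE x in lborel. norm (exp (a * \<bar>x\<bar>) * std_normal_density x)
        \<le> norm (exp (a * x) * std_normal_density x + exp (- a * x) * std_normal_density x)"
    proof (rule AE_I2)
      fix x
      have n: "0 \<le> std_normal_density x" by (simp add: normal_density_nonneg)
      then have "norm (exp (a * \<bar>x\<bar>) * std_normal_density x) = exp (a * \<bar>x\<bar>) * std_normal_density x"
        by (simp add: abs_mult)
      also have "\<dots> \<le> exp (a * x) * std_normal_density x + exp (- a * x) * std_normal_density x"
        using n by (auto simp: abs_if)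
      finally show "norm (exp (a * \<bar>x\<bar>) * std_normal_density x)
          \<le> norm (exp (a * x) * std_normal_density x + exp (- a * x) * std_normal_density x)"
        by simp
    qed
  qed simp
qed

lemma hermite_le_exp: "\<exists>C\<ge>0. \<exists>a\<ge>0. \<forall>x. \<bar>hermite k x\<bar> \<le> C * exp (a * \<bar>x\<bar>)"
  unfolding hermite_eq_poly by (rule poly_le_exp)

text \<open>One majorant serves twice: for integrability and for the vanishing of the boundary terms
  at infinity.\<close>

lemma tilted_normal_hermite_le:
  "\<exists>C\<ge>0. \<exists>a\<ge>0. \<forall>x. norm ((exp (\<sigma> * x) * (std_normal_density x * hermite k x)) *\<^sub>R iexp (t * x))
    \<le> C * (exp (a * \<bar>x\<bar>) * std_normal_density x)"
proof -
  obtain C a where Ca: "C \<ge> 0" "a \<ge> 0" "\<And>x. \<bar>hermite k x\<bar> \<le> C * exp (a * \<bar>x\<bar>)"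
    using hermite_le_exp by blast
  have "norm ((exp (\<sigma> * x) * (std_normal_density x * hermite k x)) *\<^sub>R iexp (t * x))
      \<le> C * (exp ((a + \<bar>\<sigma>\<bar>) * \<bar>x\<bar>) * std_normal_density x)" for x
  proof -
    have "norm ((exp (\<sigma> * x) * (std_normal_density x * hermite k x)) *\<^sub>R iexp (t * x))
        = exp (\<sigma> * x) * \<bar>hermite k x\<bar> * std_normal_density x"
      by (simp add: abs_mult normal_density_nonneg)
    also have "\<dots> \<le> exp (\<bar>\<sigma>\<bar> * \<bar>x\<bar>) * (C * exp (a * \<bar>x\<bar>)) * std_normal_density x"
      by (intro mult_right_mono mult_mono Ca) (auto simp: normal_density_nonneg abs_mult[symmetric])
    finally show ?thesis by (simp add: algebra_simps exp_add)
  qed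
  then show ?thesis using Ca by (intro exI[of _ C] exI[of _ "a + \<bar>\<sigma>\<bar>"] conjI) auto
qed

lemma integrable_tilted_normal_hermite:
  "integrable lborel (\<lambda>x. (exp (\<sigma> * x) * (std_normal_density x * hermite k x)) *\<^sub>R iexp (t * x))"
proof -
  obtain C a where "C \<ge> 0" and
    le: "\<And>x. norm ((exp (\<sigma> * x) * (std_normal_density x * hermite k x)) *\<^sub>R iexp (t * x))
      \<le> C * (exp (a * \<bar>x\<bar>) * std_normal_density x)"
    using tilted_normal_hermite_le by blast
  show ?thesis
    by (rule Bochner_Integration.integrable_bound[OF integrable_mult_right[OF integrable_exp_normal[of a], of C]])
       (simp, rule AE_I2, rule order_trans[OF le], simp)
qed

lemma tilted_normal_hermite_tendsto_0:
  "((\<lambda>x. (exp (\<sigma> * x) * (std_normal_density x * hermite k x)) *\<^sub>R iexp (t * x)) \<longlongrightarrow> 0) F"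
  if "F = at_top \<or> F = at_bot"
proof -
  obtain C a where "C \<ge> 0" and
    le: "\<And>x. norm ((exp (\<sigma> * x) * (std_normal_density x * hermite k x)) *\<^sub>R iexp (t * x))
      \<le> C * (exp (a * \<bar>x\<bar>) * std_normal_density x)"
    using tilted_normal_hermite_le by blast
  have "((\<lambda>x. C * (exp (a * \<bar>x\<bar>) * std_normal_density x)) \<longlongrightarrow> 0) F"
  proof -
    have "((\<lambda>x. C * (exp (a * x) * std_normal_density x)) \<longlongrightarrow> 0) at_top" for a
    proof -
      have "((\<lambda>x::real. exp (a * x - x\<^sup>2 / 2)) \<longlongrightarrow> 0) at_top" by real_asymp
      from tendsto_mult_left[OF this, of "C / sqrt (2 * pi)"]
      have "((\<lambda>x. C / sqrt (2 * pi) * exp (a * x - x\<^sup>2 / 2)) \<longlongrightarrow> 0) at_top" by simp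
      moreover have "C / sqrt (2 * pi) * exp (a * x - x\<^sup>2 / 2) = C * (exp (a * x) * std_normal_density x)" for x
      proof -
        have "exp (a * x - x\<^sup>2 / 2) = exp (a * x) * exp (- x\<^sup>2 / 2)"
          by (simp add: exp_add[symmetric])
        then show ?thesis by (simp add: std_normal_density_def)
      qed
      ultimately show ?thesis by (simp only:)
    qed
    then have top: "((\<lambda>x. C * (exp (a * \<bar>x\<bar>) * std_normal_density x)) \<longlongrightarrow> 0) at_top"
      by (rule Lim_transform_eventually) (auto intro: eventually_mono[OF eventually_ge_at_top[of 0]])
    have "((\<lambda>x. C * (exp (a * \<bar>x\<bar>) * std_normal_density x)) \<longlongrightarrow> 0) at_bot"
      unfolding filterlim_at_bot_mirror using top by (simp add: std_normal_density_def)
    then show ?thesis using top that by blast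
  qed
  then show ?thesis
    by (rule Lim_null_comparison[rotated]) (use le in auto)
qed

text \<open>With f_k for the tilted integrand and w = \<sigma> + i t this reads f_k' = w f_k -
  f_(k+1). Its integral over the line is the induction step for the transform.\<close>

lemma has_vector_derivative_tilted_normal_hermite:
  "((\<lambda>x. (exp (\<sigma> * x) * (std_normal_density x * hermite k x)) *\<^sub>R iexp (t * x)) has_vector_derivative
    Complex \<sigma> t * ((exp (\<sigma> * x) * (std_normal_density x * hermite k x)) *\<^sub>R iexp (t * x))
      - (exp (\<sigma> * x) * (std_normal_density x * hermite (Suc k) x)) *\<^sub>R iexp (t * x)) (at x)"
proof -
  have eq: "(exp (\<sigma> * x) * g) *\<^sub>R iexp (t * x) = g *\<^sub>R exp (Complex \<sigma> t * x)" for x g :: real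
    by (simp add: Complex_eq scaleR_conv_of_real exp_of_real[symmetric] exp_add[symmetric] algebra_simps)
  have "((\<lambda>z. exp (Complex \<sigma> t * z)) has_field_derivative exp (Complex \<sigma> t * of_real x) * Complex \<sigma> t) (at (of_real x))"
    by (auto intro!: derivative_eq_intros)
  then have e: "((\<lambda>x. exp (Complex \<sigma> t * of_real x)) has_vector_derivative exp (Complex \<sigma> t * of_real x) * Complex \<sigma> t) (at x)"
    by (rule has_vector_derivative_real_field)
  have "((\<lambda>y. std_normal_density y * hermite k y) has_field_derivative - (std_normal_density x * hermite (Suc k) x)) (at x)"
    by (rule DERIV_normal_hermite)
  from has_vector_derivative_scaleR[OF this e] show ?thesis
    unfolding eq by (simp add: algebra_simps)
qed

text \<open>The integral of f_k' vanishes, so each step in k contributes one more factor w. The base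
  case is the Gaussian transform at a complex point, reduced to the real frequency t by the shift x
  -> x + \<sigma>.\<close>

lemma has_bochner_integral_tilted_normal_hermite:
  "has_bochner_integral lborel (\<lambda>x. (exp (\<sigma> * x) * (std_normal_density x * hermite k x)) *\<^sub>R iexp (t * x))
    (Complex \<sigma> t ^ k * exp ((Complex \<sigma> t)\<^sup>2 / 2))"
proof -
  let ?f = "\<lambda>k x. (exp (\<sigma> * x) * (std_normal_density x * hermite k x)) *\<^sub>R iexp (t * x)"
  let ?w = "Complex \<sigma> t"
  have "(\<integral>x. ?f k x \<partial>lborel) = ?w ^ k * exp (?w\<^sup>2 / 2)"
  proof (induction k)
    case 0
    have "(\<integral>x. ?f 0 x \<partial>lborel) = (\<integral>x. exp (\<sigma>\<^sup>2 / 2) *\<^sub>R (std_normal_density (x - \<sigma>) *\<^sub>R iexp (t * x)) \<partial>lborel)"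
    proof (intro Bochner_Integration.integral_cong refl)
      fix x
      have "exp (\<sigma> * x) * std_normal_density x = exp (\<sigma>\<^sup>2 / 2) * std_normal_density (x - \<sigma>)"
        by (simp add: normal_density_def exp_add[symmetric] power2_eq_square algebra_simps add_divide_distrib diff_divide_distrib)
      then show "?f 0 x = exp (\<sigma>\<^sup>2 / 2) *\<^sub>R (std_normal_density (x - \<sigma>) *\<^sub>R iexp (t * x))"
        by (simp only: hermite_eq_poly hermite_poly.simps poly_1 mult_1_right scaleR_scaleR)
    qed
    also have "\<dots> = exp (\<sigma>\<^sup>2 / 2) *\<^sub>R (\<integral>x. std_normal_density (x - \<sigma>) *\<^sub>R iexp (t * x) \<partial>lborel)"
      by (rule integral_scaleR_right)
    also have "(\<integral>x. std_normal_density (x - \<sigma>) *\<^sub>R iexp (t * x) \<partial>lborel)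
        = (\<integral>x. std_normal_density x *\<^sub>R (iexp (t * \<sigma>) * iexp (t * x)) \<partial>lborel)"
    proof -
      have "iexp (t * (\<sigma> + x)) = iexp (t * \<sigma>) * iexp (t * x)" for x
        by (simp add: exp_add[symmetric] distrib_left)
      then show ?thesis
        by (subst lborel_integral_real_affine[where c = 1 and t = \<sigma>]) (simp_all only:, simp_all)
    qed
    also have "\<dots> = iexp (t * \<sigma>) * (\<integral>x. std_normal_density x *\<^sub>R iexp (t * x) \<partial>lborel)"
      by (simp only: mult_scaleR_right[symmetric] integral_mult_right_zero)
    also have "(\<integral>x. std_normal_density x *\<^sub>R iexp (t * x) \<partial>lborel) = exp (- (t\<^sup>2 / 2))"
      using fun_cong[OF char_std_normal_distribution, of t]
      by (simp add: char_def integral_density normal_density_nonneg)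
    also have "exp (\<sigma>\<^sup>2 / 2) *\<^sub>R (iexp (t * \<sigma>) * complex_of_real (exp (- (t\<^sup>2 / 2)))) = exp (?w\<^sup>2 / 2)"
    proof -
      have "exp (?w\<^sup>2 / 2) = exp (complex_of_real (\<sigma>\<^sup>2 / 2) + \<i> * complex_of_real (t * \<sigma>) + complex_of_real (- (t\<^sup>2 / 2)))"
        by (rule arg_cong[where f = exp]) (simp add: complex_eq_iff power2_eq_square algebra_simps diff_divide_distrib)
      then show ?thesis
        by (simp only: exp_add exp_of_real scaleR_conv_of_real mult.assoc)
    qed
    finally show ?case by simp
  next
    case (Suc k)
    let ?f' = "\<lambda>x. ?w * ?f k x - ?f (Suc k) x"
    have int: "integrable lborel (?f k)" for k by (rule integrable_tilted_normal_hermite)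
    have "(LBINT x=-\<infinity>..\<infinity>. ?f' x) = 0 - 0"
    proof (rule interval_integral_FTC_integrable)
      show "((\<lambda>x. ?f k x) has_vector_derivative ?f' x) (at x)" for x
        by (rule has_vector_derivative_tilted_normal_hermite)
      show "isCont ?f' x" for x
        by (intro continuous_diff continuous_mult continuous_const
            has_vector_derivative_continuous[OF has_vector_derivative_tilted_normal_hermite])
      have "integrable lborel ?f'"
        by (intro Bochner_Integration.integrable_diff integrable_mult_right int)
      then show "set_integrable lborel (einterval (-\<infinity>) \<infinity>) ?f'"
        by (simp only: set_integrable_def einterval_eq indicator_UNIV scaleR_one)
      show "((?f k \<circ> real_of_ereal) \<longlongrightarrow> 0) (at_right (-\<infinity>))" "((?f k \<circ> real_of_ereal) \<longlongrightarrow> 0) (at_left \<infinity>)"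
        unfolding ereal_tendsto_simps1 by (rule tilted_normal_hermite_tendsto_0, simp)+
    qed simp
    then have "(\<integral>x. ?f' x \<partial>lborel) = 0"
      by (simp only: interval_lebesgue_integral_def set_lebesgue_integral_def einterval_eq indicator_UNIV
          scaleR_one MInfty_neq_PInfty ereal_less_eq(1) if_True diff_0_right)
    moreover have "(\<integral>x. ?f' x \<partial>lborel) = ?w * (\<integral>x. ?f k x \<partial>lborel) - (\<integral>x. ?f (Suc k) x \<partial>lborel)"
      using int
      by (subst Bochner_Integration.integral_diff)
         (rule integrable_mult_right, rule int, rule int, simp only: integral_mult_right_zero)
    ultimately have "(\<integral>x. ?f (Suc k) x \<partial>lborel) = ?w * (\<integral>x. ?f k x \<partial>lborel)"
      by (simp only: eq_iff_diff_eq_0[symmetric] right_minus_eq)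
    then show ?case by (simp only: Suc.IH power_Suc mult.assoc)
  qed
  then show ?thesis
    using integrable_tilted_normal_hermite by (simp only: has_bochner_integral_iff conj_absorb simp_thms)
qed

section \<open>Cumulants\<close>

lemma cmod_iexp_diff_le: "cmod (iexp b - iexp a) \<le> \<bar>b - a\<bar>"
proof -
  have "iexp b - iexp a = iexp a * (iexp (b - a) - 1)"
    by (simp add: right_diff_distrib exp_add[symmetric])
  then have "cmod (iexp b - iexp a) = cmod (iexp (b - a) - 1)"
    by (simp add: norm_mult)
  then show ?thesis
    using iexp_approx1[of "b - a" 0] by simp
qed

lemma has_vector_derivative_iff_quotient:
  fixes f :: "real \<Rightarrow> 'a::real_normed_vector"
  shows "(f has_vector_derivative d) (at t) \<longleftrightarrow> ((\<lambda>h. (f (t + h) - f t) /\<^sub>R h) \<longlongrightarrow> d) (at 0)"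
proof -
  have eq: "norm (f (t + h) - f t - h *\<^sub>R d) / norm h = norm ((f (t + h) - f t) /\<^sub>R h - d)" if "h \<noteq> 0" for h
  proof -
    have "(f (t + h) - f t) /\<^sub>R h - d = (f (t + h) - f t - h *\<^sub>R d) /\<^sub>R h"
      using that by (simp add: scaleR_diff_right)
    then show ?thesis by (simp add: divide_inverse mult.commute)
  qed
  have "((\<lambda>h. norm (f (t + h) - f t - h *\<^sub>R d) / norm h) \<longlongrightarrow> 0) (at 0)
      \<longleftrightarrow> ((\<lambda>h. norm ((f (t + h) - f t) /\<^sub>R h - d)) \<longlongrightarrow> 0) (at 0)"
    by (rule filterlim_cong[OF refl refl]) (auto simp: eventually_at_filter eq[unfolded real_norm_def])
  then show ?thesis
    by (simp only: has_vector_derivative_def has_derivative_at bounded_linear_scaleR_left simp_thms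
        tendsto_norm_zero_iff LIM_zero_iff)
qed

text \<open>Differentiation under the integral: the difference quotients are dominated by |x|^(k+1),
  as |exp (i b) - exp (i a)| \<le> |b - a|.\<close>

lemma (in real_distribution) has_vector_derivative_char_moment:
  assumes int: "integrable M (\<lambda>x. x ^ Suc k)" and intk: "integrable M (\<lambda>x. x ^ k)"
  shows "((\<lambda>t. \<integral>x. (\<i> * x) ^ k * iexp (t * x) \<partial>M) has_vector_derivative
    (\<integral>x. (\<i> * x) ^ Suc k * iexp (t * x) \<partial>M)) (at t)"
proof -
  have intc: "integrable M (\<lambda>x. (\<i> * x) ^ j * iexp (u * x))" if "integrable M (\<lambda>x. x ^ j)" for j u
    by (rule Bochner_Integration.integrable_bound[OF that])
       (auto simp: norm_mult norm_power power_abs)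
  let ?q = "\<lambda>h x. ((\<i> * x) ^ k * iexp ((t + h) * x) - (\<i> * x) ^ k * iexp (t * x)) /\<^sub>R h :: complex"
  have "((\<lambda>h. \<integral>x. ?q h x \<partial>M) \<longlongrightarrow> (\<integral>x. (\<i> * x) ^ Suc k * iexp (t * x) \<partial>M)) (at 0)"
  proof (subst tendsto_at_iff_sequentially, intro allI impI)
    fix X :: "nat \<Rightarrow> real" assume X: "\<forall>i. X i \<in> UNIV - {0}" "X \<longlonglongrightarrow> 0"
    show "((\<lambda>h. \<integral>x. ?q h x \<partial>M) \<circ> X) \<longlonglongrightarrow> (\<integral>x. (\<i> * x) ^ Suc k * iexp (t * x) \<partial>M)"
      unfolding comp_def
    proof (rule integral_dominated_convergence[where w = "\<lambda>x. \<bar>x ^ Suc k\<bar>"])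
      show "AE x in M. (\<lambda>i. ?q (X i) x) \<longlonglongrightarrow> (\<i> * x) ^ Suc k * iexp (t * x)"
      proof (rule AE_I2)
        fix x :: real
        have "((\<lambda>z. (\<i> * x) ^ k * exp (\<i> * (z * x))) has_field_derivative (\<i> * x) ^ k * (exp (\<i> * (of_real t * x)) * (\<i> * x))) (at (of_real t))"
          by (auto intro!: derivative_eq_intros)
        from has_vector_derivative_real_field[OF this, of UNIV]
        have "((\<lambda>u. (\<i> * x) ^ k * iexp (u * x)) has_vector_derivative (\<i> * x) ^ Suc k * iexp (t * x)) (at t)"
          by (simp add: mult_ac)
        then have "((\<lambda>h. ?q h x) \<longlongrightarrow> (\<i> * x) ^ Suc k * iexp (t * x)) (at 0)"
          by (simp only: has_vector_derivative_iff_quotient)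
        then show "(\<lambda>i. ?q (X i) x) \<longlonglongrightarrow> (\<i> * x) ^ Suc k * iexp (t * x)"
          using X by (subst (asm) tendsto_at_iff_sequentially) (auto simp: comp_def)
      qed
      show "AE x in M. norm (?q (X i) x) \<le> \<bar>x ^ Suc k\<bar>" for i
      proof (rule AE_I2)
        fix x :: real
        have nz: "X i \<noteq> 0" using X by auto
        have "norm (?q (X i) x) = \<bar>x\<bar> ^ k * cmod (iexp ((t + X i) * x) - iexp (t * x)) / \<bar>X i\<bar>"
          by (simp add: norm_mult norm_power divide_inverse flip: right_diff_distrib)
        also have "\<dots> \<le> \<bar>x\<bar> ^ k * \<bar>(t + X i) * x - t * x\<bar> / \<bar>X i\<bar>"
          by (intro divide_right_mono mult_left_mono cmod_iexp_diff_le) auto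
        also have "\<dots> = \<bar>x ^ Suc k\<bar>"
          using nz by (simp add: abs_mult algebra_simps power_abs)
        finally show "norm (?q (X i) x) \<le> \<bar>x ^ Suc k\<bar>" .
      qed
    qed (use int in auto)
  qed
  moreover have "(\<integral>x. ?q h x \<partial>M) = ((\<integral>x. (\<i> * x) ^ k * iexp ((t + h) * x) \<partial>M) - (\<integral>x. (\<i> * x) ^ k * iexp (t * x) \<partial>M)) /\<^sub>R h" for h
    by (subst integral_scaleR_right, subst Bochner_Integration.integral_diff)
       (rule intc[OF intk], rule intc[OF intk], rule refl)
  ultimately show ?thesis
    by (simp only: has_vector_derivative_iff_quotient)
qed

text \<open>The derivative is existentially quantified, so closure under sums, products, inverses
  and \<open>Ln\<close> follows by exhibiting it; the link to the iterated
  \<open>vector_derivative\<close> in \<open>cumulant\<close> is made only in the Taylor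
  theorem.\<close>

fun C_k_on :: "nat \<Rightarrow> real set \<Rightarrow> (real \<Rightarrow> complex) \<Rightarrow> bool" where
  "C_k_on 0 U f \<longleftrightarrow> continuous_on U f"
| "C_k_on (Suc k) U f \<longleftrightarrow> (\<exists>f'. (\<forall>t\<in>U. (f has_vector_derivative f' t) (at t)) \<and> C_k_on k U f')"

lemma C_k_on_imp_continuous_on: "C_k_on k U f \<Longrightarrow> continuous_on U f"
  by (cases k) (auto intro!: continuous_at_imp_continuous_on dest: has_vector_derivative_continuous)

lemma C_k_on_SucD: "C_k_on (Suc k) U f \<Longrightarrow> C_k_on k U f"
proof (induction k arbitrary: f)
  case 0
  then show ?case using C_k_on_imp_continuous_on C_k_on.simps(1) by blast
next
  case (Suc k)
  then show ?case by (metis C_k_on.simps(2))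
qed

lemma C_k_on_add: "C_k_on k U f \<Longrightarrow> C_k_on k U g \<Longrightarrow> C_k_on k U (\<lambda>t. f t + g t)"
proof (induction k arbitrary: f g)
  case (Suc k)
  then obtain f' g' where "\<forall>t\<in>U. (f has_vector_derivative f' t) (at t)" "C_k_on k U f'"
    "\<forall>t\<in>U. (g has_vector_derivative g' t) (at t)" "C_k_on k U g'" by auto
  then show ?case
    by (intro C_k_on.simps(2)[THEN iffD2] exI[of _ "\<lambda>t. f' t + g' t"] conjI ballI has_vector_derivative_add Suc.IH) auto
qed (auto intro: continuous_on_add)

lemma C_k_on_mult: "C_k_on k U f \<Longrightarrow> C_k_on k U g \<Longrightarrow> C_k_on k U (\<lambda>t. f t * g t)"
proof (induction k arbitrary: f g)
  case (Suc k)
  then obtain f' g' where fg: "\<forall>t\<in>U. (f has_vector_derivative f' t) (at t)" "C_k_on k U f'"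
    "\<forall>t\<in>U. (g has_vector_derivative g' t) (at t)" "C_k_on k U g'" by auto
  have "C_k_on k U (\<lambda>t. f t * g' t + f' t * g t)"
    by (rule C_k_on_add[OF Suc.IH[OF C_k_on_SucD[OF Suc.prems(1)] fg(4)] Suc.IH[OF fg(2) C_k_on_SucD[OF Suc.prems(2)]]])
  then show ?case
    using fg
    by (intro C_k_on.simps(2)[THEN iffD2] exI[of _ "\<lambda>t. f t * g' t + f' t * g t"] conjI ballI has_vector_derivative_mult) auto
qed (auto intro: continuous_on_mult)

lemma C_k_on_inverse: "C_k_on k U f \<Longrightarrow> (\<And>t. t \<in> U \<Longrightarrow> f t \<noteq> 0) \<Longrightarrow> C_k_on k U (\<lambda>t. inverse (f t))"
proof (induction k arbitrary: f)
  case (Suc k)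
  then obtain f' where f: "\<forall>t\<in>U. (f has_vector_derivative f' t) (at t)" "C_k_on k U f'" by auto
  have i: "C_k_on k U (\<lambda>t. inverse (f t))"
    by (rule Suc.IH[OF C_k_on_SucD[OF Suc.prems(1)] Suc.prems(2)])
  have z: "C_k_on j U (\<lambda>t. 0)" for j
  proof (induction j)
    case (Suc j)
    then show ?case unfolding C_k_on.simps by (intro exI[of _ "\<lambda>_. 0"]) auto
  qed simp
  have c: "C_k_on j U (\<lambda>t. -1)" for j
  proof (cases j)
    case (Suc i)
    then show ?thesis unfolding Suc C_k_on.simps using z by (intro exI[of _ "\<lambda>_. 0"]) auto
  qed simp
  have "C_k_on k U (\<lambda>t. (-1) * (inverse (f t) * (f' t * inverse (f t))))"
    by (rule C_k_on_mult[OF c C_k_on_mult[OF i C_k_on_mult[OF f(2) i]]])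
  moreover have "((\<lambda>t. inverse (f t)) has_vector_derivative (-1) * (inverse (f t) * (f' t * inverse (f t)))) (at t)"
    if "t \<in> U" for t
  proof -
    have "(inverse has_field_derivative - (inverse (f t) ^ Suc (Suc 0))) (at (f t))"
      by (rule DERIV_inverse[OF Suc.prems(2)[OF that]])
    from field_vector_diff_chain_at[OF f(1)[rule_format, OF that] this] show ?thesis
      by (simp add: comp_def mult_ac)
  qed
  ultimately show ?case
    by (intro C_k_on.simps(2)[THEN iffD2] exI conjI ballI)
qed (auto intro: continuous_on_inverse)

lemma C_k_on_Ln:
  assumes f: "C_k_on k U f" and "\<And>t. t \<in> U \<Longrightarrow> f t \<notin> \<real>\<^sub>\<le>\<^sub>0"
  shows "C_k_on k U (\<lambda>t. Ln (f t))"
proof (cases k)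
  case 0
  then show ?thesis using assms by (auto intro!: continuous_on_Ln')
next
  case (Suc j)
  then obtain f' where f': "\<forall>t\<in>U. (f has_vector_derivative f' t) (at t)" "C_k_on j U f'" using f by auto
  have "C_k_on j U (\<lambda>t. f' t * inverse (f t))"
  proof (rule C_k_on_mult[OF f'(2) C_k_on_inverse[OF C_k_on_SucD[OF f[unfolded Suc]]]])
    show "f t \<noteq> 0" if "t \<in> U" for t using assms(2)[OF that] by auto
  qed
  moreover have "((\<lambda>t. Ln (f t)) has_vector_derivative f' t * inverse (f t)) (at t)" if "t \<in> U" for t
  proof -
    have "(Ln has_field_derivative inverse (f t)) (at (f t))"
      using assms(2)[OF that] by (rule has_field_derivative_Ln)
    from field_vector_diff_chain_at[OF f'(1)[rule_format, OF that] this] show ?thesis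
      by (simp add: comp_def)
  qed
  ultimately have "C_k_on (Suc j) U (\<lambda>t. Ln (f t))"
    by (intro C_k_on.simps(2)[THEN iffD2] exI[of _ "\<lambda>t. f' t * inverse (f t)"] conjI ballI)
  then show ?thesis by (simp only: Suc)
qed

text \<open>The same iterate as in the definition of \<open>cumulant\<close>.\<close>

abbreviation vderiv :: "nat \<Rightarrow> (real \<Rightarrow> complex) \<Rightarrow> real \<Rightarrow> complex" where
  "vderiv k f \<equiv> ((\<lambda>f t. vector_derivative f (at t)) ^^ k) f"

lemma vderiv_cong:
  assumes "open U" "\<And>t. t \<in> U \<Longrightarrow> f t = g t" "t \<in> U"
  shows "vderiv k f t = vderiv k g t"
  using assms(2,3)
proof (induction k arbitrary: t)
  case (Suc k)
  have "vector_derivative (vderiv k f) (at t) = vector_derivative (vderiv k g) (at t)"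
  proof (rule vector_derivative_cong_eq)
    show "\<forall>\<^sub>F x in nhds t. x \<in> UNIV \<longrightarrow> vderiv k f x = vderiv k g x"
      using assms(1) Suc by (auto simp: eventually_nhds)
  qed auto
  then show ?case by simp
qed auto

lemma vderiv_Suc_right: "vderiv (Suc k) f = vderiv k (\<lambda>t. vector_derivative f (at t))"
  unfolding funpow_Suc_right comp_def ..

text \<open>Peano's form of the remainder: exactly k continuous derivatives are at hand, and an
  error of order k + 1 would ask for one more. The remainder of f has the remainder of f' as its
  derivative, and the mean value inequality gains one power of t.\<close>

lemma C_k_on_Taylor:
  assumes "open U" "0 \<in> U" "C_k_on k U f" "e > 0"
  shows "\<exists>d>0. \<forall>t. \<bar>t\<bar> < d \<longrightarrow> cmod (f t - (\<Sum>j\<le>k. vderiv j f 0 * of_real t ^ j / fact j)) \<le> e * \<bar>t\<bar> ^ k"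
  using assms(3,4)
proof (induction k arbitrary: f e)
  case 0
  then have "isCont f 0" using assms by (simp add: continuous_on_eq_continuous_at)
  then have "\<exists>d>0. \<forall>t. dist t 0 < d \<longrightarrow> dist (f t) (f 0) < e"
    using 0 by (auto simp: continuous_at_eps_delta)
  then show ?case by (auto simp: dist_norm intro: less_imp_le)
next
  case (Suc k)
  then obtain f' where f': "\<forall>t\<in>U. (f has_vector_derivative f' t) (at t)" "C_k_on k U f'" by auto
  have vd: "vderiv (Suc j) f 0 = vderiv j f' 0" for j
    unfolding vderiv_Suc_right
    by (rule vderiv_cong[OF assms(1) _ assms(2)]) (use f' in \<open>auto intro: vector_derivative_at\<close>)
  obtain d where d: "d > 0" "\<And>t. \<bar>t\<bar> < d \<Longrightarrow> cmod (f' t - (\<Sum>j\<le>k. vderiv j f' 0 * of_real t ^ j / fact j)) \<le> e * \<bar>t\<bar> ^ k"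
    using Suc.IH[OF f'(2) Suc.prems(2)] by auto
  obtain r where r: "r > 0" "ball 0 r \<subseteq> U" using assms by (meson openE)
  let ?h = "\<lambda>t. f t - (\<Sum>j\<le>Suc k. vderiv j f 0 * of_real t ^ j / fact j)"
  let ?h' = "\<lambda>t. f' t - (\<Sum>j\<le>k. vderiv j f' 0 * of_real t ^ j / fact j)"
  have der: "(?h has_vector_derivative ?h' t) (at t within S)" if "\<bar>t\<bar> < r" for t S
  proof -
    have "((\<lambda>z. \<Sum>j\<le>Suc k. vderiv j f 0 * z ^ j / fact j) has_field_derivative
        (\<Sum>j\<le>Suc k. vderiv j f 0 * (of_nat j * of_real t ^ (j - 1)) / fact j)) (at (of_real t))"
    proof (rule DERIV_sum)
      show "((\<lambda>z. vderiv j f 0 * z ^ j / fact j) has_field_derivative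
          vderiv j f 0 * (of_nat j * of_real t ^ (j - 1)) / fact j) (at (of_real t))" for j
        by (auto intro!: derivative_eq_intros)
    qed
    also have "(\<Sum>j\<le>Suc k. vderiv j f 0 * (of_nat j * of_real t ^ (j - 1)) / fact j)
        = (\<Sum>j\<le>k. vderiv (Suc j) f 0 * (of_nat (Suc j) * of_real t ^ j) / fact (Suc j))"
      by (subst sum.atMost_Suc_shift) (simp del: of_nat_Suc fact_Suc funpow.simps)
    also have "\<dots> = (\<Sum>j\<le>k. vderiv j f' 0 * of_real t ^ j / fact j)"
      unfolding vd by (intro sum.cong refl) (simp add: fact_Suc del: of_nat_Suc)
    finally have "((\<lambda>t. \<Sum>j\<le>Suc k. vderiv j f 0 * of_real t ^ j / fact j) has_vector_derivative
        (\<Sum>j\<le>k. vderiv j f' 0 * of_real t ^ j / fact j)) (at t within S)"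
      by (rule has_vector_derivative_real_field)
    moreover have "(f has_vector_derivative f' t) (at t within S)"
      using f'(1) r that by (auto intro: has_vector_derivative_at_within simp: subset_eq dist_norm)
    ultimately show ?thesis by (rule has_vector_derivative_diff[rotated])
  qed
  have "cmod (?h t) \<le> e * \<bar>t\<bar> ^ Suc k" if t: "\<bar>t\<bar> < min d r" for t
  proof -
    have "cmod (?h t - ?h 0) \<le> (e * \<bar>t\<bar> ^ k) * norm (t - 0)"
    proof (rule differentiable_bound[where S = "closed_segment 0 t" and f' = "\<lambda>u x. x *\<^sub>R ?h' u"])
      fix u assume u: "u \<in> closed_segment 0 t"
      then have ut: "\<bar>u\<bar> \<le> \<bar>t\<bar>" using segment_bound(1)[of u 0 t] by simp
      then show "(?h has_derivative (\<lambda>x. x *\<^sub>R ?h' u)) (at u within closed_segment 0 t)"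
        using der[of u] t by (simp add: has_vector_derivative_def)
      have "cmod (?h' u) \<le> e * \<bar>u\<bar> ^ k" using d(2) ut t by simp
      also have "\<dots> \<le> e * \<bar>t\<bar> ^ k" using ut Suc.prems by (intro mult_left_mono power_mono) auto
      finally have le: "cmod (?h' u) \<le> e * \<bar>t\<bar> ^ k" .
      have "onorm (\<lambda>x::real. x *\<^sub>R ?h' u) = cmod (?h' u)"
        by (simp add: onorm_scaleR_left onorm_id)
      then show "onorm (\<lambda>x::real. x *\<^sub>R ?h' u) \<le> e * \<bar>t\<bar> ^ k" using le by simp
    qed auto
    moreover have "?h 0 = 0" by (simp add: sum.atMost_Suc_shift del: sum.atMost_Suc funpow.simps(2))
    ultimately show ?thesis by (simp only: diff_zero) (simp add: mult_ac)
  qed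
  then show ?case using d(1) r(1) by (intro exI[of _ "min d r"]) auto
qed

section \<open>Taylor coefficients and smallness at the origin\<close>

lemma poly_coeffs_zero_of_small:
  fixes a :: "nat \<Rightarrow> complex"
  assumes "((\<lambda>t::real. (\<Sum>j\<le>m. a j * of_real t ^ j) / of_real t ^ m) \<longlongrightarrow> 0) (at 0)" and "j \<le> m"
  shows "a j = 0"
  using assms
proof (induction m arbitrary: a j)
  case 0
  then have "((\<lambda>t::real. a 0) \<longlongrightarrow> 0) (at 0)" by simp
  then show ?case using 0 tendsto_unique[OF _ tendsto_const] trivial_limit_at[of "0::real"] by fastforce
next
  case (Suc m)
  let ?P = "\<lambda>t::real. \<Sum>j\<le>Suc m. a j * of_real t ^ j"
  have "((\<lambda>t. ?P t / of_real t ^ Suc m * of_real t ^ Suc m) \<longlongrightarrow> 0 * of_real 0 ^ Suc m) (at 0)"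
    by (intro tendsto_mult Suc.prems tendsto_intros)
  then have "(?P \<longlongrightarrow> 0) (at 0)"
    unfolding mult_zero_left by (rule Lim_transform_eventually) (auto simp: eventually_at_filter)
  moreover have "(?P \<longlongrightarrow> ?P 0) (at 0)" by (intro tendsto_intros)
  ultimately have "?P 0 = 0" by (intro tendsto_unique[OF trivial_limit_at])
  then have a0: "a 0 = 0" by (simp add: sum.atMost_Suc_shift del: sum.atMost_Suc)
  have "((\<lambda>t::real. (\<Sum>j\<le>m. a (Suc j) * of_real t ^ j) / of_real t ^ m) \<longlongrightarrow> 0) (at 0)"
  proof (rule Lim_transform_eventually[OF Suc.prems(1)])
    have "?P t / of_real t ^ Suc m = (\<Sum>j\<le>m. a (Suc j) * of_real t ^ j) / of_real t ^ m" if "t \<noteq> 0" for t :: real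
      using that by (simp add: sum.atMost_Suc_shift a0 mult.left_commute[of _ "of_real t"] flip: sum_distrib_left del: sum.atMost_Suc)
    then show "\<forall>\<^sub>F t in at 0. ?P t / of_real t ^ Suc m = (\<Sum>j\<le>m. a (Suc j) * of_real t ^ j) / of_real t ^ m"
      by (auto simp: eventually_at_filter)
  qed
  then show ?case using Suc.IH[of "\<lambda>j. a (Suc j)" "j - 1"] a0 Suc.prems(2) by (cases j) auto
qed

text \<open>Smallness is assumed on the imaginary axis only, which is all that characteristic
  functions can supply. Zeros of holomorphic functions have integer order, so o(|t|^m) on one line
  already forces a zero of order m + 1 in every direction. Each step splits off one factor u by the
  removable singularity of D u / u.\<close>

lemma holomorphic_factor_of_small:
  assumes "D holomorphic_on UNIV"
    and "((\<lambda>t::real. D (\<i> * of_real t) / of_real t ^ m) \<longlongrightarrow> 0) (at 0)"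
  shows "\<exists>g. g holomorphic_on UNIV \<and> (\<forall>u. D u = u ^ Suc m * g u)"
  using assms
proof (induction m arbitrary: D)
  have step: "\<exists>g. g holomorphic_on UNIV \<and> (\<forall>u. D u = u * g u)"
    if D: "D holomorphic_on UNIV" and lim: "((\<lambda>t::real. D (\<i> * of_real t) / of_real t ^ m) \<longlongrightarrow> 0) (at 0)" for D m
  proof -
    have "((\<lambda>t::real. D (\<i> * of_real t) / of_real t ^ m * of_real t ^ m) \<longlongrightarrow> 0 * of_real 0 ^ m) (at 0)"
      by (intro tendsto_mult lim tendsto_intros)
    then have "((\<lambda>t::real. D (\<i> * of_real t)) \<longlongrightarrow> 0) (at 0)"
      unfolding mult_zero_left by (rule Lim_transform_eventually) (auto simp: eventually_at_filter)
    moreover have "isCont D 0"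
      using holomorphic_on_imp_continuous_on[OF D] by (simp add: continuous_on_eq_continuous_at)
    then have "((\<lambda>t::real. D (\<i> * of_real t)) \<longlongrightarrow> D (\<i> * of_real 0)) (at 0)"
      by (intro isCont_tendsto_compose[of _ D] tendsto_intros) simp
    ultimately have "D (\<i> * of_real 0) = 0" by (intro tendsto_unique[OF trivial_limit_at])
    then have D0: "D 0 = 0" by simp
    show ?thesis
      using pole_lemma[OF D, of 0] D0
      by (intro exI[of _ "\<lambda>z. if z = 0 then deriv D 0 else (D z - D 0) / (z - 0)"]) auto
  qed
  {
    case 0
    then show ?case using step[of D 0] by simp
  next
    case (Suc m)
    obtain g where g: "g holomorphic_on UNIV" "\<And>u. D u = u * g u"
      using step[OF Suc.prems] by blast
    have "((\<lambda>t::real. (1 / \<i>) * (D (\<i> * of_real t) / of_real t ^ Suc m)) \<longlongrightarrow> (1 / \<i>) * 0) (at 0)"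
      by (intro tendsto_mult_left Suc.prems)
    then have "((\<lambda>t::real. g (\<i> * of_real t) / of_real t ^ m) \<longlongrightarrow> 0) (at 0)"
      unfolding mult_zero_right
      by (rule Lim_transform_eventually) (auto simp: eventually_at_filter g(2))
    from Suc.IH[OF g(1) this] show ?case using g(2) by (metis mult.assoc power_Suc)
  }
qed

text \<open>The cofactor is bounded on the closed unit disc, so o(|t|^m) on a line improves to
  O(|u|^(m+1)) on the disc.\<close>

lemma holomorphic_bound_of_small:
  assumes "D holomorphic_on UNIV"
    and "((\<lambda>t::real. D (\<i> * of_real t) / of_real t ^ m) \<longlongrightarrow> 0) (at 0)"
  shows "\<exists>C\<ge>0. \<forall>u. cmod u \<le> 1 \<longrightarrow> cmod (D u) \<le> C * cmod u ^ Suc m"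
proof -
  obtain g where g: "g holomorphic_on UNIV" "\<And>u. D u = u ^ Suc m * g u"
    using holomorphic_factor_of_small[OF assms] by blast
  have "compact (g ` cball 0 1)"
    using g(1) by (intro compact_continuous_image holomorphic_on_imp_continuous_on holomorphic_on_subset[OF g(1)]) auto
  then have "bounded (g ` cball 0 1)" by (rule compact_imp_bounded)
  then obtain C where "\<forall>x\<in>g ` cball 0 1. cmod x \<le> C" unfolding bounded_iff by blast
  then have C: "\<And>u. cmod u \<le> 1 \<Longrightarrow> cmod (g u) \<le> C" by auto
  have "0 \<le> C" using order_trans[OF norm_ge_zero C[of 0]] by simp
  moreover have "cmod (D u) \<le> C * cmod u ^ Suc m" if "cmod u \<le> 1" for u
  proof -
    have "cmod (D u) = cmod (g u) * cmod u ^ Suc m"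
      unfolding g(2) norm_mult norm_power by (rule mult.commute)
    then show ?thesis using mult_right_mono[OF C[OF that], of "cmod u ^ Suc m"] by simp
  qed
  ultimately show ?thesis by blast
qed

lemma tendsto_div_power_of_eps:
  fixes f :: "real \<Rightarrow> complex"
  assumes "\<And>e. e > 0 \<Longrightarrow> \<exists>d>0. \<forall>t. \<bar>t\<bar> < d \<longrightarrow> cmod (f t) \<le> e * \<bar>t\<bar> ^ m"
  shows "((\<lambda>t. f t / of_real t ^ m) \<longlongrightarrow> 0) (at 0)"
  unfolding LIM_def
proof (intro allI impI)
  fix e :: real assume e: "e > 0"
  then obtain d where d: "d > 0" "\<And>t. \<bar>t\<bar> < d \<Longrightarrow> cmod (f t) \<le> e / 2 * \<bar>t\<bar> ^ m"
    using assms[of "e / 2"] by auto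
  have "cmod (f t / of_real t ^ m) < e" if "t \<noteq> 0" "\<bar>t\<bar> < d" for t
  proof -
    have "cmod (f t / of_real t ^ m) \<le> e / 2"
      using d(2)[OF that(2)] that(1) by (simp add: norm_divide norm_power divide_le_eq)
    then show ?thesis using e by simp
  qed
  then show "\<exists>s>0. \<forall>x. x \<noteq> 0 \<and> dist x 0 < s \<longrightarrow> dist (f x / of_real x ^ m) 0 < e"
    using d(1) by (intro exI[of _ d]) (auto simp: dist_norm)
qed

text \<open>The cumulant polynomial; the sum starts at 2 because the cumulants of order 0 and 1 of a
  centred law vanish.\<close>

definition cgf :: "real measure \<Rightarrow> nat \<Rightarrow> complex \<Rightarrow> complex" where
  "cgf \<mu> m w = (\<Sum>j=2..m. of_real (cumulant \<mu> j) * w ^ j / fact j)"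

locale moment_distribution = real_distribution +
  fixes m :: nat
  assumes integrable_moments: "\<And>k. k \<le> m \<Longrightarrow> integrable M (\<lambda>x. x ^ k)"
begin

lemma char_Taylor:
  "((\<lambda>t. (char M t - (\<Sum>k\<le>m. ((\<i> * t) ^ k / fact k) * expectation (\<lambda>x. x ^ k))) / of_real t ^ m) \<longlongrightarrow> 0) (at 0)"
proof (rule Lim_null_comparison)
  \<comment> \<open>The expectation of the minimum of two remainder bounds: the first is integrable
    with m moments only, the second tends to 0 with t. Dominated convergence combines them.\<close>
  let ?E = "\<lambda>t. expectation (\<lambda>x. min (2 * \<bar>x\<bar> ^ m * real (Suc m)) (\<bar>t\<bar> * \<bar>x\<bar> ^ Suc m))"
  show "\<forall>\<^sub>F t in at 0. norm ((char M t - (\<Sum>k\<le>m. ((\<i> * t) ^ k / fact k) * expectation (\<lambda>x. x ^ k))) / of_real t ^ m)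
      \<le> ?E t / fact (Suc m)"
  proof (unfold eventually_at_filter, intro always_eventually allI impI)
    fix t :: real assume "t \<noteq> 0"
    have "norm ((char M t - (\<Sum>k\<le>m. ((\<i> * t) ^ k / fact k) * expectation (\<lambda>x. x ^ k))) / of_real t ^ m)
      \<le> ((\<bar>t\<bar> ^ m / fact (Suc m)) * ?E t) / \<bar>t\<bar> ^ m"
      unfolding norm_divide norm_power norm_of_real
      by (intro divide_right_mono char_approx2 integrable_moments) auto
    then show "norm ((char M t - (\<Sum>k\<le>m. ((\<i> * t) ^ k / fact k) * expectation (\<lambda>x. x ^ k))) / of_real t ^ m)
      \<le> ?E t / fact (Suc m)"
      using \<open>t \<noteq> 0\<close> by (simp del: fact_Suc of_nat_Suc)
  qed
  have "(?E \<longlongrightarrow> 0) (at 0)"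
  proof (subst tendsto_at_iff_sequentially, intro allI impI)
    fix X :: "nat \<Rightarrow> real" assume X: "\<forall>i. X i \<in> UNIV - {0}" "X \<longlonglongrightarrow> 0"
    have "(\<lambda>i. ?E (X i)) \<longlonglongrightarrow> expectation (\<lambda>x. 0)"
    proof (rule integral_dominated_convergence[where w = "\<lambda>x. 2 * \<bar>x\<bar> ^ m * real (Suc m)"])
      show "integrable M (\<lambda>x. 2 * \<bar>x\<bar> ^ m * real (Suc m))"
        unfolding power_abs[symmetric]
        by (intro integrable_mult_left integrable_mult_right integrable_abs integrable_moments order_refl)
      show "AE x in M. (\<lambda>i. min (2 * \<bar>x\<bar> ^ m * real (Suc m)) (\<bar>X i\<bar> * \<bar>x\<bar> ^ Suc m)) \<longlonglongrightarrow> 0"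
      proof (rule AE_I2)
        fix x :: real
        have "(\<lambda>i. min (2 * \<bar>x\<bar> ^ m * real (Suc m)) (\<bar>X i\<bar> * \<bar>x\<bar> ^ Suc m))
            \<longlonglongrightarrow> min (2 * \<bar>x\<bar> ^ m * real (Suc m)) (\<bar>0\<bar> * \<bar>x\<bar> ^ Suc m)"
          by (intro tendsto_intros X)
        then show "(\<lambda>i. min (2 * \<bar>x\<bar> ^ m * real (Suc m)) (\<bar>X i\<bar> * \<bar>x\<bar> ^ Suc m)) \<longlonglongrightarrow> 0" by simp
      qed
    qed auto
    then show "(?E \<circ> X) \<longlonglongrightarrow> 0" by (simp add: comp_def)
  qed
  then show "((\<lambda>t. ?E t / fact (Suc m)) \<longlongrightarrow> 0) (at 0)"
    by (rule tendsto_divide_zero)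
qed

lemma C_k_on_char: "C_k_on m UNIV (char M)"
proof -
  let ?f = "\<lambda>k t. \<integral>x. (\<i> * x) ^ k * iexp (t * x) \<partial>M"
  \<comment> \<open>\<open>?f k\<close> is the k-th derivative of the characteristic function; after
    m - j derivatives j more are left.\<close>
  have "C_k_on j UNIV (?f (m - j))" if "j \<le> m" for j
    using that
  proof (induction j)
    case 0
    have "(\<lambda>n. ?f m (X n)) \<longlonglongrightarrow> ?f m t" if X: "X \<longlonglongrightarrow> t" for X :: "nat \<Rightarrow> real" and t
    proof (rule integral_dominated_convergence[where w = "\<lambda>x. \<bar>x ^ m\<bar>"])
      show "AE x in M. (\<lambda>n. (\<i> * x) ^ m * iexp (X n * x)) \<longlonglongrightarrow> (\<i> * x) ^ m * iexp (t * x)"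
        by (intro AE_I2 tendsto_intros X)
      show "integrable M (\<lambda>x. \<bar>x ^ m\<bar>)" by (intro integrable_abs integrable_moments order_refl)
    qed (auto simp: norm_mult norm_power power_abs)
    then show ?case
      by (simp add: continuous_on_sequentially comp_def)
  next
    case (Suc j)
    have "Suc (m - Suc j) = m - j" using Suc.prems by simp
    then have "(?f (m - Suc j) has_vector_derivative ?f (m - j) t) (at t)" for t
      using has_vector_derivative_char_moment[OF integrable_moments integrable_moments, of "m - Suc j" t] by simp
    then show ?case using Suc by (auto intro!: exI[of _ "?f (m - j)"])
  qed
  from this[of m] show ?thesis by (simp add: char_def[abs_def])
qed

lemma Ln_char_Taylor_vderiv:
  "((\<lambda>t. (Ln (char M t) - (\<Sum>j\<le>m. vderiv j (\<lambda>t. Ln (char M t)) 0 * of_real t ^ j / fact j)) / of_real t ^ m) \<longlongrightarrow> 0) (at 0)"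
proof (rule tendsto_div_power_of_eps)
  fix e :: real assume e: "e > 0"
  \<comment> \<open>On this neighbourhood of 0 the values avoid the branch cut of
    \<open>Ln\<close>.\<close>
  define U where "U = {t. 0 < Re (char M t)}"
  have "continuous_on UNIV (\<lambda>t. Re (char M t))"
    by (intro continuous_intros continuous_at_imp_continuous_on ballI isCont_char)
  then have "open U"
    unfolding U_def by (rule open_Collect_less[OF continuous_on_const])
  moreover have "0 \<in> U" by (simp add: U_def char_zero)
  moreover have "C_k_on m U (\<lambda>t. Ln (char M t))"
  proof (rule C_k_on_Ln)
    have "C_k_on k U f" if "C_k_on k UNIV f" for k f
      using that by (induction k arbitrary: f) (auto intro: continuous_on_subset)
    then show "C_k_on m U (char M)" using C_k_on_char by blast
  qed (auto simp: U_def complex_nonpos_Reals_iff)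
  ultimately show "\<exists>d>0. \<forall>t. \<bar>t\<bar> < d \<longrightarrow>
      cmod (Ln (char M t) - (\<Sum>j\<le>m. vderiv j (\<lambda>t. Ln (char M t)) 0 * of_real t ^ j / fact j)) \<le> e * \<bar>t\<bar> ^ m"
    by (rule C_k_on_Taylor[OF _ _ _ e])
qed

lemma eventually_Re_char_pos: "\<forall>\<^sub>F t in at 0. 0 < Re (char M t)"
proof -
  have "((\<lambda>t. Re (char M t)) \<longlongrightarrow> Re (char M 0)) (at 0)"
    using isCont_char[of 0] by (intro tendsto_Re) (simp add: isCont_def)
  then show ?thesis
    by (rule order_tendstoD) (simp add: char_zero)
qed

text \<open>The real part in \<open>cumulant\<close> loses nothing: Ln char at - t is the conjugate
  of its value at t. Comparing the two expansions gives cnj g_j = (-1)^j g_j for the coefficients,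
  which makes g_j / i^j real.\<close>

lemma vderiv_Ln_char_eq_cumulant:
  assumes "j \<le> m"
  shows "vderiv j (\<lambda>t. Ln (char M t)) 0 = \<i> ^ j * cumulant M j"
proof -
  define g where "g j = vderiv j (\<lambda>t. Ln (char M t)) 0" for j
  let ?e = "\<lambda>t. Ln (char M t) - (\<Sum>j\<le>m. g j * of_real t ^ j / fact j)"
  have lim: "((\<lambda>t. ?e t / of_real t ^ m) \<longlongrightarrow> 0) (at 0)"
    using Ln_char_Taylor_vderiv by (simp add: g_def)
  have lim1: "((\<lambda>t. cnj (?e t / of_real t ^ m)) \<longlongrightarrow> 0) (at 0)"
    using tendsto_cnj[OF lim] by simp
  have "filterlim (\<lambda>t::real. - t) (at 0) (at 0)"
    unfolding filterlim_at by (auto intro!: tendsto_eq_intros simp: eventually_at_filter)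
  from filterlim_compose[OF lim this]
  have "((\<lambda>t. ?e (- t) / of_real (- t) ^ m) \<longlongrightarrow> 0) (at 0)" .
  from tendsto_mult_left[OF this, of "(-1) ^ m"]
  have lim2: "((\<lambda>t. (-1) ^ m * (?e (- t) / of_real (- t) ^ m)) \<longlongrightarrow> 0) (at 0)" by simp
  have "((\<lambda>t. cnj (?e t / of_real t ^ m) - (-1) ^ m * (?e (- t) / of_real (- t) ^ m)) \<longlongrightarrow> 0) (at 0)"
    using tendsto_diff[OF lim1 lim2] by simp
  then have "((\<lambda>t::real. (\<Sum>j\<le>m. ((-1) ^ j * g j / fact j - cnj (g j) / fact j) * of_real t ^ j) / of_real t ^ m) \<longlongrightarrow> 0) (at 0)"
  proof (rule Lim_transform_eventually)
    show "\<forall>\<^sub>F t in at 0. cnj (?e t / of_real t ^ m) - (-1) ^ m * (?e (- t) / of_real (- t) ^ m)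
        = (\<Sum>j\<le>m. ((-1) ^ j * g j / fact j - cnj (g j) / fact j) * of_real t ^ j) / of_real t ^ m"
      using eventually_Re_char_pos eventually_neq_at_within[of 0]
    proof eventually_elim
      case (elim t)
      have "Ln (char M (- t)) = cnj (Ln (char M t))"
        using elim(1) by (subst char_uminus, subst cnj_Ln) (auto simp: complex_nonpos_Reals_iff)
      moreover have "(-1) ^ m * (?e (- t) / of_real (- t) ^ m) = ?e (- t) / of_real t ^ m"
        by (cases "even m") (auto simp: minus_divide_left)
      ultimately have "cnj (?e t / of_real t ^ m) - (-1) ^ m * (?e (- t) / of_real (- t) ^ m)
          = ((\<Sum>j\<le>m. g j * of_real (- t) ^ j / fact j) - (\<Sum>j\<le>m. cnj (g j) * of_real t ^ j / fact j)) / of_real t ^ m"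
        by (simp add: diff_divide_distrib)
      also have "(\<Sum>j\<le>m. g j * of_real (- t) ^ j / fact j) - (\<Sum>j\<le>m. cnj (g j) * of_real t ^ j / fact j)
          = (\<Sum>j\<le>m. ((-1) ^ j * g j / fact j - cnj (g j) / fact j) * of_real t ^ j)"
        by (subst sum_subtractf[symmetric], rule sum.cong)
           (auto simp: algebra_simps power_minus[of "complex_of_real t"])
      finally show ?case .
    qed
  qed
  from poly_coeffs_zero_of_small[OF this assms]
  have c: "cnj (g j) = (-1) ^ j * g j" by simp
  let ?z = "inverse (\<i> ^ j) * g j"
  have i: "cnj (inverse (\<i> ^ j)) = (-1) ^ j * inverse (\<i> ^ j)"
    by (simp add: power_inverse[symmetric] power_mult_distrib[symmetric])
  have "cnj ?z = ?z"
    unfolding complex_cnj_mult i c by (simp add: mult_ac)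
  then have "?z = of_real (Re ?z)"
    by (metis Reals_cnj_iff complex_is_Real_iff of_real_Re)
  then have z: "?z = of_real (cumulant M j)"
    by (simp add: cumulant_def g_def)
  have "g j = (\<i> ^ j * inverse (\<i> ^ j)) * g j" by simp
  also have "\<dots> = \<i> ^ j * ?z" by (simp only: mult.assoc)
  finally have "g j = \<i> ^ j * of_real (cumulant M j)" unfolding z .
  then show ?thesis unfolding g_def .
qed

lemma Ln_char_Taylor:
  "((\<lambda>t. (Ln (char M t) - (\<Sum>j\<le>m. of_real (cumulant M j) * (\<i> * of_real t) ^ j / fact j)) / of_real t ^ m) \<longlongrightarrow> 0) (at 0)"
proof -
  have "(\<Sum>j\<le>m. vderiv j (\<lambda>t. Ln (char M t)) 0 * of_real t ^ j / fact j)
      = (\<Sum>j\<le>m. of_real (cumulant M j) * (\<i> * of_real t) ^ j / fact j)" for t :: real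
    by (rule sum.cong) (auto simp: vderiv_Ln_char_eq_cumulant power_mult_distrib mult_ac)
  then show ?thesis using Ln_char_Taylor_vderiv by simp
qed

end

locale standardized_distribution = moment_distribution +
  assumes m_ge_2: "2 \<le> m" and mean_0: "expectation (\<lambda>x. x) = 0" and variance_1: "expectation (\<lambda>x. x\<^sup>2) = 1"
begin

lemma moment_distribution_2: "moment_distribution M 2"
proof
  show "integrable M (\<lambda>x. x ^ k)" if "k \<le> 2" for k
    using that m_ge_2 by (intro integrable_moments) simp
qed

text \<open>From char t = 1 - t^2 / 2 + o(t^2) and Ln z = (z - 1) (1 + o(1)) near 1 follows Ln char
  t = - t^2 / 2 + o(t^2); uniqueness of Taylor coefficients then reads off the three values.\<close>

lemma low_cumulants: "cumulant M 0 = 0" "cumulant M 1 = 0" "cumulant M 2 = 1"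
proof -
  interpret M2: moment_distribution M 2 by (rule moment_distribution_2)
  \<comment> \<open>The divided difference of \<open>Ln\<close> at 1, filled in holomorphically, so
    that Ln z = (z - 1) * h z holds without excluding z = 1.\<close>
  define h where "h z = (if z = 1 then deriv Ln 1 else (Ln z - Ln 1) / (z - 1))" for z :: complex
  have "h holomorphic_on {z. 0 < Re z}"
    unfolding h_def[abs_def]
    by (rule pole_lemma)
       (auto intro!: holomorphic_intros simp: complex_nonpos_Reals_iff interior_open open_halfspace_Re_gt)
  then have "isCont h 1"
    by (auto dest!: holomorphic_on_imp_continuous_on simp: continuous_on_eq_continuous_at open_halfspace_Re_gt)
  moreover have "(char M \<longlongrightarrow> 1) (at 0)"
    using isCont_char[of 0] by (simp add: isCont_def char_zero)
  ultimately have "((\<lambda>t. h (char M t)) \<longlongrightarrow> h 1) (at 0)"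
    by (rule isCont_tendsto_compose)
  moreover have "h 1 = 1"
    using DERIV_imp_deriv[OF has_field_derivative_Ln[of 1]] by (simp add: h_def)
  ultimately have h: "((\<lambda>t. h (char M t)) \<longlongrightarrow> 1) (at 0)" by simp
  have "((\<lambda>t. (char M t - (1 - of_real t ^ 2 / 2)) / of_real t ^ 2) \<longlongrightarrow> 0) (at 0)"
    using M2.char_Taylor mean_0 variance_1 prob_space by (simp add: numeral_2_eq_2 power2_eq_square algebra_simps)
  then have "((\<lambda>t. (char M t - (1 - of_real t ^ 2 / 2)) / of_real t ^ 2 - 1 / 2) \<longlongrightarrow> 0 - 1 / 2) (at 0)"
    by (intro tendsto_intros)
  from tendsto_mult[OF this h]
  have "((\<lambda>t. ((char M t - (1 - of_real t ^ 2 / 2)) / of_real t ^ 2 - 1 / 2) * h (char M t)) \<longlongrightarrow> - 1 / 2) (at 0)" by simp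
  moreover have "((\<lambda>t. (Ln (char M t) - (\<Sum>j\<le>2. of_real (cumulant M j) * (\<i> * of_real t) ^ j / fact j)) / of_real t ^ 2) \<longlongrightarrow> 0) (at 0)"
    by (rule M2.Ln_char_Taylor)
  ultimately have "((\<lambda>t. ((char M t - (1 - of_real t ^ 2 / 2)) / of_real t ^ 2 - 1 / 2) * h (char M t) + 1 / 2
      - (Ln (char M t) - (\<Sum>j\<le>2. of_real (cumulant M j) * (\<i> * of_real t) ^ j / fact j)) / of_real t ^ 2) \<longlongrightarrow> - 1 / 2 + 1 / 2 - 0) (at 0)"
    by (intro tendsto_intros)
  then have lim: "((\<lambda>t. ((char M t - (1 - of_real t ^ 2 / 2)) / of_real t ^ 2 - 1 / 2) * h (char M t) + 1 / 2
      - (Ln (char M t) - (\<Sum>j\<le>2. of_real (cumulant M j) * (\<i> * of_real t) ^ j / fact j)) / of_real t ^ 2) \<longlongrightarrow> 0) (at 0)"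
    by simp
  let ?a = "\<lambda>j::nat. of_real (cumulant M j) * \<i> ^ j / fact j + (if j = 2 then 1 / 2 else 0 :: complex)"
  have "((\<lambda>t::real. (\<Sum>j\<le>2. ?a j * of_real t ^ j) / of_real t ^ 2) \<longlongrightarrow> 0) (at 0)"
  proof (rule Lim_transform_eventually[OF lim])
    show "\<forall>\<^sub>F t in at 0. ((char M t - (1 - of_real t ^ 2 / 2)) / of_real t ^ 2 - 1 / 2) * h (char M t) + 1 / 2
      - (Ln (char M t) - (\<Sum>j\<le>2. of_real (cumulant M j) * (\<i> * of_real t) ^ j / fact j)) / of_real t ^ 2
      = (\<Sum>j\<le>2. ?a j * of_real t ^ j) / of_real t ^ 2"
      unfolding eventually_at_filter
    proof (intro always_eventually allI impI)
      fix t :: real assume t: "t \<noteq> 0"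
      have 1: "(char M t - (1 - of_real t ^ 2 / 2)) / of_real t ^ 2 - 1 / 2 = (char M t - 1) / of_real t ^ 2"
        using t by (simp add: field_simps)
      have "(char M t - 1) * h (char M t) = Ln (char M t)"
        by (simp add: h_def)
      then have 2: "(char M t - 1) / of_real t ^ 2 * h (char M t) = Ln (char M t) / of_real t ^ 2"
        by simp
      have 3: "(\<Sum>j\<le>2. ?a j * of_real t ^ j) = (\<Sum>j\<le>2. of_real (cumulant M j) * (\<i> * of_real t) ^ j / fact j) + of_real t ^ 2 / 2"
        by (simp add: numeral_2_eq_2 power_mult_distrib algebra_simps)
      show "((char M t - (1 - of_real t ^ 2 / 2)) / of_real t ^ 2 - 1 / 2) * h (char M t) + 1 / 2
        - (Ln (char M t) - (\<Sum>j\<le>2. of_real (cumulant M j) * (\<i> * of_real t) ^ j / fact j)) / of_real t ^ 2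
        = (\<Sum>j\<le>2. ?a j * of_real t ^ j) / of_real t ^ 2"
        unfolding 1 2 3 using t by (simp add: diff_divide_distrib add_divide_distrib)
    qed
  qed
  note c = poly_coeffs_zero_of_small[OF this]
  show "cumulant M 0 = 0" "cumulant M 1 = 0" using c[of 0] c[of 1] by simp_all
  have "of_real (cumulant M 2) = (1::complex)" using c[of 2] by (simp add: field_simps)
  then show "cumulant M 2 = 1" by (simp only: of_real_eq_1_iff)
qed

lemma sum_cumulants_eq_cgf: "(\<Sum>j\<le>m. of_real (cumulant M j) * w ^ j / fact j) = cgf M m w"
proof -
  have "{..m} = {0, 1} \<union> {2..m}" using m_ge_2 by auto
  then have "(\<Sum>j\<le>m. of_real (cumulant M j) * w ^ j / fact j)
      = (\<Sum>j\<in>{0, 1}. of_real (cumulant M j) * w ^ j / fact j) + cgf M m w"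
    unfolding cgf_def by (simp only:, subst sum.union_disjoint) auto
  then show ?thesis using low_cumulants by simp
qed

text \<open>On the imaginary axis both functions match the characteristic function of \<nu> to order
  m: the polynomial by its moments, the exponential because char \<nu> = exp (l * Ln (char M)) near
  0. Holomorphy carries the agreement to the whole disc, hence to points w / \<tau> with Re w = 1 or
  Re w = -1.\<close>

lemma exp_cgf_Taylor:
  assumes nu: "moment_distribution \<nu> m" and char: "\<And>t. char \<nu> t = char M t ^ l"
  shows "\<exists>C\<ge>0. \<forall>u. cmod u \<le> 1 \<longrightarrow>
    cmod (exp (of_nat l * cgf M m u) - (\<Sum>k\<le>m. of_real (\<integral>x. x ^ k \<partial>\<nu>) * u ^ k / fact k)) \<le> C * cmod u ^ Suc m"
proof (rule holomorphic_bound_of_small)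
  interpret nu: moment_distribution \<nu> m by (rule nu)
  show "(\<lambda>u. exp (of_nat l * cgf M m u) - (\<Sum>k\<le>m. of_real (\<integral>x. x ^ k \<partial>\<nu>) * u ^ k / fact k)) holomorphic_on UNIV"
    unfolding cgf_def by (intro holomorphic_intros) auto
  define e where "e t = Ln (char M t) - cgf M m (\<i> * of_real t)" for t :: real
  have e: "((\<lambda>t. e t / of_real t ^ m) \<longlongrightarrow> 0) (at 0)"
    using Ln_char_Taylor by (simp add: sum_cumulants_eq_cgf e_def)
  have "((\<lambda>t. e t / of_real t ^ m * of_real t ^ m) \<longlongrightarrow> 0 * of_real 0 ^ m) (at 0)"
    by (intro tendsto_mult e tendsto_intros)
  then have e0: "(e \<longlongrightarrow> 0) (at 0)"
    unfolding mult_zero_left by (rule Lim_transform_eventually) (auto simp: eventually_at_filter)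
  \<comment> \<open>The divided difference of exp at 0: it turns the error e in the exponent into a
    multiplicative error without dividing by e.\<close>
  define h where "h z = (if z = 0 then deriv exp 0 else (exp z - exp 0) / (z - 0))" for z :: complex
  have "h holomorphic_on UNIV"
    unfolding h_def[abs_def] by (rule pole_lemma) (auto intro!: holomorphic_intros)
  then have "isCont h 0"
    by (auto dest!: holomorphic_on_imp_continuous_on simp: continuous_on_eq_continuous_at)
  moreover have "((\<lambda>t. - of_nat l * e t) \<longlongrightarrow> 0) (at 0)"
    using tendsto_mult_left[OF e0, of "- of_nat l"] by simp
  ultimately have h: "((\<lambda>t. h (- of_nat l * e t)) \<longlongrightarrow> h 0) (at 0)"
    by (rule isCont_tendsto_compose)
  have hexp: "exp z - 1 = z * h z" for z
    by (simp add: h_def)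
  have chlim: "((\<lambda>t. char \<nu> t) \<longlongrightarrow> 1) (at 0)"
    using nu.isCont_char[of 0] by (simp add: isCont_def nu.char_zero)
  have "((\<lambda>t. char \<nu> t * (- of_nat l * (e t / of_real t ^ m)) * h (- of_nat l * e t)
      + (char \<nu> t - (\<Sum>k\<le>m. ((\<i> * t) ^ k / fact k) * nu.expectation (\<lambda>x. x ^ k))) / of_real t ^ m)
      \<longlongrightarrow> 1 * (- of_nat l * 0) * h 0 + 0) (at 0)"
    by (intro tendsto_intros chlim e h nu.char_Taylor)
  then have "((\<lambda>t. char \<nu> t * (- of_nat l * (e t / of_real t ^ m)) * h (- of_nat l * e t)
      + (char \<nu> t - (\<Sum>k\<le>m. ((\<i> * t) ^ k / fact k) * nu.expectation (\<lambda>x. x ^ k))) / of_real t ^ m) \<longlongrightarrow> 0) (at 0)"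
    by simp
  then show "((\<lambda>t. (exp (of_nat l * cgf M m (\<i> * of_real t))
      - (\<Sum>k\<le>m. of_real (\<integral>x. x ^ k \<partial>\<nu>) * (\<i> * of_real t) ^ k / fact k)) / of_real t ^ m) \<longlongrightarrow> 0) (at 0)"
  proof (rule Lim_transform_eventually)
    show "\<forall>\<^sub>F t in at 0. char \<nu> t * (- of_nat l * (e t / of_real t ^ m)) * h (- of_nat l * e t)
      + (char \<nu> t - (\<Sum>k\<le>m. ((\<i> * t) ^ k / fact k) * nu.expectation (\<lambda>x. x ^ k))) / of_real t ^ m
      = (exp (of_nat l * cgf M m (\<i> * of_real t))
      - (\<Sum>k\<le>m. of_real (\<integral>x. x ^ k \<partial>\<nu>) * (\<i> * of_real t) ^ k / fact k)) / of_real t ^ m"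
      using eventually_Re_char_pos
    proof eventually_elim
      case (elim t)
      then have nz: "char M t \<noteq> 0" by auto
      have "exp (of_nat l * cgf M m (\<i> * of_real t)) = exp (of_nat l * Ln (char M t)) * exp (- of_nat l * e t)"
        by (simp add: e_def algebra_simps flip: exp_add)
      also have "exp (of_nat l * Ln (char M t)) = char \<nu> t"
        using nz by (simp add: exp_of_nat_mult char)
      finally have "exp (of_nat l * cgf M m (\<i> * of_real t)) - char \<nu> t = char \<nu> t * (- of_nat l * e t * h (- of_nat l * e t))"
        by (simp only: hexp[symmetric] right_diff_distrib mult_1_right)
      then have "exp (of_nat l * cgf M m (\<i> * of_real t)) = char \<nu> t * (- of_nat l * e t * h (- of_nat l * e t)) + char \<nu> t"
        by (simp only: diff_eq_eq)
      then show ?case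
        by (simp add: add_divide_distrib diff_divide_distrib mult_ac)
    qed
  qed
qed

end

section \<open>The exponential of a polynomial as a sum over multi-indices\<close>

lemma has_sum_exp_sum:
  fixes x :: "nat \<Rightarrow> 'c::{banach, real_normed_field, second_countable_topology}"
  assumes fin: "finite I"
  shows "((\<lambda>p. \<Prod>i\<in>I. x i ^ p i / fact (p i)) has_sum exp (\<Sum>i\<in>I. x i)) (PiE I (\<lambda>_. UNIV))"
proof -
  let ?f = "\<lambda>i (n::nat). x i ^ n / fact n"
  have s: "summable (\<lambda>n. norm (?f i n))" for i
    using summable_norm_exp[of "x i"] by (simp add: scaleR_conv_of_real divide_inverse mult.commute)
  have "(?f i has_sum exp (x i)) UNIV" for i
    using exp_converges[of "x i"]
    by (intro norm_summable_imp_has_sum s) (simp add: scaleR_conv_of_real divide_inverse mult.commute)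
  then have inf: "infsum (?f i) UNIV = exp (x i)" for i
    by (rule infsumI)
  have abs: "(\<lambda>n. norm (?f i n)) summable_on UNIV" for i
    using s by (intro norm_summable_imp_summable_on) simp
  have "Infinite_Set_Sum.abs_summable_on (\<lambda>p. \<Prod>i\<in>I. ?f i (p i)) (PiE I (\<lambda>_. UNIV))"
    by (rule Infinite_Set_Sum.abs_summable_on_prod_PiE) (use fin abs in \<open>auto simp: abs_summable_equivalent[symmetric]\<close>)
  then have "(\<lambda>p. norm (\<Prod>i\<in>I. ?f i (p i))) summable_on (PiE I (\<lambda>_. UNIV))"
    by (simp only: abs_summable_equivalent)
  then have "(\<lambda>p. \<Prod>i\<in>I. ?f i (p i)) summable_on (PiE I (\<lambda>_. UNIV))"
    by (rule abs_summable_summable)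
  then have "((\<lambda>p. \<Prod>i\<in>I. ?f i (p i)) has_sum infsum (\<lambda>p. \<Prod>i\<in>I. ?f i (p i)) (PiE I (\<lambda>_. UNIV))) (PiE I (\<lambda>_. UNIV))"
    by (rule has_sum_infsum)
  moreover have "infsum (\<lambda>p. \<Prod>i\<in>I. ?f i (p i)) (PiE I (\<lambda>_. UNIV)) = exp (\<Sum>i\<in>I. x i)"
    by (subst infsum_prod_PiE_abs) (use fin abs in \<open>auto simp: inf exp_sum\<close>)
  ultimately show ?thesis
    by (simp only:)
qed

text \<open>The coefficient of z^k in exp (c 1 * z + c 2 * z^2 + ...), a complete Bell polynomial up
  to normalisation.\<close>

definition weight_poly :: "(nat \<Rightarrow> complex) \<Rightarrow> nat \<Rightarrow> complex" where
  "weight_poly c k = (\<Sum>p\<in>weight_solutions k. \<Prod>i=1..k. c i ^ p i / fact (p i))"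

text \<open>A solution of weight k has p i = 0 for i > k, so tuples of any length M \<ge> k carry
  the same sum. This identifies the Edgeworth sums over k-tuples with coefficients of a single
  exponential.\<close>

lemma weight_solutions_extend:
  fixes c :: "nat \<Rightarrow> complex"
  assumes "k \<le> M"
  shows "(\<Sum>p | p \<in> PiE {1..M} (\<lambda>_. UNIV) \<and> (\<Sum>i=1..M. i * p i) = k. \<Prod>i=1..M. c i ^ p i / fact (p i)) = weight_poly c k"
  unfolding weight_poly_def
proof (rule sum.reindex_bij_witness[where i = "\<lambda>p. \<lambda>i\<in>{1..M}. if i \<le> k then p i else 0" and j = "\<lambda>p. restrict p {1..k}"])
  have sub: "{1..k} \<subseteq> {1..M}" using assms by auto
  fix p assume p: "p \<in> {p. p \<in> PiE {1..M} (\<lambda>_. UNIV) \<and> (\<Sum>i=1..M. i * p i) = k}"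
  have z: "p i = 0" if "i \<in> {1..M} - {1..k}" for i
  proof (rule ccontr)
    assume "p i \<noteq> 0"
    have "i \<le> i * p i" using \<open>p i \<noteq> 0\<close> by simp
    also have "\<dots> \<le> (\<Sum>i=1..M. i * p i)" by (rule member_le_sum) (use that in auto)
    finally show False using p that by auto
  qed
  show "(\<lambda>i\<in>{1..M}. if i \<le> k then restrict p {1..k} i else 0) = p"
  proof
    fix i
    show "(\<lambda>i\<in>{1..M}. if i \<le> k then restrict p {1..k} i else 0) i = p i"
    proof (cases "i \<in> {1..M}")
      case True
      show ?thesis
      proof (cases "i \<le> k")
        case False
        then have "p i = 0" using z[of i] True by simp
        then show ?thesis using False True by simp
      qed (use True in simp)
    next
      case False
      have "p \<in> PiE {1..M} (\<lambda>_. UNIV)" using p by simp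
      from PiE_arb[OF this False] show ?thesis unfolding restrict_def using False by (simp only: if_False)
    qed
  qed
  have "(\<Sum>i=1..k. i * p i) = (\<Sum>i=1..M. i * p i)"
    by (rule sum.mono_neutral_left) (use sub z in auto)
  then show "restrict p {1..k} \<in> weight_solutions k"
    using p by (simp add: weight_solutions_def)
  have "(\<Prod>i=1..k. c i ^ p i / fact (p i)) = (\<Prod>i=1..M. c i ^ p i / fact (p i))"
    by (rule prod.mono_neutral_left) (use sub z in auto)
  then show "(\<Prod>i=1..k. c i ^ restrict p {1..k} i / fact (restrict p {1..k} i)) = (\<Prod>i=1..M. c i ^ p i / fact (p i))"
    by simp
next
  have sub: "{1..k} \<subseteq> {1..M}" using assms by auto
  fix p assume p: "p \<in> weight_solutions k"
  let ?q = "\<lambda>i\<in>{1..M}. if i \<le> k then p i else 0"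
  show "restrict ?q {1..k} = p"
  proof
    fix i
    show "restrict ?q {1..k} i = p i"
    proof (cases "i \<in> {1..k}")
      case True
      then show ?thesis using assms by simp
    next
      case False
      have "p \<in> PiE {1..k} (\<lambda>_. UNIV)" using p by (simp add: weight_solutions_def)
      from PiE_arb[OF this False] show ?thesis unfolding restrict_def using False by (simp only: if_False)
    qed
  qed
  have "(\<Sum>i=1..M. i * ?q i) = (\<Sum>i=1..k. i * p i)"
    by (rule sum.mono_neutral_cong_right) (use sub in auto)
  then show "?q \<in> {p. p \<in> PiE {1..M} (\<lambda>_. UNIV) \<and> (\<Sum>i=1..M. i * p i) = k}"
    using p by (simp add: weight_solutions_def)
qed

text \<open>Cauchy's method of majorants: a multi-index of weight v contributes a constant times
  z^v, hence at most (z / \<zeta>)^v times its term in the majorant series at \<zeta>. The weights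
  left over exceed M, so (z / \<zeta>)^(M+1) can be taken out in front of the full majorant.\<close>

lemma exp_sum_weight_remainder:
  fixes c :: "nat \<Rightarrow> complex" and z \<zeta> :: real
  assumes z: "0 \<le> z" "z \<le> \<zeta>" "0 < \<zeta>"
  shows "cmod (exp (\<Sum>i=1..M. c i * of_real z ^ i) - (\<Sum>k\<le>M. of_real z ^ k * weight_poly c k))
    \<le> (z / \<zeta>) ^ Suc M * exp (\<Sum>i=1..M. cmod (c i) * \<zeta> ^ i)"
proof -
  let ?S = "PiE {1..M} (\<lambda>_. UNIV) :: (nat \<Rightarrow> nat) set"
  define wt where "wt p = (\<Sum>i=1..M. i * p i)" for p :: "nat \<Rightarrow> nat"
  define f where "f p = (\<Prod>i=1..M. (c i * of_real z ^ i) ^ p i / fact (p i))" for p :: "nat \<Rightarrow> nat"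
  define A where "A p = (\<Prod>i=1..M. (cmod (c i) * \<zeta> ^ i) ^ p i / fact (p i))" for p :: "nat \<Rightarrow> nat"
  define S0 where "S0 = {p \<in> ?S. wt p \<le> M}"
  have S0: "S0 \<subseteq> ?S" by (auto simp: S0_def)
  have finS0: "finite S0"
  proof (rule finite_subset)
    show "S0 \<subseteq> PiE {1..M} (\<lambda>_. {..M})"
    proof
      fix p assume p: "p \<in> S0"
      have "p i \<le> M" if i: "i \<in> {1..M}" for i
      proof -
        have "p i \<le> i * p i" using i by simp
        also have "\<dots> \<le> wt p" unfolding wt_def by (rule member_le_sum[OF i]) auto
        finally show ?thesis using p by (simp add: S0_def)
      qed
      then show "p \<in> PiE {1..M} (\<lambda>_. {..M})"
        using p by (auto simp: S0_def PiE_def)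
    qed
  qed (simp add: finite_PiE)
  have f: "(f has_sum exp (\<Sum>i=1..M. c i * of_real z ^ i)) ?S"
    unfolding f_def by (rule has_sum_exp_sum) simp
  have A: "(A has_sum exp (\<Sum>i=1..M. cmod (c i) * \<zeta> ^ i)) ?S"
    unfolding A_def by (rule has_sum_exp_sum) simp
  have A0: "0 \<le> A p" for p
    unfolding A_def using z by (intro prod_nonneg) auto
  have fw: "f p = of_real z ^ wt p * (\<Prod>i=1..M. c i ^ p i / fact (p i))" for p
  proof -
    have "f p = (\<Prod>i=1..M. of_real z ^ (i * p i) * (c i ^ p i / fact (p i)))"
      unfolding f_def by (intro prod.cong refl) (simp add: power_mult_distrib power_mult)
    then show ?thesis by (simp only: prod.distrib power_sum wt_def)
  qed
  have Aw: "A p = \<zeta> ^ wt p * (\<Prod>i=1..M. cmod (c i) ^ p i / fact (p i))" for p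
  proof -
    have "A p = (\<Prod>i=1..M. \<zeta> ^ (i * p i) * (cmod (c i) ^ p i / fact (p i)))"
      unfolding A_def by (intro prod.cong refl) (simp add: power_mult_distrib power_mult)
    then show ?thesis by (simp only: prod.distrib power_sum wt_def)
  qed
  have fA: "norm (f p) \<le> (z / \<zeta>) ^ Suc M * A p" if "p \<in> ?S - S0" for p
  proof -
    have w: "Suc M \<le> wt p" using that by (auto simp: S0_def)
    have "norm (f p) = (z / \<zeta>) ^ wt p * A p"
      unfolding fw Aw using z by (simp add: norm_mult norm_power norm_divide power_divide flip: prod_norm)
    also have "\<dots> \<le> (z / \<zeta>) ^ Suc M * A p"
      using z by (intro mult_right_mono power_decreasing[OF w] A0) auto
    finally show ?thesis .
  qed
  have fdiff: "(f has_sum exp (\<Sum>i=1..M. c i * of_real z ^ i) - sum f S0) (?S - S0)"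
    by (rule has_sum_Diff[OF f has_sum_finite[OF finS0] S0])
  have Adiff: "((\<lambda>p. (z / \<zeta>) ^ Suc M * A p) has_sum (z / \<zeta>) ^ Suc M * (exp (\<Sum>i=1..M. cmod (c i) * \<zeta> ^ i) - sum A S0)) (?S - S0)"
    by (intro has_sum_cmult_right has_sum_Diff[OF A has_sum_finite[OF finS0] S0])
  have "norm (exp (\<Sum>i=1..M. c i * of_real z ^ i) - sum f S0)
      \<le> (z / \<zeta>) ^ Suc M * (exp (\<Sum>i=1..M. cmod (c i) * \<zeta> ^ i) - sum A S0)"
    by (rule norm_infsum_le[OF fdiff Adiff fA])
  also have "\<dots> \<le> (z / \<zeta>) ^ Suc M * exp (\<Sum>i=1..M. cmod (c i) * \<zeta> ^ i)"
    using z A0 by (intro mult_left_mono) (auto intro!: sum_nonneg)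
  also have "sum f S0 = (\<Sum>k\<le>M. \<Sum>p | p \<in> S0 \<and> wt p = k. f p)"
    by (rule sum.group[symmetric, OF finS0]) (auto simp: S0_def)
  also have "\<dots> = (\<Sum>k\<le>M. of_real z ^ k * weight_poly c k)"
  proof (rule sum.cong[OF refl])
    fix k assume k: "k \<in> {..M}"
    then have "{p. p \<in> S0 \<and> wt p = k} = {p. p \<in> ?S \<and> (\<Sum>i=1..M. i * p i) = k}"
      by (auto simp: S0_def wt_def)
    then have "(\<Sum>p | p \<in> S0 \<and> wt p = k. f p) = (\<Sum>p | p \<in> ?S \<and> (\<Sum>i=1..M. i * p i) = k. of_real z ^ k * (\<Prod>i=1..M. c i ^ p i / fact (p i)))"
      by (intro sum.cong) (auto simp: fw wt_def)
    then show "(\<Sum>p | p \<in> S0 \<and> wt p = k. f p) = of_real z ^ k * weight_poly c k"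
      using k weight_solutions_extend[of k M c] by (simp flip: sum_distrib_left)
  qed
  finally show ?thesis .
qed

section \<open>Truncated Laplace transforms\<close>

text \<open>Cutting at \<tau> and dividing by \<tau> puts the exponent on [-1, 1], so the transform
  is entire in w whatever the tails of \<nu>; \<tau> will be the square root of n.\<close>

definition trunc_laplace :: "real measure \<Rightarrow> real \<Rightarrow> complex \<Rightarrow> complex" where
  "trunc_laplace \<nu> \<tau> w = (\<integral>y. indicator {-\<tau>..\<tau>} y *\<^sub>R exp (w * of_real (y / \<tau>)) \<partial>\<nu>)"

text \<open>One quantity for two errors: with e = m + 1 - s, the part |y| \<le> \<tau> gives
  \<tau>^(s-m-1) times a truncated moment of order m + 1, and the part |y| > \<tau> the tail of the
  moment of order s. That it tends to 0 for large \<tau> is the main source of the o(.) in the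
  theorem.\<close>

definition tail_moment :: "real measure \<Rightarrow> real \<Rightarrow> real \<Rightarrow> real \<Rightarrow> real" where
  "tail_moment \<nu> s e \<tau> = (\<integral>y. \<bar>y\<bar> powr s * min 1 (\<bar>y\<bar> / \<tau>) powr e \<partial>\<nu>)"

lemma min_1_powr_le_1: "0 \<le> u \<Longrightarrow> 0 \<le> e \<Longrightarrow> min 1 u powr e \<le> (1::real)"
  by (intro powr_le1) auto

lemma integrable_tail_moment:
  fixes \<nu> :: "real measure"
  assumes [measurable_cong]: "sets \<nu> = sets borel" and int: "integrable \<nu> (\<lambda>y. \<bar>y\<bar> powr s)" and "0 < \<tau>" "0 \<le> e"
  shows "integrable \<nu> (\<lambda>y. \<bar>y\<bar> powr s * min 1 (\<bar>y\<bar> / \<tau>) powr e)"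
proof (rule Bochner_Integration.integrable_bound[OF int])
  show "AE y in \<nu>. norm (\<bar>y\<bar> powr s * min 1 (\<bar>y\<bar> / \<tau>) powr e) \<le> norm (\<bar>y\<bar> powr s)"
  proof (rule AE_I2)
    fix y
    have "min 1 (\<bar>y\<bar> / \<tau>) powr e \<le> 1" using assms by (intro min_1_powr_le_1) auto
    then show "norm (\<bar>y\<bar> powr s * min 1 (\<bar>y\<bar> / \<tau>) powr e) \<le> norm (\<bar>y\<bar> powr s)"
      by (simp add: abs_mult mult_left_le)
  qed
qed measurable

lemma tail_moment_nonneg: "0 \<le> tail_moment \<nu> s e \<tau>"
  unfolding tail_moment_def by (intro integral_nonneg_AE AE_I2) auto

lemma tendsto_tail_moment:
  assumes sets [measurable_cong]: "sets \<nu> = sets borel" and int: "integrable \<nu> (\<lambda>y. \<bar>y\<bar> powr s)" and "0 < e"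
  shows "(tail_moment \<nu> s e \<longlongrightarrow> 0) at_top"
proof -
  have "((\<lambda>\<tau>. \<integral>y. \<bar>y\<bar> powr s * min 1 (\<bar>y\<bar> / \<tau>) powr e \<partial>\<nu>) \<longlongrightarrow> (\<integral>y. 0 \<partial>\<nu>)) at_top"
  proof (rule integral_dominated_convergence_at_top[where w = "\<lambda>y. \<bar>y\<bar> powr s"])
    show "\<forall>\<^sub>F \<tau> in at_top. AE y in \<nu>. norm (\<bar>y\<bar> powr s * min 1 (\<bar>y\<bar> / \<tau>) powr e) \<le> \<bar>y\<bar> powr s"
    proof (rule eventually_mono[OF eventually_gt_at_top[of 0]], rule AE_I2)
      fix \<tau> y :: real assume "0 < \<tau>"
      then have "min 1 (\<bar>y\<bar> / \<tau>) powr e \<le> 1" using assms by (intro min_1_powr_le_1) auto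
      then show "norm (\<bar>y\<bar> powr s * min 1 (\<bar>y\<bar> / \<tau>) powr e) \<le> \<bar>y\<bar> powr s"
        by (simp add: abs_mult mult_left_le)
    qed
    show "AE y in \<nu>. ((\<lambda>\<tau>. \<bar>y\<bar> powr s * min 1 (\<bar>y\<bar> / \<tau>) powr e) \<longlongrightarrow> 0) at_top"
    proof (rule AE_I2)
      fix y :: real
      have "((\<lambda>\<tau>. \<bar>y\<bar> / \<tau>) \<longlongrightarrow> 0) at_top"
        by (intro real_tendsto_divide_at_top[OF tendsto_const] filterlim_ident)
      then have "((\<lambda>\<tau>. min 1 (\<bar>y\<bar> / \<tau>)) \<longlongrightarrow> 0) at_top"
        using tendsto_min[OF tendsto_const[of 1], of "\<lambda>\<tau>. \<bar>y\<bar> / \<tau>" 0 at_top] by simp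
      then have "((\<lambda>\<tau>. min 1 (\<bar>y\<bar> / \<tau>) powr e) \<longlongrightarrow> 0) at_top"
        using assms by (intro tendsto_zero_powrI[OF _ tendsto_const]) (auto intro: eventually_mono[OF eventually_gt_at_top[of 0]])
      then show "((\<lambda>\<tau>. \<bar>y\<bar> powr s * min 1 (\<bar>y\<bar> / \<tau>) powr e) \<longlongrightarrow> 0) at_top"
        by (rule tendsto_mult_right_zero)
    qed
  qed (use int in auto)
  then show ?thesis by (simp add: tail_moment_def[abs_def])
qed

lemma Re_times_of_real: "Re (w * of_real x) = Re w * x"
  by simp

text \<open>Inside [-1, 1] the Taylor remainder of order m + 1 counts. Outside, the exponential is
  cut to 0 and each of the m + 1 monomials is at most |x|^s times a power of 1 + |w|. The constants
  3, from e \<le> 3, and m + 1 are merged into m + 3.\<close>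

lemma trunc_exp_Taylor_le:
  fixes x s :: real and w :: complex
  assumes Re: "\<bar>Re w\<bar> \<le> 1" and s: "real m \<le> s" "s < real m + 1"
  shows "cmod ((if \<bar>x\<bar> \<le> 1 then exp (w * of_real x) else 0) - (\<Sum>k\<le>m. (w * of_real x) ^ k / fact k))
    \<le> (real m + 3) * (1 + cmod w) ^ Suc m * (\<bar>x\<bar> powr s * min 1 \<bar>x\<bar> powr (real m + 1 - s))"
proof (cases "\<bar>x\<bar> \<le> 1")
  case True
  have x: "\<bar>x\<bar> powr s * min 1 \<bar>x\<bar> powr (real m + 1 - s) = \<bar>x\<bar> ^ Suc m"
  proof (cases "x = 0")
    case False
    then have "\<bar>x\<bar> powr s * min 1 \<bar>x\<bar> powr (real m + 1 - s) = \<bar>x\<bar> powr real (Suc m)"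
      using True by (simp add: powr_add[symmetric] min_def add.commute)
    moreover have "\<bar>x\<bar> powr real (Suc m) = \<bar>x\<bar> ^ Suc m"
      by (rule powr_realpow) (use False in simp)
    ultimately show ?thesis by (simp only:)
  qed simp
  have "\<bar>Re (w * of_real x)\<bar> \<le> 1 * 1"
    unfolding Re_times_of_real abs_mult by (intro mult_mono Re True) auto
  then have e: "exp \<bar>Re (w * of_real x)\<bar> \<le> 3"
    using exp_le exp_le_cancel_iff[of "\<bar>Re (w * of_real x)\<bar>" 1] by linarith
  have "cmod (exp (w * of_real x) - (\<Sum>k\<le>m. (w * of_real x) ^ k / fact k))
      \<le> exp \<bar>Re (w * of_real x)\<bar> * cmod (w * of_real x) ^ Suc m / fact m"
    by (rule Taylor_exp)
  also have "\<dots> \<le> 3 * cmod (w * of_real x) ^ Suc m / 1"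
    using e by (intro frac_le mult_mono) (auto simp: fact_ge_1)
  also have "\<dots> = 3 * cmod w ^ Suc m * \<bar>x\<bar> ^ Suc m"
    unfolding norm_mult norm_of_real by (simp only: power_mult_distrib div_by_1 mult.assoc)
  also have "\<dots> \<le> (real m + 3) * (1 + cmod w) ^ Suc m * \<bar>x\<bar> ^ Suc m"
    by (intro mult_right_mono mult_mono power_mono) auto
  finally show ?thesis using True unfolding x by simp
next
  case False
  have "cmod (\<Sum>k\<le>m. (w * of_real x) ^ k / fact k) \<le> (\<Sum>k\<le>m. (1 + cmod w) ^ Suc m * \<bar>x\<bar> powr s)"
  proof (rule sum_norm_le)
    fix k assume k: "k \<in> {..m}"
    have "cmod ((w * of_real x) ^ k / fact k) = cmod w ^ k * \<bar>x\<bar> ^ k / fact k"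
      by (simp add: norm_divide norm_power norm_mult power_mult_distrib)
    also have "\<dots> \<le> cmod w ^ k * \<bar>x\<bar> ^ k / 1"
      by (intro frac_le) (auto simp: fact_ge_1)
    also have "\<dots> \<le> (1 + cmod w) ^ Suc m * \<bar>x\<bar> powr s"
    proof (unfold div_by_1, rule mult_mono)
      have "cmod w ^ k \<le> (1 + cmod w) ^ k" by (intro power_mono) auto
      also have "\<dots> \<le> (1 + cmod w) ^ Suc m" using k by (intro power_increasing) auto
      finally show "cmod w ^ k \<le> (1 + cmod w) ^ Suc m" .
      have "\<bar>x\<bar> ^ k = \<bar>x\<bar> powr real k" using False by (simp add: powr_realpow)
      also have "\<dots> \<le> \<bar>x\<bar> powr s" using False s k by (intro powr_mono) auto
      finally show "\<bar>x\<bar> ^ k \<le> \<bar>x\<bar> powr s" .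
    qed auto
    finally show "cmod ((w * of_real x) ^ k / fact k) \<le> (1 + cmod w) ^ Suc m * \<bar>x\<bar> powr s" .
  qed
  also have "\<dots> = (real m + 1) * ((1 + cmod w) ^ Suc m * \<bar>x\<bar> powr s)" by simp
  also have "\<dots> \<le> (real m + 3) * ((1 + cmod w) ^ Suc m * \<bar>x\<bar> powr s)"
    by (intro mult_right_mono) auto
  finally show ?thesis using False by (simp add: min_def mult.assoc)
qed

text \<open>For |w| as large as a multiple of \<tau>, where the expansion to order m is useless. The
  cubic remainder yields the factor r, the quadratic one the factor 1. Outside [-1, 1] the condition
  1 \<le> r makes the minimum equal to 1.\<close>

lemma trunc_exp_quadratic_le:
  fixes x :: real and w :: complex
  assumes Re: "\<bar>Re w\<bar> \<le> 1" and wx: "cmod w * \<bar>x\<bar> \<le> r" and r: "\<bar>x\<bar> > 1 \<Longrightarrow> 1 \<le> r"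
  shows "cmod ((if \<bar>x\<bar> \<le> 1 then exp (w * of_real x) else 0) - (1 + w * of_real x + (w * of_real x)\<^sup>2 / 2))
    \<le> 4 * (1 + (cmod w)\<^sup>2) * (x\<^sup>2 * min 1 r)"
proof (cases "\<bar>x\<bar> \<le> 1")
  case True
  let ?z = "w * of_real x"
  have r0: "0 \<le> r" by (rule order_trans[OF _ wx]) simp
  have "\<bar>Re ?z\<bar> \<le> 1 * 1"
    unfolding Re_times_of_real abs_mult by (intro mult_mono Re True) auto
  then have e: "exp \<bar>Re ?z\<bar> \<le> 3"
    using exp_le exp_le_cancel_iff[of "\<bar>Re (w * of_real x)\<bar>" 1] by linarith
  have z2: "(cmod ?z)\<^sup>2 = (cmod w)\<^sup>2 * x\<^sup>2"
    by (simp add: norm_mult power_mult_distrib)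
  have "cmod (exp ?z - (1 + ?z + ?z\<^sup>2 / 2)) \<le> exp \<bar>Re ?z\<bar> * cmod ?z ^ 3 / 2"
  proof -
    have "(\<Sum>k\<le>2. ?z ^ k / fact k) = 1 + ?z + ?z\<^sup>2 / 2" by (simp add: numeral_2_eq_2)
    moreover have "Suc 2 = 3" "fact 2 = (2::real)" by simp_all
    ultimately show ?thesis using Taylor_exp[of ?z 2] by (simp only:)
  qed
  also have "\<dots> \<le> 3 * cmod ?z ^ 3 / 2"
    using e by (intro divide_right_mono mult_right_mono) auto
  also have "\<dots> = 3 / 2 * (cmod ?z)\<^sup>2 * cmod ?z" by (simp add: power3_eq_cube power2_eq_square)
  also have "\<dots> \<le> 3 / 2 * (cmod ?z)\<^sup>2 * r"
    using wx by (intro mult_left_mono) (auto simp: norm_mult)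
  also have "\<dots> \<le> 4 * (cmod ?z)\<^sup>2 * r"
    using r0 by (intro mult_right_mono) auto
  finally have 1: "cmod (exp ?z - (1 + ?z + ?z\<^sup>2 / 2)) \<le> 4 * (cmod ?z)\<^sup>2 * r" .
  have "cmod (exp ?z - (1 + ?z)) \<le> exp \<bar>Re ?z\<bar> * (cmod ?z)\<^sup>2"
  proof -
    have "(\<Sum>k\<le>1. ?z ^ k / fact k) = 1 + ?z" by simp
    moreover have "Suc 1 = 2" "fact 1 = (1::real)" by simp_all
    ultimately show ?thesis using Taylor_exp[of ?z 1] by (simp only: div_by_1)
  qed
  also have "\<dots> \<le> 3 * (cmod ?z)\<^sup>2" using e by (intro mult_right_mono) auto
  finally have e2: "cmod (exp ?z - (1 + ?z)) \<le> 3 * (cmod ?z)\<^sup>2" .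
  have "cmod (?z\<^sup>2 / 2) = (cmod ?z)\<^sup>2 / 2" by (simp only: norm_divide norm_power norm_numeral)
  then have "cmod (exp ?z - (1 + ?z) - ?z\<^sup>2 / 2) \<le> 3 * (cmod ?z)\<^sup>2 + (cmod ?z)\<^sup>2 / 2"
    by (intro order_trans[OF norm_triangle_ineq4] add_mono e2) simp
  then have 2: "cmod (exp ?z - (1 + ?z + ?z\<^sup>2 / 2)) \<le> 4 * (cmod ?z)\<^sup>2"
  proof -
    have "exp ?z - (1 + ?z) - ?z\<^sup>2 / 2 = exp ?z - (1 + ?z + ?z\<^sup>2 / 2)" by (rule diff_diff_add)
    moreover have "3 * (cmod ?z)\<^sup>2 + (cmod ?z)\<^sup>2 / 2 \<le> 4 * (cmod ?z)\<^sup>2" by simp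
    ultimately show ?thesis using \<open>cmod (exp ?z - (1 + ?z) - ?z\<^sup>2 / 2) \<le> 3 * (cmod ?z)\<^sup>2 + (cmod ?z)\<^sup>2 / 2\<close> by (simp only:)
  qed
  have "cmod (exp ?z - (1 + ?z + ?z\<^sup>2 / 2)) \<le> 4 * (cmod ?z)\<^sup>2 * min 1 r"
    using 1 2 by (simp add: min_def)
  also have "\<dots> = 4 * (cmod w)\<^sup>2 * (x\<^sup>2 * min 1 r)"
    by (simp add: z2)
  also have "\<dots> \<le> 4 * (1 + (cmod w)\<^sup>2) * (x\<^sup>2 * min 1 r)"
    using r0 by (intro mult_right_mono) auto
  finally show ?thesis using True by (simp only: if_True)
next
  case False
  have x1: "1 \<le> x\<^sup>2" and x2: "\<bar>x\<bar> \<le> x\<^sup>2"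
    using False power_increasing[of 0 2 "\<bar>x\<bar>"] power_increasing[of 1 2 "\<bar>x\<bar>"] by auto
  have "cmod (1 + w * of_real x + (w * of_real x)\<^sup>2 / 2) \<le> 1 + cmod w * \<bar>x\<bar> + (cmod w)\<^sup>2 * x\<^sup>2 / 2"
    by (intro order_trans[OF norm_triangle_ineq] add_mono) (auto simp: norm_mult norm_power norm_divide power_mult_distrib)
  also have "\<dots> \<le> x\<^sup>2 + cmod w * x\<^sup>2 + (cmod w)\<^sup>2 * x\<^sup>2"
    using x1 x2 by (intro add_mono mult_left_mono) auto
  also have "\<dots> = (1 + cmod w + (cmod w)\<^sup>2) * x\<^sup>2" by (simp add: algebra_simps)
  also have "\<dots> \<le> (4 * (1 + (cmod w)\<^sup>2)) * x\<^sup>2"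
  proof (rule mult_right_mono)
    have "2 * cmod w \<le> 1 + (cmod w)\<^sup>2" using sum_squares_bound[of 1 "cmod w"] by simp
    then show "1 + cmod w + (cmod w)\<^sup>2 \<le> 4 * (1 + (cmod w)\<^sup>2)" by (smt (verit) zero_le_power2)
  qed simp
  finally have le: "cmod (1 + w * of_real x + (w * of_real x)\<^sup>2 / 2) \<le> 4 * (1 + (cmod w)\<^sup>2) * x\<^sup>2" .
  have "min 1 r = 1" using r False by simp
  then show ?thesis using le False by (simp only: if_False diff_0 norm_minus_cancel mult_1_right)
qed

lemma integrable_trunc_exp:
  fixes w :: complex
  assumes "finite_measure \<nu>" and [measurable_cong]: "sets \<nu> = sets borel"
  shows "integrable \<nu> (\<lambda>y. indicator {-\<tau>..\<tau>} y *\<^sub>R exp (w * of_real (y / \<tau>)))"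
proof -
  interpret finite_measure \<nu> by fact
  show ?thesis
  proof (rule integrable_const_bound[where B = "exp (cmod w)"])
    show "AE y in \<nu>. norm (indicator {-\<tau>..\<tau>} y *\<^sub>R exp (w * of_real (y / \<tau>))) \<le> exp (cmod w)"
    proof (rule AE_I2)
      fix y
      have "Re (w * of_real (y / \<tau>)) \<le> cmod w" if "y \<in> {-\<tau>..\<tau>}"
      proof -
        have "\<bar>y / \<tau>\<bar> \<le> 1" using that by (cases "\<tau> = 0") (auto simp: abs_le_iff divide_simps)
        then have "cmod (w * of_real (y / \<tau>)) \<le> cmod w"
          unfolding norm_mult norm_of_real by (rule mult_left_le) simp
        then show ?thesis using complex_Re_le_cmod order_trans by blast
      qed
      then show "norm (indicator {-\<tau>..\<tau>} y *\<^sub>R exp (w * of_real (y / \<tau>))) \<le> exp (cmod w)"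
        by (auto simp: indicator_def)
    qed
  qed measurable
qed

lemma powr_moment_integrable:
  fixes \<nu> :: "real measure"
  assumes "finite_measure \<nu>" and [measurable_cong]: "sets \<nu> = sets borel"
    and int: "integrable \<nu> (\<lambda>y. \<bar>y\<bar> powr s)" and "real k \<le> s"
  shows "integrable \<nu> (\<lambda>y. y ^ k)"
proof -
  interpret finite_measure \<nu> by fact
  have "integrable \<nu> (\<lambda>y. 1 + \<bar>y\<bar> powr s)" using int by simp
  then show ?thesis
  proof (rule Bochner_Integration.integrable_bound)
    show "AE y in \<nu>. norm (y ^ k) \<le> norm (1 + \<bar>y\<bar> powr s)"
    proof (rule AE_I2)
      fix y :: real
      show "norm (y ^ k) \<le> norm (1 + \<bar>y\<bar> powr s)"
      proof (cases "\<bar>y\<bar> \<le> 1")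
        case True
        then have "\<bar>y\<bar> ^ k \<le> 1" by (intro power_le_one) auto
        moreover have "0 \<le> \<bar>y\<bar> powr s" by simp
        ultimately have "\<bar>y\<bar> ^ k \<le> 1 + \<bar>y\<bar> powr s" by linarith
        then show ?thesis by (simp add: power_abs)
      next
        case False
        then have "\<bar>y\<bar> ^ k = \<bar>y\<bar> powr real k" by (simp add: powr_realpow)
        also have "\<dots> \<le> \<bar>y\<bar> powr s" using False assms by (intro powr_mono) auto
        finally show ?thesis by (simp add: power_abs)
      qed
    qed
  qed measurable
qed

lemma trunc_laplace_Taylor_le:
  assumes fin: "finite_measure \<nu>" and sets [measurable_cong]: "sets \<nu> = sets borel"
    and int: "integrable \<nu> (\<lambda>y. \<bar>y\<bar> powr s)"
    and s: "real m \<le> s" "s < real m + 1" and \<tau>: "0 < \<tau>" and Re: "\<bar>Re w\<bar> \<le> 1"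
  shows "cmod (trunc_laplace \<nu> \<tau> w - (\<Sum>k\<le>m. of_real (\<integral>y. y ^ k \<partial>\<nu>) * (w / \<tau>) ^ k / fact k))
    \<le> (real m + 3) * (1 + cmod w) ^ Suc m * (\<tau> powr (- s) * tail_moment \<nu> s (real m + 1 - s) \<tau>)"
proof -
  have ig: "integrable \<nu> (\<lambda>y. (w * of_real (y / \<tau>)) ^ k / fact k)"
    and eg: "(\<integral>y. (w * of_real (y / \<tau>)) ^ k / fact k \<partial>\<nu>) = of_real (\<integral>y. y ^ k \<partial>\<nu>) * (w / \<tau>) ^ k / fact k"
    if "k \<le> m" for k
  proof -
    have eq: "(w * of_real (y / \<tau>)) ^ k / fact k = of_real (y ^ k) * ((w / \<tau>) ^ k / fact k)" for y
      by (simp add: power_mult_distrib power_divide)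
    have i: "integrable \<nu> (\<lambda>y. complex_of_real (y ^ k))"
      by (intro integrable_of_real powr_moment_integrable[OF fin sets int]) (use that s in linarith)
    show "integrable \<nu> (\<lambda>y. (w * of_real (y / \<tau>)) ^ k / fact k)"
      unfolding eq by (rule integrable_mult_left) (rule i)
    show "(\<integral>y. (w * of_real (y / \<tau>)) ^ k / fact k \<partial>\<nu>) = of_real (\<integral>y. y ^ k \<partial>\<nu>) * (w / \<tau>) ^ k / fact k"
      unfolding eq integral_mult_left_zero integral_complex_of_real by simp
  qed
  have es: "(\<integral>y. (\<Sum>k\<le>m. (w * of_real (y / \<tau>)) ^ k / fact k) \<partial>\<nu>) = (\<Sum>k\<le>m. of_real (\<integral>y. y ^ k \<partial>\<nu>) * (w / \<tau>) ^ k / fact k)"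
    by (subst Bochner_Integration.integral_sum) (rule ig, simp, rule sum.cong[OF refl], rule eg, simp)
  have eqi: "indicator {-\<tau>..\<tau>} y *\<^sub>R exp (w * of_real (y / \<tau>)) = (if \<bar>y / \<tau>\<bar> \<le> 1 then exp (w * of_real (y / \<tau>)) else 0)" for y
    using \<tau> by (auto simp: indicator_def abs_le_iff divide_simps)
  have tm: "\<bar>y / \<tau>\<bar> powr s * min 1 \<bar>y / \<tau>\<bar> powr (real m + 1 - s)
      = \<tau> powr (- s) * (\<bar>y\<bar> powr s * min 1 (\<bar>y\<bar> / \<tau>) powr (real m + 1 - s))" for y
    using \<tau> by (simp add: powr_divide powr_minus_divide abs_divide)
  have eq: "trunc_laplace \<nu> \<tau> w - (\<Sum>k\<le>m. of_real (\<integral>y. y ^ k \<partial>\<nu>) * (w / \<tau>) ^ k / fact k)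
      = (\<integral>y. indicator {-\<tau>..\<tau>} y *\<^sub>R exp (w * of_real (y / \<tau>)) - (\<Sum>k\<le>m. (w * of_real (y / \<tau>)) ^ k / fact k) \<partial>\<nu>)"
    unfolding trunc_laplace_def es[symmetric]
    by (rule Bochner_Integration.integral_diff[symmetric])
       (rule integrable_trunc_exp[OF fin sets], rule Bochner_Integration.integrable_sum, rule ig, simp)
  have "cmod (trunc_laplace \<nu> \<tau> w - (\<Sum>k\<le>m. of_real (\<integral>y. y ^ k \<partial>\<nu>) * (w / \<tau>) ^ k / fact k)) \<le> (\<integral>y. (real m + 3) * (1 + cmod w) ^ Suc m * (\<tau> powr (- s) * (\<bar>y\<bar> powr s * min 1 (\<bar>y\<bar> / \<tau>) powr (real m + 1 - s))) \<partial>\<nu>)"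
  unfolding eq
  proof (rule Bochner_Integration.integral_norm_bound_integral)
    show "integrable \<nu> (\<lambda>y. indicator {-\<tau>..\<tau>} y *\<^sub>R exp (w * of_real (y / \<tau>)) - (\<Sum>k\<le>m. (w * of_real (y / \<tau>)) ^ k / fact k))"
      by (intro Bochner_Integration.integrable_diff integrable_trunc_exp fin sets Bochner_Integration.integrable_sum ig) simp
    show "integrable \<nu> (\<lambda>y. (real m + 3) * (1 + cmod w) ^ Suc m * (\<tau> powr (- s) * (\<bar>y\<bar> powr s * min 1 (\<bar>y\<bar> / \<tau>) powr (real m + 1 - s))))"
      by (intro integrable_mult_right integrable_tail_moment sets int \<tau>) (use s in simp)
    fix y
    show "norm (indicator {-\<tau>..\<tau>} y *\<^sub>R exp (w * of_real (y / \<tau>)) - (\<Sum>k\<le>m. (w * of_real (y / \<tau>)) ^ k / fact k))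
        \<le> (real m + 3) * (1 + cmod w) ^ Suc m * (\<tau> powr (- s) * (\<bar>y\<bar> powr s * min 1 (\<bar>y\<bar> / \<tau>) powr (real m + 1 - s)))"
      unfolding eqi tm[symmetric] by (rule trunc_exp_Taylor_le[OF Re s])
  qed
  also have "\<dots> = (real m + 3) * (1 + cmod w) ^ Suc m * (\<tau> powr (- s) * tail_moment \<nu> s (real m + 1 - s) \<tau>)"
    unfolding tail_moment_def by (subst integral_mult_right_zero, subst integral_mult_right_zero, rule refl)
  finally show ?thesis .
qed

text \<open>The error has the natural size (1 + |w|^2) / \<tau>^2 times a factor depending on
  \<delta> alone, uniformly in \<tau>; a small \<delta> makes it a small fraction of the quadratic
  term.\<close>

lemma trunc_laplace_quadratic_le:
  assumes "prob_space \<nu>" and sets [measurable_cong]: "sets \<nu> = sets borel"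
    and int: "integrable \<nu> (\<lambda>y. y\<^sup>2)" and mean: "(\<integral>y. y \<partial>\<nu>) = 0"
    and \<delta>: "0 < \<delta>" "1 \<le> \<delta> * \<tau>" and \<tau>: "0 < \<tau>" and Re: "\<bar>Re w\<bar> \<le> 1" and w: "cmod w \<le> \<delta> * \<tau>"
  shows "cmod (trunc_laplace \<nu> \<tau> w - (1 + of_real (\<integral>y. y\<^sup>2 \<partial>\<nu>) * w\<^sup>2 / (2 * \<tau>\<^sup>2)))
    \<le> 4 * (1 + (cmod w)\<^sup>2) / \<tau>\<^sup>2 * tail_moment \<nu> 2 1 (1 / \<delta>)"
proof -
  interpret prob_space \<nu> by fact
  have pw2: "\<bar>y\<bar> powr 2 = y\<^sup>2" for y :: real
    by (cases "y = 0") (simp_all add: powr_numeral)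
  have int': "integrable \<nu> (\<lambda>y. \<bar>y\<bar> powr 2)" unfolding pw2 by (rule int)
  have int1: "integrable \<nu> (\<lambda>y. y)"
    using powr_moment_integrable[OF finite_measure_axioms sets int', of 1] by simp
  have eqi: "indicator {-\<tau>..\<tau>} y *\<^sub>R exp (w * of_real (y / \<tau>)) = (if \<bar>y / \<tau>\<bar> \<le> 1 then exp (w * of_real (y / \<tau>)) else 0)" for y
    using \<tau> by (auto simp: indicator_def abs_le_iff divide_simps)
  have eqp: "1 + w * of_real (y / \<tau>) + (w * of_real (y / \<tau>))\<^sup>2 / 2 = 1 + of_real y * (w / \<tau>) + of_real (y\<^sup>2) * (w\<^sup>2 / (2 * \<tau>\<^sup>2))" for y
    by (simp add: power_mult_distrib power_divide mult.commute)
  have i1: "integrable \<nu> (\<lambda>y. 1 + complex_of_real y * (w / \<tau>))" "integrable \<nu> (\<lambda>y. complex_of_real (y\<^sup>2) * (w\<^sup>2 / (2 * \<tau>\<^sup>2)))"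
    using int1 int by (auto intro!: integrable_mult_left integrable_of_real simp del: of_real_power)
  then have ip: "integrable \<nu> (\<lambda>y. 1 + w * of_real (y / \<tau>) + (w * of_real (y / \<tau>))\<^sup>2 / 2)"
    unfolding eqp by (rule Bochner_Integration.integrable_add)
  have ep: "(\<integral>y. 1 + w * of_real (y / \<tau>) + (w * of_real (y / \<tau>))\<^sup>2 / 2 \<partial>\<nu>) = 1 + of_real (\<integral>y. y\<^sup>2 \<partial>\<nu>) * w\<^sup>2 / (2 * \<tau>\<^sup>2)"
  proof -
    have "(\<integral>y. 1 + complex_of_real y * (w / \<tau>) \<partial>\<nu>) = 1"
      using int1 mean by (subst Bochner_Integration.integral_add) (auto simp: prob_space)
    moreover have "(\<integral>y. complex_of_real (y\<^sup>2) * (w\<^sup>2 / (2 * \<tau>\<^sup>2)) \<partial>\<nu>) = of_real (\<integral>y. y\<^sup>2 \<partial>\<nu>) * (w\<^sup>2 / (2 * \<tau>\<^sup>2))"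
      by (simp only: integral_mult_left_zero integral_complex_of_real)
    ultimately show ?thesis
      unfolding eqp using i1 by (subst Bochner_Integration.integral_add) simp_all
  qed
  have eq: "trunc_laplace \<nu> \<tau> w - (1 + of_real (\<integral>y. y\<^sup>2 \<partial>\<nu>) * w\<^sup>2 / (2 * \<tau>\<^sup>2))
      = (\<integral>y. indicator {-\<tau>..\<tau>} y *\<^sub>R exp (w * of_real (y / \<tau>)) - (1 + w * of_real (y / \<tau>) + (w * of_real (y / \<tau>))\<^sup>2 / 2) \<partial>\<nu>)"
    unfolding trunc_laplace_def ep[symmetric]
    by (rule Bochner_Integration.integral_diff[symmetric]) (intro integrable_trunc_exp finite_measure_axioms sets ip)+
  have "cmod (trunc_laplace \<nu> \<tau> w - (1 + of_real (\<integral>y. y\<^sup>2 \<partial>\<nu>) * w\<^sup>2 / (2 * \<tau>\<^sup>2))) \<le> (\<integral>y. 4 * (1 + (cmod w)\<^sup>2) / \<tau>\<^sup>2 * (\<bar>y\<bar> powr 2 * min 1 (\<bar>y\<bar> / (1 / \<delta>)) powr 1) \<partial>\<nu>)"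
  unfolding eq
  proof (rule Bochner_Integration.integral_norm_bound_integral)
    show "integrable \<nu> (\<lambda>y. indicator {-\<tau>..\<tau>} y *\<^sub>R exp (w * of_real (y / \<tau>)) - (1 + w * of_real (y / \<tau>) + (w * of_real (y / \<tau>))\<^sup>2 / 2))"
      by (intro Bochner_Integration.integrable_diff integrable_trunc_exp finite_measure_axioms sets ip)
    show "integrable \<nu> (\<lambda>y. 4 * (1 + (cmod w)\<^sup>2) / \<tau>\<^sup>2 * (\<bar>y\<bar> powr 2 * min 1 (\<bar>y\<bar> / (1 / \<delta>)) powr 1))"
      by (intro integrable_mult_right integrable_tail_moment sets int') (use \<delta> in auto)
    fix y
    have m: "min 1 (\<bar>y\<bar> / (1 / \<delta>)) powr 1 = min 1 (\<delta> * \<bar>y\<bar>)"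
      using \<delta> by (simp add: min_def mult.commute)
    have "norm (indicator {-\<tau>..\<tau>} y *\<^sub>R exp (w * of_real (y / \<tau>)) - (1 + w * of_real (y / \<tau>) + (w * of_real (y / \<tau>))\<^sup>2 / 2))
        \<le> 4 * (1 + (cmod w)\<^sup>2) * ((y / \<tau>)\<^sup>2 * min 1 (\<delta> * \<bar>y\<bar>))"
      unfolding eqi
    proof (rule trunc_exp_quadratic_le[OF Re])
      have "cmod w * \<bar>y / \<tau>\<bar> \<le> \<delta> * \<tau> * \<bar>y / \<tau>\<bar>" by (intro mult_right_mono w) auto
      then show "cmod w * \<bar>y / \<tau>\<bar> \<le> \<delta> * \<bar>y\<bar>" using \<tau> by (simp add: abs_divide)
      assume "\<bar>y / \<tau>\<bar> > 1"
      then have "\<tau> \<le> \<bar>y\<bar>" using \<tau> by (simp add: abs_divide)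
      then have "\<delta> * \<tau> \<le> \<delta> * \<bar>y\<bar>" using \<delta> by (intro mult_left_mono) auto
      then show "1 \<le> \<delta> * \<bar>y\<bar>" using \<delta> by linarith
    qed
    also have "\<dots> = 4 * (1 + (cmod w)\<^sup>2) / \<tau>\<^sup>2 * (\<bar>y\<bar> powr 2 * min 1 (\<bar>y\<bar> / (1 / \<delta>)) powr 1)"
      unfolding m pw2 by (simp add: power_divide)
    finally show "norm (indicator {-\<tau>..\<tau>} y *\<^sub>R exp (w * of_real (y / \<tau>)) - (1 + w * of_real (y / \<tau>) + (w * of_real (y / \<tau>))\<^sup>2 / 2))
        \<le> 4 * (1 + (cmod w)\<^sup>2) / \<tau>\<^sup>2 * (\<bar>y\<bar> powr 2 * min 1 (\<bar>y\<bar> / (1 / \<delta>)) powr 1)" .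
  qed
  also have "\<dots> = 4 * (1 + (cmod w)\<^sup>2) / \<tau>\<^sup>2 * tail_moment \<nu> 2 1 (1 / \<delta>)"
    unfolding tail_moment_def by (subst integral_mult_right_zero, rule refl)
  finally show ?thesis .
qed

text \<open>|1 + v|^2 = 1 + 2 Re v + |v|^2 and 1 + x \<le> exp x; this yields Gaussian decay while
  avoiding the logarithm.\<close>

lemma cmod_1_add_le_exp: "cmod (1 + v) \<le> exp (Re v + (cmod v)\<^sup>2 / 2)"
proof -
  have "(cmod (1 + v))\<^sup>2 = 1 + (2 * Re v + (cmod v)\<^sup>2)"
    unfolding cmod_power2 by (simp add: power2_eq_square algebra_simps)
  also have "\<dots> \<le> exp (2 * Re v + (cmod v)\<^sup>2)" by (rule exp_ge_add_one_self)
  also have "\<dots> = (exp (Re v + (cmod v)\<^sup>2 / 2))\<^sup>2" by (simp add: power2_eq_square flip: exp_add)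
  finally show ?thesis by (rule power2_le_imp_le) simp
qed

text \<open>For \<sigma> = 1 and \<sigma> = -1 one has Re (w^2) = 1 - t^2, so the quadratic term
  decays like - l t^2 / (2 \<tau>^2), with room for errors in the weaker constant 1 / 8. The
  exponent is proportional to l, so over blocks of total length n = \<tau>^2 the bounds multiply to
  exp (3 - t^2 / 8).\<close>

lemma trunc_laplace_decay:
  assumes prob: "prob_space \<nu>" and sets [measurable_cong]: "sets \<nu> = sets borel"
    and int: "integrable \<nu> (\<lambda>y. y\<^sup>2)" and mean: "(\<integral>y. y \<partial>\<nu>) = 0" and var: "(\<integral>y. y\<^sup>2 \<partial>\<nu>) = real l" and l: "1 \<le> l"
  shows "\<exists>\<delta>>0. \<exists>T. \<forall>\<tau>\<ge>T. \<forall>\<sigma> t. \<bar>\<sigma>\<bar> = 1 \<longrightarrow> \<bar>t\<bar> \<le> \<delta> * \<tau> \<longrightarrow>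
    cmod (trunc_laplace \<nu> \<tau> (Complex \<sigma> t)) \<le> exp (real l * (3 - t\<^sup>2 / 8) / \<tau>\<^sup>2)"
proof -
  have pw2: "\<bar>y\<bar> powr 2 = y\<^sup>2" for y :: real
    by (cases "y = 0") (simp_all add: powr_numeral)
  have "(tail_moment \<nu> 2 1 \<longlongrightarrow> 0) at_top"
    by (rule tendsto_tail_moment) (use sets int in \<open>auto simp: pw2\<close>)
  then have "\<forall>\<^sub>F u in at_top. tail_moment \<nu> 2 1 u < 1 / 64"
    by (rule order_tendstoD) simp
  then obtain U where U: "\<And>u. u \<ge> U \<Longrightarrow> tail_moment \<nu> 2 1 u < 1 / 64"
    by (auto simp: eventually_at_top_linorder)
  define \<delta>1 where "\<delta>1 = 1 / max 1 U"
  have \<delta>1: "0 < \<delta>1" by (simp add: \<delta>1_def)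
  \<comment> \<open>With 1 / 64 the error term is at most (2 + t^2) / (16 \<tau>^2).\<close>
  have \<kappa>: "tail_moment \<nu> 2 1 (1 / \<delta>1) < 1 / 64" by (rule U) (simp add: \<delta>1_def)
  \<comment> \<open>Half of \<delta>1 leaves room for the real part in |w| \<le> 1 + |t| \<le>
    \<delta>1 * \<tau>. The bound 1 / (4 l) makes A \<le> 1 / (8 l^2), so that |v|^2 is at most A /
    8.\<close>
  define \<delta> where "\<delta> = min (\<delta>1 / 2) (1 / (4 * real l))"
  have \<delta>: "0 < \<delta>" "\<delta> \<le> \<delta>1 / 2" "\<delta> \<le> 1 / (4 * real l)" using \<delta>1 l by (auto simp: \<delta>_def)
  define T where "T = max 1 (max (2 / \<delta>1) (2 / \<delta>))"
  have "cmod (trunc_laplace \<nu> \<tau> (Complex \<sigma> t)) \<le> exp (real l * (3 - t\<^sup>2 / 8) / \<tau>\<^sup>2)"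
    if \<tau>: "\<tau> \<ge> T" and \<sigma>: "\<bar>\<sigma>\<bar> = 1" and t: "\<bar>t\<bar> \<le> \<delta> * \<tau>" for \<tau> \<sigma> t
  proof -
    let ?w = "Complex \<sigma> t"
    have \<tau>1: "1 \<le> \<tau>" "2 / \<delta>1 \<le> \<tau>" "2 / \<delta> \<le> \<tau>" using \<tau> by (auto simp: T_def)
    then have \<tau>2: "2 \<le> \<delta>1 * \<tau>" "2 \<le> \<delta> * \<tau>" using \<delta>1 \<delta> by (auto simp: field_simps)
    have \<sigma>2: "\<sigma>\<^sup>2 = 1" using \<sigma> by (metis power2_abs one_power2)
    have cw2: "(cmod ?w)\<^sup>2 = 1 + t\<^sup>2" by (simp add: cmod_power2 \<sigma>2)
    have "cmod ?w \<le> \<bar>\<sigma>\<bar> + \<bar>t\<bar>" using cmod_le[of ?w] by simp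
    also have "\<dots> \<le> \<delta>1 * \<tau>"
    proof -
      have "\<delta> * \<tau> \<le> \<delta>1 / 2 * \<tau>" using \<delta>(2) \<tau>1 by (intro mult_right_mono) auto
      also have "\<dots> = \<delta>1 * \<tau> / 2" by simp
      finally show ?thesis using \<sigma> t \<tau>2 by linarith
    qed
    finally have cw: "cmod ?w \<le> \<delta>1 * \<tau>" .
    define err where "err = trunc_laplace \<nu> \<tau> ?w - (1 + of_real (real l) * ?w\<^sup>2 / (2 * \<tau>\<^sup>2))"
    have "cmod err \<le> 4 * (1 + (cmod ?w)\<^sup>2) / \<tau>\<^sup>2 * tail_moment \<nu> 2 1 (1 / \<delta>1)"
      unfolding err_def var[symmetric]
      by (rule trunc_laplace_quadratic_le[OF prob sets int mean \<delta>1 _ _ _ cw]) (use \<tau>1 \<tau>2 \<sigma> in auto)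
    also have "\<dots> \<le> 4 * (1 + (cmod ?w)\<^sup>2) / \<tau>\<^sup>2 * (1 / 64)"
      using \<kappa> by (intro mult_left_mono) auto
    finally have err: "cmod err \<le> (2 + t\<^sup>2) / (16 * \<tau>\<^sup>2)"
      unfolding cw2 using \<tau>1 by (simp add: field_simps)
    define v where "v = of_real (real l) * ?w\<^sup>2 / (2 * \<tau>\<^sup>2) + err"
    have F: "trunc_laplace \<nu> \<tau> ?w = 1 + v" by (simp add: v_def err_def)
    have l1: "1 \<le> real l" using l by simp
    have Re2: "Re (?w\<^sup>2) = 1 - t\<^sup>2" by (simp add: power2_eq_square \<sigma>2[unfolded power2_eq_square])
    define A where "A = (2 + t\<^sup>2) / \<tau>\<^sup>2"
    have A0: "0 \<le> A" by (simp add: A_def)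
    have "A \<le> 2 * \<delta>\<^sup>2"
    proof -
      have "t\<^sup>2 \<le> (\<delta> * \<tau>)\<^sup>2" using t by (metis abs_ge_zero power2_abs power_mono)
      moreover have "2\<^sup>2 \<le> (\<delta> * \<tau>)\<^sup>2" using \<tau>2 by (intro power_mono) auto
      ultimately have "2 + t\<^sup>2 \<le> 2 * (\<delta> * \<tau>)\<^sup>2" by simp
      then show ?thesis using \<tau>1 by (simp add: A_def divide_le_eq power_mult_distrib)
    qed
    also have "\<dots> \<le> 2 * (1 / (4 * real l))\<^sup>2" using \<delta> by (intro mult_left_mono power_mono) auto
    finally have A1: "A \<le> 1 / (8 * (real l)\<^sup>2)" by (simp add: power_divide power_mult_distrib)
    have errA: "cmod err \<le> A / 16" using err by (simp add: A_def)
    have "Re v \<le> real l * (1 - t\<^sup>2) / (2 * \<tau>\<^sup>2) + A / 16"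
      using errA complex_Re_le_cmod[of err] Re2 by (simp add: v_def)
    moreover have "cmod v \<le> real l * A"
    proof -
      have "cmod (of_real (real l) * ?w\<^sup>2 / (2 * of_real (\<tau>\<^sup>2))) = real l * (cmod ?w)\<^sup>2 / (2 * \<tau>\<^sup>2)"
        by (simp add: norm_mult norm_divide norm_power)
      also have "\<dots> \<le> real l * (2 + t\<^sup>2) / (2 * \<tau>\<^sup>2)"
        unfolding cw2 by (intro divide_right_mono mult_left_mono) auto
      also have "\<dots> = real l * A / 2" by (simp add: A_def)
      finally have "cmod v \<le> real l * A / 2 + A / 16"
        unfolding v_def by (intro order_trans[OF norm_triangle_ineq] add_mono errA) simp
      also have "\<dots> \<le> real l * A" using mult_right_mono[OF l1 A0] A0 by simp
      finally show ?thesis .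
    qed
    then have "(cmod v)\<^sup>2 \<le> (real l * A)\<^sup>2" by (intro power_mono) auto
    moreover have "(real l * A)\<^sup>2 \<le> A / 8"
    proof -
      have "(real l)\<^sup>2 * A * A \<le> (real l)\<^sup>2 * (1 / (8 * (real l)\<^sup>2)) * A"
        using A1 A0 by (intro mult_right_mono mult_left_mono) auto
      then show ?thesis using l1 by (simp add: power_mult_distrib power2_eq_square mult_ac)
    qed
    ultimately have "Re v + (cmod v)\<^sup>2 / 2 \<le> real l * (1 - t\<^sup>2) / (2 * \<tau>\<^sup>2) + A / 8" by simp
    also have "\<dots> \<le> real l * (1 - t\<^sup>2) / (2 * \<tau>\<^sup>2) + real l * A / 8"
      using mult_right_mono[OF l1 A0] by simp
    also have "\<dots> = real l * (3 / 4 - 3 / 8 * t\<^sup>2) / \<tau>\<^sup>2"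
      using \<tau>1 by (simp add: A_def field_simps)
    also have "\<dots> \<le> real l * (3 - t\<^sup>2 / 8) / \<tau>\<^sup>2"
    proof (intro divide_right_mono mult_left_mono)
      show "3 / 4 - 3 / 8 * t\<^sup>2 \<le> 3 - t\<^sup>2 / 8" using zero_le_power2[of t] by linarith
    qed auto
    finally show ?thesis
      unfolding F using order_trans[OF cmod_1_add_le_exp[of v]] by simp
  qed
  then show ?thesis using \<delta>(1) by blast
qed

text \<open>Powers of t are paid for by a small part of the Gaussian; 1 / 32 fits into every
  exponent met below.\<close>

lemma one_plus_abs_power_le_exp:
  "\<exists>C>0. \<forall>t::real. (2 + \<bar>t\<bar>) ^ k \<le> C * exp (t\<^sup>2 / 32)"
proof -
  have "((\<lambda>u::real. (2 + u) ^ k * exp (- u\<^sup>2 / 32)) \<longlongrightarrow> 0) at_top"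
    by real_asymp
  then have "\<forall>\<^sub>F u in at_top. (2 + u) ^ k * exp (- u\<^sup>2 / 32) < (1::real)"
    by (rule order_tendstoD) simp
  then obtain U where U: "\<And>u::real. u \<ge> U \<Longrightarrow> (2 + u) ^ k * exp (- u\<^sup>2 / 32) < 1"
    by (auto simp: eventually_at_top_linorder)
  define C where "C = 1 + (2 + \<bar>U\<bar>) ^ k"
  have "(2 + \<bar>t\<bar>) ^ k \<le> C * exp (t\<^sup>2 / 32)" for t :: real
  proof (cases "\<bar>t\<bar> \<ge> U")
    case True
    have "(2 + \<bar>t\<bar>) ^ k = ((2 + \<bar>t\<bar>) ^ k * exp (- \<bar>t\<bar>\<^sup>2 / 32)) * exp (t\<^sup>2 / 32)"
      by (simp add: exp_minus)
    also have "\<dots> \<le> C * exp (t\<^sup>2 / 32)"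
    proof (rule mult_right_mono)
      have "(2 + \<bar>t\<bar>) ^ k * exp (- \<bar>t\<bar>\<^sup>2 / 32) \<le> 1" using U[OF True] by simp
      also have "\<dots> \<le> C" by (simp add: C_def)
      finally show "(2 + \<bar>t\<bar>) ^ k * exp (- \<bar>t\<bar>\<^sup>2 / 32) \<le> C" .
    qed simp
    finally show ?thesis .
  next
    case False
    then have "(2 + \<bar>t\<bar>) ^ k \<le> (2 + \<bar>U\<bar>) ^ k" by (intro power_mono) auto
    also have "\<dots> \<le> C * 1" by (simp add: C_def)
    also have "\<dots> \<le> C * exp (t\<^sup>2 / 32)" by (intro mult_left_mono) (auto simp: C_def)
    finally show ?thesis .
  qed
  moreover have "C > 0" by (simp add: C_def add_pos_nonneg)
  ultimately show ?thesis by blast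
qed

lemma cmod_Complex_unit_le: "\<bar>\<sigma>\<bar> = 1 \<Longrightarrow> cmod (Complex \<sigma> t) \<le> 1 + \<bar>t\<bar>"
  using cmod_le[of "Complex \<sigma> t"] by simp

lemma cmod_Complex_unit_power2: "\<bar>\<sigma>\<bar> = 1 \<Longrightarrow> (cmod (Complex \<sigma> t))\<^sup>2 = 1 + t\<^sup>2"
  by (simp add: cmod_power2 abs_square_eq_1[symmetric])

lemma Re_Complex_unit_power2: "\<bar>\<sigma>\<bar> = 1 \<Longrightarrow> Re ((Complex \<sigma> t)\<^sup>2) = 1 - t\<^sup>2"
  by (simp add: Re_power2 abs_square_eq_1[symmetric])

section \<open>The cumulant polynomial and the transform of the Edgeworth approximation\<close>

context standardized_distribution
begin

definition cgf_coeff :: "nat \<Rightarrow> real" where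
  "cgf_coeff i = cumulant M (i + 2) / fact (i + 2)"

lemma cgf_eq: "cgf M m w = w\<^sup>2 / 2 + (\<Sum>i=1..m-2. of_real (cgf_coeff i) * w ^ (i + 2))"
proof -
  have "cgf M m w = (\<Sum>j\<in>{2..m}. of_real (cumulant M j) * w ^ j / fact j)"
    by (simp add: cgf_def)
  also have "\<dots> = (\<Sum>i\<in>{0..m-2}. of_real (cumulant M (i + 2)) * w ^ (i + 2) / fact (i + 2))"
  proof (rule sum.reindex_bij_witness[where i = "\<lambda>i. i + 2" and j = "\<lambda>j. j - 2"])
    fix j assume j: "j \<in> {2..m}"
    then have e: "j - 2 + 2 = j" by auto
    show "j - 2 + 2 = j" by (rule e)
    show "j - 2 \<in> {0..m-2}" using j by auto
    show "of_real (cumulant M (j - 2 + 2)) * w ^ (j - 2 + 2) / fact (j - 2 + 2) = of_real (cumulant M j) * w ^ j / fact j"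
      unfolding e ..
  qed (use m_ge_2 in auto)
  also have "{0..m-2} = insert 0 {1..m-2}" by auto
  finally show ?thesis
    using low_cumulants by (simp add: cgf_coeff_def numeral_2_eq_2)
qed

definition cgf_bound :: real where
  "cgf_bound = (\<Sum>i=1..m-2. \<bar>cgf_coeff i\<bar>)"

lemma cgf_bound_nonneg: "0 \<le> cgf_bound"
  unfolding cgf_bound_def by (intro sum_nonneg) auto

lemma cgf_sub_square_le:
  assumes "cmod u \<le> r" "r \<le> 1"
  shows "cmod (cgf M m u - u\<^sup>2 / 2) \<le> cgf_bound * r * (cmod u)\<^sup>2"
proof -
  have r: "0 \<le> r" using order_trans[OF norm_ge_zero assms(1)] .
  have "cmod (cgf M m u - u\<^sup>2 / 2) \<le> (\<Sum>i=1..m-2. \<bar>cgf_coeff i\<bar> * (r * (cmod u)\<^sup>2))"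
    unfolding cgf_eq add_diff_cancel_left'
  proof (rule sum_norm_le)
    fix i assume i: "i \<in> {1..m-2}"
    have "cmod u ^ i \<le> cmod u ^ 1" using assms i by (intro power_decreasing) auto
    then have "cmod u ^ i \<le> r" using assms by simp
    then have "cmod u ^ i * (cmod u)\<^sup>2 \<le> r * (cmod u)\<^sup>2" by (rule mult_right_mono) simp
    then show "cmod (of_real (cgf_coeff i) * u ^ (i + 2)) \<le> \<bar>cgf_coeff i\<bar> * (r * (cmod u)\<^sup>2)"
      unfolding norm_mult norm_of_real norm_power power_add by (rule mult_left_mono) simp
  qed
  then show ?thesis by (simp add: cgf_bound_def sum_distrib_right mult.assoc)
qed

text \<open>Per summand the same exponent as in \<open>trunc_laplace_decay\<close>: the two products
  are compared factor by factor, and both kinds of factors need a common bound.\<close>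

lemma Re_cgf_le:
  assumes \<delta>: "0 < \<delta>" "\<delta> \<le> 1 / 2" "16 * cgf_bound * \<delta> \<le> 1"
    and \<tau>: "1 \<le> \<delta> * \<tau>" and \<sigma>: "\<bar>\<sigma>\<bar> = 1" and t: "\<bar>t\<bar> \<le> \<delta> * \<tau>"
  shows "Re (cgf M m (Complex \<sigma> t / of_real \<tau>)) \<le> (3 - t\<^sup>2 / 8) / \<tau>\<^sup>2"
proof -
  let ?w = "Complex \<sigma> t" let ?u = "?w / of_real \<tau>"
  have \<tau>0: "0 < \<tau>" using \<tau> \<delta> by (metis less_le_trans mult.commute zero_less_mult_pos zero_less_one)
  have "cmod ?w \<le> 2 * \<delta> * \<tau>" using cmod_Complex_unit_le[OF \<sigma>, of t] t \<tau> by linarith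
  then have u: "cmod ?u \<le> 2 * \<delta>" using \<tau>0 by (simp add: norm_divide divide_le_eq)
  have u2: "(cmod ?u)\<^sup>2 = (1 + t\<^sup>2) / \<tau>\<^sup>2"
    using cmod_Complex_unit_power2[OF \<sigma>, of t] by (simp add: norm_divide power_divide)
  have Ru: "Re (?u\<^sup>2 / 2) = (1 - t\<^sup>2) / (2 * \<tau>\<^sup>2)"
    using Re_Complex_unit_power2[OF \<sigma>, of t] \<tau>0 by (simp add: power_divide flip: of_real_power)
  have "Re (cgf M m ?u) - Re (?u\<^sup>2 / 2) \<le> cmod (cgf M m ?u - ?u\<^sup>2 / 2)"
    using complex_Re_le_cmod[of "cgf M m ?u - ?u\<^sup>2 / 2"] by simp
  also have "\<dots> \<le> cgf_bound * (2 * \<delta>) * (cmod ?u)\<^sup>2"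
    by (rule cgf_sub_square_le[OF u]) (use \<delta> in simp)
  also have "\<dots> \<le> 1 / 8 * (cmod ?u)\<^sup>2"
    using \<delta> by (intro mult_right_mono) auto
  finally have "Re (cgf M m ?u) \<le> (1 - t\<^sup>2) / (2 * \<tau>\<^sup>2) + (1 + t\<^sup>2) / (8 * \<tau>\<^sup>2)"
    unfolding Ru u2 by simp
  also have "\<dots> = (5 / 8 - 3 / 8 * t\<^sup>2) / \<tau>\<^sup>2" using \<tau>0 by (simp add: field_simps)
  also have "\<dots> \<le> (3 - t\<^sup>2 / 8) / \<tau>\<^sup>2"
  proof (intro divide_right_mono)
    show "5 / 8 - 3 / 8 * t\<^sup>2 \<le> 3 - t\<^sup>2 / 8" using zero_le_power2[of t] by linarith
  qed simp
  finally show ?thesis .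
qed

text \<open>The transform of the Edgeworth approximation, with \<open>\<tau> = \<surd>n\<close>.\<close>

definition edgeworth_laplace :: "real \<Rightarrow> complex \<Rightarrow> complex" where
  "edgeworth_laplace \<tau> w = exp (w\<^sup>2 / 2) *
    (\<Sum>k\<le>m-2. of_real (1 / \<tau>) ^ k * weight_poly (\<lambda>i. of_real (cgf_coeff i) * w ^ (i + 2)) k)"

text \<open>The degree in w: since i \<ge> 1, (i + 2) * p i \<le> 3 * (i * p i), and the weights i *
  p i add up to k.\<close>

lemma weight_poly_bound:
  "\<exists>C\<ge>0. \<forall>w. cmod (weight_poly (\<lambda>i. of_real (cgf_coeff i) * w ^ (i + 2)) k) \<le> C * (1 + cmod w) ^ (3 * k)"
proof -
  define C where "C = (\<Sum>p\<in>weight_solutions k. \<Prod>i=1..k. \<bar>cgf_coeff i\<bar> ^ p i)"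
  have C: "0 \<le> C" unfolding C_def by (intro sum_nonneg prod_nonneg) auto
  have "cmod (weight_poly (\<lambda>i. of_real (cgf_coeff i) * w ^ (i + 2)) k) \<le> C * (1 + cmod w) ^ (3 * k)" for w
    unfolding weight_poly_def C_def sum_distrib_right
  proof (rule sum_norm_le)
    fix p assume p: "p \<in> weight_solutions k"
    have "(\<Sum>i=1..k. (i + 2) * p i) \<le> (\<Sum>i=1..k. 3 * (i * p i))"
    proof (rule sum_mono)
      fix i assume "i \<in> {1..k}"
      then have "(i + 2) * p i \<le> (3 * i) * p i" by (intro mult_right_mono) auto
      then show "(i + 2) * p i \<le> 3 * (i * p i)" by (simp only: mult.assoc)
    qed
    also have "\<dots> = 3 * k" using p by (simp add: weight_solutions_def flip: sum_distrib_left)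
    finally have le: "(\<Sum>i=1..k. (i + 2) * p i) \<le> 3 * k" .
    have "cmod (\<Prod>i=1..k. (of_real (cgf_coeff i) * w ^ (i + 2)) ^ p i / fact (p i))
        = (\<Prod>i=1..k. (\<bar>cgf_coeff i\<bar> * cmod w ^ (i + 2)) ^ p i / fact (p i))"
      by (simp add: norm_mult norm_power norm_divide flip: prod_norm)
    also have "\<dots> \<le> (\<Prod>i=1..k. \<bar>cgf_coeff i\<bar> ^ p i * (1 + cmod w) ^ ((i + 2) * p i))"
    proof (intro prod_mono conjI)
      fix i
      have "(\<bar>cgf_coeff i\<bar> * cmod w ^ (i + 2)) ^ p i / fact (p i) \<le> (\<bar>cgf_coeff i\<bar> * (1 + cmod w) ^ (i + 2)) ^ p i / 1"
        by (intro frac_le power_mono mult_left_mono) (auto simp: fact_ge_1)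
      then show "(\<bar>cgf_coeff i\<bar> * cmod w ^ (i + 2)) ^ p i / fact (p i) \<le> \<bar>cgf_coeff i\<bar> ^ p i * (1 + cmod w) ^ ((i + 2) * p i)"
        by (simp only: div_by_1 power_mult_distrib power_mult)
    qed auto
    also have "\<dots> = (\<Prod>i=1..k. \<bar>cgf_coeff i\<bar> ^ p i) * (1 + cmod w) ^ (\<Sum>i=1..k. (i + 2) * p i)"
      by (simp only: prod.distrib power_sum)
    also have "\<dots> \<le> (\<Prod>i=1..k. \<bar>cgf_coeff i\<bar> ^ p i) * (1 + cmod w) ^ (3 * k)"
      by (intro mult_left_mono power_increasing le prod_nonneg) auto
    finally show "cmod (\<Prod>i=1..k. (of_real (cgf_coeff i) * w ^ (i + 2)) ^ p i / fact (p i))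
        \<le> (\<Prod>i=1..k. \<bar>cgf_coeff i\<bar> ^ p i) * (1 + cmod w) ^ (3 * k)" .
  qed
  then show ?thesis using C by blast
qed

lemma edgeworth_laplace_bound:
  "\<exists>C\<ge>0. \<forall>\<tau>\<ge>1. \<forall>\<sigma> t. \<bar>\<sigma>\<bar> = 1 \<longrightarrow> cmod (edgeworth_laplace \<tau> (Complex \<sigma> t)) \<le> C * exp (- t\<^sup>2 / 4)"
proof -
  have "\<forall>k. \<exists>C\<ge>0. \<forall>w. cmod (weight_poly (\<lambda>i. of_real (cgf_coeff i) * w ^ (i + 2)) k) \<le> C * (1 + cmod w) ^ (3 * k)"
    using weight_poly_bound by blast
  then obtain B where B: "\<And>k. B k \<ge> 0"
    "\<And>k w. cmod (weight_poly (\<lambda>i. of_real (cgf_coeff i) * w ^ (i + 2)) k) \<le> B k * (1 + cmod w) ^ (3 * k)" by metis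
  have "\<forall>k. \<exists>C>0. \<forall>t::real. (2 + \<bar>t\<bar>) ^ (3 * k) \<le> C * exp (t\<^sup>2 / 32)"
    using one_plus_abs_power_le_exp by blast
  then obtain D where D: "\<And>k. D k > 0" "\<And>k t. (2 + \<bar>t::real\<bar>) ^ (3 * k) \<le> D k * exp (t\<^sup>2 / 32)" by metis
  define C where "C = exp 1 * (\<Sum>k\<le>m-2. B k * D k)"
  have "cmod (edgeworth_laplace \<tau> (Complex \<sigma> t)) \<le> C * exp (- t\<^sup>2 / 4)"
    if \<tau>: "\<tau> \<ge> 1" and \<sigma>: "\<bar>\<sigma>\<bar> = 1" for \<tau> \<sigma> t
  proof -
    let ?w = "Complex \<sigma> t"
    have "cmod (\<Sum>k\<le>m-2. of_real (1 / \<tau>) ^ k * weight_poly (\<lambda>i. of_real (cgf_coeff i) * ?w ^ (i + 2)) k)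
        \<le> (\<Sum>k\<le>m-2. B k * D k * exp (t\<^sup>2 / 32))"
    proof (rule sum_norm_le)
      fix k
      have "cmod (of_real (1 / \<tau>) ^ k * weight_poly (\<lambda>i. of_real (cgf_coeff i) * ?w ^ (i + 2)) k)
          = (1 / \<tau>) ^ k * cmod (weight_poly (\<lambda>i. of_real (cgf_coeff i) * ?w ^ (i + 2)) k)"
        using \<tau> by (simp add: norm_mult norm_power norm_divide)
      also have "\<dots> \<le> 1 * (B k * (1 + cmod ?w) ^ (3 * k))"
        using \<tau> by (intro mult_mono B power_le_one) auto
      also have "\<dots> \<le> 1 * (B k * (2 + \<bar>t\<bar>) ^ (3 * k))"
        using cmod_Complex_unit_le[OF \<sigma>, of t] by (intro mult_left_mono power_mono B) auto
      also have "\<dots> \<le> 1 * (B k * (D k * exp (t\<^sup>2 / 32)))"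
        by (intro mult_left_mono B D) auto
      finally show "cmod (of_real (1 / \<tau>) ^ k * weight_poly (\<lambda>i. of_real (cgf_coeff i) * ?w ^ (i + 2)) k)
          \<le> B k * D k * exp (t\<^sup>2 / 32)" by (simp only: mult.assoc mult_1)
    qed
    also have "\<dots> = (\<Sum>k\<le>m-2. B k * D k) * exp (t\<^sup>2 / 32)" by (simp only: sum_distrib_right)
    finally have 1: "cmod (\<Sum>k\<le>m-2. of_real (1 / \<tau>) ^ k * weight_poly (\<lambda>i. of_real (cgf_coeff i) * ?w ^ (i + 2)) k)
        \<le> (\<Sum>k\<le>m-2. B k * D k) * exp (t\<^sup>2 / 32)" .
    have 2: "cmod (exp (?w\<^sup>2 / 2)) = exp ((1 - t\<^sup>2) / 2)"
      using Re_Complex_unit_power2[OF \<sigma>, of t] by simp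
    have "cmod (edgeworth_laplace \<tau> ?w) \<le> exp ((1 - t\<^sup>2) / 2) * ((\<Sum>k\<le>m-2. B k * D k) * exp (t\<^sup>2 / 32))"
      unfolding edgeworth_laplace_def norm_mult 2 by (intro mult_left_mono 1) simp
    also have "\<dots> = (\<Sum>k\<le>m-2. B k * D k) * exp ((1 - t\<^sup>2) / 2 + t\<^sup>2 / 32)"
      by (simp add: exp_add)
    also have "\<dots> \<le> (\<Sum>k\<le>m-2. B k * D k) * exp (1 + - t\<^sup>2 / 4)"
    proof (intro mult_left_mono iffD2[OF exp_le_cancel_iff] sum_nonneg mult_nonneg_nonneg B less_imp_le[OF D(1)])
      have "(1 - x) / 2 + x / 32 \<le> 1 + - x / 4" if "0 \<le> x" for x :: real
        using that by (simp add: field_simps)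
      then show "(1 - t\<^sup>2) / 2 + t\<^sup>2 / 32 \<le> 1 + - t\<^sup>2 / 4" using zero_le_power2[of t] by blast
    qed
    also have "\<dots> = C * exp (- t\<^sup>2 / 4)" unfolding C_def exp_add by (simp only: mult_ac)
    finally show ?thesis .
  qed
  moreover have "C \<ge> 0" unfolding C_def using B D by (intro mult_nonneg_nonneg sum_nonneg) (auto simp: less_imp_le)
  ultimately show ?thesis by blast
qed

text \<open>The exponent is w^2 / 2 plus a polynomial in 1 / \<tau> whose i-th coefficient is a
  multiple of w^(i+2). Expanding the exponential of that polynomial up to (1 / \<tau>)^(m-2) gives
  the Edgeworth sum, and the first omitted order is (1 / \<tau>)^(m-1).\<close>

lemma exp_cgf_edgeworth_le:
  assumes \<delta>: "0 < \<delta>" "\<delta> \<le> 1 / 2" "16 * cgf_bound * \<delta> \<le> 1"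
  shows "\<exists>C\<ge>0. \<forall>\<tau>. 2 \<le> \<delta> * \<tau> \<longrightarrow> (\<forall>\<sigma> t. \<bar>\<sigma>\<bar> = 1 \<longrightarrow> \<bar>t\<bar> \<le> \<delta> * \<tau> \<longrightarrow>
    cmod (exp (of_real (\<tau>\<^sup>2) * cgf M m (Complex \<sigma> t / of_real \<tau>)) - edgeworth_laplace \<tau> (Complex \<sigma> t))
      \<le> C * (1 / \<tau>) ^ (m - 1) * exp (- t\<^sup>2 / 32))"
proof -
  obtain D where D: "D > 0" "\<And>t. (2 + \<bar>t::real\<bar>) ^ (m - 1) \<le> D * exp (t\<^sup>2 / 32)"
    using one_plus_abs_power_le_exp by blast
  define C where "C = exp 1 * D * (1 / (2 * \<delta>)) ^ (m - 1)"
  have "cmod (exp (of_real (\<tau>\<^sup>2) * cgf M m (Complex \<sigma> t / of_real \<tau>)) - edgeworth_laplace \<tau> (Complex \<sigma> t))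
      \<le> C * (1 / \<tau>) ^ (m - 1) * exp (- t\<^sup>2 / 32)"
    if \<tau>: "2 \<le> \<delta> * \<tau>" and \<sigma>: "\<bar>\<sigma>\<bar> = 1" and t: "\<bar>t\<bar> \<le> \<delta> * \<tau>" for \<tau> \<sigma> t
  proof -
    let ?w = "Complex \<sigma> t" let ?z = "1 / \<tau>"
    let ?c = "\<lambda>i. of_real (cgf_coeff i) * ?w ^ (i + 2)"
    \<comment> \<open>A radius as large as |w| * \<zeta> \<le> 2 \<delta> permits: the majorant then
      grows at most like exp ((1 + t^2) / 8), slower than exp ((1 - t^2) / 2) decays, and (1 /
      (\<tau> * \<zeta>))^(m-1) costs only a polynomial in |t|. The conditions on t and \<tau> give
      1 / \<tau> \<le> \<zeta>.\<close>
    define \<zeta> where "\<zeta> = 2 * \<delta> / (2 + \<bar>t\<bar>)"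
    have "0 < \<delta> * \<tau>" using \<tau> by linarith
    then have \<tau>0: "0 < \<tau>" using \<delta> by (simp add: zero_less_mult_iff)
    have cw: "cmod ?w \<le> 2 + \<bar>t\<bar>" using cmod_Complex_unit_le[OF \<sigma>, of t] by simp
    have \<zeta>: "0 < \<zeta>" "?z \<le> \<zeta>"
      using \<delta> t \<tau> \<tau>0 by (auto simp: \<zeta>_def field_simps)
    have w\<zeta>: "cmod ?w * \<zeta> \<le> 2 * \<delta>"
      using mult_right_mono[OF cw, of "2 * \<delta>"] \<delta> by (simp add: \<zeta>_def divide_le_eq mult.commute)
    have "of_real (\<tau>\<^sup>2) * cgf M m (?w / of_real \<tau>) = ?w\<^sup>2 / 2 + (\<Sum>i=1..m-2. ?c i * of_real ?z ^ i)"
      unfolding cgf_eq distrib_left sum_distrib_left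
    proof (intro arg_cong2[where f = "(+)"] sum.cong refl)
      show "of_real (\<tau>\<^sup>2) * ((?w / of_real \<tau>)\<^sup>2 / 2) = ?w\<^sup>2 / 2"
        using \<tau>0 by (simp add: power_divide)
      show "of_real (\<tau>\<^sup>2) * (of_real (cgf_coeff i) * (?w / of_real \<tau>) ^ (i + 2)) = ?c i * of_real ?z ^ i" for i
        using \<tau>0 by (simp add: power_divide power_add power2_eq_square)
    qed
    then have "exp (of_real (\<tau>\<^sup>2) * cgf M m (?w / of_real \<tau>)) - edgeworth_laplace \<tau> ?w
        = exp (?w\<^sup>2 / 2) * (exp (\<Sum>i=1..m-2. ?c i * of_real ?z ^ i) - (\<Sum>k\<le>m-2. of_real ?z ^ k * weight_poly ?c k))"
      by (simp only: exp_add edgeworth_laplace_def right_diff_distrib)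
    then have "cmod (exp (of_real (\<tau>\<^sup>2) * cgf M m (?w / of_real \<tau>)) - edgeworth_laplace \<tau> ?w)
        = exp ((1 - t\<^sup>2) / 2) * cmod (exp (\<Sum>i=1..m-2. ?c i * of_real ?z ^ i) - (\<Sum>k\<le>m-2. of_real ?z ^ k * weight_poly ?c k))"
      using Re_Complex_unit_power2[OF \<sigma>, of t] by (simp only: norm_mult norm_exp_eq_Re Re_divide_numeral)
    also have "\<dots> \<le> exp ((1 - t\<^sup>2) / 2) * ((?z / \<zeta>) ^ Suc (m - 2) * exp (\<Sum>i=1..m-2. cmod (?c i) * \<zeta> ^ i))"
      by (intro mult_left_mono exp_sum_weight_remainder) (use \<tau>0 \<zeta> in auto)
    also have "\<dots> \<le> exp ((1 - t\<^sup>2) / 2) * ((?z / \<zeta>) ^ Suc (m - 2) * exp ((1 + t\<^sup>2) / 8))"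
    proof (intro mult_left_mono iffD2[OF exp_le_cancel_iff])
      have "(\<Sum>i=1..m-2. cmod (?c i) * \<zeta> ^ i) \<le> (\<Sum>i=1..m-2. \<bar>cgf_coeff i\<bar> * ((2 * \<delta>) * (cmod ?w)\<^sup>2))"
      proof (rule sum_mono)
        fix i assume i: "i \<in> {1..m-2}"
        have "cmod (?c i) * \<zeta> ^ i = \<bar>cgf_coeff i\<bar> * ((cmod ?w * \<zeta>) ^ i * (cmod ?w)\<^sup>2)"
          by (simp add: norm_mult norm_power power_add power_mult_distrib power2_eq_square)
        also have "\<dots> \<le> \<bar>cgf_coeff i\<bar> * ((2 * \<delta>) * (cmod ?w)\<^sup>2)"
        proof (intro mult_left_mono mult_right_mono)
          have "(cmod ?w * \<zeta>) ^ i \<le> (2 * \<delta>) ^ i" using w\<zeta> \<zeta> by (intro power_mono) auto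
          also have "\<dots> \<le> (2 * \<delta>) ^ 1" using \<delta> i by (intro power_decreasing) auto
          finally show "(cmod ?w * \<zeta>) ^ i \<le> 2 * \<delta>" by simp
        qed auto
        finally show "cmod (?c i) * \<zeta> ^ i \<le> \<bar>cgf_coeff i\<bar> * ((2 * \<delta>) * (cmod ?w)\<^sup>2)" .
      qed
      also have "\<dots> = cgf_bound * (2 * \<delta>) * (1 + t\<^sup>2)"
        unfolding cgf_bound_def cmod_Complex_unit_power2[OF \<sigma>] by (simp only: sum_distrib_right mult.assoc)
      also have "\<dots> \<le> 1 / 8 * (1 + t\<^sup>2)"
        using \<delta> by (intro mult_right_mono) auto
      finally show "(\<Sum>i=1..m-2. cmod (?c i) * \<zeta> ^ i) \<le> (1 + t\<^sup>2) / 8" by simp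
    qed (use \<tau>0 \<zeta> in auto)
    also have "(?z / \<zeta>) ^ Suc (m - 2) = ?z ^ (m - 1) * ((1 / (2 * \<delta>)) ^ (m - 1) * (2 + \<bar>t\<bar>) ^ (m - 1))"
    proof -
      have "Suc (m - 2) = m - 1" using m_ge_2 by simp
      moreover have "?z / \<zeta> = ?z * (1 / (2 * \<delta>) * (2 + \<bar>t\<bar>))" by (simp add: \<zeta>_def)
      ultimately show ?thesis by (simp only: power_mult_distrib)
    qed
    also have "exp ((1 - t\<^sup>2) / 2) * (?z ^ (m - 1) * ((1 / (2 * \<delta>)) ^ (m - 1) * (2 + \<bar>t\<bar>) ^ (m - 1)) * exp ((1 + t\<^sup>2) / 8))
        \<le> exp ((1 - t\<^sup>2) / 2) * (?z ^ (m - 1) * ((1 / (2 * \<delta>)) ^ (m - 1) * (D * exp (t\<^sup>2 / 32))) * exp ((1 + t\<^sup>2) / 8))"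
      using \<tau>0 \<delta> by (intro mult_left_mono mult_right_mono D) auto
    also have "\<dots> = D * (1 / (2 * \<delta>)) ^ (m - 1) * ?z ^ (m - 1) * (exp ((1 - t\<^sup>2) / 2) * exp (t\<^sup>2 / 32) * exp ((1 + t\<^sup>2) / 8))"
      by (simp only: mult_ac)
    also have "exp ((1 - t\<^sup>2) / 2) * exp (t\<^sup>2 / 32) * exp ((1 + t\<^sup>2) / 8) = exp ((1 - t\<^sup>2) / 2 + t\<^sup>2 / 32 + (1 + t\<^sup>2) / 8)"
      by (simp only: exp_add)
    also have "D * (1 / (2 * \<delta>)) ^ (m - 1) * ?z ^ (m - 1) * \<dots> \<le> D * (1 / (2 * \<delta>)) ^ (m - 1) * ?z ^ (m - 1) * exp (1 + - t\<^sup>2 / 32)"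
    proof (intro mult_left_mono iffD2[OF exp_le_cancel_iff])
      have "(1 - x) / 2 + x / 32 + (1 + x) / 8 \<le> 1 + - x / 32" if "0 \<le> x" for x :: real
        using that by (simp add: field_simps)
      then show "(1 - t\<^sup>2) / 2 + t\<^sup>2 / 32 + (1 + t\<^sup>2) / 8 \<le> 1 + - t\<^sup>2 / 32"
        using zero_le_power2[of t] by blast
    qed (use \<tau>0 \<delta> D in auto)
    also have "\<dots> = C * ?z ^ (m - 1) * exp (- t\<^sup>2 / 32)"
      unfolding C_def exp_add by (simp only: mult_ac)
    finally show ?thesis .
  qed
  moreover have "C \<ge> 0" unfolding C_def using D \<delta> by auto
  ultimately show ?thesis by blast
qed

end

section \<open>From transforms to weighted bounds\<close>

text \<open>The quotient by a^2 of (a + b)^i minus its terms of degree 0 and 1 in a, given by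
  recursion because a semiring has neither subtraction nor division.\<close>

primrec rem_poly :: "'a::comm_semiring_1 \<Rightarrow> 'a \<Rightarrow> nat \<Rightarrow> 'a" where
  "rem_poly a b 0 = 0"
| "rem_poly a b (Suc i) = (a + b) * rem_poly a b i + of_nat i * b ^ (i - 1)"

lemma power_add_eq_rem_poly:
  "(a + b) ^ i = a\<^sup>2 * rem_poly a b i + b ^ i + of_nat i * a * b ^ (i - 1)"
proof (induction i)
  case (Suc i)
  have "of_nat i * (b * b ^ (i - 1)) = of_nat i * b ^ i"
    by (cases i) simp_all
  then have b: "of_nat i * a * (b * b ^ (i - 1)) = of_nat i * a * b ^ i"
    by (metis mult.assoc mult.commute)
  have "(a + b) ^ Suc i = (a + b) * (a\<^sup>2 * rem_poly a b i + b ^ i + of_nat i * a * b ^ (i - 1))"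
    by (simp only: power_Suc Suc)
  also have "\<dots> = a\<^sup>2 * ((a + b) * rem_poly a b i + of_nat i * b ^ (i - 1)) + b * b ^ i + a * b ^ i + of_nat i * a * (b * b ^ (i - 1))"
    by (simp add: algebra_simps power2_eq_square)
  also have "\<dots> = a\<^sup>2 * rem_poly a b (Suc i) + b ^ Suc i + of_nat (Suc i) * a * b ^ (Suc i - 1)"
    unfolding b by (simp add: algebra_simps)
  finally show ?case .
qed simp

lemma tilt_rem_poly: "tilt \<sigma> (rem_poly a b i) = rem_poly (tilt \<sigma> a) (tilt \<sigma> b) i"
  by (induction i) (simp_all add: tilt_add tilt_mult tilt_power)

lemma mass_finite_add: "mass x < \<infinity> \<Longrightarrow> mass y < \<infinity> \<Longrightarrow> mass (x + y) < \<infinity>"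
  by (simp add: mass_add)

lemma mass_finite_mult: "mass x < \<infinity> \<Longrightarrow> mass y < \<infinity> \<Longrightarrow> mass (x * y) < \<infinity>"
  by (simp add: mass_mult ennreal_mult_less_top)

lemma mass_finite_of_nat: "mass (of_nat k) < \<infinity>"
  by (simp add: mass_of_nat of_nat_less_top)

lemma mass_finite_rem_poly:
  assumes "mass a < \<infinity>" "mass b < \<infinity>"
  shows "mass (rem_poly a b i) < \<infinity>"
proof (induction i)
  case (Suc i)
  show ?case unfolding rem_poly.simps
    by (intro mass_finite_add mass_finite_mult mass_finite_of_nat mass_power_finite assms Suc)
qed simp

lemma ch_rem_poly:
  assumes "mass a < \<infinity>" "mass b < \<infinity>"
  shows "ch (rem_poly a b i) t = rem_poly (ch a t) (ch b t) i"
proof (induction i)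
  case (Suc i)
  have "ch (rem_poly a b (Suc i)) t = ch ((a + b) * rem_poly a b i) t + ch (of_nat i * b ^ (i - 1)) t"
    unfolding rem_poly.simps
    by (intro ch_add mass_finite_add mass_finite_mult mass_finite_rem_poly mass_finite_of_nat mass_power_finite assms)
  also have "ch ((a + b) * rem_poly a b i) t = ch (a + b) t * ch (rem_poly a b i) t"
    by (intro ch_mult mass_finite_add mass_finite_rem_poly assms)
  also have "ch (a + b) t = ch a t + ch b t" by (intro ch_add assms)
  also have "ch (of_nat i * b ^ (i - 1)) t = ch (of_nat i) t * ch (b ^ (i - 1)) t"
    by (intro ch_mult mass_finite_of_nat mass_power_finite assms)
  finally show ?case using Suc assms by (simp add: ch_power)
qed simp

text \<open>Dividing an estimate by a^2 would fail near a = 0, whereas the recursion involves only a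
  + b and b, both bounded by \<theta>. For i < 2 the polynomial is 0, so the truncated exponent i -
  2 is harmless.\<close>

lemma norm_rem_poly_le:
  fixes a b :: complex
  assumes "cmod (a + b) \<le> \<theta>" "cmod b \<le> \<theta>" "\<theta> \<le> 1"
  shows "cmod (rem_poly a b i) \<le> real i ^ 2 * \<theta> ^ (i - 2)"
proof (induction i)
  case (Suc i)
  have \<theta>: "0 \<le> \<theta>" using order_trans[OF norm_ge_zero assms(2)] .
  have "cmod (rem_poly a b (Suc i)) \<le> cmod (a + b) * cmod (rem_poly a b i) + real i * cmod b ^ (i - 1)"
    unfolding rem_poly.simps by (rule order_trans[OF norm_triangle_ineq]) (simp add: norm_mult norm_power)
  also have "\<dots> \<le> \<theta> * (real i ^ 2 * \<theta> ^ (i - 2)) + real i * \<theta> ^ (i - 1)"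
    using Suc assms \<theta> by (intro add_mono mult_mono power_mono) auto
  also have "\<dots> \<le> (real i ^ 2 + real i) * \<theta> ^ (i - 1)"
  proof -
    have "\<theta> * (real i ^ 2 * \<theta> ^ (i - 2)) \<le> real i ^ 2 * \<theta> ^ (i - 1)"
    proof (cases "i \<ge> 2")
      case True
      then have "i - 1 = Suc (i - 2)" by simp
      then show ?thesis by simp
    next
      case False
      then have "i = 0 \<or> i = 1" by auto
      then show ?thesis using assms by auto
    qed
    then show ?thesis by (simp add: algebra_simps)
  qed
  also have "\<dots> \<le> real (Suc i) ^ 2 * \<theta> ^ (i - 1)"
    using \<theta> by (intro mult_right_mono) (auto simp: power2_eq_square algebra_simps)
  also have "i - 1 = Suc i - 2" by simp
  finally show ?case .
qed simp

text \<open>The sup bound for an integrable transform is applied to both tilts; exp x and exp (- x)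
  together give exp |x|.\<close>

lemma AE_tilted_diff_le:
  fixes g :: "real \<Rightarrow> real" and G :: "real \<Rightarrow> real \<Rightarrow> complex"
  assumes z: "atom z = 0" and g [measurable]: "g \<in> borel_measurable borel" and B: "0 \<le> B"
    and fin: "\<And>\<sigma>. \<bar>\<sigma>\<bar> = 1 \<Longrightarrow> mass (tilt \<sigma> z) < \<infinity>"
    and G: "\<And>\<sigma> t. \<bar>\<sigma>\<bar> = 1 \<Longrightarrow> has_bochner_integral lborel (\<lambda>x. (exp (\<sigma> * x) * g x) *\<^sub>R iexp (t * x)) (G \<sigma> t)"
    and hat: "\<And>\<sigma>. \<bar>\<sigma>\<bar> = 1 \<Longrightarrow> (\<integral>\<^sup>+t. ennreal (cmod (ch (tilt \<sigma> z) t - G \<sigma> t)) \<partial>lborel) \<le> ennreal (2 * pi * B)"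
  shows "AE x in lborel. dens z x < \<infinity> \<and> exp \<bar>x\<bar> * \<bar>enn2real (dens z x) - g x\<bar> \<le> B"
proof -
  have one: "AE x in lborel. dens z x < \<infinity> \<and> exp (\<sigma> * x) * \<bar>enn2real (dens z x) - g x\<bar> \<le> B" if \<sigma>: "\<bar>\<sigma>\<bar> = 1" for \<sigma>
  proof -
    let ?d = "\<lambda>x. enn2real (dens (tilt \<sigma> z) x)"
    let ?g = "\<lambda>x. exp (\<sigma> * x) * g x"
    note finD = mass_finiteD[OF fin[OF \<sigma>]]
    have id: "integrable lborel ?d"
      by (rule integrable_enn2real[OF _ finD(2)]) simp
    have "integrable lborel (\<lambda>x. complex_of_real (?g x))"
      using G[OF \<sigma>, of 0] by (simp add: has_bochner_integral_iff scaleR_conv_of_real)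
    then have ig: "integrable lborel ?g"
      by (drule_tac integrable_Re) simp
    define h where "h x = ?d x - ?g x" for x
    have ih: "integrable lborel h" unfolding h_def[abs_def] using id ig by (rule Bochner_Integration.integrable_diff)
    have "(\<integral>x. h x *\<^sub>R iexp (t * x) \<partial>lborel) = ch (tilt \<sigma> z) t - G \<sigma> t" for t
    proof -
      have "(\<integral>x. h x *\<^sub>R iexp (t * x) \<partial>lborel) = (\<integral>x. ?d x *\<^sub>R iexp (t * x) - ?g x *\<^sub>R iexp (t * x) \<partial>lborel)"
        by (simp only: h_def scaleR_diff_left)
      also have "\<dots> = (\<integral>x. ?d x *\<^sub>R iexp (t * x) \<partial>lborel) - (\<integral>x. ?g x *\<^sub>R iexp (t * x) \<partial>lborel)"
        by (intro Bochner_Integration.integral_diff integrable_scaleR_iexp id ig)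
      also have "(\<integral>x. ?g x *\<^sub>R iexp (t * x) \<partial>lborel) = G \<sigma> t"
        by (rule has_bochner_integral_integral_eq[OF G[OF \<sigma>]])
      also have "(\<integral>x. ?d x *\<^sub>R iexp (t * x) \<partial>lborel) = ch (tilt \<sigma> z) t"
        using char_density[OF _ finD(2), of t] z by (simp add: ch_def)
      finally show ?thesis .
    qed
    then have "AE x in lborel. \<bar>h x\<bar> \<le> B"
      using hat[OF \<sigma>] by (intro AE_abs_le_Fourier[OF ih B]) simp
    moreover have "AE x in lborel. dens (tilt \<sigma> z) x \<noteq> \<infinity>"
      using finD(2) by (intro nn_integral_PInf_AE) auto
    ultimately show ?thesis
    proof eventually_elim
      case (elim x)
      have "dens z x \<noteq> \<infinity>"
        using elim(2) by (auto simp: dens_tilt ennreal_mult_eq_top_iff)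
      moreover have "h x = exp (\<sigma> * x) * (enn2real (dens z x) - g x)"
        by (simp add: h_def dens_tilt enn2real_mult algebra_simps)
      ultimately show ?case using elim(1) by (simp add: abs_mult less_top)
    qed
  qed
  have "AE x in lborel. dens z x < \<infinity> \<and> exp (1 * x) * \<bar>enn2real (dens z x) - g x\<bar> \<le> B"
    by (rule one) simp
  moreover have "AE x in lborel. dens z x < \<infinity> \<and> exp (- 1 * x) * \<bar>enn2real (dens z x) - g x\<bar> \<le> B"
    by (rule one) simp
  ultimately show ?thesis
  proof eventually_elim
    case (elim x)
    then show ?case by (cases "0 \<le> x") simp_all
  qed
qed

text \<open>The constant is s^s e^(1-s), the maximum of (1 + u)^s e^(-u) over u > -1, taken at u = s
  - 1. It comes from ln v \<le> v - 1 at v = (1 + u) / s.\<close>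

lemma one_plus_powr_le_exp:
  fixes s u :: real
  assumes "0 < s" "0 \<le> u"
  shows "(1 + u) powr s \<le> exp (1 - s + s * ln s) * exp u"
proof -
  have "ln ((1 + u) / s) \<le> (1 + u) / s - 1"
    using assms by (intro ln_le_minus_one) auto
  then have "ln (1 + u) - ln s \<le> (1 + u) / s - 1" using assms by (simp add: ln_div)
  then have "s * (ln (1 + u) - ln s) \<le> s * ((1 + u) / s - 1)" using assms by (intro mult_left_mono) auto
  moreover have "s * ((1 + u) / s - 1) = 1 + u - s" using assms by (simp add: field_simps)
  ultimately have "s * ln (1 + u) \<le> 1 - s + s * ln s + u" by (simp add: right_diff_distrib)
  then show ?thesis using assms by (simp add: powr_def flip: exp_add)
qed

definition poly_weight :: "real \<Rightarrow> real \<Rightarrow> real" where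
  "poly_weight s x = (1 + \<bar>x\<bar>) powr s"

lemma submult_poly_weight:
  assumes "0 \<le> s"
  shows "submult_weight (poly_weight s)"
proof
  show "poly_weight s \<in> borel_measurable borel" unfolding poly_weight_def[abs_def] by measurable
  show "1 \<le> poly_weight s t" for t
    unfolding poly_weight_def using assms by (intro ge_one_powr_ge_zero) auto
  show "poly_weight s (t + u) \<le> poly_weight s t * poly_weight s u" for t u
  proof -
    have "0 \<le> \<bar>t\<bar> * \<bar>u\<bar>" by simp
    then have "1 + \<bar>t + u\<bar> \<le> (1 + \<bar>t\<bar>) * (1 + \<bar>u\<bar>)"
      using abs_triangle_ineq[of t u] unfolding distrib_left distrib_right mult_1 mult_1_right by linarith
    then have "(1 + \<bar>t + u\<bar>) powr s \<le> ((1 + \<bar>t\<bar>) * (1 + \<bar>u\<bar>)) powr s"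
      using assms by (intro powr_mono2) auto
    then show ?thesis by (simp add: poly_weight_def powr_mult)
  qed
qed

text \<open>An additive substitute for submultiplicativity: one of |t|, |u| is at least half of |t +
  u|. It serves the convolution of two tails, where each factor in turn carries the weight while the
  other is merely bounded.\<close>

lemma poly_weight_add_le:
  assumes "0 \<le> s"
  shows "poly_weight s (t + u) \<le> 2 powr s * (poly_weight s t + poly_weight s u)"
proof -
  have *: "(1 + \<bar>t + u\<bar>) powr s \<le> 2 powr s * (1 + \<bar>v\<bar>) powr s" if "\<bar>t + u\<bar> \<le> 2 * \<bar>v\<bar>" for v
  proof -
    have "(1 + \<bar>t + u\<bar>) powr s \<le> (2 * (1 + \<bar>v\<bar>)) powr s"
      using assms that by (intro powr_mono2) auto
    also have "\<dots> = 2 powr s * (1 + \<bar>v\<bar>) powr s" by (rule powr_mult)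
    finally show ?thesis .
  qed
  have "\<bar>t + u\<bar> \<le> 2 * \<bar>t\<bar> \<or> \<bar>t + u\<bar> \<le> 2 * \<bar>u\<bar>" by auto
  then show ?thesis
    unfolding poly_weight_def distrib_left
    using *[of t] *[of u] by (elim disjE) (auto intro: order_trans add_increasing add_increasing2)
qed

text \<open>If the modulus is 1 at t, a rotation u makes the mean of the nonnegative function 1 - Re
  (u exp (i t x)) vanish, so the law sits on the solutions of cos (\<alpha> + t x) = 1. They form a
  countable set, which a law with a density does not charge.\<close>

lemma char_abs_continuous_lt_1:
  fixes f :: "real \<Rightarrow> real"
  assumes [measurable]: "f \<in> borel_measurable borel" and f0: "\<And>x. 0 \<le> f x" and mass: "(\<integral>\<^sup>+x. ennreal (f x) \<partial>lborel) = 1" and t: "t \<noteq> 0"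
  shows "cmod (char (density lborel (\<lambda>x. ennreal (f x))) t) < 1"
proof (rule ccontr)
  let ?\<nu> = "density lborel (\<lambda>x. ennreal (f x))"
  have "prob_space ?\<nu>" by (rule prob_spaceI) (simp add: emeasure_density mass)
  then interpret real_distribution ?\<nu> by (intro real_distribution.intro real_distribution_axioms.intro) auto
  assume "\<not> ?thesis"
  then have one: "cmod (char ?\<nu> t) = 1" using cmod_char_le_1[of t] by simp
  define u where "u = cnj (char ?\<nu> t)"
  have u: "cmod u = 1" using one by (simp add: u_def)
  have i: "integrable ?\<nu> (\<lambda>x. u * iexp (t * x))"
    by (rule integrable_const_bound[where B = 1]) (auto simp: norm_mult u)
  have "expectation (\<lambda>x. Re (u * iexp (t * x))) = Re (u * char ?\<nu> t)"
    unfolding char_def by (simp only: integral_Re[OF i] integral_mult_right_zero)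
  also have "\<dots> = 1" using one by (simp add: u_def mult.commute complex_norm_square[symmetric])
  finally have e1: "expectation (\<lambda>x. Re (u * iexp (t * x))) = 1" .
  have "expectation (\<lambda>x. 1 - Re (u * iexp (t * x))) = expectation (\<lambda>x. 1) - expectation (\<lambda>x. Re (u * iexp (t * x)))"
    by (rule Bochner_Integration.integral_diff) (simp, rule integrable_Re[OF i])
  moreover have "expectation (\<lambda>x. 1 :: real) = 1" using prob_space by simp
  ultimately have e: "expectation (\<lambda>x. 1 - Re (u * iexp (t * x))) = 0" using e1 by (simp only:)
  have le: "Re (u * iexp (t * x)) \<le> 1" for x
    using complex_Re_le_cmod[of "u * iexp (t * x)"] by (simp add: norm_mult u)
  have "AE x in ?\<nu>. 1 - Re (u * iexp (t * x)) = 0"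
    using e le integrable_Re[OF i] by (subst integral_nonneg_eq_0_iff_AE[symmetric]) auto
  then have "AE x in lborel. 0 < f x \<longrightarrow> Re (u * iexp (t * x)) = 1"
    by (subst (asm) AE_density) (auto elim: eventually_mono)
  moreover have "AE x in lborel. Re (u * iexp (t * x)) \<noteq> 1"
  proof (rule AE_I')
    define \<alpha> where "\<alpha> = Arg u"
    have "u \<noteq> 0" using u by auto
    then have ua: "u = iexp \<alpha>" using Arg_eq[of u] u by (simp add: \<alpha>_def)
    have "{x. Re (u * iexp (t * x)) = 1} \<subseteq> range (\<lambda>k::int. (2 * pi * k - \<alpha>) / t)"
    proof
      fix x assume "x \<in> {x. Re (u * iexp (t * x)) = 1}"
      then have "cos (\<alpha> + t * x) = 1"
        unfolding ua exp_add[symmetric] distrib_left[symmetric] of_real_add[symmetric] by (simp add: Re_exp)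
      then obtain k :: int where "\<alpha> + t * x = k * 2 * pi" by (auto simp: cos_one_2pi_int)
      then show "x \<in> range (\<lambda>k::int. (2 * pi * k - \<alpha>) / t)"
        using t by (intro image_eqI[of _ _ k]) (auto simp: field_simps)
    qed
    then have "countable {x. Re (u * iexp (t * x)) = 1}" by (rule countable_subset) simp
    then show "{x. Re (u * iexp (t * x)) = 1} \<in> null_sets lborel" by (rule countable_imp_null_set_lborel)
  qed auto
  ultimately have "AE x in lborel. ennreal (f x) = 0"
    by eventually_elim (use f0 in \<open>auto simp: less_le\<close>)
  then have "(\<integral>\<^sup>+x. ennreal (f x) \<partial>lborel) = 0" by (subst nn_integral_0_iff_AE) auto
  then show False using mass by simp
qed

section \<open>Blocks of summands\<close>

lemma tendsto_integral_excess:
  fixes f :: "real \<Rightarrow> real"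
  assumes if': "integrable lborel f" and f0: "\<And>x. 0 \<le> f x"
  shows "((\<lambda>L. \<integral>y. max 0 (f y - L) \<partial>lborel) \<longlongrightarrow> 0) at_top"
proof -
  have [measurable]: "f \<in> borel_measurable borel" using if' by auto
  have "((\<lambda>L. \<integral>y. max 0 (f y - L) \<partial>lborel) \<longlongrightarrow> (\<integral>y. 0 \<partial>(lborel :: real measure))) at_top"
  proof (rule integral_dominated_convergence_at_top[where w = f])
    show "\<forall>\<^sub>F L in at_top. AE y in lborel. norm (max 0 (f y - L)) \<le> f y"
      by (rule eventually_mono[OF eventually_ge_at_top[of 0]]) (use f0 in \<open>auto simp: max_def\<close>)
    show "AE y in lborel. ((\<lambda>L. max 0 (f y - L)) \<longlongrightarrow> 0) at_top"
    proof (intro AE_I2 tendsto_eventually)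
      fix y show "\<forall>\<^sub>F L in at_top. max 0 (f y - L) = 0"
        by (rule eventually_mono[OF eventually_ge_at_top[of "f y"]]) auto
    qed
  qed (auto intro: if')
  then show ?thesis by simp
qed

lemma nn_integral_scale_density:
  fixes g :: "real \<Rightarrow> ennreal" and f :: "real \<Rightarrow> real"
  assumes [measurable]: "g \<in> borel_measurable borel" "f \<in> borel_measurable borel" and \<tau>: "0 < \<tau>"
  shows "(\<integral>\<^sup>+x. g (\<tau> * x) * ennreal (\<tau> * f (\<tau> * x)) \<partial>lborel) = (\<integral>\<^sup>+y. g y * ennreal (f y) \<partial>lborel)"
proof -
  have "(\<integral>\<^sup>+y. g y * ennreal (f y) \<partial>lborel) = ennreal \<tau> * (\<integral>\<^sup>+x. g (\<tau> * x) * ennreal (f (\<tau> * x)) \<partial>lborel)"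
    using \<tau> by (subst nn_integral_real_affine[where c = \<tau> and t = 0]) simp_all
  also have "\<dots> = (\<integral>\<^sup>+x. ennreal \<tau> * (g (\<tau> * x) * ennreal (f (\<tau> * x))) \<partial>lborel)"
    by (rule nn_integral_cmult[symmetric]) measurable
  also have "\<dots> = (\<integral>\<^sup>+x. g (\<tau> * x) * ennreal (\<tau> * f (\<tau> * x)) \<partial>lborel)"
    using \<tau> by (intro nn_integral_cong) (simp add: ennreal_mult' mult.left_commute)
  finally show ?thesis by simp
qed

text \<open>\<open>p l\<close> stands for the density of the sum of l summands without
  normalisation, hence mean 0 and variance l. For l < N it is an arbitrary nonnegative measurable
  function.\<close>

locale block_densities = standardized_distribution M m for M m +
  fixes s :: real and N :: nat and p :: "nat \<Rightarrow> real \<Rightarrow> real"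
  assumes s_bounds: "real m \<le> s" "s < real m + 1" and N_ge_1: "1 \<le> N"
    and p_measurable [measurable]: "\<And>l. p l \<in> borel_measurable borel"
    and p_nonneg: "\<And>l x. 0 \<le> p l x"
    and p_mass: "\<And>l. N \<le> l \<Longrightarrow> (\<integral>\<^sup>+x. ennreal (p l x) \<partial>lborel) = 1"
    and p_char: "\<And>l t. N \<le> l \<Longrightarrow> char (density lborel (\<lambda>x. ennreal (p l x))) t = char M t ^ l"
    and p_moment: "\<And>l. N \<le> l \<Longrightarrow> integrable (density lborel (\<lambda>x. ennreal (p l x))) (\<lambda>y. \<bar>y\<bar> powr s)"
    and p_mean: "\<And>l. N \<le> l \<Longrightarrow> (\<integral>y. y \<partial>density lborel (\<lambda>x. ennreal (p l x))) = 0"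
    and p_variance: "\<And>l. N \<le> l \<Longrightarrow> (\<integral>y. y\<^sup>2 \<partial>density lborel (\<lambda>x. ennreal (p l x))) = real l"
begin

abbreviation law :: "nat \<Rightarrow> real measure" where
  "law l \<equiv> density lborel (\<lambda>x. ennreal (p l x))"

abbreviation rate :: "nat \<Rightarrow> real" where
  "rate n \<equiv> real n powr (- (s - 2) / 2)"

lemma prob_space_law: "N \<le> l \<Longrightarrow> prob_space (law l)"
  by (rule prob_spaceI) (simp add: emeasure_density p_mass)

lemma s_ge_2: "2 \<le> s"
  using s_bounds m_ge_2 by linarith

sublocale weight: submult_weight "poly_weight s"
  using s_ge_2 by (intro submult_poly_weight) simp

definition blk :: "real \<Rightarrow> nat \<Rightarrow> adens" where
  "blk \<tau> l = of_dens (\<lambda>x. ennreal (\<tau> * p l (\<tau> * x)))"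

definition core :: "real \<Rightarrow> nat \<Rightarrow> adens" where
  "core \<tau> l = of_dens (\<lambda>x. indicator {-1..1} x * ennreal (\<tau> * p l (\<tau> * x)))"

definition tail :: "real \<Rightarrow> nat \<Rightarrow> adens" where
  "tail \<tau> l = of_dens (\<lambda>x. indicator (- {-1..1}) x * ennreal (\<tau> * p l (\<tau> * x)))"

text \<open>Only blocks of length N are capped; the last block, whose length varies with n, occurs
  once and keeps its density. The cap applies before scaling, so the mass of the excess has a bound
  independent of \<tau>.\<close>

definition capped :: "real \<Rightarrow> real \<Rightarrow> adens" where
  "capped L \<tau> = of_dens (\<lambda>x. indicator {-1..1} x * ennreal (\<tau> * min (p N (\<tau> * x)) L))"

definition excess :: "real \<Rightarrow> real \<Rightarrow> adens" where
  "excess L \<tau> = of_dens (\<lambda>x. indicator {-1..1} x * ennreal (\<tau> * max 0 (p N (\<tau> * x) - L)))"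

lemma atom_pieces [simp]: "atom (blk \<tau> l) = 0" "atom (core \<tau> l) = 0" "atom (tail \<tau> l) = 0"
  "atom (capped L \<tau>) = 0" "atom (excess L \<tau>) = 0"
  by (simp_all add: blk_def core_def tail_def capped_def excess_def)

lemma dens_pieces:
  "dens (blk \<tau> l) = (\<lambda>x. ennreal (\<tau> * p l (\<tau> * x)))"
  "dens (core \<tau> l) = (\<lambda>x. indicator {-1..1} x * ennreal (\<tau> * p l (\<tau> * x)))"
  "dens (tail \<tau> l) = (\<lambda>x. indicator (- {-1..1}) x * ennreal (\<tau> * p l (\<tau> * x)))"
  "dens (capped L \<tau>) = (\<lambda>x. indicator {-1..1} x * ennreal (\<tau> * min (p N (\<tau> * x)) L))"
  "dens (excess L \<tau>) = (\<lambda>x. indicator {-1..1} x * ennreal (\<tau> * max 0 (p N (\<tau> * x) - L)))"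
  unfolding blk_def core_def tail_def capped_def excess_def by (rule dens_of_dens; measurable)+

lemma blk_eq: "blk \<tau> l = core \<tau> l + tail \<tau> l"
  by (rule adens_eqI) (auto simp: dens_simps dens_pieces indicator_def)

lemma core_eq: "0 \<le> \<tau> \<Longrightarrow> 0 \<le> L \<Longrightarrow> core \<tau> N = capped L \<tau> + excess L \<tau>"
proof (rule adens_eqI)
  fix x assume "0 \<le> \<tau>" "0 \<le> L"
  moreover have "\<tau> * p N (\<tau> * x) = \<tau> * min (p N (\<tau> * x)) L + \<tau> * max 0 (p N (\<tau> * x) - L)"
    by (simp add: min_def max_def algebra_simps)
  ultimately have "ennreal (\<tau> * p N (\<tau> * x)) = ennreal (\<tau> * min (p N (\<tau> * x)) L) + ennreal (\<tau> * max 0 (p N (\<tau> * x) - L))"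
    using p_nonneg[of N "\<tau> * x"] by (metis ennreal_plus max.cobounded1 min_def mult_nonneg_nonneg)
  then show "dens (core \<tau> N) x = dens (capped L \<tau> + excess L \<tau>) x"
    by (simp add: dens_simps dens_pieces distrib_left)
qed simp

lemma mass_blk: "0 < \<tau> \<Longrightarrow> N \<le> l \<Longrightarrow> mass (blk \<tau> l) = 1"
  using nn_integral_scale_density[of "\<lambda>_. 1" "p l" \<tau>] by (simp add: mass_def dens_pieces p_mass)

lemma mass_core_le: "0 < \<tau> \<Longrightarrow> N \<le> l \<Longrightarrow> mass (core \<tau> l) \<le> 1"
  using mass_blk[of \<tau> l] by (simp add: blk_eq mass_add) (metis le_iff_add)

lemma mass_tail_le: "0 < \<tau> \<Longrightarrow> N \<le> l \<Longrightarrow> mass (tail \<tau> l) \<le> 1"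
  using mass_blk[of \<tau> l] by (simp add: blk_eq mass_add) (metis add.commute le_iff_add)

lemma mass_capped_le: "0 < \<tau> \<Longrightarrow> 0 \<le> L \<Longrightarrow> mass (capped L \<tau>) \<le> 1"
  using mass_core_le[of \<tau> N] by (simp add: core_eq[of \<tau> L] mass_add) (metis le_iff_add order_trans)

lemma nn_integral_weight_le:
  assumes [measurable]: "g \<in> borel_measurable borel" and dens: "\<And>x. x \<notin> {-1..1} \<Longrightarrow> dens z x = 0"
    and g: "\<And>x. x \<in> {-1..1} \<Longrightarrow> g x \<le> C" and "atom z = 0"
  shows "(\<integral>\<^sup>+x. ennreal (g x) * dens z x \<partial>lborel) \<le> ennreal C * mass z"
proof -
  have "(\<integral>\<^sup>+x. ennreal (g x) * dens z x \<partial>lborel) \<le> (\<integral>\<^sup>+x. ennreal C * dens z x \<partial>lborel)"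
  proof (rule nn_integral_mono)
    fix x
    show "ennreal (g x) * dens z x \<le> ennreal C * dens z x"
      using dens[of x] g[of x] by (cases "x \<in> {-1..1}") (auto intro!: mult_right_mono ennreal_leI)
  qed
  then show ?thesis using assms by (simp add: nn_integral_cmult mass_def)
qed

lemma mass_tilt_le:
  assumes "\<And>x. x \<notin> {-1..1} \<Longrightarrow> dens z x = 0" and "atom z = 0" and \<sigma>: "\<bar>\<sigma>\<bar> = 1"
  shows "mass (tilt \<sigma> z) \<le> ennreal (exp 1) * mass z"
proof -
  have "(\<integral>\<^sup>+x. ennreal (exp (\<sigma> * x)) * dens z x \<partial>lborel) \<le> ennreal (exp 1) * mass z"
  proof (rule nn_integral_weight_le[OF _ assms(1) _ assms(2)])
    fix x :: real assume "x \<in> {-1..1}"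
    then have "\<sigma> * x \<le> 1" using \<sigma> by (auto simp: abs_if split: if_splits)
    then show "exp (\<sigma> * x) \<le> exp 1" by simp
  qed auto
  then show ?thesis by (simp add: mass_def dens_tilt assms)
qed

lemma wmass_supported_le:
  assumes "\<And>x. x \<notin> {-1..1} \<Longrightarrow> dens z x = 0" and "atom z = 0"
  shows "wmass (poly_weight s) z \<le> ennreal (2 powr s) * mass z"
proof -
  have "(\<integral>\<^sup>+x. ennreal (poly_weight s x) * dens z x \<partial>lborel) \<le> ennreal (2 powr s) * mass z"
  proof (rule nn_integral_weight_le[OF _ assms(1) _ assms(2)])
    fix x :: real assume "x \<in> {-1..1}"
    then show "poly_weight s x \<le> 2 powr s"
      unfolding poly_weight_def using s_ge_2 by (intro powr_mono2) auto
  qed auto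
  then show ?thesis by (simp add: wmass_def assms)
qed

lemma support_pieces:
  "x \<notin> {-1..1} \<Longrightarrow> dens (core \<tau> l) x = 0" "x \<notin> {-1..1} \<Longrightarrow> dens (capped L \<tau>) x = 0" "x \<notin> {-1..1} \<Longrightarrow> dens (excess L \<tau>) x = 0"
  by (auto simp: dens_pieces)

definition \<eta> :: "nat \<Rightarrow> real \<Rightarrow> real" where
  "\<eta> l \<tau> = tail_moment (law l) s (real m + 1 - s) \<tau>"

lemma tendsto_\<eta>: "N \<le> l \<Longrightarrow> (\<eta> l \<longlongrightarrow> 0) at_top"
  unfolding \<eta>_def[abs_def] by (rule tendsto_tail_moment) (use s_bounds in \<open>auto intro: p_moment\<close>)

lemma \<eta>_nonneg: "0 \<le> \<eta> l \<tau>"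
  unfolding \<eta>_def by (rule tail_moment_nonneg)

text \<open>For |x| > 1 the weight is at most (2 |x|)^s, and with y = \<tau> x the factor min 1 (|y|
  / \<tau>) equals 1 there, so the tail moment dominates.\<close>

lemma wmass_tail_le:
  assumes \<tau>: "0 < \<tau>" and l: "N \<le> l"
  shows "wmass (poly_weight s) (tail \<tau> l) \<le> ennreal (2 powr s * \<tau> powr (- s) * \<eta> l \<tau>)"
proof -
  let ?e = "real m + 1 - s"
  let ?g = "\<lambda>y. \<bar>y\<bar> powr s * min 1 (\<bar>y\<bar> / \<tau>) powr ?e"
  have i: "integrable (law l) ?g"
    using s_bounds \<tau> by (intro integrable_tail_moment p_moment l) auto
  have "wmass (poly_weight s) (tail \<tau> l) = (\<integral>\<^sup>+x. ennreal (poly_weight s x) * (indicator (- {-1..1}) x * ennreal (\<tau> * p l (\<tau> * x))) \<partial>lborel)"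
    by (simp add: wmass_def dens_pieces)
  also have "\<dots> \<le> (\<integral>\<^sup>+x. ennreal (2 powr s * \<tau> powr (- s)) * (ennreal (?g (\<tau> * x)) * ennreal (\<tau> * p l (\<tau> * x))) \<partial>lborel)"
  proof (rule nn_integral_mono)
    fix x :: real
    show "ennreal (poly_weight s x) * (indicator (- {-1..1}) x * ennreal (\<tau> * p l (\<tau> * x)))
        \<le> ennreal (2 powr s * \<tau> powr (- s)) * (ennreal (?g (\<tau> * x)) * ennreal (\<tau> * p l (\<tau> * x)))"
    proof (cases "x \<in> {-1..1}")
      case False
      then have x: "1 < \<bar>x\<bar>" by auto
      have "poly_weight s x \<le> (2 * \<bar>x\<bar>) powr s"
        unfolding poly_weight_def using s_ge_2 x by (intro powr_mono2) auto
      also have "\<dots> = 2 powr s * \<tau> powr (- s) * ?g (\<tau> * x)"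
        using \<tau> x by (simp add: powr_mult abs_mult powr_minus field_simps)
      finally have "ennreal (poly_weight s x) \<le> ennreal (2 powr s * \<tau> powr (- s)) * ennreal (?g (\<tau> * x))"
        by (simp add: ennreal_mult'[symmetric] ennreal_leI del: times_divide_eq_right)
      then show ?thesis using False by (simp add: mult.assoc[symmetric] mult_right_mono)
    qed simp
  qed
  also have "\<dots> = ennreal (2 powr s * \<tau> powr (- s)) * (\<integral>\<^sup>+x. ennreal (?g (\<tau> * x)) * ennreal (\<tau> * p l (\<tau> * x)) \<partial>lborel)"
    by (rule nn_integral_cmult) measurable
  also have "(\<integral>\<^sup>+x. ennreal (?g (\<tau> * x)) * ennreal (\<tau> * p l (\<tau> * x)) \<partial>lborel) = (\<integral>\<^sup>+y. ennreal (?g y) * ennreal (p l y) \<partial>lborel)"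
    by (rule nn_integral_scale_density[OF _ _ \<tau>]) measurable
  also have "\<dots> = (\<integral>\<^sup>+y. ennreal (?g y) \<partial>law l)"
    by (simp add: nn_integral_density mult.commute)
  also have "\<dots> = ennreal (\<eta> l \<tau>)"
    unfolding \<eta>_def tail_moment_def by (rule nn_integral_eq_integral[OF i]) simp
  finally show ?thesis by (simp add: ennreal_mult' \<eta>_nonneg)
qed

lemma mass_core_finite: "0 < \<tau> \<Longrightarrow> N \<le> l \<Longrightarrow> mass (core \<tau> l) < \<infinity>"
  using mass_core_le[of \<tau> l] by (auto intro: le_less_trans)

lemma mass_tilt_core_finite: "0 < \<tau> \<Longrightarrow> N \<le> l \<Longrightarrow> \<bar>\<sigma>\<bar> = 1 \<Longrightarrow> mass (tilt \<sigma> (core \<tau> l)) < \<infinity>"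
  using mass_tilt_le[of "core \<tau> l" \<sigma>] mass_core_finite[of \<tau> l]
  by (auto simp: support_pieces ennreal_mult_less_top intro: le_less_trans)

text \<open>Tilting by \<sigma> and transforming at t combine to exp ((\<sigma> + i t) x); the
  substitution y = \<tau> x returns to the unscaled law.\<close>

lemma ch_tilt_core:
  assumes \<tau>: "0 < \<tau>" and l: "N \<le> l" and \<sigma>: "\<bar>\<sigma>\<bar> = 1"
  shows "ch (tilt \<sigma> (core \<tau> l)) t = trunc_laplace (law l) \<tau> (Complex \<sigma> t)"
proof -
  let ?w = "Complex \<sigma> t"
  have fin: "(\<integral>\<^sup>+x. dens (tilt \<sigma> (core \<tau> l)) x \<partial>lborel) < \<infinity>"
    by (rule mass_finiteD(2)[OF mass_tilt_core_finite[OF assms]])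
  have e: "(exp (\<sigma> * x)) *\<^sub>R iexp (t * x) = exp (?w * of_real x)" for x
    by (simp add: Complex_eq scaleR_conv_of_real exp_of_real[symmetric] exp_add[symmetric] algebra_simps)
  have "ch (tilt \<sigma> (core \<tau> l)) t = (\<integral>x. enn2real (dens (tilt \<sigma> (core \<tau> l)) x) *\<^sub>R iexp (t * x) \<partial>lborel)"
    unfolding ch_def by (subst char_density[OF _ fin]) simp_all
  also have "\<dots> = (\<integral>x. (\<tau> * p l (\<tau> * x)) *\<^sub>R (indicator {-1..1} x *\<^sub>R exp (?w * of_real x)) \<partial>lborel)"
  proof (rule Bochner_Integration.integral_cong[OF refl])
    fix x
    have "enn2real (dens (tilt \<sigma> (core \<tau> l)) x) = (\<tau> * p l (\<tau> * x)) * indicator {-1..1} x * exp (\<sigma> * x)"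
      using \<tau> p_nonneg[of l "\<tau> * x"] by (simp add: dens_tilt dens_pieces enn2real_mult indicator_def)
    then show "enn2real (dens (tilt \<sigma> (core \<tau> l)) x) *\<^sub>R iexp (t * x) = (\<tau> * p l (\<tau> * x)) *\<^sub>R (indicator {-1..1} x *\<^sub>R exp (?w * of_real x))"
      unfolding e[symmetric] by (simp only: scaleR_scaleR mult.assoc)
  qed
  also have "\<dots> = (\<integral>y. p l y *\<^sub>R (indicator {-\<tau>..\<tau>} y *\<^sub>R exp (?w * of_real (y / \<tau>))) \<partial>lborel)"
  proof -
    have "(\<integral>y. p l y *\<^sub>R (indicator {-\<tau>..\<tau>} y *\<^sub>R exp (?w * of_real (y / \<tau>))) \<partial>lborel)
        = \<tau> *\<^sub>R (\<integral>x. p l (\<tau> * x) *\<^sub>R (indicator {-\<tau>..\<tau>} (\<tau> * x) *\<^sub>R exp (?w * of_real (\<tau> * x / \<tau>))) \<partial>lborel)"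
      by (subst lborel_integral_real_affine[where c = \<tau> and t = 0])
         (use \<tau> in simp, use \<tau> in \<open>simp only: abs_of_pos add_0\<close>)
    also have "\<dots> = (\<integral>x. \<tau> *\<^sub>R (p l (\<tau> * x) *\<^sub>R (indicator {-\<tau>..\<tau>} (\<tau> * x) *\<^sub>R exp (?w * of_real (\<tau> * x / \<tau>)))) \<partial>lborel)"
      by (rule integral_scaleR_right[symmetric])
    also have "\<dots> = (\<integral>x. (\<tau> * p l (\<tau> * x)) *\<^sub>R (indicator {-1..1} x *\<^sub>R exp (?w * of_real x)) \<partial>lborel)"
    proof (rule Bochner_Integration.integral_cong[OF refl])
      fix x
      have "indicator {-\<tau>..\<tau>} (\<tau> * x) = (indicator {-1..1} x :: real)" "\<tau> * x / \<tau> = x"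
        using \<tau> mult_le_cancel_left_pos[OF \<tau>, of "-1" x] mult_le_cancel_left_pos[OF \<tau>, of x 1] by (auto simp: indicator_def)
      then show "\<tau> *\<^sub>R (p l (\<tau> * x) *\<^sub>R (indicator {-\<tau>..\<tau>} (\<tau> * x) *\<^sub>R exp (?w * of_real (\<tau> * x / \<tau>))))
          = (\<tau> * p l (\<tau> * x)) *\<^sub>R (indicator {-1..1} x *\<^sub>R exp (?w * of_real x))"
        by (simp only: scaleR_scaleR mult.assoc)
    qed
    finally show ?thesis by (rule sym)
  qed
  also have "\<dots> = trunc_laplace (law l) \<tau> ?w"
    unfolding trunc_laplace_def by (rule integral_density[symmetric]) (auto simp: p_nonneg)
  finally show ?thesis .
qed

text \<open>The scaled capped density is at most \<tau> L and has mass at most 1; tilting on [-1, 1]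
  costs a factor e in both.\<close>

lemma capped_Plancherel:
  assumes \<tau>: "0 < \<tau>" and L: "0 \<le> L" and \<sigma>: "\<bar>\<sigma>\<bar> = 1"
  shows "(\<integral>\<^sup>+t. ennreal ((cmod (ch (tilt \<sigma> (capped L \<tau>)) t))\<^sup>2) \<partial>lborel) \<le> ennreal (2 * pi * (exp 1 * (\<tau> * L)) * exp 1)"
proof -
  have m: "mass (tilt \<sigma> (capped L \<tau>)) \<le> ennreal (exp 1)"
  proof -
    have "mass (tilt \<sigma> (capped L \<tau>)) \<le> ennreal (exp 1) * mass (capped L \<tau>)"
      by (rule mass_tilt_le) (use support_pieces \<sigma> in auto)
    also have "\<dots> \<le> ennreal (exp 1) * 1" by (intro mult_left_mono mass_capped_le \<tau> L) simp
    finally show ?thesis by simp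
  qed
  have md: "(\<integral>\<^sup>+x. dens (tilt \<sigma> (capped L \<tau>)) x \<partial>lborel) \<le> ennreal (exp 1)"
    using m by (simp add: mass_def)
  have bd: "dens (tilt \<sigma> (capped L \<tau>)) x \<le> ennreal (exp 1 * (\<tau> * L))" for x
  proof (cases "x \<in> {-1..1}")
    case True
    then have "\<sigma> * x \<le> 1" using \<sigma> by (auto simp: abs_if split: if_splits)
    then have "exp (\<sigma> * x) * (\<tau> * min (p N (\<tau> * x)) L) \<le> exp 1 * (\<tau> * L)"
      using \<tau> L p_nonneg[of N "\<tau> * x"] by (intro mult_mono) auto
    then show ?thesis
      using True by (simp add: dens_tilt dens_pieces ennreal_mult'[symmetric] ennreal_leI)
  qed (simp add: dens_tilt dens_pieces)
  have "(\<integral>\<^sup>+t. ennreal ((cmod (char (density lborel (dens (tilt \<sigma> (capped L \<tau>)))) t))\<^sup>2) \<partial>lborel)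
      \<le> ennreal (2 * pi * (exp 1 * (\<tau> * L))) * (\<integral>\<^sup>+x. dens (tilt \<sigma> (capped L \<tau>)) x \<partial>lborel)"
    by (rule Plancherel_le[OF _ _ bd]) (use md \<tau> L in \<open>auto intro: le_less_trans\<close>)
  also have "\<dots> \<le> ennreal (2 * pi * (exp 1 * (\<tau> * L))) * ennreal (exp 1)"
    by (intro mult_left_mono md) simp
  also have "\<dots> = ennreal (2 * pi * (exp 1 * (\<tau> * L)) * exp 1)"
    by (rule ennreal_mult''[symmetric]) simp
  finally show ?thesis by (simp add: ch_def)
qed

definition excess_mass :: "real \<Rightarrow> real" where
  "excess_mass L = (\<integral>y. max 0 (p N y - L) \<partial>lborel)"

lemma integrable_p: "N \<le> l \<Longrightarrow> integrable lborel (p l)"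
  by (rule integrableI_nonneg) (auto simp: p_mass p_nonneg)

lemma integrable_excess: "0 \<le> L \<Longrightarrow> integrable lborel (\<lambda>y. max 0 (p N y - L))"
  by (rule Bochner_Integration.integrable_bound[OF integrable_p[of N]]) (use p_nonneg in \<open>auto simp: max_def\<close>)

lemma tendsto_excess_mass: "(excess_mass \<longlongrightarrow> 0) at_top"
  unfolding excess_mass_def[abs_def] by (rule tendsto_integral_excess[OF integrable_p]) (auto simp: p_nonneg)

lemma excess_mass_nonneg: "0 \<le> excess_mass L"
  unfolding excess_mass_def by (intro integral_nonneg_AE) auto

lemma mass_excess_le:
  assumes "0 < \<tau>" "0 \<le> L"
  shows "mass (excess L \<tau>) \<le> ennreal (excess_mass L)"
proof -
  have "mass (excess L \<tau>) \<le> (\<integral>\<^sup>+x. 1 * ennreal (\<tau> * max 0 (p N (\<tau> * x) - L)) \<partial>lborel)"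
    unfolding mass_def dens_pieces atom_pieces add_0 by (intro nn_integral_mono mult_right_mono) (auto simp: indicator_def)
  also have "\<dots> = (\<integral>\<^sup>+x. 1 * ennreal (max 0 (p N x - L)) \<partial>lborel)"
    by (rule nn_integral_scale_density[of "\<lambda>_. 1" "\<lambda>y. max 0 (p N y - L)"]) (use assms in auto)
  also have "\<dots> = ennreal (excess_mass L)"
    unfolding excess_mass_def mult_1 by (rule nn_integral_eq_integral[OF integrable_excess[OF assms(2)]]) simp
  finally show ?thesis .
qed

end

text \<open>A substitute for the Riemann-Lebesgue lemma. Capping splits the transform into a part of
  modulus at most 1 / 4 and a square integrable one. By uniform continuity a value above 3 / 4 would
  leave at least 1 / 4 to the second part on an interval of length h, contributing h / 16 to an
  integral whose tail is smaller than that.\<close>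

lemma char_density_bounded_away_far:
  fixes f :: "real \<Rightarrow> real"
  assumes [measurable]: "f \<in> borel_measurable borel" and f0: "\<And>x. 0 \<le> f x" and mass: "(\<integral>\<^sup>+x. ennreal (f x) \<partial>lborel) = 1"
  shows "\<exists>T. \<forall>t. T \<le> \<bar>t\<bar> \<longrightarrow> cmod (char (density lborel (\<lambda>x. ennreal (f x))) t) \<le> 3 / 4"
proof -
  let ?\<nu> = "density lborel (\<lambda>x. ennreal (f x))"
  have "prob_space ?\<nu>" by (rule prob_spaceI) (simp add: emeasure_density mass)
  then interpret real_distribution ?\<nu> by (intro real_distribution.intro real_distribution_axioms.intro) auto
  have if': "integrable lborel f" by (rule integrableI_nonneg) (use f0 mass in auto)
  from tendsto_integral_excess[OF if' f0] have "\<forall>\<^sub>F L in at_top. (\<integral>y. max 0 (f y - L) \<partial>lborel) < 1 / 4"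
    by (intro order_tendstoD(2)) auto
  then have "\<forall>\<^sub>F L in at_top. 0 \<le> L \<and> (\<integral>y. max 0 (f y - L) \<partial>lborel) < 1 / 4"
    using eventually_ge_at_top[of 0] by eventually_elim simp
  then obtain L where L: "0 \<le> L" "(\<integral>y. max 0 (f y - L) \<partial>lborel) < 1 / 4"
    by (auto simp: eventually_at_top_linorder)
  define f1 where "f1 y = min (f y) L" for y
  define f2 where "f2 y = max 0 (f y - L)" for y
  have [measurable]: "f1 \<in> borel_measurable borel" "f2 \<in> borel_measurable borel"
    unfolding f1_def[abs_def] f2_def[abs_def] by measurable
  have f12: "0 \<le> f1 y" "0 \<le> f2 y" "f y = f1 y + f2 y" "f1 y \<le> f y" "f2 y \<le> f y" for y
    using f0[of y] L by (auto simp: f1_def f2_def)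
  have fin1: "(\<integral>\<^sup>+y. ennreal (f1 y) \<partial>lborel) \<le> 1" and fin2: "(\<integral>\<^sup>+y. ennreal (f2 y) \<partial>lborel) \<le> 1"
    unfolding mass[symmetric] using f12 by (auto intro!: nn_integral_mono ennreal_leI)
  let ?c1 = "char (density lborel (\<lambda>y. ennreal (f1 y)))" and ?c2 = "char (density lborel (\<lambda>y. ennreal (f2 y)))"
  have lt: "(\<integral>\<^sup>+y. ennreal (f1 y) \<partial>lborel) < \<infinity>" "(\<integral>\<^sup>+y. ennreal (f2 y) \<partial>lborel) < \<infinity>"
    using le_less_trans[OF fin1] le_less_trans[OF fin2] by auto
  have feq: "(\<lambda>x. ennreal (f x)) = (\<lambda>y. ennreal (f1 y) + ennreal (f2 y))"
    using f12 by (auto simp: ennreal_plus)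
  have c12: "char ?\<nu> t = ?c1 t + ?c2 t" for t
    unfolding feq by (rule char_density_add) (use lt in auto)
  have c2: "cmod (?c2 t) \<le> 1 / 4" for t
  proof -
    have "cmod (?c2 t) \<le> (\<integral>y. f2 y \<partial>lborel)"
      using fin2 f12 by (subst char_density) (auto intro: le_less_trans order_trans[OF integral_norm_bound])
    then show ?thesis using L(2) by (simp add: f2_def)
  qed
  interpret M1: finite_measure "density lborel (\<lambda>y. ennreal (f1 y))"
    by (rule finite_measure_density_lborel) (use fin1 in \<open>auto intro: le_less_trans\<close>)
  have [measurable]: "?c1 \<in> borel_measurable borel"
    unfolding char_def[abs_def] by measurable
  have "(\<integral>\<^sup>+t. ennreal ((cmod (?c1 t))\<^sup>2) \<partial>lborel) \<le> ennreal (2 * pi * L) * (\<integral>\<^sup>+y. ennreal (f1 y) \<partial>lborel)"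
    by (rule Plancherel_le) (use fin1 L in \<open>auto simp: f1_def intro: le_less_trans ennreal_leI\<close>)
  also have "\<dots> < \<infinity>" using fin1 by (auto simp: ennreal_mult_less_top intro: le_less_trans)
  finally have i1: "integrable lborel (\<lambda>t. (cmod (?c1 t))\<^sup>2)"
    by (intro integrableI_nonneg) auto
  have "((\<lambda>v. \<integral>x. cmod (iexp (v * x) - 1) \<partial>?\<nu>) \<longlongrightarrow> 0) (at 0)"
  proof (subst tendsto_at_iff_sequentially, intro allI impI)
    fix X :: "nat \<Rightarrow> real" assume X: "\<forall>i. X i \<in> UNIV - {0}" "X \<longlonglongrightarrow> 0"
    have "(\<lambda>i. \<integral>x. cmod (iexp (X i * x) - 1) \<partial>?\<nu>) \<longlonglongrightarrow> (\<integral>x. cmod (iexp (0 * x) - 1) \<partial>?\<nu>)"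
    proof (rule integral_dominated_convergence[where w = "\<lambda>_. 2"])
      show "AE x in ?\<nu>. (\<lambda>i. cmod (iexp (X i * x) - 1)) \<longlonglongrightarrow> cmod (iexp (0 * x) - 1)"
        by (intro AE_I2 tendsto_intros X)
      show "AE x in ?\<nu>. norm (cmod (iexp (X i * x) - 1)) \<le> 2" for i
        by (intro AE_I2) (auto intro!: order_trans[OF norm_triangle_ineq4])
    qed auto
    then show "((\<lambda>v. \<integral>x. cmod (iexp (v * x) - 1) \<partial>?\<nu>) \<circ> X) \<longlonglongrightarrow> 0" by (simp add: comp_def)
  qed
  then have "\<forall>\<^sub>F v in at 0. (\<integral>x. cmod (iexp (v * x) - 1) \<partial>?\<nu>) < 1 / 4"
    by (rule order_tendstoD) simp
  then obtain h where h: "h > 0" "\<And>v. v \<noteq> 0 \<Longrightarrow> \<bar>v\<bar> < h \<Longrightarrow> (\<integral>x. cmod (iexp (v * x) - 1) \<partial>?\<nu>) < 1 / 4"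
    by (auto simp: eventually_at dist_norm)
  have near: "cmod (char ?\<nu> (t + v) - char ?\<nu> t) \<le> 1 / 4" if "\<bar>v\<bar> < h" for t v
  proof (cases "v = 0")
    case False
    have i: "integrable ?\<nu> (\<lambda>x. iexp (u * x))" for u by (rule integrable_const_bound[where B = 1]) auto
    have "char ?\<nu> (t + v) - char ?\<nu> t = (\<integral>x. iexp ((t + v) * x) - iexp (t * x) \<partial>?\<nu>)"
      unfolding char_def by (rule Bochner_Integration.integral_diff[symmetric, OF i i])
    then have "cmod (char ?\<nu> (t + v) - char ?\<nu> t) \<le> (\<integral>x. cmod (iexp ((t + v) * x) - iexp (t * x)) \<partial>?\<nu>)"
      by (simp only: integral_norm_bound)
    also have "(\<lambda>x. cmod (iexp ((t + v) * x) - iexp (t * x))) = (\<lambda>x. cmod (iexp (v * x) - 1))"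
    proof
      fix x
      have "iexp ((t + v) * x) - iexp (t * x) = iexp (t * x) * (iexp (v * x) - 1)"
        by (simp add: right_diff_distrib exp_add[symmetric] algebra_simps)
      then show "cmod (iexp ((t + v) * x) - iexp (t * x)) = cmod (iexp (v * x) - 1)"
        by (simp only: norm_mult norm_exp_i_times mult_1)
    qed
    finally show ?thesis using h(2)[OF False that] by simp
  qed simp
  have "(\<lambda>n::nat. \<integral>t. indicator {t. real n < \<bar>t\<bar>} t *\<^sub>R (cmod (?c1 t))\<^sup>2 \<partial>lborel) \<longlonglongrightarrow> (\<integral>t. 0 \<partial>(lborel :: real measure))"
  proof (rule integral_dominated_convergence[OF _ _ i1])
    show "AE t in lborel. (\<lambda>n::nat. indicator {t. real n < \<bar>t\<bar>} t *\<^sub>R (cmod (?c1 t))\<^sup>2) \<longlonglongrightarrow> 0"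
    proof (intro AE_I2 tendsto_eventually)
      fix t :: real
      obtain k :: nat where "\<bar>t\<bar> < real k" using reals_Archimedean2 by blast
      then show "\<forall>\<^sub>F n in sequentially. indicator {t. real n < \<bar>t\<bar>} t *\<^sub>R (cmod (?c1 t))\<^sup>2 = 0"
        by (intro eventually_sequentiallyI[of k]) (auto simp: indicator_def)
    qed
  qed (auto simp: indicator_def)
  then have "\<forall>\<^sub>F n::nat in sequentially. (\<integral>t. indicator {t. real n < \<bar>t\<bar>} t *\<^sub>R (cmod (?c1 t))\<^sup>2 \<partial>lborel) < h / 16"
    using h(1) by (intro order_tendstoD(2)) auto
  then obtain n :: nat where n: "(\<integral>t. indicator {t. real n < \<bar>t\<bar>} t *\<^sub>R (cmod (?c1 t))\<^sup>2 \<partial>lborel) < h / 16"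
    by (auto simp: eventually_sequentially)
  have "cmod (char ?\<nu> t) \<le> 3 / 4" if t: "real n + h \<le> \<bar>t\<bar>" for t
  proof (rule ccontr)
    assume not: "\<not> ?thesis"
    have ge: "1 / 16 \<le> (cmod (?c1 u))\<^sup>2" if "u \<in> {t<..<t + h}" for u
    proof -
      have "cmod (char ?\<nu> t) \<le> cmod (char ?\<nu> u) + cmod (char ?\<nu> u - char ?\<nu> t)"
        by (metis norm_triangle_sub norm_minus_commute add.commute)
      moreover have "cmod (char ?\<nu> u - char ?\<nu> t) \<le> 1 / 4" using near[of "u - t" t] that by simp
      moreover have "cmod (char ?\<nu> u) \<le> cmod (?c1 u) + cmod (?c2 u)" unfolding c12 by (rule norm_triangle_ineq)
      ultimately have "1 / 4 \<le> cmod (?c1 u)" using not c2[of u] by linarith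
      then have "(1 / 4)\<^sup>2 \<le> (cmod (?c1 u))\<^sup>2" by (rule power_mono) simp
      then show ?thesis by (simp add: power2_eq_square)
    qed
    have "h / 16 = (\<integral>u. indicator {t<..<t + h} u * (1 / 16) \<partial>lborel)"
      using h(1) by simp
    also have "\<dots> \<le> (\<integral>u. indicator {t. real n < \<bar>t\<bar>} u *\<^sub>R (cmod (?c1 u))\<^sup>2 \<partial>lborel)"
    proof (rule integral_mono)
      show "integrable lborel (\<lambda>u. indicator {t<..<t + h} u * (1 / 16) :: real)"
        using h(1) by (auto intro!: integrable_mult_left integrable_real_indicator)
      show "integrable lborel (\<lambda>u. indicator {t. real n < \<bar>t\<bar>} u *\<^sub>R (cmod (?c1 u))\<^sup>2)"
        by (rule integrable_mult_indicator[OF _ i1]) auto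
      fix u
      show "indicator {t<..<t + h} u * (1 / 16) \<le> indicator {t. real n < \<bar>t\<bar>} u *\<^sub>R (cmod (?c1 u))\<^sup>2"
        using ge[of u] t h(1) by (auto simp: indicator_def)
    qed
    finally show False using n by simp
  qed
  then show ?thesis by blast
qed

text \<open>Far out the bound 3 / 4 applies; on the compact rest the continuous modulus attains its
  maximum, at a nonzero point and hence below 1.\<close>

lemma char_density_bounded_away:
  fixes f :: "real \<Rightarrow> real"
  assumes [measurable]: "f \<in> borel_measurable borel" and f0: "\<And>x. 0 \<le> f x" and mass: "(\<integral>\<^sup>+x. ennreal (f x) \<partial>lborel) = 1" and \<delta>: "0 < \<delta>"
  shows "\<exists>\<theta><1. \<forall>t. \<delta> \<le> \<bar>t\<bar> \<longrightarrow> cmod (char (density lborel (\<lambda>x. ennreal (f x))) t) \<le> \<theta>"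
proof -
  let ?\<nu> = "density lborel (\<lambda>x. ennreal (f x))"
  have "prob_space ?\<nu>" by (rule prob_spaceI) (simp add: emeasure_density mass)
  then interpret real_distribution ?\<nu> by (intro real_distribution.intro real_distribution_axioms.intro) auto
  obtain T where T: "\<And>t. T \<le> \<bar>t\<bar> \<Longrightarrow> cmod (char ?\<nu> t) \<le> 3 / 4"
    using char_density_bounded_away_far[OF assms(1) f0 mass] by blast
  define S where "S = {-max T \<delta>..-\<delta>} \<union> {\<delta>..max T \<delta>}"
  have "\<delta> \<in> S" by (auto simp: S_def)
  then have "\<exists>x\<in>S. \<forall>y\<in>S. cmod (char ?\<nu> y) \<le> cmod (char ?\<nu> x)"
    by (intro continuous_attains_sup continuous_intros continuous_at_imp_continuous_on)
       (auto simp: S_def intro: compact_Un isCont_char)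
  then obtain x where x: "x \<in> S" "\<And>y. y \<in> S \<Longrightarrow> cmod (char ?\<nu> y) \<le> cmod (char ?\<nu> x)" by blast
  have "x \<noteq> 0" using x(1) \<delta> by (auto simp: S_def)
  then have lt: "cmod (char ?\<nu> x) < 1" by (rule char_abs_continuous_lt_1[OF assms(1) f0 mass])
  have "cmod (char ?\<nu> t) \<le> max (3 / 4) (cmod (char ?\<nu> x))" if "\<delta> \<le> \<bar>t\<bar>" for t
  proof (cases "T \<le> \<bar>t\<bar>")
    case True
    then show ?thesis using T[of t] by simp
  next
    case False
    then have "t \<in> S" using that by (auto simp: S_def)
    then show ?thesis using x(2)[of t] by simp
  qed
  then show ?thesis using lt by (intro exI[of _ "max (3 / 4) (cmod (char ?\<nu> x))"]) auto
qed

section \<open>Central frequencies, at most a small multiple of sqrt n\<close>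

lemma filterlim_sqrt_real: "filterlim (\<lambda>n. sqrt (real n)) at_top sequentially"
  by (intro filterlim_compose[OF sqrt_at_top] filterlim_real_sequentially)

lemma norm_diff_le_diff_diff: "cmod (a - b) \<le> cmod (a - c) + cmod (b - c)"
  by (metis dist_norm dist_triangle2)

lemma norm_diff_le_diff_diff': "cmod (a - b) \<le> cmod (a - c) + cmod (c - b)"
  by (metis dist_norm dist_triangle)

lemma norm_power_diff_le:
  fixes a b :: complex
  assumes "cmod a \<le> A" "cmod b \<le> A" "cmod (a - b) \<le> D"
  shows "cmod (a ^ k - b ^ k) \<le> real k * A ^ (k - 1) * D"
proof (induction k)
  case (Suc k)
  have A: "0 \<le> A" and D: "0 \<le> D" using order_trans[OF norm_ge_zero assms(1)] order_trans[OF norm_ge_zero assms(3)] .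
  have "a ^ Suc k - b ^ Suc k = a * (a ^ k - b ^ k) + (a - b) * b ^ k"
    by (simp add: algebra_simps)
  then have "cmod (a ^ Suc k - b ^ Suc k) \<le> cmod a * cmod (a ^ k - b ^ k) + cmod (a - b) * cmod b ^ k"
    using norm_triangle_ineq[of "a * (a ^ k - b ^ k)" "(a - b) * b ^ k"] by (simp only: norm_mult norm_power)
  also have "\<dots> \<le> A * (real k * A ^ (k - 1) * D) + D * A ^ k"
    using assms A D Suc by (intro add_mono mult_mono power_mono) auto
  also have "A * (real k * A ^ (k - 1) * D) = real k * A ^ k * D"
    by (cases k) simp_all
  finally show ?case by (simp add: algebra_simps)
qed simp

text \<open>One factor is exchanged at a time: k + 1 exchanges, each costing D while the other k
  factors keep their bounds.\<close>

lemma norm_telescope_le: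
  fixes a b c d :: complex
  assumes "cmod a \<le> A" "cmod b \<le> A" "cmod c \<le> B" "cmod d \<le> B" "cmod (a - b) \<le> D" "cmod (c - d) \<le> D"
  shows "cmod (a ^ k * c - b ^ k * d) \<le> D * (real k * (A ^ (k - 1) * B) + A ^ k)"
proof -
  have A: "0 \<le> A" and D: "0 \<le> D" and B: "0 \<le> B"
    using order_trans[OF norm_ge_zero assms(1)] order_trans[OF norm_ge_zero assms(5)] order_trans[OF norm_ge_zero assms(3)] .
  have "a ^ k * c - b ^ k * d = (a ^ k - b ^ k) * c + b ^ k * (c - d)" by (simp add: algebra_simps)
  then have "cmod (a ^ k * c - b ^ k * d) \<le> cmod (a ^ k - b ^ k) * cmod c + cmod b ^ k * cmod (c - d)"
    using norm_triangle_ineq[of "(a ^ k - b ^ k) * c" "b ^ k * (c - d)"] by (simp only: norm_mult norm_power)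
  also have "\<dots> \<le> real k * A ^ (k - 1) * D * B + A ^ k * D"
    using norm_power_diff_le[OF assms(1,2,5), of k] assms A B D
    by (intro add_mono mult_mono power_mono) auto
  finally show ?thesis by (simp add: algebra_simps)
qed

lemma sqrt_powr: "0 < n \<Longrightarrow> sqrt (real n) powr a = real n powr (a / 2)"
  by (simp add: powr_half_sqrt[symmetric] powr_powr mult.commute)

context block_densities
begin

text \<open>One block fewer than fit: the n mod N leftover summands alone may be too few to have a
  density, so they are joined to a full block and the last length lies between N and 2 N - 1. For n
  < 2 N the count is 0.\<close>

definition K :: "nat \<Rightarrow> nat" where "K n = n div N - 1"

definition last_len :: "nat \<Rightarrow> nat" where "last_len n = N + n mod N"

lemma n_eq: "N \<le> n \<Longrightarrow> n = K n * N + last_len n"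
proof -
  assume n: "N \<le> n"
  then have "1 \<le> n div N" using N_ge_1 by (simp add: div_greater_zero_iff Suc_le_eq)
  then have "K n * N + N = n div N * N" by (simp add: K_def diff_mult_distrib)
  then show ?thesis by (simp add: last_len_def) (metis add.assoc div_mult_mod_eq)
qed

lemma last_len: "last_len n \<in> {N..<2*N}"
  using N_ge_1 by (simp add: last_len_def)

lemma moment_distribution_law: "N \<le> l \<Longrightarrow> moment_distribution (law l) m"
proof -
  assume l: "N \<le> l"
  interpret L: prob_space "law l" by (rule prob_space_law[OF l])
  show ?thesis
  proof
    show "integrable (law l) (\<lambda>x. x ^ k)" if "k \<le> m" for k
      by (rule powr_moment_integrable[OF L.finite_measure_axioms _ p_moment[OF l]]) (use that s_bounds in auto)
  qed simp_all
qed

text \<open>Both sides are compared with the moment polynomial of the block, by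
  \<open>trunc_laplace_Taylor_le\<close> and by \<open>exp_cgf_Taylor\<close>. The error per block
  is o(n^(-s/2)), small enough to be incurred n times. There are finitely many lengths, so summing
  over them gives one \<epsilon> for all.\<close>

lemma trunc_laplace_approx:
  "\<exists>\<epsilon>::nat \<Rightarrow> real. \<epsilon> \<longlonglongrightarrow> 0 \<and> (\<forall>n. 0 \<le> \<epsilon> n) \<and> (\<forall>n>0. \<forall>l\<in>{N..<2*N}. \<forall>\<sigma> t. \<bar>\<sigma>\<bar> = 1 \<longrightarrow> 1 + \<bar>t\<bar> \<le> sqrt n \<longrightarrow>
    cmod (trunc_laplace (law l) (sqrt n) (Complex \<sigma> t) - exp (of_nat l * cgf M m (Complex \<sigma> t / sqrt n)))
      \<le> \<epsilon> n * real n powr (- s / 2) * (2 + \<bar>t\<bar>) ^ Suc m)"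
proof -
  have "\<forall>l\<in>{N..<2*N}. \<exists>C\<ge>0. \<forall>u. cmod u \<le> 1 \<longrightarrow>
    cmod (exp (of_nat l * cgf M m u) - (\<Sum>k\<le>m. of_real (\<integral>x. x ^ k \<partial>law l) * u ^ k / fact k)) \<le> C * cmod u ^ Suc m"
    using exp_cgf_Taylor[OF moment_distribution_law p_char] by auto
  from bchoice[OF this] obtain C where C0: "\<forall>l\<in>{N..<2*N}. 0 \<le> C l \<and> (\<forall>u. cmod u \<le> 1 \<longrightarrow>
    cmod (exp (of_nat l * cgf M m u) - (\<Sum>k\<le>m. of_real (\<integral>x. x ^ k \<partial>law l) * u ^ k / fact k)) \<le> C l * cmod u ^ Suc m)" ..
  have C: "0 \<le> C l" "\<forall>u. cmod u \<le> 1 \<longrightarrow>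
    cmod (exp (of_nat l * cgf M m u) - (\<Sum>k\<le>m. of_real (\<integral>x. x ^ k \<partial>law l) * u ^ k / fact k)) \<le> C l * cmod u ^ Suc m" if "l \<in> {N..<2*N}" for l
    by (rule conjunct1[OF bspec[OF C0 that]], rule conjunct2[OF bspec[OF C0 that]])
  \<comment> \<open>(1 / sqrt n)^(m+1) = n^(-e/2) * n^(-s/2), and e > 0 because s < m + 1; so the
    error on the side of the cumulant polynomial is o(n^(-s/2)) as well.\<close>
  define e where "e = real m + 1 - s"
  have e: "0 < e" using s_bounds by (simp add: e_def)
  define \<epsilon> where "\<epsilon> n = (\<Sum>l\<in>{N..<2*N}. (real m + 3) * \<eta> l (sqrt (real n)) + C l * real n powr (- e / 2))" for n
  have "\<epsilon> \<longlonglongrightarrow> (\<Sum>l\<in>{N..<2*N}. (real m + 3) * 0 + C l * 0)"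
    unfolding \<epsilon>_def[abs_def]
  proof (intro tendsto_sum tendsto_add tendsto_mult tendsto_const)
    show "(\<lambda>n. \<eta> l (sqrt (real n))) \<longlonglongrightarrow> 0" if "l \<in> {N..<2*N}" for l
      by (rule filterlim_compose[OF tendsto_\<eta> filterlim_sqrt_real]) (use that in simp)
    show "(\<lambda>n. real n powr (- e / 2)) \<longlonglongrightarrow> 0"
      by (rule tendsto_neg_powr) (use e filterlim_real_sequentially in auto)
  qed
  then have lim: "\<epsilon> \<longlonglongrightarrow> 0" by simp
  have nn: "0 \<le> (real m + 3) * \<eta> l (sqrt (real n)) + C l * real n powr (- e / 2)" if "l \<in> {N..<2*N}" for l n
    using C(1)[OF that] by (intro add_nonneg_nonneg mult_nonneg_nonneg \<eta>_nonneg) auto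
  have main: "cmod (trunc_laplace (law l) (sqrt n) (Complex \<sigma> t) - exp (of_nat l * cgf M m (Complex \<sigma> t / sqrt n)))
      \<le> \<epsilon> n * real n powr (- s / 2) * (2 + \<bar>t\<bar>) ^ Suc m"
    if n: "0 < n" and l: "l \<in> {N..<2*N}" and \<sigma>: "\<bar>\<sigma>\<bar> = 1" and t: "1 + \<bar>t\<bar> \<le> sqrt n" for n l \<sigma> t
  proof -
    let ?w = "Complex \<sigma> t" let ?\<tau> = "sqrt (real n)"
    let ?S = "\<Sum>k\<le>m. of_real (\<integral>x. x ^ k \<partial>law l) * (?w / ?\<tau>) ^ k / fact k"
    have lN: "N \<le> l" using l by simp
    interpret L: prob_space "law l" by (rule prob_space_law[OF lN])
    have \<tau>: "0 < ?\<tau>" using n by simp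
    have cw: "cmod ?w \<le> 1 + \<bar>t\<bar>" by (rule cmod_Complex_unit_le[OF \<sigma>])
    have pw: "(1 + cmod ?w) ^ Suc m \<le> (2 + \<bar>t\<bar>) ^ Suc m" "cmod ?w ^ Suc m \<le> (2 + \<bar>t\<bar>) ^ Suc m"
      using cw by (intro power_mono; simp)+
    have 1: "cmod (trunc_laplace (law l) ?\<tau> ?w - ?S) \<le> (real m + 3) * \<eta> l ?\<tau> * real n powr (- s / 2) * (2 + \<bar>t\<bar>) ^ Suc m"
    proof -
      have "cmod (trunc_laplace (law l) ?\<tau> ?w - ?S) \<le> (real m + 3) * (1 + cmod ?w) ^ Suc m * (?\<tau> powr (- s) * tail_moment (law l) s (real m + 1 - s) ?\<tau>)"
        by (rule trunc_laplace_Taylor_le[OF L.finite_measure_axioms _ p_moment[OF lN] s_bounds \<tau>]) (use \<sigma> in auto)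
      also have "\<dots> = (real m + 3) * \<eta> l ?\<tau> * real n powr (- s / 2) * (1 + cmod ?w) ^ Suc m"
        unfolding \<eta>_def using sqrt_powr[OF n, of "- s"] by (simp only: mult_ac)
      also have "\<dots> \<le> (real m + 3) * \<eta> l ?\<tau> * real n powr (- s / 2) * (2 + \<bar>t\<bar>) ^ Suc m"
        by (intro mult_left_mono pw mult_nonneg_nonneg \<eta>_nonneg) auto
      finally show ?thesis .
    qed
    have 2: "cmod (exp (of_nat l * cgf M m (?w / ?\<tau>)) - ?S) \<le> C l * real n powr (- e / 2) * real n powr (- s / 2) * (2 + \<bar>t\<bar>) ^ Suc m"
    proof -
      have "cmod (?w / ?\<tau>) \<le> 1" using cw t \<tau> by (simp add: norm_divide divide_le_eq)
      then have "cmod (exp (of_nat l * cgf M m (?w / ?\<tau>)) - ?S) \<le> C l * cmod (?w / ?\<tau>) ^ Suc m"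
        by (rule C(2)[OF l, rule_format])
      also have "cmod (?w / ?\<tau>) ^ Suc m = cmod ?w ^ Suc m * ?\<tau> powr (- real (Suc m))"
        using \<tau> powr_realpow[OF \<tau>, of "Suc m"] unfolding norm_divide norm_of_real powr_minus power_divide
        by (simp only: abs_of_pos divide_inverse)
      also have "?\<tau> powr (- real (Suc m)) = real n powr (- e / 2) * real n powr (- s / 2)"
        unfolding sqrt_powr[OF n] powr_add[symmetric] by (rule arg_cong[where f = "\<lambda>x. real n powr x"]) (simp add: e_def field_simps)
      also have "C l * (cmod ?w ^ Suc m * (real n powr (- e / 2) * real n powr (- s / 2)))
          \<le> C l * ((2 + \<bar>t\<bar>) ^ Suc m * (real n powr (- e / 2) * real n powr (- s / 2)))"
        by (intro mult_left_mono mult_right_mono pw C(1)[OF l]) simp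
      finally show ?thesis by (simp only: mult_ac)
    qed
    have "cmod (trunc_laplace (law l) ?\<tau> ?w - exp (of_nat l * cgf M m (?w / ?\<tau>)))
        \<le> cmod (trunc_laplace (law l) ?\<tau> ?w - ?S) + cmod (exp (of_nat l * cgf M m (?w / ?\<tau>)) - ?S)"
      by (rule norm_diff_le_diff_diff)
    also have "\<dots> \<le> (real m + 3) * \<eta> l ?\<tau> * real n powr (- s / 2) * (2 + \<bar>t\<bar>) ^ Suc m
        + C l * real n powr (- e / 2) * real n powr (- s / 2) * (2 + \<bar>t\<bar>) ^ Suc m"
      by (rule add_mono[OF 1 2])
    also have "\<dots> = ((real m + 3) * \<eta> l ?\<tau> + C l * real n powr (- e / 2)) * (real n powr (- s / 2) * (2 + \<bar>t\<bar>) ^ Suc m)"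
      by (simp only: distrib_right mult.assoc)
    also have "\<dots> \<le> \<epsilon> n * (real n powr (- s / 2) * (2 + \<bar>t\<bar>) ^ Suc m)"
      unfolding \<epsilon>_def by (intro mult_right_mono member_le_sum[OF l] nn) auto
    finally show ?thesis by (simp only: mult.assoc)
  qed
  have "0 \<le> \<epsilon> n" for n unfolding \<epsilon>_def by (intro sum_nonneg nn)
  then show ?thesis using lim main by (intro exI[of _ \<epsilon>] conjI allI impI ballI)
qed

text \<open>One radius for the whole central range: small enough for all block lengths in
  \<open>{N..<2*N}\<close> and for the cumulant polynomial.\<close>

definition decay_radius :: "real \<Rightarrow> bool" where
  "decay_radius \<delta> \<longleftrightarrow> 0 < \<delta> \<and> \<delta> \<le> 1 / 2 \<and> 16 * cgf_bound * \<delta> \<le> 1 \<and>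
    (\<forall>\<^sub>F n in sequentially. \<forall>l\<in>{N..<2*N}. \<forall>\<sigma> t. \<bar>\<sigma>\<bar> = 1 \<longrightarrow> \<bar>t\<bar> \<le> \<delta> * sqrt (real n) \<longrightarrow>
      cmod (trunc_laplace (law l) (sqrt (real n)) (Complex \<sigma> t)) \<le> exp (real l * (3 - t\<^sup>2 / 8) / real n))"

lemma ex_decay_radius: "\<exists>\<delta>. decay_radius \<delta>"
proof -
  have "\<forall>l\<in>{N..<2*N}. \<exists>\<delta>>0. \<exists>T. \<forall>\<tau>\<ge>T. \<forall>\<sigma> t. \<bar>\<sigma>\<bar> = 1 \<longrightarrow> \<bar>t\<bar> \<le> \<delta> * \<tau> \<longrightarrow>
    cmod (trunc_laplace (law l) \<tau> (Complex \<sigma> t)) \<le> exp (real l * (3 - t\<^sup>2 / 8) / \<tau>\<^sup>2)"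
  proof
    fix l assume l: "l \<in> {N..<2*N}"
    interpret L: moment_distribution "law l" m by (rule moment_distribution_law) (use l in simp)
    show "\<exists>\<delta>>0. \<exists>T. \<forall>\<tau>\<ge>T. \<forall>\<sigma> t. \<bar>\<sigma>\<bar> = 1 \<longrightarrow> \<bar>t\<bar> \<le> \<delta> * \<tau> \<longrightarrow>
        cmod (trunc_laplace (law l) \<tau> (Complex \<sigma> t)) \<le> exp (real l * (3 - t\<^sup>2 / 8) / \<tau>\<^sup>2)"
      by (rule trunc_laplace_decay[OF L.prob_space_axioms]) (use l m_ge_2 N_ge_1 in \<open>auto intro: L.integrable_moments p_mean p_variance\<close>)
  qed
  from bchoice[OF this] obtain d where d0: "\<forall>l\<in>{N..<2*N}. 0 < d l \<and> (\<exists>T. \<forall>\<tau>\<ge>T. \<forall>\<sigma> t. \<bar>\<sigma>\<bar> = 1 \<longrightarrow> \<bar>t\<bar> \<le> d l * \<tau> \<longrightarrow>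
    cmod (trunc_laplace (law l) \<tau> (Complex \<sigma> t)) \<le> exp (real l * (3 - t\<^sup>2 / 8) / \<tau>\<^sup>2))" ..
  have d: "0 < d l" "\<exists>T. \<forall>\<tau>\<ge>T. \<forall>\<sigma> t. \<bar>\<sigma>\<bar> = 1 \<longrightarrow> \<bar>t\<bar> \<le> d l * \<tau> \<longrightarrow>
    cmod (trunc_laplace (law l) \<tau> (Complex \<sigma> t)) \<le> exp (real l * (3 - t\<^sup>2 / 8) / \<tau>\<^sup>2)" if "l \<in> {N..<2*N}" for l
    by (rule conjunct1[OF bspec[OF d0 that]], rule conjunct2[OF bspec[OF d0 that]])
  define \<delta> where "\<delta> = Min (insert (1 / 2) (insert (1 / (16 * (1 + cgf_bound))) (d ` {N..<2*N})))"
  have \<delta>: "0 < \<delta>" "\<delta> \<le> 1 / 2" "\<delta> \<le> 1 / (16 * (1 + cgf_bound))" "\<And>l. l \<in> {N..<2*N} \<Longrightarrow> \<delta> \<le> d l"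
  proof -
    let ?S = "insert (1 / 2) (insert (1 / (16 * (1 + cgf_bound))) (d ` {N..<2*N}))"
    have fin: "finite ?S" by simp
    have "\<forall>a\<in>?S. 0 < a" using d(1) cgf_bound_nonneg by auto
    then show "0 < \<delta>" unfolding \<delta>_def by (subst Min_gr_iff) auto
    show "\<delta> \<le> 1 / 2" "\<delta> \<le> 1 / (16 * (1 + cgf_bound))" "\<And>l. l \<in> {N..<2*N} \<Longrightarrow> \<delta> \<le> d l"
      unfolding \<delta>_def by (rule Min_le[OF fin]; simp)+
  qed
  have "16 * cgf_bound * \<delta> \<le> 16 * (1 + cgf_bound) * \<delta>" using \<delta> by (intro mult_right_mono) auto
  also have "\<dots> \<le> 1" using \<delta>(3) cgf_bound_nonneg by (simp add: field_simps)
  finally have \<delta>c: "16 * cgf_bound * \<delta> \<le> 1" .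
  have "\<forall>\<^sub>F n in sequentially. \<forall>l\<in>{N..<2*N}. \<forall>\<sigma> t. \<bar>\<sigma>\<bar> = 1 \<longrightarrow> \<bar>t\<bar> \<le> \<delta> * sqrt (real n) \<longrightarrow>
      cmod (trunc_laplace (law l) (sqrt (real n)) (Complex \<sigma> t)) \<le> exp (real l * (3 - t\<^sup>2 / 8) / real n)"
  proof (rule eventually_ball_finite, simp, rule ballI)
    fix l assume l: "l \<in> {N..<2*N}"
    obtain T where T: "\<And>\<tau> \<sigma> t. \<tau> \<ge> T \<Longrightarrow> \<bar>\<sigma>\<bar> = 1 \<Longrightarrow> \<bar>t\<bar> \<le> d l * \<tau> \<Longrightarrow>
      cmod (trunc_laplace (law l) \<tau> (Complex \<sigma> t)) \<le> exp (real l * (3 - t\<^sup>2 / 8) / \<tau>\<^sup>2)" using d(2)[OF l] by blast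
    have "\<forall>\<^sub>F n in sequentially. T \<le> sqrt (real n)"
      using filterlim_sqrt_real by (simp add: filterlim_at_top)
    then show "\<forall>\<^sub>F n in sequentially. \<forall>\<sigma> t. \<bar>\<sigma>\<bar> = 1 \<longrightarrow> \<bar>t\<bar> \<le> \<delta> * sqrt (real n) \<longrightarrow>
      cmod (trunc_laplace (law l) (sqrt (real n)) (Complex \<sigma> t)) \<le> exp (real l * (3 - t\<^sup>2 / 8) / real n)"
    proof eventually_elim
      case (elim n)
      show ?case
      proof (intro allI impI)
        fix \<sigma> t :: real assume \<sigma>: "\<bar>\<sigma>\<bar> = 1" and t: "\<bar>t\<bar> \<le> \<delta> * sqrt (real n)"
        have "\<bar>t\<bar> \<le> d l * sqrt (real n)" using t mult_right_mono[OF \<delta>(4)[OF l], of "sqrt (real n)"] by simp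
        from T[OF elim \<sigma> this] show "cmod (trunc_laplace (law l) (sqrt (real n)) (Complex \<sigma> t)) \<le> exp (real l * (3 - t\<^sup>2 / 8) / real n)"
          by simp
      qed
    qed
  qed
  then show ?thesis using \<delta> \<delta>c by (auto simp: decay_radius_def)
qed

text \<open>Half of the exponent survives when boundedly many summands are dropped.\<close>

lemma exp_partial_le:
  assumes "real n \<le> 2 * real j" "j \<le> n" "0 < n"
  shows "exp (real j * (3 - t\<^sup>2 / 8) / real n) \<le> exp 3 * exp (- t\<^sup>2 / 16)"
proof -
  define c where "c = real j / real n"
  have c: "1 / 2 \<le> c" "c \<le> 1" using assms by (auto simp: c_def field_simps)
  have "real j * (3 - t\<^sup>2 / 8) / real n = 3 * c - c * (t\<^sup>2 / 8)" by (simp add: c_def algebra_simps diff_divide_distrib)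
  also have "\<dots> \<le> 3 - 1 / 2 * (t\<^sup>2 / 8)" using c by (intro diff_mono mult_right_mono) auto
  finally show ?thesis by (simp add: exp_add[symmetric])
qed

text \<open>Telescoping leads from the product of block transforms to exp (n * cgf (w / sqrt n)) and
  from there to the Edgeworth transform. At most n exchanges of size o(n^(-s/2)) give
  o(n^(-(s-2)/2)); the factors kept in each exchange represent at least half of the summands, and
  their Gaussian bound absorbs the powers of t.\<close>

lemma central_approx:
  assumes "decay_radius \<delta>"
  shows "\<exists>\<epsilon>::nat \<Rightarrow> real. \<epsilon> \<longlonglongrightarrow> 0 \<and> (\<forall>\<^sub>F n in sequentially. 0 \<le> \<epsilon> n \<and> (\<forall>\<sigma> t. \<bar>\<sigma>\<bar> = 1 \<longrightarrow> \<bar>t\<bar> \<le> \<delta> * sqrt n \<longrightarrow>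
    cmod (trunc_laplace (law N) (sqrt n) (Complex \<sigma> t) ^ K n * trunc_laplace (law (last_len n)) (sqrt n) (Complex \<sigma> t)
      - edgeworth_laplace (sqrt n) (Complex \<sigma> t)) \<le> \<epsilon> n * rate n * exp (- t\<^sup>2 / 32)))"
proof -
  have \<delta>: "0 < \<delta>" "\<delta> \<le> 1 / 2" "16 * cgf_bound * \<delta> \<le> 1"
    using assms by (auto simp: decay_radius_def)
  note dec = assms[unfolded decay_radius_def, THEN conjunct2, THEN conjunct2, THEN conjunct2]
  from trunc_laplace_approx obtain \<epsilon>1 :: "nat \<Rightarrow> real" where h: "\<epsilon>1 \<longlonglongrightarrow> 0 \<and> (\<forall>n. 0 \<le> \<epsilon>1 n) \<and> (\<forall>n>0. \<forall>l\<in>{N..<2*N}. \<forall>\<sigma> t. \<bar>\<sigma>\<bar> = 1 \<longrightarrow> 1 + \<bar>t\<bar> \<le> sqrt n \<longrightarrow>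
    cmod (trunc_laplace (law l) (sqrt n) (Complex \<sigma> t) - exp (of_nat l * cgf M m (Complex \<sigma> t / sqrt n)))
      \<le> \<epsilon>1 n * real n powr (- s / 2) * (2 + \<bar>t\<bar>) ^ Suc m)" ..
  note e1 = conjunct1[OF h] conjunct1[OF conjunct2[OF h], rule_format] conjunct2[OF conjunct2[OF h], rule_format]
  from exp_cgf_edgeworth_le[OF \<delta>] obtain C where h: "0 \<le> C \<and> (\<forall>\<tau>. 2 \<le> \<delta> * \<tau> \<longrightarrow> (\<forall>\<sigma> t. \<bar>\<sigma>\<bar> = 1 \<longrightarrow> \<bar>t\<bar> \<le> \<delta> * \<tau> \<longrightarrow>
    cmod (exp (of_real (\<tau>\<^sup>2) * cgf M m (Complex \<sigma> t / of_real \<tau>)) - edgeworth_laplace \<tau> (Complex \<sigma> t))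
      \<le> C * (1 / \<tau>) ^ (m - 1) * exp (- t\<^sup>2 / 32)))" ..
  note C = conjunct1[OF h] conjunct2[OF h, rule_format]
  obtain D where D: "0 < D" "\<And>t::real. (2 + \<bar>t\<bar>) ^ Suc m \<le> D * exp (t\<^sup>2 / 32)"
    using one_plus_abs_power_le_exp by blast
  define \<epsilon> where "\<epsilon> n = \<epsilon>1 n * (D * exp 3) + C * real n powr (- (real m + 1 - s) / 2)" for n
  have "\<epsilon> \<longlonglongrightarrow> 0 * (D * exp 3) + C * 0"
    unfolding \<epsilon>_def[abs_def]
  proof (intro tendsto_add tendsto_mult e1 tendsto_const)
    show "(\<lambda>n. real n powr (- (real m + 1 - s) / 2)) \<longlonglongrightarrow> 0"
      by (rule tendsto_neg_powr) (use s_bounds filterlim_real_sequentially in auto)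
  qed
  then have lim: "\<epsilon> \<longlonglongrightarrow> 0" by simp
  have "\<forall>\<^sub>F n in sequentially. max 2 (2 / \<delta>) \<le> sqrt (real n)"
    using filterlim_sqrt_real unfolding filterlim_at_top by blast
  then have "\<forall>\<^sub>F n in sequentially. 0 \<le> \<epsilon> n \<and> (\<forall>\<sigma> t. \<bar>\<sigma>\<bar> = 1 \<longrightarrow> \<bar>t\<bar> \<le> \<delta> * sqrt n \<longrightarrow>
    cmod (trunc_laplace (law N) (sqrt n) (Complex \<sigma> t) ^ K n * trunc_laplace (law (last_len n)) (sqrt n) (Complex \<sigma> t)
      - edgeworth_laplace (sqrt n) (Complex \<sigma> t)) \<le> \<epsilon> n * rate n * exp (- t\<^sup>2 / 32))"
    \<comment> \<open>From n \<ge> 4 N on, leaving out the last block, which has fewer than 2 N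
      summands, or one block of length N keeps at least n / 2 summands.\<close>
    using dec eventually_ge_at_top[of "4 * N"]
  proof eventually_elim
    case (elim n)
    have n0: "0 < n" using elim(3) N_ge_1 by linarith
    have "2 / \<delta> \<le> sqrt (real n)" using elim(1) by simp
    then have "2 \<le> \<delta> * sqrt (real n)" using \<delta> by (simp add: divide_le_eq mult.commute)
    then have \<tau>: "2 \<le> sqrt (real n)" "2 \<le> \<delta> * sqrt (real n)"
      using elim(1) by simp_all
    have NN: "N \<in> {N..<2*N}" using N_ge_1 by simp
    show ?case
    proof (intro conjI allI impI)
      show "0 \<le> \<epsilon> n" unfolding \<epsilon>_def using e1(2) D C by (intro add_nonneg_nonneg mult_nonneg_nonneg) auto
      fix \<sigma> t :: real assume \<sigma>: "\<bar>\<sigma>\<bar> = 1" and t: "\<bar>t\<bar> \<le> \<delta> * sqrt (real n)"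
      let ?w = "Complex \<sigma> t" let ?\<tau> = "sqrt (real n)" let ?l = "last_len n"
      let ?F = "\<lambda>l. trunc_laplace (law l) ?\<tau> ?w"
      let ?G = "\<lambda>l. exp (of_nat l * cgf M m (?w / ?\<tau>))"
      have "\<delta> * ?\<tau> \<le> 1 / 2 * ?\<tau>" using \<delta> by (intro mult_right_mono) auto
      then have t1: "1 + \<bar>t\<bar> \<le> ?\<tau>" using t \<tau> by linarith
      have F: "cmod (?F l) \<le> exp (real l * (3 - t\<^sup>2 / 8) / real n)" if "l \<in> {N..<2*N}" for l
        using elim(2) that \<sigma> t by blast
      have G: "cmod (?G l) \<le> exp (real l * (3 - t\<^sup>2 / 8) / real n)" for l
      proof -
        have "Re (cgf M m (?w / ?\<tau>)) \<le> (3 - t\<^sup>2 / 8) / real n"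
          using Re_cgf_le[OF \<delta> _ \<sigma> t] \<tau> by simp
        then have "real l * Re (cgf M m (?w / ?\<tau>)) \<le> real l * ((3 - t\<^sup>2 / 8) / real n)" by (rule mult_left_mono) simp
        then show ?thesis by simp
      qed
      let ?D = "\<epsilon>1 n * real n powr (- s / 2) * (2 + \<bar>t\<bar>) ^ Suc m"
      let ?A = "exp (real N * (3 - t\<^sup>2 / 8) / real n)" and ?B = "exp (real ?l * (3 - t\<^sup>2 / 8) / real n)"
      have tel: "cmod (?F N ^ K n * ?F ?l - ?G N ^ K n * ?G ?l) \<le> ?D * (real (K n) * (?A ^ (K n - 1) * ?B) + ?A ^ K n)"
        by (rule norm_telescope_le[OF F[OF NN] G F[OF last_len] G e1(3)[OF n0 NN \<sigma> t1] e1(3)[OF n0 last_len \<sigma> t1]])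
      have nK: "n = K n * N + ?l" using n_eq[of n] elim(3) by simp
      have Kn: "Suc (K n) \<le> n"
      proof -
        have "K n * 1 \<le> K n * N" using N_ge_1 by (intro mult_left_mono) auto
        moreover have "1 \<le> ?l" using N_ge_1 by (simp add: last_len_def)
        ultimately show ?thesis using nK by linarith
      qed
      have lN: "?l < 2 * N" using last_len[of n] by simp
      have K1: "1 \<le> K n"
      proof (rule ccontr)
        assume "\<not> 1 \<le> K n" then have "K n = 0" by simp
        then show False using nK lN elim(3) by simp
      qed
      have nm: "n - N = (K n - 1) * N + ?l" using nK K1 N_ge_1
        by (cases "K n") auto
      have pA: "?A ^ k = exp (real (k * N) * (3 - t\<^sup>2 / 8) / real n)" for k
        by (simp add: exp_of_nat_mult[symmetric])
      have "?A ^ (K n - 1) * ?B = exp (real (n - N) * (3 - t\<^sup>2 / 8) / real n)"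
        unfolding pA exp_add[symmetric] nm by (simp add: algebra_simps add_divide_distrib diff_divide_distrib)
      also have "\<dots> \<le> exp 3 * exp (- t\<^sup>2 / 16)" using elim(3) n0 by (intro exp_partial_le) auto
      finally have AB: "?A ^ (K n - 1) * ?B \<le> exp 3 * exp (- t\<^sup>2 / 16)" .
      have AK: "?A ^ K n \<le> exp 3 * exp (- t\<^sup>2 / 16)"
        unfolding pA
      proof (rule exp_partial_le)
        have "n \<le> 2 * (K n * N)" using nK lN elim(3) by linarith
        from of_nat_mono[OF this, where 'a = real] show "real n \<le> 2 * real (K n * N)"
          by (simp only: of_nat_mult of_nat_numeral)
        show "K n * N \<le> n" using nK by linarith
      qed (rule n0)
      have D0: "0 \<le> ?D" using e1(2)[of n] by auto
      have "?D * (real (K n) * (?A ^ (K n - 1) * ?B) + ?A ^ K n) \<le> ?D * (real (K n) * (exp 3 * exp (- t\<^sup>2 / 16)) + exp 3 * exp (- t\<^sup>2 / 16))"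
        by (intro mult_left_mono add_mono AB AK D0) simp
      also have "\<dots> = ?D * (real (Suc (K n)) * (exp 3 * exp (- t\<^sup>2 / 16)))"
        by (simp add: algebra_simps)
      also have "\<dots> \<le> ?D * (real n * (exp 3 * exp (- t\<^sup>2 / 16)))"
        using Kn by (intro mult_left_mono mult_right_mono D0) auto
      also have "\<dots> = \<epsilon>1 n * (real n powr (- s / 2) * real n) * exp 3 * exp (- t\<^sup>2 / 16) * (2 + \<bar>t\<bar>) ^ Suc m"
        by (simp only: mult_ac)
      also have "\<dots> \<le> \<epsilon>1 n * (real n powr (- s / 2) * real n) * exp 3 * exp (- t\<^sup>2 / 16) * (D * exp (t\<^sup>2 / 32))"
        using e1(2)[of n] by (intro mult_left_mono D) auto
      also have "real n powr (- s / 2) * real n = rate n"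
      proof -
        have "real n powr (- s / 2) * real n powr 1 = real n powr (- s / 2 + 1)" by (rule powr_add[symmetric])
        also have "- s / 2 + 1 = - (s - 2) / 2" by (simp add: field_simps)
        finally show ?thesis using n0 by simp
      qed
      also have "\<epsilon>1 n * rate n * exp 3 * exp (- t\<^sup>2 / 16) * (D * exp (t\<^sup>2 / 32))
          = \<epsilon>1 n * (D * exp 3) * rate n * (exp (- t\<^sup>2 / 16) * exp (t\<^sup>2 / 32))"
        by (simp only: mult_ac)
      also have "exp (- t\<^sup>2 / 16) * exp (t\<^sup>2 / 32) = exp (- t\<^sup>2 / 32)" by (simp add: exp_add[symmetric])
      finally have part1: "cmod (?F N ^ K n * ?F ?l - ?G N ^ K n * ?G ?l) \<le> \<epsilon>1 n * (D * exp 3) * rate n * exp (- t\<^sup>2 / 32)"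
        using tel by linarith
      have GG: "?G N ^ K n * ?G ?l = exp (of_real (?\<tau>\<^sup>2) * cgf M m (?w / of_real ?\<tau>))"
      proof -
        have "complex_of_real (?\<tau>\<^sup>2) = of_nat n" by simp
        also have "\<dots> = of_nat (K n * N + ?l)" by (rule arg_cong[OF nK])
        also have "\<dots> = of_nat (K n) * of_nat N + of_nat ?l" by (simp only: of_nat_add of_nat_mult)
        finally show ?thesis by (simp only: exp_of_nat_mult[symmetric] exp_add[symmetric] distrib_right mult.assoc)
      qed
      have part2: "cmod (?G N ^ K n * ?G ?l - edgeworth_laplace ?\<tau> ?w) \<le> C * real n powr (- (real m + 1 - s) / 2) * rate n * exp (- t\<^sup>2 / 32)"
      proof -
        have "(1 / ?\<tau>) ^ (m - 1) = ?\<tau> powr (- real (m - 1))"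
          using n0 powr_realpow[of ?\<tau> "m - 1"] by (simp add: powr_minus power_one_over inverse_eq_divide)
        also have "\<dots> = real n powr (- (real m + 1 - s) / 2) * rate n"
          unfolding sqrt_powr[OF n0] powr_add[symmetric]
          by (rule arg_cong[where f = "\<lambda>x. real n powr x"]) (use m_ge_2 in \<open>simp add: of_nat_diff field_simps\<close>)
        finally have "(1 / ?\<tau>) ^ (m - 1) = real n powr (- (real m + 1 - s) / 2) * rate n" .
        then show ?thesis unfolding GG using C(2)[OF \<tau>(2) \<sigma> t] by (simp only: mult.assoc)
      qed
      have "cmod (?F N ^ K n * ?F ?l - edgeworth_laplace ?\<tau> ?w)
          \<le> cmod (?F N ^ K n * ?F ?l - ?G N ^ K n * ?G ?l) + cmod (?G N ^ K n * ?G ?l - edgeworth_laplace ?\<tau> ?w)"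
        by (rule norm_diff_le_diff_diff')
      also have "\<dots> \<le> \<epsilon>1 n * (D * exp 3) * rate n * exp (- t\<^sup>2 / 32)
          + C * real n powr (- (real m + 1 - s) / 2) * rate n * exp (- t\<^sup>2 / 32)"
        by (rule add_mono[OF part1 part2])
      also have "\<dots> = \<epsilon> n * rate n * exp (- t\<^sup>2 / 32)"
        unfolding \<epsilon>_def by (simp only: distrib_right)
      finally show "cmod (?F N ^ K n * ?F ?l - edgeworth_laplace ?\<tau> ?w) \<le> \<epsilon> n * rate n * exp (- t\<^sup>2 / 32)" .
    qed
  qed
  with lim show ?thesis by (intro exI[of _ \<epsilon>] conjI)
qed

end

section \<open>Transforms of convolutions of blocks\<close>

context standardized_distribution
begin

text \<open>The exponent of w is the sum of (i + 2) * p i, that is k + 2 j with j = p 1 + ... + p k: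
  precisely the Hermite index in \<open>edgeworth_term\<close>.\<close>

lemma weight_poly_edgeworth:
  "weight_poly (\<lambda>i. of_real (cgf_coeff i) * w ^ (i + 2)) k =
    (\<Sum>p\<in>weight_solutions k. of_real ((1 / (\<Prod>i=1..k. fact (p i))) * (\<Prod>i=1..k. (cumulant M (i + 2) / fact (i + 2)) ^ p i))
      * w ^ (k + 2 * (\<Sum>i=1..k. p i)))"
  unfolding weight_poly_def
proof (rule sum.cong[OF refl])
  fix p assume p: "p \<in> weight_solutions k"
  have "(\<Sum>i=1..k. (i + 2) * p i) = (\<Sum>i=1..k. i * p i) + 2 * (\<Sum>i=1..k. p i)"
    by (simp only: add_mult_distrib sum.distrib sum_distrib_left)
  then have e: "(\<Sum>i=1..k. (i + 2) * p i) = k + 2 * (\<Sum>i=1..k. p i)"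
    using p by (simp add: weight_solutions_def)
  have "(\<Prod>i=1..k. (of_real (cgf_coeff i) * w ^ (i + 2)) ^ p i / fact (p i))
      = (\<Prod>i=1..k. of_real (1 / fact (p i)) * (of_real (cgf_coeff i ^ p i) * w ^ ((i + 2) * p i)))"
    unfolding power_mult_distrib power_mult of_real_power of_real_divide of_real_1 of_real_fact by simp
  also have "\<dots> = of_real (\<Prod>i=1..k. 1 / fact (p i)) * (of_real (\<Prod>i=1..k. cgf_coeff i ^ p i) * w ^ (\<Sum>i=1..k. (i + 2) * p i))"
    by (simp only: prod.distrib power_sum of_real_prod)
  also have "(\<Prod>i=1..k. 1 / fact (p i)) = (1 / (\<Prod>i=1..k. fact (p i)) :: real)"
    by (simp add: prod_dividef)
  finally show "(\<Prod>i=1..k. (of_real (cgf_coeff i) * w ^ (i + 2)) ^ p i / fact (p i))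
      = of_real ((1 / (\<Prod>i=1..k. fact (p i))) * (\<Prod>i=1..k. (cumulant M (i + 2) / fact (i + 2)) ^ p i)) * w ^ (k + 2 * (\<Sum>i=1..k. p i))"
    unfolding e by (simp only: cgf_coeff_def of_real_mult mult.assoc)
qed

lemma has_bochner_integral_edgeworth_term:
  "has_bochner_integral lborel (\<lambda>x. (exp (\<sigma> * x) * edgeworth_term M k x) *\<^sub>R iexp (t * x))
    (exp ((Complex \<sigma> t)\<^sup>2 / 2) * weight_poly (\<lambda>i. of_real (cgf_coeff i) * Complex \<sigma> t ^ (i + 2)) k)"
proof -
  let ?w = "Complex \<sigma> t"
  define A where "A p = (1 / (\<Prod>i=1..k. fact (p i))) * (\<Prod>i=1..k. (cumulant M (i + 2) / fact (i + 2)) ^ p i)" for p :: "nat \<Rightarrow> nat"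
  define j where "j p = k + 2 * (\<Sum>i=1..k. p i)" for p :: "nat \<Rightarrow> nat"
  have "has_bochner_integral lborel
      (\<lambda>x. \<Sum>p\<in>weight_solutions k. A p *\<^sub>R ((exp (\<sigma> * x) * (std_normal_density x * hermite (j p) x)) *\<^sub>R iexp (t * x)))
      (\<Sum>p\<in>weight_solutions k. A p *\<^sub>R (?w ^ j p * exp (?w\<^sup>2 / 2)))"
    by (intro has_bochner_integral_sum has_bochner_integral_scaleR_right has_bochner_integral_tilted_normal_hermite)
  moreover have "(\<Sum>p\<in>weight_solutions k. A p *\<^sub>R ((exp (\<sigma> * x) * (std_normal_density x * hermite (j p) x)) *\<^sub>R iexp (t * x)))
      = (exp (\<sigma> * x) * edgeworth_term M k x) *\<^sub>R iexp (t * x)" for x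
  proof -
    have "exp (\<sigma> * x) * edgeworth_term M k x = (\<Sum>p\<in>weight_solutions k. A p * (exp (\<sigma> * x) * (std_normal_density x * hermite (j p) x)))"
      unfolding edgeworth_term_def A_def j_def sum_distrib_left by (rule sum.cong[OF refl]) (simp only: mult_ac)
    then show ?thesis by (simp only: scaleR_scaleR scaleR_sum_left)
  qed
  moreover have "(\<Sum>p\<in>weight_solutions k. A p *\<^sub>R (?w ^ j p * exp (?w\<^sup>2 / 2)))
      = exp (?w\<^sup>2 / 2) * weight_poly (\<lambda>i. of_real (cgf_coeff i) * ?w ^ (i + 2)) k"
    unfolding weight_poly_edgeworth sum_distrib_left A_def j_def scaleR_conv_of_real
    by (rule sum.cong[OF refl]) (simp only: mult_ac)
  ultimately show ?thesis by (simp only:)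
qed

lemma weight_poly_0: "weight_poly c 0 = 1"
proof -
  have "weight_solutions 0 = {\<lambda>_. undefined}"
    by (auto simp: weight_solutions_def)
  then show ?thesis by (simp add: weight_poly_def)
qed

text \<open>Termwise, a Hermite function of index j transforms to w^j exp (w^2 / 2). The normal
  density is the summand k = 0, as \<open>weight_poly c 0 = 1\<close>.\<close>

lemma has_bochner_integral_edgeworth_approx:
  assumes "0 < n"
  shows "has_bochner_integral lborel (\<lambda>x. (exp (\<sigma> * x) * edgeworth_approx M m n x) *\<^sub>R iexp (t * x))
    (edgeworth_laplace (sqrt n) (Complex \<sigma> t))"
proof -
  let ?w = "Complex \<sigma> t"
  let ?W = "\<lambda>k. weight_poly (\<lambda>i. of_real (cgf_coeff i) * ?w ^ (i + 2)) k"
  have pw: "real n powr (- real k / 2) = (1 / sqrt (real n)) ^ k" for k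
  proof -
    have "real n powr (- real k / 2) = sqrt (real n) powr (- real k)"
      using assms by (simp add: powr_half_sqrt[symmetric] powr_powr)
    also have "\<dots> = (1 / sqrt (real n)) ^ k"
      using assms by (simp add: powr_minus powr_realpow power_one_over inverse_eq_divide)
    finally show ?thesis .
  qed
  have h0: "has_bochner_integral lborel (\<lambda>x. (exp (\<sigma> * x) * std_normal_density x) *\<^sub>R iexp (t * x)) (exp (?w\<^sup>2 / 2))"
    using has_bochner_integral_tilted_normal_hermite[of \<sigma> 0 t] unfolding hermite_eq_poly hermite_poly.simps poly_1 power_0 mult_1_right mult_1 .
  have "has_bochner_integral lborel
      (\<lambda>x. (exp (\<sigma> * x) * std_normal_density x) *\<^sub>R iexp (t * x) +
        (\<Sum>k=1..m-2. (real n powr (- real k / 2)) *\<^sub>R ((exp (\<sigma> * x) * edgeworth_term M k x) *\<^sub>R iexp (t * x))))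
      (exp (?w\<^sup>2 / 2) + (\<Sum>k=1..m-2. (real n powr (- real k / 2)) *\<^sub>R (exp (?w\<^sup>2 / 2) * ?W k)))"
    by (intro has_bochner_integral_add has_bochner_integral_sum has_bochner_integral_scaleR_right
        has_bochner_integral_edgeworth_term h0)
  moreover have "(exp (\<sigma> * x) * std_normal_density x) *\<^sub>R iexp (t * x) +
        (\<Sum>k=1..m-2. (real n powr (- real k / 2)) *\<^sub>R ((exp (\<sigma> * x) * edgeworth_term M k x) *\<^sub>R iexp (t * x)))
      = (exp (\<sigma> * x) * edgeworth_approx M m n x) *\<^sub>R iexp (t * x)" for x
  proof -
    have "exp (\<sigma> * x) * edgeworth_approx M m n x
        = exp (\<sigma> * x) * std_normal_density x + (\<Sum>k=1..m-2. (real n powr (- real k / 2)) * (exp (\<sigma> * x) * edgeworth_term M k x))"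
      unfolding edgeworth_approx_def distrib_left sum_distrib_left by (simp only: mult_ac)
    then show ?thesis by (simp only: scaleR_scaleR scaleR_sum_left scaleR_add_left)
  qed
  moreover have "exp (?w\<^sup>2 / 2) + (\<Sum>k=1..m-2. (real n powr (- real k / 2)) *\<^sub>R (exp (?w\<^sup>2 / 2) * ?W k)) = edgeworth_laplace (sqrt n) ?w"
  proof -
    have "{..m-2} = insert 0 {1..m-2}" by auto
    then have "edgeworth_laplace (sqrt n) ?w = exp (?w\<^sup>2 / 2) * (1 + (\<Sum>k=1..m-2. of_real (1 / sqrt n) ^ k * ?W k))"
      unfolding edgeworth_laplace_def by (simp add: weight_poly_0)
    also have "\<dots> = exp (?w\<^sup>2 / 2) + (\<Sum>k=1..m-2. (real n powr (- real k / 2)) *\<^sub>R (exp (?w\<^sup>2 / 2) * ?W k))"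
      unfolding distrib_left sum_distrib_left pw scaleR_conv_of_real of_real_power by (simp only: mult_1_right mult_1_left mult_ac)
    finally show ?thesis by (rule sym)
  qed
  ultimately show ?thesis by (simp only:)
qed

lemma continuous_on_edgeworth_approx: "continuous_on A (edgeworth_approx M m n)"
  unfolding edgeworth_approx_def[abs_def] edgeworth_term_def std_normal_density_def
  by (intro continuous_intros) auto

end

section \<open>Outer frequencies\<close>

context block_densities
begin

text \<open>For |t| \<ge> \<delta> sqrt n the ordinary characteristic function at t / sqrt n is
  bounded away from 1. The truncated tilted transform differs from it by at most the mean distance
  between the cut-off tilting factor and 1, which is free of t and tends to 0.\<close>

lemma outer_bound:
  assumes \<delta>: "0 < \<delta>"
  shows "\<exists>\<theta>. 0 \<le> \<theta> \<and> \<theta> < 1 \<and> (\<forall>\<^sub>F n in sequentially. \<forall>\<sigma> t. \<bar>\<sigma>\<bar> = 1 \<longrightarrow> \<delta> * sqrt (real n) \<le> \<bar>t\<bar> \<longrightarrow>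
    cmod (trunc_laplace (law N) (sqrt (real n)) (Complex \<sigma> t)) \<le> \<theta>)"
proof -
  interpret L: prob_space "law N" by (rule prob_space_law) simp
  obtain \<theta>0 where \<theta>0: "\<theta>0 < 1" "\<And>t. \<delta> \<le> \<bar>t\<bar> \<Longrightarrow> cmod (char (law N) t) \<le> \<theta>0"
    using char_density_bounded_away[OF p_measurable p_nonneg p_mass \<delta>, of N] by auto
  define \<Delta> where "\<Delta> \<sigma> \<tau> = (\<integral>y. \<bar>indicator {-\<tau>..\<tau>} y * exp (\<sigma> * y / \<tau>) - 1\<bar> \<partial>law N)" for \<sigma> \<tau> :: real
  have bd: "\<bar>indicator {-\<tau>..\<tau>} y * exp (\<sigma> * y / \<tau>) - 1\<bar> \<le> exp 1 + 1" if "0 < \<tau>" "\<bar>\<sigma>\<bar> = 1" for \<sigma> \<tau> y :: real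
  proof (cases "y \<in> {-\<tau>..\<tau>}")
    case True
    have "\<bar>\<sigma> * y / \<tau>\<bar> \<le> 1" using True that by (simp add: abs_mult abs_divide abs_le_iff)
    from abs_le_D1[OF this] have "exp (\<sigma> * y / \<tau>) \<le> exp 1" by simp
    then have "\<bar>exp (\<sigma> * y / \<tau>) - 1\<bar> \<le> exp 1 + 1" using exp_gt_zero[of "\<sigma> * y / \<tau>"] by (subst abs_le_iff) linarith
    then show ?thesis using True by simp
  qed (simp add: add_nonneg_nonneg)
  have int\<Delta>: "integrable (law N) (\<lambda>y. \<bar>indicator {-\<tau>..\<tau>} y * exp (\<sigma> * y / \<tau>) - 1\<bar>)" if "0 < \<tau>" "\<bar>\<sigma>\<bar> = 1" for \<sigma> \<tau> :: real
    by (rule L.integrable_const_bound[where B = "exp 1 + 1"]) (use bd[OF that] in auto)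
  have lim: "(\<Delta> \<sigma> \<longlongrightarrow> 0) at_top" if \<sigma>: "\<bar>\<sigma>\<bar> = 1" for \<sigma>
  proof -
    have "((\<lambda>\<tau>. \<integral>y. \<bar>indicator {-\<tau>..\<tau>} y * exp (\<sigma> * y / \<tau>) - 1\<bar> \<partial>law N) \<longlongrightarrow> (\<integral>y. 0 \<partial>law N)) at_top"
    proof (rule integral_dominated_convergence_at_top[where w = "\<lambda>_. exp 1 + 1"])
      show "\<forall>\<^sub>F \<tau> in at_top. AE y in law N. norm \<bar>indicator {-\<tau>..\<tau>} y * exp (\<sigma> * y / \<tau>) - 1\<bar> \<le> exp 1 + 1"
        by (rule eventually_mono[OF eventually_gt_at_top[of 0]]) (use bd[OF _ \<sigma>] in auto)
      show "AE y in law N. ((\<lambda>\<tau>. \<bar>indicator {-\<tau>..\<tau>} y * exp (\<sigma> * y / \<tau>) - 1\<bar>) \<longlongrightarrow> 0) at_top"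
      proof (rule AE_I2)
        fix y :: real
        have "((\<lambda>\<tau>. \<sigma> * y / \<tau>) \<longlongrightarrow> 0) at_top"
          by (intro real_tendsto_divide_at_top[OF tendsto_const] filterlim_ident)
        then have "((\<lambda>\<tau>. \<bar>exp (\<sigma> * y / \<tau>) - 1\<bar>) \<longlongrightarrow> \<bar>exp 0 - 1\<bar>) at_top"
          by (intro tendsto_intros)
        then have "((\<lambda>\<tau>. \<bar>exp (\<sigma> * y / \<tau>) - 1\<bar>) \<longlongrightarrow> 0) at_top" by simp
        then show "((\<lambda>\<tau>. \<bar>indicator {-\<tau>..\<tau>} y * exp (\<sigma> * y / \<tau>) - 1\<bar>) \<longlongrightarrow> 0) at_top"
        proof (rule Lim_transform_eventually)
          show "\<forall>\<^sub>F \<tau> in at_top. \<bar>exp (\<sigma> * y / \<tau>) - 1\<bar> = \<bar>indicator {-\<tau>..\<tau>} y * exp (\<sigma> * y / \<tau>) - 1\<bar>"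
            by (rule eventually_mono[OF eventually_ge_at_top[of "\<bar>y\<bar>"]]) (auto simp: indicator_def abs_le_iff)
        qed
      qed
    qed auto
    then show ?thesis by (simp add: \<Delta>_def[abs_def])
  qed
  have le: "cmod (trunc_laplace (law N) \<tau> (Complex \<sigma> t)) \<le> cmod (char (law N) (t / \<tau>)) + \<Delta> \<sigma> \<tau>"
    if \<tau>: "0 < \<tau>" and \<sigma>: "\<bar>\<sigma>\<bar> = 1" for \<tau> \<sigma> t
  proof -
    have e: "indicator {-\<tau>..\<tau>} y *\<^sub>R exp (Complex \<sigma> t * of_real (y / \<tau>)) - iexp (t / \<tau> * y)
        = of_real (indicator {-\<tau>..\<tau>} y * exp (\<sigma> * y / \<tau>) - 1) * iexp (t / \<tau> * y)" for y
    proof -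
      have "Complex \<sigma> t * of_real (y / \<tau>) = of_real (\<sigma> * y / \<tau>) + \<i> * of_real (t / \<tau> * y)"
        by (simp add: complex_eq_iff)
      then have "exp (Complex \<sigma> t * of_real (y / \<tau>)) = of_real (exp (\<sigma> * y / \<tau>)) * iexp (t / \<tau> * y)"
        by (simp only: exp_add exp_of_real)
      then show ?thesis by (simp add: scaleR_conv_of_real algebra_simps)
    qed
    have i2: "integrable (law N) (\<lambda>y. iexp (t / \<tau> * y))" by (rule L.integrable_const_bound[where B = 1]) auto
    have "trunc_laplace (law N) \<tau> (Complex \<sigma> t) - char (law N) (t / \<tau>)
        = (\<integral>y. indicator {-\<tau>..\<tau>} y *\<^sub>R exp (Complex \<sigma> t * of_real (y / \<tau>)) - iexp (t / \<tau> * y) \<partial>law N)"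
      unfolding trunc_laplace_def char_def
      by (rule Bochner_Integration.integral_diff[symmetric, OF integrable_trunc_exp[OF L.finite_measure_axioms] i2]) simp
    then have "cmod (trunc_laplace (law N) \<tau> (Complex \<sigma> t) - char (law N) (t / \<tau>))
        \<le> (\<integral>y. cmod (of_real (indicator {-\<tau>..\<tau>} y * exp (\<sigma> * y / \<tau>) - 1) * iexp (t / \<tau> * y)) \<partial>law N)"
      unfolding e by (simp only: integral_norm_bound)
    also have "\<dots> = \<Delta> \<sigma> \<tau>"
      unfolding \<Delta>_def norm_mult norm_exp_i_times norm_of_real by simp
    finally show ?thesis using norm_triangle_sub[of "trunc_laplace (law N) \<tau> (Complex \<sigma> t)" "char (law N) (t / \<tau>)"] by linarith
  qed
  have ev: "\<forall>\<^sub>F n in sequentially. \<Delta> \<sigma> (sqrt (real n)) < (1 - \<theta>0) / 2" if "\<bar>\<sigma>\<bar> = 1" for \<sigma>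
    using \<theta>0(1) by (intro order_tendstoD(2)[OF filterlim_compose[OF lim[OF that] filterlim_sqrt_real]]) simp
  have e1: "\<forall>\<^sub>F n in sequentially. \<Delta> 1 (sqrt (real n)) < (1 - \<theta>0) / 2" and e2: "\<forall>\<^sub>F n in sequentially. \<Delta> (-1) (sqrt (real n)) < (1 - \<theta>0) / 2"
    by (rule ev; simp)+
  define \<theta> where "\<theta> = max 0 ((1 + \<theta>0) / 2)"
  have "\<forall>\<^sub>F n in sequentially. \<forall>\<sigma> t. \<bar>\<sigma>\<bar> = 1 \<longrightarrow> \<delta> * sqrt (real n) \<le> \<bar>t\<bar> \<longrightarrow>
    cmod (trunc_laplace (law N) (sqrt (real n)) (Complex \<sigma> t)) \<le> \<theta>"
    using e1 e2 eventually_gt_at_top[of 0]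
  proof eventually_elim
    case (elim n)
    show ?case
    proof (intro allI impI)
      fix \<sigma> t :: real assume \<sigma>: "\<bar>\<sigma>\<bar> = 1" and t: "\<delta> * sqrt (real n) \<le> \<bar>t\<bar>"
      have \<tau>: "0 < sqrt (real n)" using elim by simp
      have "\<delta> \<le> \<bar>t / sqrt (real n)\<bar>" using t \<tau> by (simp add: abs_divide le_divide_eq)
      then have "cmod (char (law N) (t / sqrt (real n))) \<le> \<theta>0" by (rule \<theta>0(2))
      moreover have "\<sigma> = 1 \<or> \<sigma> = -1" using \<sigma> by auto
      then have "\<Delta> \<sigma> (sqrt (real n)) < (1 - \<theta>0) / 2" using elim(1,2) by auto
      ultimately have "cmod (trunc_laplace (law N) (sqrt (real n)) (Complex \<sigma> t)) \<le> \<theta>0 + (1 - \<theta>0) / 2"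
        using le[OF \<tau> \<sigma>, of t] by linarith
      also have "\<dots> \<le> \<theta>" by (simp add: \<theta>_def field_simps)
      finally show "cmod (trunc_laplace (law N) (sqrt (real n)) (Complex \<sigma> t)) \<le> \<theta>" .
    qed
  qed
  moreover have "0 \<le> \<theta>" "\<theta> < 1" using \<theta>0 by (auto simp: \<theta>_def)
  ultimately show ?thesis by (intro exI[of _ \<theta>] conjI)
qed

text \<open>The defect 5 collects the omitted block, the roundings and the - 3.\<close>

lemma half_K_ge: "real n / (2 * real N) - 5 \<le> real (K n div 2 - 3)"
proof -
  have "n < N * (n div N + 1)" using N_ge_1 by (simp add: dividend_less_times_div)
  then have "real n < real N * (real (n div N) + 1)"
    by (metis of_nat_1 of_nat_add of_nat_less_iff of_nat_mult)
  then have "real n / real N < real (n div N) + 1" using N_ge_1 by (simp add: divide_less_eq mult.commute)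
  moreover have "n div N \<le> 2 * (K n div 2 - 3) + 8" unfolding K_def by linarith
  then have "real (n div N) \<le> 2 * real (K n div 2 - 3) + 8" by linarith
  ultimately have "real n / real N \<le> 2 * real (K n div 2 - 3) + 10" by linarith
  then show ?thesis by (simp add: field_simps)
qed

text \<open>K n grows linearly in n, so the geometric factor beats every power of n. The - 3 leaves
  room for the exponents i - 1 and i - 2 in the binomial remainder.\<close>

lemma power_half_K_tendsto_0:
  assumes "0 \<le> \<theta>" "\<theta> < 1"
  shows "(\<lambda>n. real n ^ k * \<theta> ^ (K n div 2 - 3)) \<longlonglongrightarrow> 0"
proof -
  \<comment> \<open>A positive base, so that its logarithm can be used even if \<theta> = 0.\<close>
  define \<theta>1 where "\<theta>1 = max \<theta> (1 / 2)"
  define c where "c = - ln \<theta>1"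
  have t: "0 < \<theta>1" "\<theta>1 < 1" "\<theta> \<le> \<theta>1" using assms by (auto simp: \<theta>1_def)
  have c: "0 < c" using t by (simp add: c_def)
  define d where "d = c / (2 * real N)"
  have d: "0 < d" using c N_ge_1 by (simp add: d_def)
  have *: "\<theta> ^ (K n div 2 - 3) \<le> exp (5 * c) * exp (- (d * real n))" for n
  proof -
    have "\<theta> ^ (K n div 2 - 3) \<le> \<theta>1 ^ (K n div 2 - 3)" using assms t by (intro power_mono) auto
    also have "\<dots> = exp (- c * real (K n div 2 - 3))"
      using t powr_realpow[of \<theta>1 "K n div 2 - 3"] by (simp add: powr_def c_def mult.commute)
    also have "\<dots> \<le> exp (- c * (real n / (2 * real N) - 5))"
      using mult_left_mono[OF half_K_ge[of n], of c] c by simp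
    also have "\<dots> = exp (5 * c) * exp (- (d * real n))"
      by (simp add: d_def exp_add[symmetric] algebra_simps)
    finally show ?thesis .
  qed
  have le: "norm (real n ^ k * \<theta> ^ (K n div 2 - 3)) \<le> exp (5 * c) * (real n ^ k * exp (- (d * real n)))" for n
    using assms mult_left_mono[OF *, of "real n ^ k"] by (simp add: mult_ac abs_mult)
  have "(\<lambda>n::nat. real n ^ k * exp (- (d * real n))) \<longlonglongrightarrow> 0"
    using d by real_asymp
  then have "(\<lambda>n. exp (5 * c) * (real n ^ k * exp (- (d * real n)))) \<longlonglongrightarrow> 0"
    by (rule tendsto_mult_right_zero)
  then show ?thesis by (rule Lim_null_comparison[rotated]) (use le in auto)
qed

end

section \<open>Terms with at least two capped factors\<close>

context block_densities
begin

text \<open>The terms of the binomial expansion of \<open>core\<^sup>i\<close> that contain \<open>capped\<close> at least twice.\<close>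

definition head :: "real \<Rightarrow> real \<Rightarrow> nat \<Rightarrow> adens" where
  "head L \<tau> i = (capped L \<tau>)\<^sup>2 * rem_poly (capped L \<tau>) (excess L \<tau>) i"

lemma core_power_eq:
  assumes "0 \<le> \<tau>" "0 \<le> L"
  shows "core \<tau> N ^ i = head L \<tau> i + (excess L \<tau> ^ i + of_nat i * capped L \<tau> * excess L \<tau> ^ (i - 1))"
  unfolding core_eq[OF assms] head_def by (subst power_add_eq_rem_poly) (simp only: add.assoc)

lemma atom_head [simp]: "atom (head L \<tau> i) = 0"
  by (simp add: head_def power2_eq_square)

definition hat_a :: "real \<Rightarrow> nat \<Rightarrow> real \<Rightarrow> real \<Rightarrow> complex" where
  "hat_a L n \<sigma> t = ch (tilt \<sigma> (capped L (sqrt n))) t"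

definition hat_b :: "real \<Rightarrow> nat \<Rightarrow> real \<Rightarrow> real \<Rightarrow> complex" where
  "hat_b L n \<sigma> t = ch (tilt \<sigma> (excess L (sqrt n))) t"

lemma mass_tilt_finite:
  assumes "0 < \<tau>" "0 \<le> L" "\<bar>\<sigma>\<bar> = 1"
  shows "mass (tilt \<sigma> (capped L \<tau>)) \<le> ennreal (exp 1)" "mass (tilt \<sigma> (excess L \<tau>)) \<le> ennreal (exp 1 * excess_mass L)"
    "mass (tilt \<sigma> (capped L \<tau>)) < \<infinity>" "mass (tilt \<sigma> (excess L \<tau>)) < \<infinity>"
proof -
  have "mass (tilt \<sigma> (capped L \<tau>)) \<le> ennreal (exp 1) * mass (capped L \<tau>)"
    by (rule mass_tilt_le) (use support_pieces assms in auto)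
  also have "\<dots> \<le> ennreal (exp 1) * 1" by (intro mult_left_mono mass_capped_le assms) simp
  finally show 1: "mass (tilt \<sigma> (capped L \<tau>)) \<le> ennreal (exp 1)" by simp
  have "mass (tilt \<sigma> (excess L \<tau>)) \<le> ennreal (exp 1) * mass (excess L \<tau>)"
    by (rule mass_tilt_le) (use support_pieces assms in auto)
  also have "\<dots> \<le> ennreal (exp 1) * ennreal (excess_mass L)" by (intro mult_left_mono mass_excess_le assms) simp
  finally show 2: "mass (tilt \<sigma> (excess L \<tau>)) \<le> ennreal (exp 1 * excess_mass L)" by (simp add: ennreal_mult')
  show "mass (tilt \<sigma> (capped L \<tau>)) < \<infinity>" "mass (tilt \<sigma> (excess L \<tau>)) < \<infinity>"
    by (rule le_less_trans[OF 1], simp) (rule le_less_trans[OF 2], simp)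
qed

lemma mass_tilt_head_finite:
  assumes "0 < \<tau>" "0 \<le> L" "\<bar>\<sigma>\<bar> = 1"
  shows "mass (tilt \<sigma> (head L \<tau> i)) < \<infinity>"
  unfolding head_def tilt_mult tilt_power tilt_rem_poly
  by (intro mass_finite_mult mass_power_finite mass_finite_rem_poly mass_tilt_finite(3,4) assms)

lemma ch_tilt_head:
  assumes "0 < n" "0 \<le> L" "\<bar>\<sigma>\<bar> = 1"
  shows "ch (tilt \<sigma> (head L (sqrt n) i)) t = (hat_a L n \<sigma> t)\<^sup>2 * rem_poly (hat_a L n \<sigma> t) (hat_b L n \<sigma> t) i"
proof -
  have \<tau>: "0 < sqrt (real n)" using assms by simp
  note f = mass_tilt_finite(3,4)[OF \<tau> assms(2,3)]
  have "ch (tilt \<sigma> (head L (sqrt n) i)) t = ch (tilt \<sigma> (capped L (sqrt n)) ^ 2) t * ch (rem_poly (tilt \<sigma> (capped L (sqrt n))) (tilt \<sigma> (excess L (sqrt n))) i) t"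
    unfolding head_def tilt_mult tilt_power tilt_rem_poly by (intro ch_mult mass_power_finite mass_finite_rem_poly f)
  then show ?thesis by (simp only: ch_power[OF f(1)] ch_rem_poly[OF f] hat_a_def hat_b_def)
qed

lemma hat_sum:
  assumes "0 < n" "0 \<le> L" "\<bar>\<sigma>\<bar> = 1"
  shows "hat_a L n \<sigma> t + hat_b L n \<sigma> t = trunc_laplace (law N) (sqrt n) (Complex \<sigma> t)"
proof -
  have \<tau>: "0 < sqrt (real n)" using assms by simp
  have "trunc_laplace (law N) (sqrt n) (Complex \<sigma> t) = ch (tilt \<sigma> (core (sqrt n) N)) t"
    by (rule ch_tilt_core[symmetric, OF \<tau> _ assms(3)]) simp
  also have "core (sqrt n) N = capped L (sqrt n) + excess L (sqrt n)" using \<tau> assms by (intro core_eq) auto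
  finally show ?thesis
    by (simp only: tilt_add ch_add[OF mass_tilt_finite(3,4)[OF \<tau> assms(2,3)]] hat_a_def hat_b_def)
qed

text \<open>Masses bound transforms. The condition on L keeps the excess below 1 / 2 even after
  tilting, which costs a factor e.\<close>

lemma hat_bounds:
  assumes "0 < n" "0 \<le> L" "\<bar>\<sigma>\<bar> = 1" and \<beta>: "exp 1 * excess_mass L \<le> 1 / 2"
  shows "cmod (hat_a L n \<sigma> t) \<le> exp 1" "cmod (hat_b L n \<sigma> t) \<le> 1 / 2"
proof -
  have \<tau>: "0 < sqrt (real n)" using assms by simp
  note m = mass_tilt_finite[OF \<tau> assms(2,3)]
  have "cmod (hat_a L n \<sigma> t) \<le> enn2real (mass (tilt \<sigma> (capped L (sqrt n))))"
    unfolding hat_a_def by (rule cmod_ch_le[OF m(3)])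
  also have "\<dots> \<le> exp 1" using m(1) by (simp add: enn2real_leI)
  finally show "cmod (hat_a L n \<sigma> t) \<le> exp 1" .
  have "cmod (hat_b L n \<sigma> t) \<le> enn2real (mass (tilt \<sigma> (excess L (sqrt n))))"
    unfolding hat_b_def by (rule cmod_ch_le[OF m(4)])
  also have "\<dots> \<le> exp 1 * excess_mass L" using m(2) excess_mass_nonneg[of L] by (intro enn2real_leI) auto
  finally show "cmod (hat_b L n \<sigma> t) \<le> 1 / 2" using \<beta> by simp
qed

lemma cmod_trunc_laplace_le:
  assumes "0 < \<tau>" "N \<le> l" "\<bar>\<sigma>\<bar> = 1"
  shows "cmod (trunc_laplace (law l) \<tau> (Complex \<sigma> t)) \<le> exp 1"
proof -
  have m: "mass (tilt \<sigma> (core \<tau> l)) \<le> ennreal (exp 1)"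
  proof -
    have "mass (tilt \<sigma> (core \<tau> l)) \<le> ennreal (exp 1) * mass (core \<tau> l)"
      by (rule mass_tilt_le) (use support_pieces assms in auto)
    also have "\<dots> \<le> ennreal (exp 1) * 1" by (intro mult_left_mono mass_core_le assms) simp
    finally show ?thesis by simp
  qed
  have "cmod (ch (tilt \<sigma> (core \<tau> l)) t) \<le> enn2real (mass (tilt \<sigma> (core \<tau> l)))"
    by (rule cmod_ch_le[OF mass_tilt_core_finite[OF assms]])
  also have "\<dots> \<le> exp 1" using m by (intro enn2real_leI) auto
  finally show ?thesis by (simp only: ch_tilt_core[OF assms])
qed

definition gauss_const :: real where
  "gauss_const = (\<integral>t. exp (- t\<^sup>2 / 32) \<partial>lborel)"

lemma nn_integral_gauss: "(\<integral>\<^sup>+t. ennreal (exp (- t\<^sup>2 / 32)) \<partial>lborel) = ennreal gauss_const"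
proof -
  have "integrable lborel (\<lambda>t::real. exp (- t\<^sup>2 / 32))"
    using integrable_gaussian[of "1 / 4"] by (simp add: power_divide)
  then show ?thesis unfolding gauss_const_def by (intro nn_integral_eq_integral) auto
qed

lemma gauss_const_nonneg: "0 \<le> gauss_const"
  unfolding gauss_const_def by (intro integral_nonneg_AE) auto

text \<open>The common shape of the integral estimates: a Gaussian part everywhere, a constant on
  the central interval, and outside it a multiple of the squared capped transform, integrable by
  Plancherel. Replacing sqrt n by n is affordable, since Y and Z will be smaller than every power of
  1 / n.\<close>

lemma three_part_integral_le:
  assumes n: "0 < n" and L: "0 \<le> L" and \<sigma>: "\<bar>\<sigma>\<bar> = 1" and nn: "0 \<le> X" "0 \<le> Y" "0 \<le> Z" and \<delta>: "0 < \<delta>"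
    and f: "\<And>t. \<bar>t\<bar> \<le> \<delta> * sqrt n \<Longrightarrow> f t \<le> X * exp (- t\<^sup>2 / 32) + Y"
      "\<And>t. \<delta> * sqrt n \<le> \<bar>t\<bar> \<Longrightarrow> f t \<le> X * exp (- t\<^sup>2 / 32) + Z * (cmod (hat_a L n \<sigma> t))\<^sup>2"
  shows "(\<integral>\<^sup>+t. ennreal (f t) \<partial>lborel) \<le> ennreal (X * gauss_const + Y * (2 * \<delta> * n) + Z * (2 * pi * (exp 1 * (n * L)) * exp 1))"
proof -
  have sq: "sqrt (real n) \<le> real n" using n by (intro real_le_lsqrt) (auto simp: power2_eq_square)
  let ?I = "{- (\<delta> * sqrt n)..\<delta> * sqrt n}"
  have [measurable]: "(\<lambda>t. hat_a L n \<sigma> t) \<in> borel_measurable borel"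
  proof -
    interpret finite_measure "density lborel (dens (tilt \<sigma> (capped L (sqrt n))))"
      by (rule finite_measure_density_lborel) (use mass_finiteD(2)[OF mass_tilt_finite(3)[of "sqrt n" L \<sigma>]] n L \<sigma> in auto)
    show ?thesis unfolding hat_a_def ch_def char_def by measurable
  qed
  have "(\<integral>\<^sup>+t. ennreal (f t) \<partial>lborel) \<le> (\<integral>\<^sup>+t. ennreal X * ennreal (exp (- t\<^sup>2 / 32)) + (ennreal Y * indicator ?I t + ennreal Z * ennreal ((cmod (hat_a L n \<sigma> t))\<^sup>2)) \<partial>lborel)"
  proof (rule nn_integral_mono)
    fix t
    show "ennreal (f t) \<le> ennreal X * ennreal (exp (- t\<^sup>2 / 32)) + (ennreal Y * indicator ?I t + ennreal Z * ennreal ((cmod (hat_a L n \<sigma> t))\<^sup>2))"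
    proof (cases "\<bar>t\<bar> \<le> \<delta> * sqrt n")
      case True
      then have "t \<in> ?I" by (auto simp: abs_le_iff)
      have "ennreal (f t) \<le> ennreal (X * exp (- t\<^sup>2 / 32) + Y)" by (rule ennreal_leI[OF f(1)[OF True]])
      also have "\<dots> = ennreal X * ennreal (exp (- t\<^sup>2 / 32)) + ennreal Y * indicator ?I t"
        using nn \<open>t \<in> ?I\<close> by (simp add: ennreal_mult' ennreal_plus)
      also have "\<dots> \<le> ennreal X * ennreal (exp (- t\<^sup>2 / 32)) + (ennreal Y * indicator ?I t + ennreal Z * ennreal ((cmod (hat_a L n \<sigma> t))\<^sup>2))"
        by (intro add_left_mono) simp
      finally show ?thesis .
    next
      case False
      then have "\<delta> * sqrt n \<le> \<bar>t\<bar>" by simp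
      then have "ennreal (f t) \<le> ennreal (X * exp (- t\<^sup>2 / 32) + Z * (cmod (hat_a L n \<sigma> t))\<^sup>2)" by (intro ennreal_leI f(2))
      also have "\<dots> = ennreal X * ennreal (exp (- t\<^sup>2 / 32)) + ennreal Z * ennreal ((cmod (hat_a L n \<sigma> t))\<^sup>2)"
        using nn by (simp add: ennreal_mult' ennreal_plus)
      also have "\<dots> \<le> ennreal X * ennreal (exp (- t\<^sup>2 / 32)) + (ennreal Y * indicator ?I t + ennreal Z * ennreal ((cmod (hat_a L n \<sigma> t))\<^sup>2))"
        by (intro add_left_mono) simp
      finally show ?thesis .
    qed
  qed
  also have "\<dots> = ennreal X * ennreal gauss_const + (ennreal Y * emeasure lborel ?I + ennreal Z * (\<integral>\<^sup>+t. ennreal ((cmod (hat_a L n \<sigma> t))\<^sup>2) \<partial>lborel))"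
    by (simp add: nn_integral_add nn_integral_cmult nn_integral_gauss[simplified] nn_integral_cmult_indicator)
  also have "\<dots> \<le> ennreal X * ennreal gauss_const + (ennreal Y * ennreal (2 * \<delta> * n) + ennreal Z * ennreal (2 * pi * (exp 1 * (n * L)) * exp 1))"
  proof (intro add_mono mult_left_mono)
    show "emeasure lborel ?I \<le> ennreal (2 * \<delta> * n)" using \<delta> sq by (simp add: ennreal_leI)
    have "(\<integral>\<^sup>+t. ennreal ((cmod (hat_a L n \<sigma> t))\<^sup>2) \<partial>lborel) \<le> ennreal (2 * pi * (exp 1 * (sqrt n * L)) * exp 1)"
      unfolding hat_a_def by (rule capped_Plancherel) (use n L \<sigma> in auto)
    also have "\<dots> \<le> ennreal (2 * pi * (exp 1 * (n * L)) * exp 1)"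
      using sq L by (intro ennreal_leI mult_right_mono mult_left_mono) auto
    finally show "(\<integral>\<^sup>+t. ennreal ((cmod (hat_a L n \<sigma> t))\<^sup>2) \<partial>lborel) \<le> ennreal (2 * pi * (exp 1 * (n * L)) * exp 1)" .
  qed auto
  also have "\<dots> = ennreal (X * gauss_const + Y * (2 * \<delta> * n) + Z * (2 * pi * (exp 1 * (n * L)) * exp 1))"
    using nn gauss_const_nonneg \<delta> L by (simp add: ennreal_plus ennreal_mult' add.assoc)
  finally show ?thesis .
qed

end

context block_densities
begin

text \<open>With half of the blocks central, at least a quarter of all summands is left: from n
  \<ge> 20 N on, the loss 5 N is at most n / 4.\<close>

lemma half_K_mult_ge: "20 * N \<le> n \<Longrightarrow> K n div 2 \<le> i \<Longrightarrow> real n / 4 \<le> real i * real N"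
proof -
  assume n: "20 * N \<le> n" and i: "K n div 2 \<le> i"
  have N: "0 < real N" using N_ge_1 by simp
  have "real n / (2 * real N) - 5 \<le> real i" using half_K_ge[of n] i by linarith
  then have "(real n / (2 * real N) - 5) * real N \<le> real i * real N" using N by (intro mult_right_mono) auto
  then have "real n / 2 - 5 * real N \<le> real i * real N" using N by (simp add: left_diff_distrib)
  moreover have "20 * real N \<le> real n" using n by linarith
  ultimately show ?thesis by linarith
qed

lemma K_mult_le: "K n * N \<le> n"
  unfolding K_def by (metis diff_le_self div_times_less_eq_dividend le_trans mult_le_mono1)

lemma K_le: "K n \<le> n"
  using K_mult_le[of n] N_ge_1 by (metis le_trans mult.commute mult_le_mono1 nat_mult_1)

text \<open>\<omega> decays faster than every power of 1 / n. Centrally, leaving out the terms with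
  fewer than two capped factors is negligible; outside, the squared capped transform is kept as a
  factor because the integrability comes from it.\<close>

definition head_estimate :: "real \<Rightarrow> real \<Rightarrow> (nat \<Rightarrow> real) \<Rightarrow> bool" where
  "head_estimate L \<delta> \<omega> \<longleftrightarrow> (\<forall>k. (\<lambda>n. real n ^ k * \<omega> n) \<longlonglongrightarrow> 0) \<and> (\<forall>n. 0 \<le> \<omega> n) \<and>
    (\<forall>\<^sub>F n in sequentially. \<forall>i\<in>{K n div 2..K n}. \<forall>\<sigma> t. \<bar>\<sigma>\<bar> = 1 \<longrightarrow>
      (\<bar>t\<bar> \<le> \<delta> * sqrt n \<longrightarrow> cmod (ch (tilt \<sigma> (head L (sqrt n) i)) t - trunc_laplace (law N) (sqrt n) (Complex \<sigma> t) ^ i) \<le> (1 + exp 1 * n) * \<omega> n) \<and>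
      (\<delta> * sqrt n \<le> \<bar>t\<bar> \<longrightarrow> cmod (ch (tilt \<sigma> (head L (sqrt n) i)) t) \<le> real n ^ 2 * \<omega> n * (cmod (hat_a L n \<sigma> t))\<^sup>2))"

text \<open>With a, b for the transforms of capped part and excess, the missing terms b^i and i a
  b^(i-1) are tiny because |b| \<le> 1 / 2. In the outer range |a + b| \<le> \<theta> and |b| \<le>
  1 / 2 bound the cofactor of a^2; q is a common base for both.\<close>

lemma head_hat:
  assumes \<delta>: "decay_radius \<delta>" and L: "0 \<le> L" and \<beta>: "exp 1 * excess_mass L \<le> 1 / 2"
  shows "\<exists>\<omega>. head_estimate L \<delta> \<omega>"
proof -
  have \<delta>0: "0 < \<delta>" using \<delta> by (simp add: decay_radius_def)
  from outer_bound[OF \<delta>0] obtain \<theta> where h: "0 \<le> \<theta> \<and> \<theta> < 1 \<and> (\<forall>\<^sub>F n in sequentially. \<forall>\<sigma> t. \<bar>\<sigma>\<bar> = 1 \<longrightarrow> \<delta> * sqrt (real n) \<le> \<bar>t\<bar> \<longrightarrow>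
    cmod (trunc_laplace (law N) (sqrt (real n)) (Complex \<sigma> t)) \<le> \<theta>)" ..
  define q where "q = max \<theta> (1 / 2)"
  have q: "0 \<le> q" "q < 1" "\<theta> \<le> q" "1 / 2 \<le> q" using h by (auto simp: q_def)
  define \<omega> where "\<omega> n = q ^ (K n div 2 - 3)" for n
  have \<omega>: "0 \<le> \<omega> n" for n using q by (simp add: \<omega>_def)
  have "\<forall>\<^sub>F n in sequentially. \<forall>i\<in>{K n div 2..K n}. \<forall>\<sigma> t. \<bar>\<sigma>\<bar> = 1 \<longrightarrow>
      (\<bar>t\<bar> \<le> \<delta> * sqrt n \<longrightarrow> cmod (ch (tilt \<sigma> (head L (sqrt n) i)) t - trunc_laplace (law N) (sqrt n) (Complex \<sigma> t) ^ i) \<le> (1 + exp 1 * n) * \<omega> n) \<and>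
      (\<delta> * sqrt n \<le> \<bar>t\<bar> \<longrightarrow> cmod (ch (tilt \<sigma> (head L (sqrt n) i)) t) \<le> real n ^ 2 * \<omega> n * (cmod (hat_a L n \<sigma> t))\<^sup>2)"
    using conjunct2[OF conjunct2[OF h]] eventually_gt_at_top[of 0]
  proof eventually_elim
    case (elim n)
    show ?case
    proof (intro ballI allI impI)
      fix i \<sigma> t assume i: "i \<in> {K n div 2..K n}" and \<sigma>: "\<bar>\<sigma>\<bar> = (1::real)"
      let ?a = "hat_a L n \<sigma> t" and ?b = "hat_b L n \<sigma> t" and ?F = "trunc_laplace (law N) (sqrt n) (Complex \<sigma> t)"
      note ab = hat_bounds[OF elim(2) L \<sigma> \<beta>, of t]
      have sum: "?a + ?b = ?F" by (rule hat_sum[OF elim(2) L \<sigma>])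
      have c: "ch (tilt \<sigma> (head L (sqrt n) i)) t = ?a\<^sup>2 * rem_poly ?a ?b i" by (rule ch_tilt_head[OF elim(2) L \<sigma>])
      have bq: "cmod ?b \<le> q" using ab q by linarith
      have i_n: "real i \<le> real n" using i K_le[of n] by simp
      have qp: "q ^ j \<le> \<omega> n" if "K n div 2 - 3 \<le> j" for j
        unfolding \<omega>_def using that q by (intro power_decreasing) auto
      have pow: "cmod ?b ^ j \<le> \<omega> n" if "K n div 2 - 3 \<le> j" for j
        using power_mono[OF bq, of j] qp[OF that] by simp
      have central: "cmod (ch (tilt \<sigma> (head L (sqrt n) i)) t - ?F ^ i) \<le> (1 + exp 1 * n) * \<omega> n"
      proof -
        have "?F ^ i = ?a\<^sup>2 * rem_poly ?a ?b i + ?b ^ i + of_nat i * ?a * ?b ^ (i - 1)"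
          unfolding sum[symmetric] by (rule power_add_eq_rem_poly)
        then have d: "ch (tilt \<sigma> (head L (sqrt n) i)) t - ?F ^ i = - (?b ^ i + of_nat i * ?a * ?b ^ (i - 1))"
          unfolding c by simp
        have "cmod (ch (tilt \<sigma> (head L (sqrt n) i)) t - ?F ^ i) \<le> cmod ?b ^ i + real i * cmod ?a * cmod ?b ^ (i - 1)"
          unfolding d norm_minus_cancel
          using norm_triangle_ineq[of "?b ^ i" "of_nat i * ?a * ?b ^ (i - 1)"] by (simp add: norm_mult norm_power)
        also have "\<dots> \<le> \<omega> n + real n * exp 1 * \<omega> n"
          using i i_n ab \<omega> by (intro add_mono mult_mono pow) auto
        finally show ?thesis by (simp add: algebra_simps)
      qed
      have outer: "cmod (ch (tilt \<sigma> (head L (sqrt n) i)) t) \<le> real n ^ 2 * \<omega> n * (cmod ?a)\<^sup>2" if t: "\<delta> * sqrt n \<le> \<bar>t\<bar>"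
      proof -
        have "cmod ?F \<le> \<theta>" using elim(1) \<sigma> t by blast
        then have Fq: "cmod (?a + ?b) \<le> q" unfolding sum using q by linarith
        have "cmod (rem_poly ?a ?b i) \<le> real i ^ 2 * q ^ (i - 2)"
          by (rule norm_rem_poly_le[OF Fq bq]) (use q in simp)
        also have "\<dots> \<le> real n ^ 2 * \<omega> n"
          using i i_n q by (intro mult_mono power_mono qp) auto
        finally have "(cmod ?a)\<^sup>2 * cmod (rem_poly ?a ?b i) \<le> (cmod ?a)\<^sup>2 * (real n ^ 2 * \<omega> n)"
          by (rule mult_left_mono) simp
        then show ?thesis unfolding c norm_mult norm_power by (simp only: mult_ac)
      qed
      show "(\<bar>t\<bar> \<le> \<delta> * sqrt n \<longrightarrow> cmod (ch (tilt \<sigma> (head L (sqrt n) i)) t - ?F ^ i) \<le> (1 + exp 1 * n) * \<omega> n) \<and>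
        (\<delta> * sqrt n \<le> \<bar>t\<bar> \<longrightarrow> cmod (ch (tilt \<sigma> (head L (sqrt n) i)) t) \<le> real n ^ 2 * \<omega> n * (cmod ?a)\<^sup>2)"
        using central outer by (intro conjI impI)
    qed
  qed
  moreover have "\<forall>k. (\<lambda>n. real n ^ k * \<omega> n) \<longlonglongrightarrow> 0"
    unfolding \<omega>_def using power_half_K_tendsto_0[OF q(1,2)] by blast
  moreover have "\<forall>n. 0 \<le> \<omega> n" using \<omega> ..
  ultimately show ?thesis unfolding head_estimate_def by (intro exI[of _ \<omega>] conjI)
qed

lemma tilted_to_weighted:
  assumes z: "atom z = 0" and "g \<in> borel_measurable borel" and B: "0 \<le> B"
    and "\<And>\<sigma>. \<bar>\<sigma>\<bar> = 1 \<Longrightarrow> mass (tilt \<sigma> z) < \<infinity>"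
    and "\<And>\<sigma> t. \<bar>\<sigma>\<bar> = 1 \<Longrightarrow> has_bochner_integral lborel (\<lambda>x. (exp (\<sigma> * x) * g x) *\<^sub>R iexp (t * x)) (G \<sigma> t)"
    and "\<And>\<sigma>. \<bar>\<sigma>\<bar> = 1 \<Longrightarrow> (\<integral>\<^sup>+t. ennreal (cmod (ch (tilt \<sigma> z) t - G \<sigma> t)) \<partial>lborel) \<le> ennreal B"
  shows "AE x in lborel. dens z x < \<infinity> \<and> poly_weight s x * \<bar>enn2real (dens z x) - g x\<bar> \<le> exp (1 - s + s * ln s) * (B / (2 * pi))"
proof -
  have "AE x in lborel. dens z x < \<infinity> \<and> exp \<bar>x\<bar> * \<bar>enn2real (dens z x) - g x\<bar> \<le> B / (2 * pi)"
    by (rule AE_tilted_diff_le[where G = G]) (use assms in auto)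
  then show ?thesis
  proof (rule eventually_mono, elim conjE, intro conjI)
    fix x :: real assume a: "exp \<bar>x\<bar> * \<bar>enn2real (dens z x) - g x\<bar> \<le> B / (2 * pi)"
    have "poly_weight s x \<le> exp (1 - s + s * ln s) * exp \<bar>x\<bar>"
      unfolding poly_weight_def by (rule one_plus_powr_le_exp) (use s_ge_2 in auto)
    then have "poly_weight s x * \<bar>enn2real (dens z x) - g x\<bar> \<le> exp (1 - s + s * ln s) * exp \<bar>x\<bar> * \<bar>enn2real (dens z x) - g x\<bar>"
      by (rule mult_right_mono) simp
    also have "\<dots> \<le> exp (1 - s + s * ln s) * (B / (2 * pi))"
      using mult_left_mono[OF a, of "exp (1 - s + s * ln s)"] by (simp only: mult.assoc exp_ge_zero)
    finally show "poly_weight s x * \<bar>enn2real (dens z x) - g x\<bar> \<le> exp (1 - s + s * ln s) * (B / (2 * pi))" .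
  qed
qed

text \<open>The Fourier bound with comparison function 0. It is uniform in i because i \<ge> K n div
  2 central blocks keep a Gaussian of fixed width. These heads are the good factors to which tails
  get attached.\<close>

lemma wbounded_head:
  assumes L: "0 \<le> L" and \<beta>: "exp 1 * excess_mass L \<le> 1 / 2"
  shows "\<exists>C\<ge>0. \<forall>\<^sub>F n in sequentially. \<forall>i\<in>{K n div 2..K n}. weight.wbounded (ennreal C) (head L (sqrt n) i)"
proof -
  obtain \<delta> where \<delta>: "decay_radius \<delta>" using ex_decay_radius ..
  then have \<delta>0: "0 < \<delta>" by (auto simp: decay_radius_def)
  note dec = \<delta>[unfolded decay_radius_def, THEN conjunct2, THEN conjunct2, THEN conjunct2]
  from head_hat[OF \<delta> L \<beta>] obtain \<omega> where "head_estimate L \<delta> \<omega>" ..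
  note h = this[unfolded head_estimate_def]
  note w = conjunct1[OF h, rule_format] conjunct1[OF conjunct2[OF h], rule_format] conjunct2[OF conjunct2[OF h]]
  have w3: "\<forall>\<^sub>F n in sequentially. real n ^ 3 * \<omega> n < 1" by (rule order_tendstoD(2)[OF w(1)]) simp
  define B where "B = exp 3 * gauss_const + (1 + exp 1) * (2 * \<delta>) + 2 * pi * (exp 1 * L) * exp 1"
  have B: "0 \<le> B" unfolding B_def using gauss_const_nonneg \<delta>0 L by (intro add_nonneg_nonneg mult_nonneg_nonneg) auto
  define C where "C = exp (1 - s + s * ln s) * (B / (2 * pi))"
  have "\<forall>\<^sub>F n in sequentially. \<forall>i\<in>{K n div 2..K n}. weight.wbounded (ennreal C) (head L (sqrt n) i)"
    using dec w(3) w3 eventually_ge_at_top[of "20 * N"]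
  proof eventually_elim
    case (elim n)
    have n0: "0 < n" using elim(4) N_ge_1 by linarith
    then have n1: "1 \<le> real n" by simp
    have pw: "real n ^ k \<le> real n ^ 3" if "k \<le> 3" for k by (rule power_increasing[OF that n1])
    have w1: "real n ^ k * \<omega> n \<le> 1" if "k \<le> 3" for k
      using mult_right_mono[OF pw[OF that] w(2)] elim(3) by (meson less_imp_le order_trans)
    show ?case
    proof
      fix i assume i: "i \<in> {K n div 2..K n}"
      let ?z = "head L (sqrt n) i"
      have int: "(\<integral>\<^sup>+t. ennreal (cmod (ch (tilt \<sigma> ?z) t - 0)) \<partial>lborel) \<le> ennreal B" if \<sigma>: "\<bar>\<sigma>\<bar> = 1" for \<sigma>
      proof -
        have "(\<integral>\<^sup>+t. ennreal (cmod (ch (tilt \<sigma> ?z) t - 0)) \<partial>lborel) \<le>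
          ennreal (exp 3 * gauss_const + (1 + exp 1 * n) * \<omega> n * (2 * \<delta> * n) + real n ^ 2 * \<omega> n * (2 * pi * (exp 1 * (n * L)) * exp 1))"
        proof (rule three_part_integral_le[OF n0 L \<sigma> _ _ _ \<delta>0])
          show "0 \<le> (1 + exp 1 * real n) * \<omega> n" "0 \<le> real n ^ 2 * \<omega> n" using w(2) by (auto intro!: mult_nonneg_nonneg add_nonneg_nonneg)
          fix t
          let ?F = "trunc_laplace (law N) (sqrt n) (Complex \<sigma> t)"
          {
            assume t: "\<bar>t\<bar> \<le> \<delta> * sqrt n"
            \<comment> \<open>The share of the n summands carried by i blocks: c \<le> 1 bounds the
              constant 3 c, and c \<ge> 1 / 4 the decay.\<close>
            define c where "c = real i * real N / real n"
            have "real i * real N \<le> real n"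
              using i K_mult_le[of n] by (metis atLeastAtMost_iff le_trans mult_le_mono1 of_nat_le_iff of_nat_mult)
            then have c: "1 / 4 \<le> c" "c \<le> 1"
              using half_K_mult_ge[OF elim(4), of i] i n0 by (auto simp: c_def field_simps)
            have "cmod ?F \<le> exp (real N * (3 - t\<^sup>2 / 8) / real n)" using elim(1) N_ge_1 \<sigma> t by simp
            then have "cmod ?F ^ i \<le> exp (real N * (3 - t\<^sup>2 / 8) / real n) ^ i" by (rule power_mono) simp
            also have "\<dots> = exp (3 * c - c * (t\<^sup>2 / 8))"
              unfolding exp_of_nat_mult[symmetric] by (simp add: c_def algebra_simps diff_divide_distrib)
            also have "\<dots> \<le> exp (3 - 1 / 4 * (t\<^sup>2 / 8))"
              unfolding exp_le_cancel_iff using c by (intro diff_mono mult_right_mono) auto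
            also have "\<dots> = exp 3 * exp (- t\<^sup>2 / 32)" by (simp add: exp_add[symmetric])
            finally have 1: "cmod (?F ^ i) \<le> exp 3 * exp (- t\<^sup>2 / 32)" by (simp only: norm_power)
            have "cmod (ch (tilt \<sigma> ?z) t - ?F ^ i) \<le> (1 + exp 1 * n) * \<omega> n" using elim(2) i \<sigma> t by blast
            then show "cmod (ch (tilt \<sigma> ?z) t - 0) \<le> exp 3 * exp (- t\<^sup>2 / 32) + (1 + exp 1 * n) * \<omega> n"
              using 1 norm_triangle_sub[of "ch (tilt \<sigma> ?z) t" "?F ^ i"] by simp
          }
          {
            assume t: "\<delta> * sqrt n \<le> \<bar>t\<bar>"
            have "cmod (ch (tilt \<sigma> ?z) t) \<le> real n ^ 2 * \<omega> n * (cmod (hat_a L n \<sigma> t))\<^sup>2" using elim(2) i \<sigma> t by blast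
            then show "cmod (ch (tilt \<sigma> ?z) t - 0) \<le> exp 3 * exp (- t\<^sup>2 / 32) + real n ^ 2 * \<omega> n * (cmod (hat_a L n \<sigma> t))\<^sup>2"
              by (simp add: add_increasing)
          }
        qed simp
        also have "\<dots> \<le> ennreal B"
        proof (rule ennreal_leI)
          have "(1 + exp 1 * n) * \<omega> n * (2 * \<delta> * n) = (real n ^ 1 * \<omega> n + exp 1 * (real n ^ 2 * \<omega> n)) * (2 * \<delta>)" by (simp add: algebra_simps power2_eq_square)
          also have "\<dots> \<le> (1 + exp 1 * 1) * (2 * \<delta>)" using \<delta>0 by (intro mult_right_mono add_mono mult_left_mono w1) auto
          finally have 1: "(1 + exp 1 * n) * \<omega> n * (2 * \<delta> * n) \<le> (1 + exp 1) * (2 * \<delta>)" by simp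
          have "real n ^ 2 * \<omega> n * (2 * pi * (exp 1 * (n * L)) * exp 1) = (real n ^ 3 * \<omega> n) * (2 * pi * (exp 1 * L) * exp 1)" by (simp add: power2_eq_square power3_eq_cube)
          also have "\<dots> \<le> 1 * (2 * pi * (exp 1 * L) * exp 1)" using L by (intro mult_right_mono w1) auto
          finally show "exp 3 * gauss_const + (1 + exp 1 * n) * \<omega> n * (2 * \<delta> * n) + real n ^ 2 * \<omega> n * (2 * pi * (exp 1 * (n * L)) * exp 1) \<le> B"
            unfolding B_def using 1 by linarith
        qed
        finally show ?thesis .
      qed
      have "AE x in lborel. dens ?z x < \<infinity> \<and> poly_weight s x * \<bar>enn2real (dens ?z x) - 0\<bar> \<le> C"
        unfolding C_def
        by (rule tilted_to_weighted[where G = "\<lambda>_ _. 0", OF atom_head _ B mass_tilt_head_finite _ int]) (use n0 L in auto)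
      then have "AE x in lborel. ennreal (poly_weight s x) * dens ?z x \<le> ennreal C"
      proof (rule eventually_mono, elim conjE)
        fix x assume f: "dens ?z x < \<infinity>" and b: "poly_weight s x * \<bar>enn2real (dens ?z x) - 0\<bar> \<le> C"
        have "ennreal (poly_weight s x) * dens ?z x = ennreal (poly_weight s x) * ennreal (enn2real (dens ?z x))"
          using f by simp
        also have "\<dots> = ennreal (poly_weight s x * enn2real (dens ?z x))" by (simp add: ennreal_mult'' )
        also have "\<dots> \<le> ennreal C" using b by (intro ennreal_leI) simp
        finally show "ennreal (poly_weight s x) * dens ?z x \<le> ennreal C" .
      qed
      then show "weight.wbounded (ennreal C) ?z" by (simp add: weight.wbounded_def)
    qed
  qed
  moreover have "0 \<le> C" using B by (simp add: C_def)
  ultimately show ?thesis by blast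
qed

end

section \<open>The tail-free main part\<close>

context block_densities
begin

text \<open>An error smaller than every power of 1 / n becomes o(1) times the rate after
  multiplication by n^m, since s - 2 \<le> 2 m.\<close>

lemma one_le_power_mult_powr: "0 < n \<Longrightarrow> 1 \<le> real n ^ m * rate n"
proof -
  assume n: "0 < n"
  then have n1: "1 \<le> real n" by simp
  have "s - 2 \<le> 2 * real m" using s_bounds by linarith
  then have "1 \<le> real n powr (real m + - (s - 2) / 2)" using n1 by (intro ge_one_powr_ge_zero) (auto simp: field_simps)
  then show ?thesis unfolding powr_add using n by (simp add: powr_realpow)
qed

text \<open>No tail occurs here, not even in the last block; this is what lets both tilts have
  finite mass.\<close>

definition main_part :: "real \<Rightarrow> nat \<Rightarrow> adens" where
  "main_part L n = head L (sqrt n) (K n) * core (sqrt n) (last_len n)"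

lemma atom_main_part: "atom (main_part L n) = 0"
  by (simp add: main_part_def)

definition approximates :: "(nat \<Rightarrow> adens) \<Rightarrow> (nat \<Rightarrow> real) \<Rightarrow> bool" where
  "approximates z \<epsilon> \<longleftrightarrow> \<epsilon> \<longlonglongrightarrow> 0 \<and> (\<forall>\<^sub>F n in sequentially. AE x in lborel. dens (z n) x < \<infinity> \<and>
    poly_weight s x * \<bar>enn2real (dens (z n) x) - edgeworth_approx M m n x\<bar> \<le> \<epsilon> n * rate n)"

text \<open>Central frequencies use \<open>central_approx\<close> and the negligible change in the
  head. Outside, the two transforms are estimated separately; the Edgeworth transform is
  exponentially small in n there.\<close>

lemma main_part_approx:
  assumes L: "0 \<le> L" and \<beta>: "exp 1 * excess_mass L \<le> 1 / 2"
  shows "\<exists>\<epsilon>. approximates (main_part L) \<epsilon>"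
proof -
  obtain \<delta> where \<delta>: "decay_radius \<delta>" using ex_decay_radius ..
  then have \<delta>0: "0 < \<delta>" by (simp add: decay_radius_def)
  from head_hat[OF \<delta> L \<beta>] obtain \<omega> where "head_estimate L \<delta> \<omega>" ..
  note h = this[unfolded head_estimate_def]
  note w = conjunct1[OF h, rule_format] conjunct1[OF conjunct2[OF h], rule_format] conjunct2[OF conjunct2[OF h]]
  from central_approx[OF \<delta>] obtain \<epsilon>1 :: "nat \<Rightarrow> real" where h: "\<epsilon>1 \<longlonglongrightarrow> 0 \<and> (\<forall>\<^sub>F n in sequentially. 0 \<le> \<epsilon>1 n \<and> (\<forall>\<sigma> t. \<bar>\<sigma>\<bar> = 1 \<longrightarrow> \<bar>t\<bar> \<le> \<delta> * sqrt n \<longrightarrow>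
    cmod (trunc_laplace (law N) (sqrt n) (Complex \<sigma> t) ^ K n * trunc_laplace (law (last_len n)) (sqrt n) (Complex \<sigma> t)
      - edgeworth_laplace (sqrt n) (Complex \<sigma> t)) \<le> \<epsilon>1 n * rate n * exp (- t\<^sup>2 / 32)))" ..
  note e1 = conjunct1[OF h] conjunct2[OF h]
  from edgeworth_laplace_bound obtain C where h: "0 \<le> C \<and> (\<forall>\<tau>\<ge>1. \<forall>\<sigma> t. \<bar>\<sigma>\<bar> = 1 \<longrightarrow> cmod (edgeworth_laplace \<tau> (Complex \<sigma> t)) \<le> C * exp (- t\<^sup>2 / 4))" ..
  note C = conjunct1[OF h] conjunct2[OF h, rule_format]
  \<comment> \<open>7 / 32 = 1 / 4 - 1 / 32: the Gaussian exp (- t^2 / 32) is kept for the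
    integration, and the rest becomes exp (- d n) by t^2 \<ge> \<delta>^2 n.\<close>
  define d where "d = 7 / 32 * \<delta>\<^sup>2"
  have d: "0 < d" using \<delta>0 by (simp add: d_def)
  define R where "R n = C * exp (- d * real n) * gauss_const + exp 1 * ((1 + exp 1 * n) * \<omega> n) * (2 * \<delta> * n)
      + real n ^ 2 * \<omega> n * exp 1 * (2 * pi * (exp 1 * (n * L)) * exp 1)" for n :: nat
  define c where "c = exp (1 - s + s * ln s) / (2 * pi)"
  have c: "0 \<le> c" by (simp add: c_def)
  define \<epsilon> where "\<epsilon> n = c * (\<epsilon>1 n * gauss_const + real n ^ m * R n)" for n
  have "(\<lambda>n. real n ^ m * R n) \<longlonglongrightarrow> 0"
  proof -
    have "(\<lambda>n. real n ^ m * exp (- d * real n)) \<longlonglongrightarrow> 0" using d by real_asymp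
    then have "(\<lambda>n. (C * gauss_const) * (real n ^ m * exp (- d * real n)) + (exp 1 * 2 * \<delta>) * (real n ^ (m + 1) * \<omega> n)
      + (exp 1 * exp 1 * 2 * \<delta>) * (real n ^ (m + 2) * \<omega> n) + (exp 1 * 2 * pi * exp 1 * exp 1 * L) * (real n ^ (m + 3) * \<omega> n)) \<longlonglongrightarrow> 0"
      by (intro tendsto_add_zero tendsto_mult_right_zero w(1))
    then show ?thesis
      by (simp add: R_def distrib_left distrib_right power_add power2_eq_square power3_eq_cube mult_ac add.assoc)
  qed
  then have "\<epsilon> \<longlonglongrightarrow> c * (0 * gauss_const + 0)"
    unfolding \<epsilon>_def[abs_def] by (intro tendsto_intros e1)
  then have lim: "\<epsilon> \<longlonglongrightarrow> 0" by simp
  have "\<forall>\<^sub>F n in sequentially. AE x in lborel. dens (main_part L n) x < \<infinity> \<and>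
    poly_weight s x * \<bar>enn2real (dens (main_part L n) x) - edgeworth_approx M m n x\<bar> \<le> \<epsilon> n * rate n"
    using w(3) e1(2) eventually_gt_at_top[of 0]
  proof eventually_elim
    case (elim n)
    have n1: "1 \<le> real n" using elim(3) by simp
    have sq1: "1 \<le> sqrt (real n)" using n1 by simp
    define p2 where "p2 = rate n"
    have p2: "0 < p2" using elim(3) by (simp add: p2_def)
    have pn: "1 \<le> real n ^ m * p2" unfolding p2_def by (rule one_le_power_mult_powr[OF elim(3)])
    have R0: "0 \<le> R n" unfolding R_def using C(1) gauss_const_nonneg w(2) \<delta>0 L
      by (intro add_nonneg_nonneg mult_nonneg_nonneg) auto
    let ?z = "main_part L n" let ?l = "last_len n"
    define B where "B = \<epsilon>1 n * p2 * gauss_const + R n"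
    have B: "0 \<le> B" unfolding B_def using elim(2) p2 gauss_const_nonneg R0 by (intro add_nonneg_nonneg mult_nonneg_nonneg) auto
    have l: "N \<le> ?l" using last_len[of n] by simp
    have fin: "mass (tilt \<sigma> ?z) < \<infinity>" if "\<bar>\<sigma>\<bar> = 1" for \<sigma>
      unfolding main_part_def tilt_mult
      by (intro mass_finite_mult mass_tilt_head_finite mass_tilt_core_finite l that L) (use elim(3) in auto)
    have int: "(\<integral>\<^sup>+t. ennreal (cmod (ch (tilt \<sigma> ?z) t - edgeworth_laplace (sqrt n) (Complex \<sigma> t))) \<partial>lborel) \<le> ennreal B"
      if \<sigma>: "\<bar>\<sigma>\<bar> = 1" for \<sigma>
    proof -
      define X where "X = \<epsilon>1 n * p2 + C * exp (- d * real n)"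
      have X: "0 \<le> \<epsilon>1 n * p2" "0 \<le> C * exp (- d * real n)" using elim(2) p2 C(1) by auto
      have "(\<integral>\<^sup>+t. ennreal (cmod (ch (tilt \<sigma> ?z) t - edgeworth_laplace (sqrt n) (Complex \<sigma> t))) \<partial>lborel)
        \<le> ennreal (X * gauss_const + exp 1 * ((1 + exp 1 * n) * \<omega> n) * (2 * \<delta> * n)
          + real n ^ 2 * \<omega> n * exp 1 * (2 * pi * (exp 1 * (n * L)) * exp 1))"
      proof (rule three_part_integral_le[OF elim(3) L \<sigma> _ _ _ \<delta>0])
        show "0 \<le> X" using X by (simp add: X_def)
        show "0 \<le> exp 1 * ((1 + exp 1 * real n) * \<omega> n)" "0 \<le> real n ^ 2 * \<omega> n * exp 1" using w(2) by (auto intro!: mult_nonneg_nonneg add_nonneg_nonneg)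
        fix t
        let ?F = "trunc_laplace (law N) (sqrt n) (Complex \<sigma> t)" and ?G = "trunc_laplace (law ?l) (sqrt n) (Complex \<sigma> t)"
        let ?H = "ch (tilt \<sigma> (head L (sqrt n) (K n))) t" and ?E = "edgeworth_laplace (sqrt n) (Complex \<sigma> t)"
        have "ch (tilt \<sigma> ?z) t = ?H * ch (tilt \<sigma> (core (sqrt n) ?l)) t"
          unfolding main_part_def tilt_mult
          by (intro ch_mult mass_tilt_head_finite mass_tilt_core_finite l \<sigma> L) (use elim(3) in auto)
        also have "ch (tilt \<sigma> (core (sqrt n) ?l)) t = ?G" by (rule ch_tilt_core[OF _ l \<sigma>]) (use elim(3) in simp)
        finally have z: "ch (tilt \<sigma> ?z) t = ?H * ?G" .
        have G: "cmod ?G \<le> exp 1" by (rule cmod_trunc_laplace_le[OF _ l \<sigma>]) (use elim(3) in simp)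
        have KK: "K n \<in> {K n div 2..K n}" by simp
        {
          assume t: "\<bar>t\<bar> \<le> \<delta> * sqrt n"
          have 1: "cmod (?H - ?F ^ K n) \<le> (1 + exp 1 * n) * \<omega> n" using elim(1) KK \<sigma> t by blast
          have 2: "cmod (?F ^ K n * ?G - ?E) \<le> \<epsilon>1 n * p2 * exp (- t\<^sup>2 / 32)" unfolding p2_def using elim(2) \<sigma> t by blast
          have 4: "cmod (?H * ?G - ?E) \<le> cmod ((?H - ?F ^ K n) * ?G) + cmod (?F ^ K n * ?G - ?E)"
            using norm_triangle_ineq[of "(?H - ?F ^ K n) * ?G" "?F ^ K n * ?G - ?E"] by (simp add: algebra_simps)
          have "cmod ((?H - ?F ^ K n) * ?G) \<le> (1 + exp 1 * n) * \<omega> n * exp 1"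
            unfolding norm_mult using 1 G by (intro mult_mono) (auto intro: order_trans[OF norm_ge_zero])
          also have "\<dots> = exp 1 * ((1 + exp 1 * n) * \<omega> n)" by (rule mult.commute)
          finally have 3: "cmod (?H * ?G - ?E) \<le> \<epsilon>1 n * p2 * exp (- t\<^sup>2 / 32) + exp 1 * ((1 + exp 1 * n) * \<omega> n)" using 2 4 by linarith
          have "\<epsilon>1 n * p2 * exp (- t\<^sup>2 / 32) \<le> X * exp (- t\<^sup>2 / 32)" using X by (intro mult_right_mono) (auto simp: X_def)
          then show "cmod (ch (tilt \<sigma> ?z) t - ?E) \<le> X * exp (- t\<^sup>2 / 32) + exp 1 * ((1 + exp 1 * n) * \<omega> n)"
            using 3 unfolding z by linarith
        }
        {
          assume t: "\<delta> * sqrt n \<le> \<bar>t\<bar>"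
          have 1: "cmod ?H \<le> real n ^ 2 * \<omega> n * (cmod (hat_a L n \<sigma> t))\<^sup>2" using elim(1) KK \<sigma> t by blast
          have "cmod (?H * ?G) \<le> real n ^ 2 * \<omega> n * (cmod (hat_a L n \<sigma> t))\<^sup>2 * exp 1"
            unfolding norm_mult using 1 G by (intro mult_mono) (auto intro: order_trans[OF norm_ge_zero])
          also have "\<dots> = real n ^ 2 * \<omega> n * exp 1 * (cmod (hat_a L n \<sigma> t))\<^sup>2" by (simp only: mult_ac)
          finally have 2: "cmod (?H * ?G) \<le> real n ^ 2 * \<omega> n * exp 1 * (cmod (hat_a L n \<sigma> t))\<^sup>2" .
          have "(\<delta> * sqrt n)\<^sup>2 \<le> \<bar>t\<bar>\<^sup>2" using t \<delta>0 by (intro power_mono) auto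
          then have "\<delta>\<^sup>2 * real n \<le> t\<^sup>2" by (simp add: power_mult_distrib)
          then have "- t\<^sup>2 / 4 \<le> - d * real n + - t\<^sup>2 / 32" by (simp add: d_def field_simps)
          then have "exp (- t\<^sup>2 / 4) \<le> exp (- d * real n) * exp (- t\<^sup>2 / 32)"
            unfolding exp_add[symmetric] exp_le_cancel_iff .
          then have "C * exp (- t\<^sup>2 / 4) \<le> C * (exp (- d * real n) * exp (- t\<^sup>2 / 32))" by (rule mult_left_mono[OF _ C(1)])
          also have "\<dots> \<le> X * exp (- t\<^sup>2 / 32)" unfolding mult.assoc[symmetric] using X by (intro mult_right_mono) (auto simp: X_def)
          finally have "cmod ?E \<le> X * exp (- t\<^sup>2 / 32)" using C(2)[OF sq1 \<sigma>, of t] by linarith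
          then show "cmod (ch (tilt \<sigma> ?z) t - ?E) \<le> X * exp (- t\<^sup>2 / 32) + real n ^ 2 * \<omega> n * exp 1 * (cmod (hat_a L n \<sigma> t))\<^sup>2"
            unfolding z using 2 norm_triangle_ineq4[of "?H * ?G" ?E] by linarith
        }
      qed
      also have "\<dots> = ennreal B"
        unfolding B_def R_def X_def distrib_right by (simp only: add.assoc)
      finally show ?thesis .
    qed
    have "AE x in lborel. dens ?z x < \<infinity> \<and> poly_weight s x * \<bar>enn2real (dens ?z x) - edgeworth_approx M m n x\<bar> \<le> exp (1 - s + s * ln s) * (B / (2 * pi))"
      by (rule tilted_to_weighted[OF atom_main_part _ B fin has_bochner_integral_edgeworth_approx[OF elim(3)] int])
         (rule borel_measurable_continuous_onI[OF continuous_on_edgeworth_approx])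
    moreover have "exp (1 - s + s * ln s) * (B / (2 * pi)) \<le> \<epsilon> n * p2"
    proof -
      have "R n \<le> real n ^ m * p2 * R n" using mult_right_mono[OF pn R0] by simp
      then have "B \<le> (\<epsilon>1 n * gauss_const + real n ^ m * R n) * p2" unfolding B_def by (simp add: algebra_simps)
      then have "c * B \<le> c * ((\<epsilon>1 n * gauss_const + real n ^ m * R n) * p2)" by (rule mult_left_mono[OF _ c])
      then show ?thesis by (simp add: c_def \<epsilon>_def mult.assoc)
    qed
    ultimately show ?case unfolding p2_def[symmetric] by (elim eventually_mono) (auto intro: order_trans)
  qed
  then show ?thesis using lim unfolding approximates_def by (intro exI[of _ \<epsilon>] conjI)
qed

end

section \<open>Expansion of the full convolution\<close>

context block_densities
begin

text \<open>A sum over the finitely many block lengths, hence a common bound that still tends to 0.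
  The factor 2 powr s stems from (1 + |x|)^s \<le> (2 |x|)^s.\<close>

definition tail_rate :: "nat \<Rightarrow> real" where
  "tail_rate n = 2 powr s * (\<Sum>l\<in>{N..<2*N}. \<eta> l (sqrt n))"

definition tail_bound :: "nat \<Rightarrow> real" where
  "tail_bound n = tail_rate n * real n powr (- s / 2)"

lemma tail_rate_nonneg: "0 \<le> tail_rate n"
  unfolding tail_rate_def by (intro mult_nonneg_nonneg sum_nonneg \<eta>_nonneg) simp

lemma tail_bound_nonneg: "0 \<le> tail_bound n"
  using tail_rate_nonneg by (simp add: tail_bound_def)

lemma tendsto_tail_rate: "tail_rate \<longlonglongrightarrow> 0"
proof -
  have "(\<lambda>n. 2 powr s * (\<Sum>l\<in>{N..<2*N}. \<eta> l (sqrt n))) \<longlonglongrightarrow> 2 powr s * (\<Sum>l\<in>{N..<2*N}. 0)"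
    by (intro tendsto_mult tendsto_const tendsto_sum filterlim_compose[OF tendsto_\<eta> filterlim_sqrt_real]) auto
  then show ?thesis by (simp add: tail_rate_def[abs_def])
qed

text \<open>A single tail has at most n places; each costs o(n^(-s/2)), and together they cost o(1)
  times the target rate.\<close>

lemma n_tail_bound: "0 < n \<Longrightarrow> real n * tail_bound n = tail_rate n * rate n"
proof -
  assume "0 < n"
  then have "real n * real n powr (- s / 2) = real n powr (1 + - s / 2)" by (simp add: powr_mult_base)
  also have "1 + - s / 2 = - (s - 2) / 2" by (simp add: field_simps)
  finally show ?thesis by (simp add: tail_bound_def)
qed

lemma tendsto_n_tail_bound: "(\<lambda>n. real n * tail_bound n) \<longlonglongrightarrow> 0"
proof (rule Lim_null_comparison[OF _ tendsto_tail_rate])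
  show "\<forall>\<^sub>F n in sequentially. norm (real n * tail_bound n) \<le> tail_rate n"
    using eventually_gt_at_top[of 0]
  proof eventually_elim
    case (elim n)
    have "rate n \<le> real n powr 0" using elim s_ge_2 by (intro powr_mono) auto
    then have "tail_rate n * rate n \<le> tail_rate n * 1"
      using elim by (intro mult_left_mono tail_rate_nonneg) simp
    then have "real n * tail_bound n \<le> tail_rate n" using n_tail_bound[OF elim] by simp
    moreover have "0 \<le> real n * tail_bound n" using tail_bound_nonneg by simp
    ultimately show ?case by simp
  qed
qed

lemma wmass_tail_bound:
  assumes "0 < n" "l \<in> {N..<2*N}"
  shows "wmass (poly_weight s) (tail (sqrt n) l) \<le> ennreal (tail_bound n)"
proof -
  have "wmass (poly_weight s) (tail (sqrt n) l) \<le> ennreal (2 powr s * sqrt n powr (- s) * \<eta> l (sqrt n))"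
    by (rule wmass_tail_le) (use assms in auto)
  also have "\<dots> \<le> ennreal (tail_bound n)"
  proof (rule ennreal_leI)
    have "\<eta> l (sqrt n) \<le> (\<Sum>l\<in>{N..<2*N}. \<eta> l (sqrt n))" by (rule member_le_sum[OF assms(2)]) (auto simp: \<eta>_nonneg)
    then have "(2 powr s * real n powr (- s / 2)) * \<eta> l (sqrt n) \<le> (2 powr s * real n powr (- s / 2)) * (\<Sum>l\<in>{N..<2*N}. \<eta> l (sqrt n))"
      by (rule mult_left_mono) simp
    then show "2 powr s * sqrt n powr (- s) * \<eta> l (sqrt n) \<le> tail_bound n"
      unfolding sqrt_powr[OF assms(1)] tail_bound_def tail_rate_def by (simp only: mult_ac)
  qed
  finally show ?thesis .
qed

lemma wmass_core_le: "0 < \<tau> \<Longrightarrow> N \<le> l \<Longrightarrow> wmass (poly_weight s) (core \<tau> l) \<le> ennreal (2 powr s)"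
  using order_trans[OF wmass_supported_le[of "core \<tau> l"] mult_left_mono[OF mass_core_le[of \<tau> l], of "ennreal (2 powr s)"]] support_pieces(1)
  by simp

lemma wmass_blk_le:
  assumes "0 < n" "l \<in> {N..<2*N}"
  shows "wmass (poly_weight s) (blk (sqrt n) l) \<le> ennreal (2 powr s + tail_bound n)"
  unfolding blk_eq weight.wmass_add using assms tail_bound_nonneg[of n]
  by (subst ennreal_plus) (auto intro!: add_mono wmass_core_le wmass_tail_bound)

text \<open>The convolution \<open>full n\<close> of all blocks is split into \<open>kept\<close>, every term of which contains the
  factor \<open>(capped L)\<^sup>2\<close>, and \<open>dropped\<close>, the terms of exponentially small mass.\<close>

definition full :: "nat \<Rightarrow> adens" where
  "full n = blk (sqrt n) N ^ K n * blk (sqrt n) (last_len n)"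

text \<open>The case j = 0 is split off, since there only the last block can supply a tail; the core
  of that block belongs to \<open>main_part\<close>.\<close>

definition tail_part :: "real \<Rightarrow> nat \<Rightarrow> adens" where
  "tail_part L n = head L (sqrt n) (K n) * tail (sqrt n) (last_len n) +
    (\<Sum>j\<in>{1..K n div 2}. head L (sqrt n) (K n - j) * (of_nat (K n choose j) * tail (sqrt n) N ^ j * blk (sqrt n) (last_len n)))"

definition kept :: "real \<Rightarrow> nat \<Rightarrow> adens" where
  "kept L n = main_part L n + tail_part L n"

definition excess_part :: "real \<Rightarrow> nat \<Rightarrow> adens" where
  "excess_part L n = (\<Sum>j\<in>{..K n div 2}. of_nat (K n choose j) * tail (sqrt n) N ^ j *
    (excess L (sqrt n) ^ (K n - j) + of_nat (K n - j) * capped L (sqrt n) * excess L (sqrt n) ^ (K n - j - 1)) * blk (sqrt n) (last_len n))"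

text \<open>Too few central factors for Fourier decay, but more than half of the blocks are tails,
  and their small masses outweigh the binomial coefficients.\<close>

definition many_tails :: "nat \<Rightarrow> adens" where
  "many_tails n = (\<Sum>j\<in>{K n div 2<..K n}. of_nat (K n choose j) * tail (sqrt n) N ^ j * core (sqrt n) N ^ (K n - j) * blk (sqrt n) (last_len n))"

definition dropped :: "real \<Rightarrow> nat \<Rightarrow> adens" where
  "dropped L n = excess_part L n + many_tails n"

lemma full_eq:
  assumes L: "0 \<le> L"
  shows "full n = kept L n + dropped L n"
proof -
  let ?\<tau> = "sqrt (real n)" let ?K = "K n" let ?J = "K n div 2"
  let ?d = "tail ?\<tau> N" and ?q = "blk ?\<tau> (last_len n)" and ?H = "head L ?\<tau>"
  let ?E = "\<lambda>i. excess L ?\<tau> ^ i + of_nat i * capped L ?\<tau> * excess L ?\<tau> ^ (i - 1)"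
  let ?f = "\<lambda>j. of_nat (?K choose j) * ?d ^ j * core ?\<tau> N ^ (?K - j) * ?q"
  have core: "core ?\<tau> N ^ i = ?H i + ?E i" for i by (rule core_power_eq) (use L in auto)
  have "blk ?\<tau> N = ?d + core ?\<tau> N" by (simp add: blk_eq add.commute)
  then have "full n = (\<Sum>j\<le>?K. ?f j)"
    unfolding full_def by (simp only: binomial_ring sum_distrib_right)
  also have "{..?K} = {..?J} \<union> {?J<..?K}" by auto
  also have "(\<Sum>j\<in>{..?J} \<union> {?J<..?K}. ?f j) = (\<Sum>j\<le>?J. ?f j) + many_tails n"
    unfolding many_tails_def by (rule sum.union_disjoint) auto
  also have "(\<Sum>j\<le>?J. ?f j) = (\<Sum>j\<le>?J. ?H (?K - j) * (of_nat (?K choose j) * ?d ^ j * ?q)) + excess_part L n"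
    unfolding excess_part_def sum.distrib[symmetric] core
    by (rule sum.cong[OF refl]) (simp only: distrib_left distrib_right mult_ac)
  also have "{..?J} = insert 0 {1..?J}" by auto
  also have "(\<Sum>j\<in>insert 0 {1..?J}. ?H (?K - j) * (of_nat (?K choose j) * ?d ^ j * ?q)) = kept L n"
    unfolding kept_def main_part_def tail_part_def by (simp add: blk_eq distrib_left add.assoc)
  finally show ?thesis by (simp add: dropped_def add.assoc)
qed

lemma one_plus_power_le:
  fixes x :: real
  assumes "0 \<le> x" "real k * x \<le> 1"
  shows "(x + 1) ^ k - 1 \<le> 2 * (real k * x)"
proof -
  have "(x + 1) ^ k \<le> exp x ^ k" using assms by (intro power_mono) (auto simp: add.commute)
  also have "\<dots> = exp (real k * x)" by (rule exp_of_nat_mult[symmetric])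
  also have "\<dots> \<le> 1 + real k * x + (real k * x)\<^sup>2" by (rule exp_bound) (use assms in auto)
  finally have "(x + 1) ^ k \<le> 1 + real k * x + (real k * x)\<^sup>2" .
  moreover have "(real k * x)\<^sup>2 \<le> real k * x * 1" unfolding power2_eq_square using assms by (intro mult_left_mono) auto
  ultimately show ?thesis by linarith
qed

lemma binomial_sum_le:
  fixes x :: real
  assumes "0 \<le> x" "real k * x \<le> 1"
  shows "(\<Sum>j\<in>{1..k div 2}. real (k choose j) * x ^ j) \<le> 2 * (real k * x)"
proof -
  have "(\<Sum>j\<in>{1..k div 2}. real (k choose j) * x ^ j) \<le> (\<Sum>j\<in>{1..k}. real (k choose j) * x ^ j)"
    by (rule sum_mono2) (use assms in auto)
  also have "(x + 1) ^ k = 1 + (\<Sum>j\<in>{1..k}. real (k choose j) * x ^ j)"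
  proof -
    have "{..k} = insert 0 {1..k}" by auto
    then show ?thesis by (simp add: binomial_ring)
  qed
  then have "(\<Sum>j\<in>{1..k}. real (k choose j) * x ^ j) = (x + 1) ^ k - 1" by simp
  finally show ?thesis using one_plus_power_le[OF assms] by linarith
qed

text \<open>Every term is a head, bounded with weight, convolved with measures of controlled
  weighted mass. With w for the tail bound, the sum of (K choose j) w^j over 1 \<le> j \<le> K div 2
  is at most (1 + w)^K - 1 \<le> 2 K w once K w \<le> 1, so all tails together cost no more than
  single ones do. In the constant, 1 is for the last block and 2 (2 powr s + 1) for the sum.\<close>

lemma wbounded_tail_part:
  assumes n: "0 < n" and C: "0 \<le> C" and H: "\<forall>i\<in>{K n div 2..K n}. weight.wbounded (ennreal C) (head L (sqrt n) i)"
    and small: "real n * tail_bound n \<le> 1"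
  shows "weight.wbounded (ennreal (C * (3 + 2 * 2 powr s) * (real n * tail_bound n))) (tail_part L n)"
proof -
  let ?w = "tail_bound n" let ?l = "last_len n" let ?K = "K n" let ?wm = "wmass (poly_weight s)"
  let ?d = "tail (sqrt n) N" let ?q = "blk (sqrt n) ?l"
  let ?S = "\<Sum>j\<in>{1..?K div 2}. C * (real (?K choose j) * ?w ^ j * (2 powr s + ?w))"
  let ?S1 = "\<Sum>j\<in>{1..?K div 2}. ennreal C * ?wm (of_nat (?K choose j) * ?d ^ j * ?q)"
  let ?S2 = "\<Sum>j\<in>{1..?K div 2}. ennreal C * ennreal (real (?K choose j) * ?w ^ j * (2 powr s + ?w))"
  have N: "N \<in> {N..<2*N}" using N_ge_1 by simp
  have w: "0 \<le> ?w" by (rule tail_bound_nonneg)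
  have n1: "1 \<le> real n" using n by simp
  have wn: "?w \<le> real n * ?w" using mult_right_mono[OF n1 w] by simp
  have Kn: "real ?K * ?w \<le> real n * ?w" using K_le[of n] w by (intro mult_right_mono) auto
  have t: "?wm (of_nat (?K choose j) * ?d ^ j * ?q) \<le> ennreal (real (?K choose j) * ?w ^ j * (2 powr s + ?w))" for j
  proof -
    have "?wm (of_nat (?K choose j) * ?d ^ j * ?q) \<le> ?wm (of_nat (?K choose j)) * ?wm ?d ^ j * ?wm ?q"
      by (intro order_trans[OF weight.wmass_mult_le] mult_mono order_refl weight.wmass_power_le) auto
    also have "\<dots> \<le> of_nat (?K choose j) * ennreal ?w ^ j * ennreal (2 powr s + ?w)"
      by (intro mult_mono power_mono wmass_tail_bound wmass_blk_le n N last_len) auto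
    also have "\<dots> = ennreal (real (?K choose j) * ?w ^ j * (2 powr s + ?w))"
      using w by (simp add: ennreal_mult'' ennreal_power ennreal_of_nat_eq_real_of_nat)
    finally show ?thesis .
  qed
  have h1: "weight.wbounded (ennreal C * ?wm (tail (sqrt n) ?l) + ?S1) (tail_part L n)"
    unfolding tail_part_def
  proof (intro weight.wbounded_add weight.wbounded_mult weight.wbounded_sum)
    show "weight.wbounded (ennreal C) (head L (sqrt n) ?K)" using H by simp
    fix j assume "j \<in> {1..?K div 2}"
    then have "?K - j \<in> {?K div 2..?K}" by auto
    then show "weight.wbounded (ennreal C) (head L (sqrt n) (?K - j))" using H by blast
  qed
  have h2: "ennreal C * ?wm (tail (sqrt n) ?l) + ?S1
      \<le> ennreal C * ennreal ?w + ?S2"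
    by (intro add_mono sum_mono mult_left_mono t wmass_tail_bound n last_len) auto
  have h3: "ennreal C * ennreal ?w + ?S2 = ennreal (C * ?w + ?S)"
    using C w by (simp add: ennreal_mult'[symmetric] sum_nonneg add_nonneg_nonneg)
  have h4: "C * ?w + ?S \<le> C * (3 + 2 * 2 powr s) * (real n * ?w)"
  proof -
    have b: "(\<Sum>j\<in>{1..?K div 2}. real (?K choose j) * ?w ^ j) \<le> 2 * (real n * ?w)"
      using binomial_sum_le[OF w, of ?K] Kn small by linarith
    have "?S = C * ((\<Sum>j\<in>{1..?K div 2}. real (?K choose j) * ?w ^ j) * (2 powr s + ?w))"
      by (simp add: sum_distrib_left sum_distrib_right)
    also have "\<dots> \<le> C * (2 * (real n * ?w) * (2 powr s + 1))"
      using b C w wn small by (intro mult_left_mono mult_mono) auto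
    finally have "?S \<le> C * (2 * (real n * ?w) * (2 powr s + 1))" .
    moreover have "C * ?w \<le> C * (real n * ?w)" using wn C by (rule mult_left_mono)
    moreover have "C * (3 + 2 * 2 powr s) * (real n * ?w) = C * (real n * ?w) + C * (2 * (real n * ?w) * (2 powr s + 1))"
      by (simp add: algebra_simps)
    ultimately show ?thesis by linarith
  qed
  show ?thesis
    by (rule weight.wbounded_mono[OF h1 order_trans[OF h2]]) (unfold h3, rule ennreal_leI[OF h4])
qed

lemma approx_add:
  assumes "AE x in lborel. dens y x < \<infinity> \<and> poly_weight s x * \<bar>enn2real (dens y x) - g x\<bar> \<le> A"
    and "weight.wbounded (ennreal B) z" and B: "0 \<le> B"
  shows "AE x in lborel. dens (y + z) x < \<infinity> \<and> poly_weight s x * \<bar>enn2real (dens (y + z) x) - g x\<bar> \<le> A + B"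
proof -
  have "AE x in lborel. ennreal (poly_weight s x) * dens z x \<le> ennreal B"
    using assms(2) by (simp add: weight.wbounded_def)
  with assms(1) show ?thesis
  proof eventually_elim
    case (elim x)
    have w1: "1 \<le> poly_weight s x" by (rule weight.weight_ge_1)
    have "ennreal 1 * dens z x \<le> ennreal (poly_weight s x) * dens z x" using w1 by (intro mult_right_mono ennreal_leI) auto
    then have "dens z x \<le> ennreal B" using elim(2) by simp
    from le_less_trans[OF this ennreal_less_top] have fz: "dens z x < \<infinity>" by simp
    then obtain r where r: "dens z x = ennreal r" "0 \<le> r" by (cases "dens z x") auto
    have "poly_weight s x * r \<le> B" using elim(2) r B w1 by (simp add: ennreal_mult''[symmetric])
    have e: "enn2real (dens (y + z) x) = enn2real (dens y x) + r"
      using elim(1) r fz by (simp add: dens_simps enn2real_plus)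
    have "poly_weight s x * \<bar>enn2real (dens (y + z) x) - g x\<bar> \<le> poly_weight s x * (\<bar>enn2real (dens y x) - g x\<bar> + r)"
      unfolding e using w1 r by (intro mult_left_mono) auto
    also have "\<dots> \<le> A + B" using elim(1) \<open>poly_weight s x * r \<le> B\<close> by (simp add: distrib_left)
    finally show ?case using elim(1) fz by (simp add: dens_simps)
  qed
qed

lemma kept_approx:
  assumes L: "0 \<le> L" and \<beta>: "exp 1 * excess_mass L \<le> 1 / 2"
  shows "\<exists>\<epsilon>. approximates (kept L) \<epsilon>"
proof -
  from main_part_approx[OF L \<beta>] obtain \<epsilon>1 where "approximates (main_part L) \<epsilon>1" ..
  note h = this[unfolded approximates_def]
  note e1 = conjunct1[OF h] conjunct2[OF h]
  from wbounded_head[OF L \<beta>] obtain C where h: "C \<ge> 0 \<and> (\<forall>\<^sub>F n in sequentially. \<forall>i\<in>{K n div 2..K n}. weight.wbounded (ennreal C) (head L (sqrt n) i))" ..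
  note C = conjunct1[OF h] conjunct2[OF h]
  define D where "D = C * (3 + 2 * 2 powr s)"
  have D: "0 \<le> D" using C(1) by (simp add: D_def)
  define \<epsilon> where "\<epsilon> n = \<epsilon>1 n + D * tail_rate n" for n
  have "\<epsilon> \<longlonglongrightarrow> 0 + D * 0" unfolding \<epsilon>_def[abs_def] by (intro tendsto_intros e1 tendsto_tail_rate)
  moreover have "\<forall>\<^sub>F n in sequentially. real n * tail_bound n < 1"
    by (rule order_tendstoD(2)[OF tendsto_n_tail_bound]) simp
  then have "\<forall>\<^sub>F n in sequentially. AE x in lborel. dens (kept L n) x < \<infinity> \<and>
    poly_weight s x * \<bar>enn2real (dens (kept L n) x) - edgeworth_approx M m n x\<bar> \<le> \<epsilon> n * rate n"
    using e1(2) C(2) eventually_gt_at_top[of 0]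
  proof eventually_elim
    case (elim n)
    have "weight.wbounded (ennreal (D * (real n * tail_bound n))) (tail_part L n)"
      unfolding D_def by (rule wbounded_tail_part[OF elim(4) C(1) elim(3)]) (use elim(1) in simp)
    then have "weight.wbounded (ennreal (D * tail_rate n * rate n)) (tail_part L n)"
      unfolding n_tail_bound[OF elim(4)] by (simp add: mult.assoc)
    from approx_add[OF elim(2) this] show ?case
      unfolding kept_def \<epsilon>_def distrib_right using D tail_rate_nonneg by simp
  qed
  ultimately show ?thesis unfolding approximates_def by (intro exI[of _ \<epsilon>]) simp
qed

end

section \<open>The exponentially small remainder and the case of a bounded density\<close>

context block_densities
begin

lemma mass_blk_last: "0 < n \<Longrightarrow> mass (blk (sqrt n) (last_len n)) = 1"
  by (rule mass_blk) (use last_len[of n] in auto)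

text \<open>Each dropped term contains at least K div 2 - 1 factors of mass at most \<theta>,
  excesses or tails; capped parts, cores and the last block have mass at most 1. The binomial
  coefficients add up to 2^K, and K + 2 covers the factor K - j of the terms with one capped
  part.\<close>

lemma mass_dropped_le:
  assumes n: "0 < n" and L: "0 \<le> L" and \<theta>: "excess_mass L \<le> \<theta>" "tail_bound n \<le> \<theta>" "\<theta> \<le> 1"
  shows "mass (dropped L n) \<le> ennreal (2 ^ K n * ((real (K n) + 2) * \<theta> ^ (K n div 2 - 1)))"
proof -
  let ?\<tau> = "sqrt (real n)" let ?K = "K n" let ?J = "K n div 2"
  let ?d = "tail ?\<tau> N" and ?q = "blk ?\<tau> (last_len n)" and ?a = "capped L ?\<tau>" and ?b = "excess L ?\<tau>"
  have \<tau>: "0 < ?\<tau>" using n by simp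
  have \<theta>0: "0 \<le> \<theta>" using \<theta>(1) excess_mass_nonneg[of L] by linarith
  have N: "N \<in> {N..<2*N}" using N_ge_1 by simp
  have d: "mass ?d \<le> ennreal \<theta>"
    using weight.mass_le_wmass[of ?d] wmass_tail_bound[OF n N] ennreal_leI[OF \<theta>(2)] by (meson order_trans)
  have d1: "mass ?d \<le> 1" by (rule mass_tail_le[OF \<tau>]) simp
  have b: "mass ?b \<le> ennreal \<theta>" using mass_excess_le[OF \<tau> L] ennreal_leI[OF \<theta>(1)] by (rule order_trans)
  have a: "mass ?a \<le> 1" by (rule mass_capped_le[OF \<tau> L])
  have c: "mass (core ?\<tau> N) \<le> 1" by (rule mass_core_le[OF \<tau>]) simp
  have q: "mass ?q = 1" by (rule mass_blk_last[OF n])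
  have pow: "ennreal \<theta> ^ k \<le> ennreal (\<theta> ^ (?J - 1))" if "?J - 1 \<le> k" for k
    unfolding ennreal_power[OF \<theta>0] by (intro ennreal_leI power_decreasing that \<theta> \<theta>0)
  have bpow: "mass ?b ^ k \<le> ennreal (\<theta> ^ (?J - 1))" if "?J - 1 \<le> k" for k
    by (rule order_trans[OF power_mono[OF b] pow[OF that]]) simp
  have dpow: "mass ?d ^ k \<le> ennreal (\<theta> ^ (?J - 1))" if "?J - 1 \<le> k" for k
    by (rule order_trans[OF power_mono[OF d] pow[OF that]]) simp
  let ?B = "\<lambda>j. ennreal (real (?K choose j) * ((real ?K + 2) * \<theta> ^ (?J - 1)))"
  have "mass (excess_part L n) \<le> (\<Sum>j\<le>?J. ?B j)"
    unfolding excess_part_def mass_sum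
  proof (rule sum_mono)
    fix j assume "j \<in> {..?J}"
    then have j: "j \<le> ?J" by simp
    have "mass (of_nat (?K choose j) * ?d ^ j * (?b ^ (?K - j) + of_nat (?K - j) * ?a * ?b ^ (?K - j - 1)) * ?q)
      = of_nat (?K choose j) * mass ?d ^ j * (mass ?b ^ (?K - j) + of_nat (?K - j) * mass ?a * mass ?b ^ (?K - j - 1))"
      by (simp only: mass_mult mass_add mass_power mass_of_nat q mult_1_right)
    also have "\<dots> \<le> of_nat (?K choose j) * 1 * (ennreal (\<theta> ^ (?J - 1)) + of_nat ?K * 1 * ennreal (\<theta> ^ (?J - 1)))"
      using j by (intro mult_mono add_mono bpow a power_le_one d1 order_refl) (auto simp del: of_nat_mult)
    also have "\<dots> = ennreal (real (?K choose j) * ((real ?K + 1) * \<theta> ^ (?J - 1)))"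
      using \<theta>0 by (simp add: ennreal_of_nat_eq_real_of_nat ennreal_mult'[symmetric] ennreal_plus[symmetric] algebra_simps del: ennreal_plus)
    also have "\<dots> \<le> ?B j" using \<theta>0 by (intro ennreal_leI mult_left_mono mult_right_mono) auto
    finally show "mass (of_nat (?K choose j) * ?d ^ j * (?b ^ (?K - j) + of_nat (?K - j) * ?a * ?b ^ (?K - j - 1)) * ?q) \<le> ?B j" .
  qed
  moreover have "mass (many_tails n) \<le> (\<Sum>j\<in>{?J<..?K}. ?B j)"
    unfolding many_tails_def mass_sum
  proof (rule sum_mono)
    fix j assume j: "j \<in> {?J<..?K}"
    have "mass (of_nat (?K choose j) * ?d ^ j * core ?\<tau> N ^ (?K - j) * ?q) = of_nat (?K choose j) * mass ?d ^ j * mass (core ?\<tau> N) ^ (?K - j)"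
      by (simp only: mass_mult mass_power mass_of_nat q mult_1_right)
    also have "\<dots> \<le> of_nat (?K choose j) * ennreal (\<theta> ^ (?J - 1)) * 1"
      using j by (intro mult_mono dpow power_le_one c order_refl) auto
    also have "\<dots> = ennreal (real (?K choose j) * (1 * \<theta> ^ (?J - 1)))"
      using \<theta>0 by (simp add: ennreal_of_nat_eq_real_of_nat ennreal_mult'[symmetric])
    also have "\<dots> \<le> ?B j" using \<theta>0 by (intro ennreal_leI mult_left_mono mult_right_mono) auto
    finally show "mass (of_nat (?K choose j) * ?d ^ j * core ?\<tau> N ^ (?K - j) * ?q) \<le> ?B j" .
  qed
  ultimately have "mass (dropped L n) \<le> (\<Sum>j\<le>?J. ?B j) + (\<Sum>j\<in>{?J<..?K}. ?B j)"
    unfolding dropped_def mass_add by (rule add_mono)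
  also have "\<dots> = (\<Sum>j\<in>{..?J} \<union> {?J<..?K}. ?B j)" by (rule sum.union_disjoint[symmetric]) auto
  also have "{..?J} \<union> {?J<..?K} = {..?K}" by auto
  also have "(\<Sum>j\<le>?K. ?B j) = ennreal (\<Sum>j\<le>?K. real (?K choose j) * ((real ?K + 2) * \<theta> ^ (?J - 1)))"
    using \<theta>0 by (intro sum_ennreal) auto
  also have "(\<Sum>j\<le>?K. real (?K choose j) * ((real ?K + 2) * \<theta> ^ (?J - 1))) = real (\<Sum>j\<le>?K. ?K choose j) * ((real ?K + 2) * \<theta> ^ (?J - 1))"
    by (simp only: sum_distrib_right of_nat_sum)
  also have "real (\<Sum>j\<le>?K. ?K choose j) = 2 ^ ?K" by (simp add: choose_row_sum)
  finally show ?thesis .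
qed

lemma tendsto_tail_bound: "tail_bound \<longlonglongrightarrow> 0"
proof (rule Lim_null_comparison[OF _ tendsto_n_tail_bound])
  show "\<forall>\<^sub>F n in sequentially. norm (tail_bound n) \<le> real n * tail_bound n"
    using eventually_gt_at_top[of 0]
  proof eventually_elim
    case (elim n)
    then have "1 * tail_bound n \<le> real n * tail_bound n" by (intro mult_right_mono tail_bound_nonneg) auto
    then show ?case using tail_bound_nonneg[of n] by simp
  qed
qed

lemma K_ge: "(k + 1) * N \<le> n \<Longrightarrow> k \<le> K n"
  unfolding K_def using N_ge_1 less_eq_div_iff_mult_less_eq[of N "k + 1" n] by linarith

text \<open>The fourth power lifts the exponent K div 2 - 1 to at least K + 2. The 16 beats 2 * 4^K,
  which arises from 2^K and K + 2 \<le> 2^(K+1). Finally n \<le> N * (K + 2) turns (c^N)^(K+2) into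
  c^n.\<close>

lemma mass_dropped:
  assumes c: "0 < c" "c < 1" and L: "0 \<le> L" and \<beta>: "excess_mass L \<le> (c ^ N / 16) ^ 4"
  shows "\<forall>\<^sub>F n in sequentially. mass (dropped L n) \<le> ennreal (c ^ n / 4)"
proof -
  define v where "v = c ^ N / 16"
  have cN: "0 < c ^ N" "c ^ N \<le> 1" using c by (auto intro: power_le_one)
  have v: "0 < v" "v \<le> 1" "v \<le> 1 / 16" using cN by (auto simp: v_def)
  have "\<forall>\<^sub>F n in sequentially. tail_bound n < v ^ 4"
    by (rule order_tendstoD(2)[OF tendsto_tail_bound]) (use v in simp)
  then show ?thesis using eventually_ge_at_top[of "(12 + 1) * N"]
  proof eventually_elim
    case (elim n)
    let ?K = "K n"
    have n: "N \<le> n" "0 < n" using elim(2) N_ge_1 by auto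
    have K: "12 \<le> ?K" by (rule K_ge[OF elim(2)])
    have v4: "v ^ 4 \<le> 1" using v by (intro power_le_one) auto
    have "mass (dropped L n) \<le> ennreal (2 ^ ?K * ((real ?K + 2) * (v ^ 4) ^ (?K div 2 - 1)))"
      by (rule mass_dropped_le[OF n(2) L _ _ v4]) (use \<beta> elim(1) in \<open>auto simp: v_def\<close>)
    also have "\<dots> \<le> ennreal (c ^ n / 4)"
    proof (rule ennreal_leI)
      have "?K + 1 < 2 ^ (?K + 1)" by (rule less_exp)
      then have "?K + 2 \<le> 2 ^ (?K + 1)" by simp
      then have k2: "real ?K + 2 \<le> 2 ^ (?K + 1)" by (metis of_nat_add of_nat_le_iff of_nat_numeral of_nat_power)
      have "(v ^ 4) ^ (?K div 2 - 1) = v ^ (4 * (?K div 2 - 1))" by (rule power_mult[symmetric])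
      also have "\<dots> \<le> v ^ (?K + 2)" using K v by (intro power_decreasing) auto
      finally have "2 ^ ?K * ((real ?K + 2) * (v ^ 4) ^ (?K div 2 - 1)) \<le> 2 ^ ?K * (2 ^ (?K + 1) * v ^ (?K + 2))"
        using k2 v by (intro mult_left_mono mult_mono) auto
      also have "\<dots> = 2 * v\<^sup>2 * (4 * v) ^ ?K"
      proof -
        have "(4::real) ^ ?K = 2 ^ ?K * 2 ^ ?K" by (simp add: power_mult_distrib[symmetric])
        then show ?thesis by (simp add: power_mult_distrib power_add power2_eq_square)
      qed
      also have "\<dots> \<le> (1 / 4 * (c ^ N)\<^sup>2) * (c ^ N) ^ ?K"
      proof -
        have "2 * v\<^sup>2 = 1 / 128 * (c ^ N)\<^sup>2" by (simp add: v_def power2_eq_square)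
        also have "\<dots> \<le> 1 / 4 * (c ^ N)\<^sup>2" by (intro mult_right_mono) auto
        finally have a: "2 * v\<^sup>2 \<le> 1 / 4 * (c ^ N)\<^sup>2" .
        have "4 * v = 1 / 4 * c ^ N" by (simp add: v_def)
        then have "4 * v \<le> c ^ N" using cN by linarith
        then have "(4 * v) ^ ?K \<le> (c ^ N) ^ ?K" by (rule power_mono) (use v in simp)
        from mult_mono[OF a this] show ?thesis using v by simp
      qed
      also have "\<dots> = c ^ (N * (?K + 2)) / 4" by (simp only: power_mult power_add) simp
      also have "c ^ (N * (?K + 2)) \<le> c ^ n"
      proof (rule power_decreasing)
        show "n \<le> N * (?K + 2)" using n_eq[OF n(1)] last_len[of n] by (simp add: algebra_simps)
      qed (use c in auto)
      finally show "2 ^ ?K * ((real ?K + 2) * (v ^ 4) ^ (?K div 2 - 1)) \<le> c ^ n / 4" by simp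
    qed
    finally show ?case .
  qed
qed

lemma excess_0:
  assumes "\<And>x. p N x \<le> L"
  shows "excess L \<tau> = 0" "excess_mass L = 0"
  using assms by (auto simp: excess_mass_def dens_pieces dens_simps max_absorb1 intro!: adens_eqI)

text \<open>A bounded density alone has no weighted bound. In a convolution of two tails the weight
  can be put on one factor, where its integral is small, and the bound \<tau> L used for the
  other.\<close>

lemma wbounded_tail_square:
  assumes pL: "\<And>x. p N x \<le> L" and L: "0 \<le> L" and n: "0 < n"
  shows "weight.wbounded (ennreal (2 * 2 powr s * (sqrt n * L) * tail_bound n)) ((tail (sqrt n) N)\<^sup>2)"
proof -
  let ?\<tau> = "sqrt (real n)" let ?d = "tail ?\<tau> N" let ?w = "\<lambda>x. ennreal (poly_weight s x) * dens ?d x"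
  have [measurable]: "poly_weight s \<in> borel_measurable borel" by (rule weight.weight_measurable)
  have N: "N \<in> {N..<2*N}" using N_ge_1 by simp
  have wm: "(\<integral>\<^sup>+x. ?w x \<partial>lborel) \<le> ennreal (tail_bound n)"
    using wmass_tail_bound[OF n N] by (simp add: wmass_def)
  have dL: "dens ?d x \<le> ennreal (?\<tau> * L)" for x
    unfolding dens_pieces using pL[of "?\<tau> * x"] by (auto simp: indicator_def intro!: ennreal_leI mult_left_mono)
  have "ennreal (poly_weight s t) * dens (?d\<^sup>2) t \<le> ennreal (2 * 2 powr s * (?\<tau> * L) * tail_bound n)" for t
  proof -
    have "ennreal (poly_weight s t) * dens (?d\<^sup>2) t = (\<integral>\<^sup>+u. ennreal (poly_weight s t) * (dens ?d u * dens ?d (t - u)) \<partial>lborel)"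
      by (simp add: power2_eq_square dens_simps convol_def nn_integral_cmult)
    also have "\<dots> \<le> (\<integral>\<^sup>+u. ennreal (2 powr s * (?\<tau> * L)) * (?w u + ?w (t - u)) \<partial>lborel)"
    proof (rule nn_integral_mono)
      fix u
      have "poly_weight s (u + (t - u)) \<le> 2 powr s * (poly_weight s u + poly_weight s (t - u))"
        by (rule poly_weight_add_le) (use s_ge_2 in simp)
      then have "ennreal (poly_weight s t) \<le> ennreal (2 powr s) * (ennreal (poly_weight s u) + ennreal (poly_weight s (t - u)))"
        using weight.weight_nonneg by (simp add: ennreal_mult'[symmetric] ennreal_plus[symmetric] ennreal_leI del: ennreal_plus)
      then have "ennreal (poly_weight s t) * (dens ?d u * dens ?d (t - u))
          \<le> ennreal (2 powr s) * (ennreal (poly_weight s u) + ennreal (poly_weight s (t - u))) * (dens ?d u * dens ?d (t - u))"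
        by (rule mult_right_mono) simp
      also have "\<dots> = ennreal (2 powr s) * (?w u * dens ?d (t - u) + ?w (t - u) * dens ?d u)"
        by (simp only: distrib_left distrib_right mult_ac)
      also have "\<dots> \<le> ennreal (2 powr s) * (?w u * ennreal (?\<tau> * L) + ?w (t - u) * ennreal (?\<tau> * L))"
        by (intro mult_left_mono add_mono dL) auto
      also have "\<dots> = ennreal (2 powr s * (?\<tau> * L)) * (?w u + ?w (t - u))"
      proof -
        have "ennreal (2 powr s * (?\<tau> * L)) = ennreal (2 powr s) * ennreal (?\<tau> * L)" by (rule ennreal_mult') simp
        then show ?thesis by (simp only: distrib_left mult_ac)
      qed
      finally show "ennreal (poly_weight s t) * (dens ?d u * dens ?d (t - u)) \<le> ennreal (2 powr s * (?\<tau> * L)) * (?w u + ?w (t - u))" .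
    qed
    also have "\<dots> = ennreal (2 powr s * (?\<tau> * L)) * ((\<integral>\<^sup>+u. ?w u \<partial>lborel) + (\<integral>\<^sup>+u. ?w (t - u) \<partial>lborel))"
      by (subst nn_integral_cmult, measurable, subst nn_integral_add, measurable)
    also have "(\<integral>\<^sup>+u. ?w (t - u) \<partial>lborel) = (\<integral>\<^sup>+u. ?w u \<partial>lborel)"
      by (subst (2) nn_integral_real_affine[where c = "-1" and t = t]) simp_all
    also have "ennreal (2 powr s * (?\<tau> * L)) * ((\<integral>\<^sup>+u. ?w u \<partial>lborel) + (\<integral>\<^sup>+u. ?w u \<partial>lborel))
        \<le> ennreal (2 powr s * (?\<tau> * L)) * (ennreal (tail_bound n) + ennreal (tail_bound n))"
      by (intro mult_left_mono add_mono wm) auto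
    also have "\<dots> = ennreal (2 powr s * (?\<tau> * L) * (tail_bound n + tail_bound n))"
      using tail_bound_nonneg L by (simp only: ennreal_plus[symmetric]) (rule ennreal_mult'[symmetric], simp)
    also have "2 powr s * (?\<tau> * L) * (tail_bound n + tail_bound n) = 2 * 2 powr s * (?\<tau> * L) * tail_bound n" by simp
    finally show ?thesis .
  qed
  then show ?thesis by (simp add: weight.wbounded_def power2_eq_square)
qed

text \<open>The squared tail takes the place of the head as the good factor; the other j - 2 tails
  give powers of the small weighted mass, and each core at most 2 powr s.\<close>

lemma wbounded_many_tails:
  assumes pL: "\<And>x. p N x \<le> L" and L: "0 \<le> L" and n: "0 < n" and w1: "tail_bound n \<le> 1" and K2: "2 \<le> K n"
  shows "weight.wbounded (ennreal (2 ^ K n * (2 * 2 powr s * (sqrt n * L) * (2 powr s + 1) * (2 powr s) ^ K n * tail_bound n ^ (K n div 2)))) (many_tails n)"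
proof -
  let ?\<tau> = "sqrt (real n)" let ?K = "K n" let ?J = "K n div 2" let ?w = "tail_bound n"
  let ?d = "tail ?\<tau> N" and ?q = "blk ?\<tau> (last_len n)" let ?wm = "wmass (poly_weight s)"
  have N: "N \<in> {N..<2*N}" using N_ge_1 by simp
  have w: "0 \<le> ?w" by (rule tail_bound_nonneg)
  have s1: "1 \<le> 2 powr s" using s_ge_2 by (intro ge_one_powr_ge_zero) auto
  define Q where "Q = 2 * 2 powr s * (?\<tau> * L)"
  have Q: "0 \<le> Q" using L by (simp add: Q_def)
  define P where "P = Q * (2 powr s + 1) * (2 powr s) ^ ?K * ?w ^ ?J"
  have P: "0 \<le> P" using Q w by (simp add: P_def)
  have "weight.wbounded (\<Sum>j\<in>{?J<..?K}. ennreal (real (?K choose j) * P)) (many_tails n)"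
    unfolding many_tails_def
  proof (rule weight.wbounded_sum)
    fix j assume j: "j \<in> {?J<..?K}"
    have "1 \<le> ?J" using K2 by linarith
    then have j2: "2 \<le> j" using j by simp
    then have dj: "?d ^ j = ?d\<^sup>2 * ?d ^ (j - 2)" by (metis le_add_diff_inverse power_add)
    let ?y = "of_nat (?K choose j) * ?d ^ (j - 2) * core ?\<tau> N ^ (?K - j) * ?q"
    have e: "of_nat (?K choose j) * ?d ^ j * core ?\<tau> N ^ (?K - j) * ?q = ?d\<^sup>2 * ?y"
      unfolding dj by (simp only: mult_ac)
    have "weight.wbounded (ennreal (Q * ?w) * ?wm ?y) (?d\<^sup>2 * ?y)"
      unfolding Q_def by (intro weight.wbounded_mult wbounded_tail_square pL L n)
    moreover have "ennreal (Q * ?w) * ?wm ?y \<le> ennreal (real (?K choose j) * P)"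
    proof -
      have "?wm ?y \<le> ?wm (of_nat (?K choose j)) * ?wm ?d ^ (j - 2) * ?wm (core ?\<tau> N) ^ (?K - j) * ?wm ?q"
        by (intro order_trans[OF weight.wmass_mult_le] mult_mono order_refl weight.wmass_power_le) auto
      also have "\<dots> \<le> of_nat (?K choose j) * ennreal ?w ^ (j - 2) * ennreal (2 powr s) ^ (?K - j) * ennreal (2 powr s + ?w)"
        by (intro mult_mono power_mono wmass_tail_bound wmass_blk_le wmass_core_le n N last_len) (use n in auto)
      also have "\<dots> = ennreal (real (?K choose j) * ?w ^ (j - 2) * (2 powr s) ^ (?K - j) * (2 powr s + ?w))"
        using w by (simp add: ennreal_mult'' ennreal_power ennreal_of_nat_eq_real_of_nat)
      finally have "ennreal (Q * ?w) * ?wm ?y \<le> ennreal (Q * ?w) * ennreal (real (?K choose j) * ?w ^ (j - 2) * (2 powr s) ^ (?K - j) * (2 powr s + ?w))"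
        by (rule mult_left_mono) simp
      also have "\<dots> = ennreal (Q * ?w * (real (?K choose j) * ?w ^ (j - 2) * (2 powr s) ^ (?K - j) * (2 powr s + ?w)))"
        using Q w by (intro ennreal_mult'[symmetric]) auto
      also have "\<dots> \<le> ennreal (real (?K choose j) * P)"
      proof (rule ennreal_leI)
        have "j - 1 = Suc (j - 2)" using j2 by simp
        then have "?w * ?w ^ (j - 2) = ?w ^ (j - 1)" by simp
        also have "\<dots> \<le> ?w ^ ?J" using j w w1 by (intro power_decreasing) auto
        finally have a: "?w * ?w ^ (j - 2) \<le> ?w ^ ?J" .
        have b: "(2 powr s) ^ (?K - j) \<le> (2 powr s) ^ ?K" using s1 by (intro power_increasing) auto
        have "(?w * ?w ^ (j - 2)) * ((2 powr s) ^ (?K - j) * (2 powr s + ?w)) \<le> ?w ^ ?J * ((2 powr s) ^ ?K * (2 powr s + 1))"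
          using a b w w1 by (intro mult_mono) auto
        then have "(Q * real (?K choose j)) * ((?w * ?w ^ (j - 2)) * ((2 powr s) ^ (?K - j) * (2 powr s + ?w)))
            \<le> (Q * real (?K choose j)) * (?w ^ ?J * ((2 powr s) ^ ?K * (2 powr s + 1)))"
          using Q by (intro mult_left_mono) auto
        then show "Q * ?w * (real (?K choose j) * ?w ^ (j - 2) * (2 powr s) ^ (?K - j) * (2 powr s + ?w)) \<le> real (?K choose j) * P"
          unfolding P_def by (simp only: mult_ac)
      qed
      finally show ?thesis .
    qed
    ultimately show "weight.wbounded (ennreal (real (?K choose j) * P)) (of_nat (?K choose j) * ?d ^ j * core ?\<tau> N ^ (?K - j) * ?q)"
      unfolding e by (rule weight.wbounded_mono)
  qed
  moreover have "(\<Sum>j\<in>{?J<..?K}. ennreal (real (?K choose j) * P)) \<le> ennreal (2 ^ ?K * P)"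
  proof -
    have "(\<Sum>j\<in>{?J<..?K}. ennreal (real (?K choose j) * P)) = ennreal (\<Sum>j\<in>{?J<..?K}. real (?K choose j) * P)"
      using P by (intro sum_ennreal) auto
    also have "(\<Sum>j\<in>{?J<..?K}. real (?K choose j) * P) \<le> (\<Sum>j\<le>?K. real (?K choose j) * P)"
      using P by (intro sum_mono2) auto
    then have "ennreal (\<Sum>j\<in>{?J<..?K}. real (?K choose j) * P) \<le> ennreal (\<Sum>j\<le>?K. real (?K choose j) * P)"
      by (rule ennreal_leI)
    also have "(\<Sum>j\<le>?K. real (?K choose j) * P) = real (\<Sum>j\<le>?K. ?K choose j) * P"
      by (simp only: sum_distrib_right of_nat_sum)
    also have "real (\<Sum>j\<le>?K. ?K choose j) = 2 ^ ?K" by (simp add: choose_row_sum)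
    finally show ?thesis .
  qed
  ultimately show ?thesis unfolding P_def Q_def by (rule weight.wbounded_mono)
qed

text \<open>With L above the density of the block there is no excess, so \<open>excess_part\<close>
  vanishes, and the terms with many tails are pointwise small; the expansion then holds for the full
  convolution.\<close>

lemma full_approx:
  assumes L: "0 \<le> L" and pL: "\<And>x. p N x \<le> L"
  shows "\<exists>\<epsilon>. approximates full \<epsilon>"
proof -
  have "exp 1 * excess_mass L \<le> 1 / 2" using excess_0(2)[OF pL] by simp
  from kept_approx[OF L this] obtain \<epsilon>1 where "approximates (kept L) \<epsilon>1" ..
  note h = this[unfolded approximates_def]
  note e1 = conjunct1[OF h] conjunct2[OF h]
  \<comment> \<open>Growth per block in the bound for many tails: 2 from the binomial coefficients,
    2 powr s from the cores. Once the tail bound w is below 1 / (2 A^2), the product A^K * w^(K div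
    2) is at most A / 2^(K div 2).\<close>
  define A where "A = 2 * 2 powr s"
  have "1 \<le> 2 powr s" using s_ge_2 by (intro ge_one_powr_ge_zero) auto
  then have A: "1 \<le> A" unfolding A_def by linarith
  define D where "D = A * (2 * 2 powr s * L * (2 powr s + 1))"
  have D: "0 \<le> D" using A L by (simp add: D_def)
  define \<epsilon> where "\<epsilon> n = \<epsilon>1 n + D * (real n ^ (m + 1) * (1 / 2) ^ (K n div 2 - 3))" for n
  have "\<epsilon> \<longlonglongrightarrow> 0 + D * 0" unfolding \<epsilon>_def[abs_def] by (intro tendsto_intros e1 power_half_K_tendsto_0) auto
  moreover have "\<forall>\<^sub>F n in sequentially. tail_bound n < 1 / (2 * A\<^sup>2)"
    by (rule order_tendstoD(2)[OF tendsto_tail_bound]) (use A in simp)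
  then have "\<forall>\<^sub>F n in sequentially. AE x in lborel. dens (full n) x < \<infinity> \<and>
    poly_weight s x * \<bar>enn2real (dens (full n) x) - edgeworth_approx M m n x\<bar> \<le> \<epsilon> n * rate n"
    using e1(2) eventually_ge_at_top[of "(6 + 1) * N"]
  proof eventually_elim
    case (elim n)
    let ?K = "K n" let ?J = "K n div 2" let ?w = "tail_bound n"
    have n: "0 < n" using elim(3) N_ge_1 by auto
    have n1: "1 \<le> real n" using n by simp
    have K6: "6 \<le> ?K" by (rule K_ge[OF elim(3)])
    have Aw: "A\<^sup>2 * ?w \<le> 1 / 2" using elim(1) A by (simp add: field_simps)
    have A2: "1 \<le> A\<^sup>2" using A by (rule one_le_power)
    have "1 * ?w \<le> A\<^sup>2 * ?w" using A2 tail_bound_nonneg by (rule mult_right_mono)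
    then have w1: "?w \<le> 1" using Aw by simp
    \<comment> \<open>As 0 ^ 0 = 1, the exponents K - j and K - j - 1 have to be positive; K \<ge> 6
      and j \<le> K div 2 ensure this.\<close>
    have "excess_part L n = 0"
      unfolding excess_part_def excess_0(1)[OF pL]
    proof (intro sum.neutral ballI)
      fix j assume "j \<in> {..?J}"
      then have "0 < ?K - j" "0 < ?K - j - 1" using K6 unfolding atMost_iff by linarith+
      then show "of_nat (?K choose j) * tail (sqrt n) N ^ j * (0 ^ (?K - j) + of_nat (?K - j) * capped L (sqrt n) * 0 ^ (?K - j - 1)) * blk (sqrt n) (last_len n) = 0"
        by (simp only: zero_power mult_zero_right mult_zero_left add_0)
    qed
    then have f: "full n = kept L n + many_tails n" using full_eq[OF L, of n] by (simp add: dropped_def)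
    let ?B = "2 ^ ?K * (2 * 2 powr s * (sqrt n * L) * (2 powr s + 1) * (2 powr s) ^ ?K * ?w ^ ?J)"
    have B: "0 \<le> ?B" using L tail_bound_nonneg[of n] by simp
    have wb: "weight.wbounded (ennreal ?B) (many_tails n)"
      by (rule wbounded_many_tails[OF pL L n w1]) (use K6 in simp)
    have "?B \<le> D * (real n ^ (m + 1) * (1 / 2) ^ (?J - 3)) * rate n"
    proof -
      have "2 ^ ?K * (2 powr s) ^ ?K * ?w ^ ?J = A ^ ?K * ?w ^ ?J" by (simp only: A_def power_mult_distrib)
      also have "\<dots> \<le> A ^ (2 * ?J + 1) * ?w ^ ?J" using A tail_bound_nonneg by (intro mult_right_mono power_increasing) auto
      also have "\<dots> = A * (A\<^sup>2 * ?w) ^ ?J" by (simp add: power_mult power_mult_distrib)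
      also have "\<dots> \<le> A * (1 / 2) ^ ?J" using A Aw tail_bound_nonneg by (intro mult_left_mono power_mono) auto
      also have "\<dots> \<le> A * (1 / 2) ^ (?J - 3)" using A by (intro mult_left_mono power_decreasing) auto
      finally have 1: "2 ^ ?K * (2 powr s) ^ ?K * ?w ^ ?J \<le> A * (1 / 2) ^ (?J - 3)" .
      have sq: "sqrt (real n) \<le> real n" using n1 by (intro real_le_lsqrt) (auto simp: power2_eq_square)
      have "?B = sqrt n * (2 * 2 powr s * L * (2 powr s + 1)) * (2 ^ ?K * (2 powr s) ^ ?K * ?w ^ ?J)" by (simp only: mult_ac)
      also have "\<dots> \<le> n * (2 * 2 powr s * L * (2 powr s + 1)) * (A * (1 / 2) ^ (?J - 3))"
        using sq L tail_bound_nonneg[of n] by (intro mult_mono 1 order_refl) auto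
      also have "\<dots> = D * n * (1 / 2) ^ (?J - 3) * 1" by (simp only: D_def mult_ac mult_1_right)
      also have "\<dots> \<le> D * n * (1 / 2) ^ (?J - 3) * (real n ^ m * rate n)"
        using D by (intro mult_left_mono one_le_power_mult_powr n) auto
      also have "\<dots> = D * (real n ^ (m + 1) * (1 / 2) ^ (?J - 3)) * rate n" by (simp add: mult_ac)
      finally show ?thesis .
    qed
    then have "\<epsilon>1 n * rate n + ?B \<le> \<epsilon> n * rate n" by (simp add: \<epsilon>_def distrib_right)
    with approx_add[OF elim(2) wb B] show ?case unfolding f by (elim eventually_mono) (auto intro: order_trans)
  qed
  ultimately show ?thesis unfolding approximates_def by (intro exI[of _ \<epsilon>]) simp
qed

lemma mass_full: "0 < n \<Longrightarrow> mass (full n) = 1"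
  unfolding full_def by (simp add: mass_mult mass_power mass_blk mass_blk_last)

lemma atom_full [simp]: "atom (full n) = 0"
  by (simp add: full_def)

lemma ch_blk:
  assumes \<tau>: "0 < \<tau>" and l: "N \<le> l"
  shows "ch (blk \<tau> l) t = char M (t / \<tau>) ^ l"
proof -
  have fin: "(\<integral>\<^sup>+x. dens (blk \<tau> l) x \<partial>lborel) < \<infinity>" using mass_blk[OF assms] by (simp add: mass_def)
  have "ch (blk \<tau> l) t = (\<integral>x. enn2real (dens (blk \<tau> l) x) *\<^sub>R iexp (t * x) \<partial>lborel)"
    unfolding ch_def by (subst char_density[OF _ fin]) simp_all
  also have "\<dots> = (\<integral>x. (\<tau> * p l (\<tau> * x)) *\<^sub>R iexp (t * x) \<partial>lborel)"
    using \<tau> p_nonneg by (simp add: dens_pieces)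
  also have "\<dots> = (\<integral>x. \<tau> *\<^sub>R (p l (\<tau> * x) *\<^sub>R iexp (t / \<tau> * (\<tau> * x))) \<partial>lborel)" using \<tau> by simp
  also have "\<dots> = \<tau> *\<^sub>R (\<integral>x. p l (\<tau> * x) *\<^sub>R iexp (t / \<tau> * (\<tau> * x)) \<partial>lborel)" by (rule integral_scaleR_right)
  also have "\<dots> = (\<integral>y. p l y *\<^sub>R iexp (t / \<tau> * y) \<partial>lborel)"
    using lborel_integral_real_affine[of \<tau> "\<lambda>y. p l y *\<^sub>R iexp (t / \<tau> * y)" 0] \<tau>
    by (simp only: abs_of_pos add_0 less_imp_neq[symmetric] not_False_eq_True simp_thms)
  also have "\<dots> = char (law l) (t / \<tau>)" unfolding char_def by (rule integral_density[symmetric]) (auto simp: p_nonneg)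
  finally show ?thesis by (simp only: p_char[OF l])
qed

lemma char_full:
  assumes n: "N \<le> n"
  shows "char (density lborel (dens (full n))) t = char M (t / sqrt n) ^ n"
proof -
  have n0: "0 < n" using n N_ge_1 by simp
  have l: "N \<le> last_len n" using last_len[of n] by simp
  have m: "mass (blk (sqrt n) N) < \<infinity>" "mass (blk (sqrt n) (last_len n)) < \<infinity>" using n0 l by (simp_all add: mass_blk)
  have "ch (full n) t = char M (t / sqrt n) ^ (N * K n) * char M (t / sqrt n) ^ last_len n"
    unfolding full_def using n0 l by (simp add: ch_mult[OF mass_power_finite[OF m(1)] m(2)] ch_power[OF m(1)] ch_blk power_mult)
  also have "\<dots> = char M (t / sqrt n) ^ (N * K n + last_len n)" by (rule power_add[symmetric])
  also have "N * K n + last_len n = n" by (subst mult.commute) (rule n_eq[OF n, symmetric])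
  finally show ?thesis by (simp add: ch_def)
qed

end

section \<open>Construction of the approximating densities\<close>

lemma AE_continuous_le:
  fixes f :: "real \<Rightarrow> real"
  assumes "continuous_on UNIV f" and ae: "AE x in lborel. f x \<le> A"
  shows "f x \<le> A"
proof -
  have "closed {x. f x \<le> A}" using assms(1) by (intro closed_Collect_le continuous_on_const)
  moreover have "AE x in lebesgue. x \<in> {x. f x \<le> A}" using ae by (simp add: AE_completion)
  ultimately show ?thesis using mem_closed_if_AE_lebesgue by blast
qed

text \<open>On the exceptional null set the value \<open>max 0 (g x)\<close> is admissible: by continuity the negative part
  of \<open>g\<close> is small there as well.\<close>

lemma everywhere_version:
  fixes f g \<phi> :: "real \<Rightarrow> real"
  assumes f [measurable]: "f \<in> borel_measurable borel" and f0: "\<And>x. 0 \<le> f x"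
    and g: "continuous_on UNIV g" and \<phi>: "continuous_on UNIV \<phi>" "\<And>x. 0 \<le> \<phi> x"
    and ae: "AE x in lborel. \<phi> x * \<bar>f x - g x\<bar> \<le> A"
  shows "\<exists>h\<in>borel_measurable borel. (\<forall>x. 0 \<le> h x) \<and> (AE x in lborel. h x = f x) \<and> (\<forall>x. \<phi> x * \<bar>h x - g x\<bar> \<le> A)"
proof -
  have [measurable]: "g \<in> borel_measurable borel" "\<phi> \<in> borel_measurable borel"
    using g \<phi> by (auto intro: borel_measurable_continuous_onI)
  have "AE x in lborel. \<phi> x * max 0 (- g x) \<le> A"
    using ae
  proof eventually_elim
    case (elim x)
    have "max 0 (- g x) \<le> \<bar>f x - g x\<bar>" using f0[of x] by linarith
    then show ?case using mult_left_mono[OF _ \<phi>(2), of "max 0 (- g x)" "\<bar>f x - g x\<bar>" x] elim by linarith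
  qed
  then have neg: "\<phi> x * max 0 (- g x) \<le> A" for x
    by (rule AE_continuous_le[rotated]) (intro continuous_intros g \<phi>)
  define h where "h x = (if \<phi> x * \<bar>f x - g x\<bar> \<le> A then f x else max 0 (g x))" for x
  have "h \<in> borel_measurable borel" unfolding h_def[abs_def] by measurable
  moreover have "0 \<le> h x" for x using f0[of x] by (simp add: h_def)
  moreover have "AE x in lborel. h x = f x" using ae by eventually_elim (simp add: h_def)
  moreover have "\<phi> x * \<bar>h x - g x\<bar> \<le> A" for x
  proof (cases "\<phi> x * \<bar>f x - g x\<bar> \<le> A")
    case False
    have "\<bar>max 0 (g x) - g x\<bar> = max 0 (- g x)" by linarith
    then show ?thesis using neg[of x] False by (simp add: h_def)
  qed (simp add: h_def)
  ultimately show ?thesis by blast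
qed

text \<open>For every x and not almost everywhere, because the Landau symbols of the theorem are
  uniform over all x. The weight (1 + |x|)^s covers both weights of part a).\<close>

definition approximating_density :: "real measure \<Rightarrow> nat \<Rightarrow> real \<Rightarrow> nat \<Rightarrow> real \<Rightarrow> (real \<Rightarrow> real) \<Rightarrow> bool" where
  "approximating_density \<mu> m s n e f \<longleftrightarrow> prob_density f \<and>
    (\<forall>x. poly_weight s x * \<bar>f x - edgeworth_approx \<mu> m n x\<bar> \<le> e * real n powr (- (s - 2) / 2))"

lemma continuous_on_poly_weight: "continuous_on UNIV (poly_weight s)"
  unfolding poly_weight_def[abs_def] by (intro continuous_intros) (auto simp: add_nonneg_eq_0_iff)

context block_densities
begin

text \<open>The comparison of transforms is applied to the zero measure, so the difference is the
  Edgeworth function itself; continuity removes the null set. The bound controls the effect of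
  renormalisation.\<close>

lemma edgeworth_approx_bounded:
  "\<exists>G\<ge>0. \<forall>n>0. \<forall>x. poly_weight s x * \<bar>edgeworth_approx M m n x\<bar> \<le> G"
proof -
  from edgeworth_laplace_bound obtain C where h: "0 \<le> C \<and> (\<forall>\<tau>\<ge>1. \<forall>\<sigma> t. \<bar>\<sigma>\<bar> = 1 \<longrightarrow> cmod (edgeworth_laplace \<tau> (Complex \<sigma> t)) \<le> C * exp (- t\<^sup>2 / 4))" ..
  note C = conjunct1[OF h] conjunct2[OF h, rule_format]
  define G where "G = exp (1 - s + s * ln s) * (C * gauss_const / (2 * pi))"
  have B: "0 \<le> C * gauss_const" using C(1) gauss_const_nonneg by simp
  have "poly_weight s x * \<bar>edgeworth_approx M m n x\<bar> \<le> G" if n: "0 < n" for n x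
  proof (rule AE_continuous_le[where f = "\<lambda>x. poly_weight s x * \<bar>edgeworth_approx M m n x\<bar>"])
    show "continuous_on UNIV (\<lambda>x. poly_weight s x * \<bar>edgeworth_approx M m n x\<bar>)"
      by (intro continuous_intros continuous_on_poly_weight continuous_on_edgeworth_approx)
    have int: "(\<integral>\<^sup>+t. ennreal (cmod (ch (tilt \<sigma> 0) t - edgeworth_laplace (sqrt n) (Complex \<sigma> t))) \<partial>lborel) \<le> ennreal (C * gauss_const)" if \<sigma>: "\<bar>\<sigma>\<bar> = 1" for \<sigma>
    proof -
      have "cmod (ch (tilt \<sigma> 0) t - edgeworth_laplace (sqrt n) (Complex \<sigma> t)) \<le> C * exp (- t\<^sup>2 / 32)" for t
      proof -
        have "C * exp (- t\<^sup>2 / 4) \<le> C * exp (- t\<^sup>2 / 32)" using C(1) by (intro mult_left_mono) auto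
        then show ?thesis using C(2)[of "sqrt n" \<sigma> t] n \<sigma> by simp
      qed
      then have "(\<integral>\<^sup>+t. ennreal (cmod (ch (tilt \<sigma> 0) t - edgeworth_laplace (sqrt n) (Complex \<sigma> t))) \<partial>lborel) \<le> (\<integral>\<^sup>+t. ennreal (C * exp (- t\<^sup>2 / 32)) \<partial>lborel)"
        by (intro nn_integral_mono ennreal_leI)
      also have "\<dots> = ennreal C * (\<integral>\<^sup>+t. ennreal (exp (- t\<^sup>2 / 32)) \<partial>lborel)"
        unfolding ennreal_mult'[OF C(1)] by (rule nn_integral_cmult) simp
      also have "\<dots> = ennreal (C * gauss_const)" unfolding nn_integral_gauss by (rule ennreal_mult'[OF C(1), symmetric])
      finally show ?thesis .
    qed
    have "AE x in lborel. dens 0 x < \<infinity> \<and> poly_weight s x * \<bar>enn2real (dens 0 x) - edgeworth_approx M m n x\<bar> \<le> G"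
      unfolding G_def
      by (rule tilted_to_weighted[OF _ _ B _ has_bochner_integral_edgeworth_approx[OF n] int])
         (auto intro: borel_measurable_continuous_onI[OF continuous_on_edgeworth_approx])
    then show "AE x in lborel. poly_weight s x * \<bar>edgeworth_approx M m n x\<bar> \<le> G"
      by eventually_elim (simp add: dens_simps)
  qed
  moreover have "0 \<le> G" using B by (simp add: G_def)
  ultimately show ?thesis by blast
qed

lemma AE_dens_finite: "mass z < \<infinity> \<Longrightarrow> AE x in lborel. dens z x < \<infinity>"
  using mass_finiteD(2)[of z] by (intro nn_integral_noteq_infinite[THEN eventually_mono]) (auto simp: less_top)

lemma exact_density:
  assumes L: "0 \<le> L" and pL: "\<And>x. p N x \<le> L"
  shows "\<exists>(\<epsilon>::nat \<Rightarrow> real) f. \<epsilon> \<longlonglongrightarrow> 0 \<and> (\<forall>\<^sub>F n in sequentially. approximating_density M m s n (\<epsilon> n) (f n) \<and>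
    (AE x in lborel. f n x = enn2real (dens (full n) x)))"
proof -
  from full_approx[OF L pL] obtain \<epsilon> where "approximates full \<epsilon>" ..
  note h = this[unfolded approximates_def]
  have "\<forall>\<^sub>F n in sequentially. \<exists>f. approximating_density M m s n (\<epsilon> n) f \<and>
    (AE x in lborel. f x = enn2real (dens (full n) x))"
    using conjunct2[OF h] eventually_gt_at_top[of 0]
  proof eventually_elim
    case (elim n)
    have "AE x in lborel. poly_weight s x * \<bar>enn2real (dens (full n) x) - edgeworth_approx M m n x\<bar> \<le> \<epsilon> n * rate n"
      using elim(1) by eventually_elim simp
    from everywhere_version[OF _ _ continuous_on_edgeworth_approx continuous_on_poly_weight weight.weight_nonneg this]
    obtain f where f: "f \<in> borel_measurable borel" "\<And>x. 0 \<le> f x" "AE x in lborel. f x = enn2real (dens (full n) x)"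
      "\<And>x. poly_weight s x * \<bar>f x - edgeworth_approx M m n x\<bar> \<le> \<epsilon> n * rate n" by auto
    have "(\<integral>\<^sup>+x. ennreal (f x) \<partial>lborel) = (\<integral>\<^sup>+x. dens (full n) x \<partial>lborel)"
      by (rule nn_integral_cong_AE) (use f(3) elim(1) in eventually_elim, auto)
    also have "\<dots> = 1" using mass_full[OF elim(2)] by (simp add: mass_def)
    finally show ?case using f by (auto simp: approximating_density_def prob_density_def intro!: exI[of _ f])
  qed
  then show ?thesis using conjunct1[OF h] unfolding eventually_ex by blast
qed

lemma ex_small_excess: "0 < e \<Longrightarrow> \<exists>L\<ge>0. excess_mass L \<le> e"
proof -
  assume "0 < e"
  then have "\<forall>\<^sub>F L in at_top. excess_mass L < e" using tendsto_excess_mass by (rule order_tendstoD(2)[rotated])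
  then have "\<forall>\<^sub>F L in at_top. 0 \<le> L \<and> excess_mass L < e" using eventually_ge_at_top[of 0] by eventually_elim simp
  then show ?thesis by (auto dest!: eventually_happens'[OF trivial_limit_at_top_linorder] intro: less_imp_le)
qed

text \<open>Dropping mass \<delta> and dividing by \<kappa> = 1 - \<delta> moves the density by at
  most 2 \<delta> in L1. The relative error 1 / \<kappa> - 1 multiplies a bounded Edgeworth function
  and is exponentially small.\<close>

lemma approximate_density:
  assumes c: "0 < c" "c < 1"
  shows "\<exists>(\<epsilon>::nat \<Rightarrow> real) f. \<epsilon> \<longlonglongrightarrow> 0 \<and> (\<forall>\<^sub>F n in sequentially. approximating_density M m s n (\<epsilon> n) (f n) \<and>
    (\<integral>x. \<bar>f n x - enn2real (dens (full n) x)\<bar> \<partial>lborel) < c ^ n)"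
proof -
  have "0 < (c ^ N / 16) ^ 4" using c by simp
  from ex_small_excess[OF this] obtain L where L: "0 \<le> L" "excess_mass L \<le> (c ^ N / 16) ^ 4" by blast
  have "(c ^ N / 16) ^ 4 \<le> (1 / 16) ^ 4" using c by (intro power_mono) (auto intro: power_le_one)
  \<comment> \<open>The same cap has to satisfy the condition of the Fourier estimates; 1 / 6
    suffices because e \<le> 3.\<close>
  then have "excess_mass L \<le> 1 / 6" using L(2) by (simp add: power_divide)
  then have "exp 1 * excess_mass L \<le> 3 * (1 / 6)" using exp_le excess_mass_nonneg by (intro mult_mono) auto
  then have \<beta>: "exp 1 * excess_mass L \<le> 1 / 2" by simp
  from kept_approx[OF L(1) \<beta>] obtain \<epsilon>1 where "approximates (kept L) \<epsilon>1" ..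
  note h = this[unfolded approximates_def]
  from edgeworth_approx_bounded obtain G where h': "G \<ge> 0 \<and> (\<forall>n>0. \<forall>x. poly_weight s x * \<bar>edgeworth_approx M m n x\<bar> \<le> G)" ..
  note G = conjunct1[OF h'] conjunct2[OF h', rule_format]
  \<comment> \<open>4 / 3 bounds 1 / \<kappa>, as the dropped mass is at most 1 / 4; the second term
    is the renormalisation error relative to the rate.\<close>
  define \<epsilon> where "\<epsilon> n = 4 / 3 * \<epsilon>1 n + G * (real n ^ m * c ^ n)" for n
  have "(\<lambda>n. real n ^ m * c ^ n) \<longlonglongrightarrow> 0"
  proof -
    define d where "d = - ln c"
    have "0 < d" using c by (simp add: d_def)
    then have "(\<lambda>n::nat. real n ^ m * exp (- d * real n)) \<longlonglongrightarrow> 0" by real_asymp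
    moreover have "exp (- d * real n) = c ^ n" for n using c by (simp add: d_def exp_of_nat2_mult)
    ultimately show ?thesis by simp
  qed
  then have "\<epsilon> \<longlonglongrightarrow> 4 / 3 * 0 + G * 0"
    unfolding \<epsilon>_def[abs_def] by (intro tendsto_intros conjunct1[OF h])
  then have lim: "\<epsilon> \<longlonglongrightarrow> 0" by simp
  have "\<forall>\<^sub>F n in sequentially. \<exists>f. approximating_density M m s n (\<epsilon> n) f \<and>
    (\<integral>x. \<bar>f x - enn2real (dens (full n) x)\<bar> \<partial>lborel) < c ^ n"
    using conjunct2[OF h] mass_dropped[OF c L] eventually_gt_at_top[of 0]
  proof eventually_elim
    case (elim n)
    let ?k = "kept L n" and ?e = "dropped L n" let ?g = "edgeworth_approx M m n" let ?p2 = "rate n"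
    have cn: "0 < c ^ n" "c ^ n \<le> 1" using c by (auto intro: power_le_one)
    have "mass ?k + mass ?e = 1" using mass_full[OF elim(3)] by (simp add: full_eq[OF L(1)] mass_add)
    then have fin: "mass ?k < \<infinity>" "mass ?e < \<infinity>" by (metis ennreal_add_eq_top ennreal_one_neq_top infinity_ennreal_def less_top)+
    define \<kappa> where "\<kappa> = enn2real (mass ?k)"
    define \<delta> where "\<delta> = enn2real (mass ?e)"
    have m: "mass ?k = ennreal \<kappa>" "mass ?e = ennreal \<delta>" "0 \<le> \<kappa>" "0 \<le> \<delta>" using fin by (auto simp: \<kappa>_def \<delta>_def)
    have "ennreal (\<kappa> + \<delta>) = ennreal 1" using \<open>mass ?k + mass ?e = 1\<close> m by simp
    then have k1: "\<kappa> + \<delta> = 1" using m by (subst (asm) ennreal_inj) auto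
    have \<delta>: "\<delta> \<le> c ^ n / 4" using elim(2) m cn by (simp add: ennreal_le_iff)
    have \<kappa>: "3 / 4 \<le> \<kappa>" using k1 \<delta> cn by linarith
    have atoms: "atom ?k = 0" "atom ?e = 0"
    proof -
      have "atom ?k + atom ?e = 0" using atom_full[of n] by (simp add: full_eq[OF L(1)])
      then show "atom ?k = 0" "atom ?e = 0" by auto
    qed
    let ?fk = "\<lambda>x. enn2real (dens ?k x)" and ?fe = "\<lambda>x. enn2real (dens ?e x)"
    have finI: "(\<integral>\<^sup>+x. dens ?k x \<partial>lborel) = ennreal \<kappa>" "(\<integral>\<^sup>+x. dens ?e x \<partial>lborel) = ennreal \<delta>"
      using m atoms by (simp_all add: mass_def)
    have aek: "AE x in lborel. dens ?k x < \<infinity>" and aee: "AE x in lborel. dens ?e x < \<infinity>" by (rule AE_dens_finite[OF fin(1)], rule AE_dens_finite[OF fin(2)])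
    have hk: "has_bochner_integral lborel ?fk \<kappa>" 
      by (rule has_bochner_integral_nn_integral) (use finI(1) m in \<open>auto simp flip: finI(1) intro!: nn_integral_cong_AE eventually_mono[OF aek]\<close>)
    have he: "has_bochner_integral lborel ?fe \<delta>" 
      by (rule has_bochner_integral_nn_integral) (use finI(2) m in \<open>auto simp flip: finI(2) intro!: nn_integral_cong_AE eventually_mono[OF aee]\<close>)
    have ae: "AE x in lborel. poly_weight s x * \<bar>?fk x / \<kappa> - ?g x\<bar> \<le> \<epsilon> n * ?p2"
      using elim(1)
    proof eventually_elim
      case (elim x)
      have r: "0 \<le> 1 / \<kappa> - 1" "1 / \<kappa> - 1 \<le> c ^ n" "1 / \<kappa> \<le> 4 / 3"
      proof -
        show "0 \<le> 1 / \<kappa> - 1" "1 / \<kappa> \<le> 4 / 3" using \<kappa> k1 m by (auto simp: field_simps)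
        have "1 / \<kappa> - 1 = \<delta> / \<kappa>" using \<kappa> k1 by (auto simp: field_simps)
        also have "\<dots> \<le> (c ^ n / 4) / (3 / 4)" using \<delta> \<kappa> cn by (intro frac_le) auto
        also have "\<dots> \<le> c ^ n" using cn by simp
        finally show "1 / \<kappa> - 1 \<le> c ^ n" .
      qed
      have "?fk x / \<kappa> - ?g x = (?fk x - ?g x) * (1 / \<kappa>) + ?g x * (1 / \<kappa> - 1)" by (simp add: algebra_simps)
      then have "\<bar>?fk x / \<kappa> - ?g x\<bar> \<le> \<bar>?fk x - ?g x\<bar> * (1 / \<kappa>) + \<bar>?g x\<bar> * (1 / \<kappa> - 1)"
        using abs_triangle_ineq[of "(?fk x - ?g x) * (1 / \<kappa>)" "?g x * (1 / \<kappa> - 1)"] r(1) m by (simp add: abs_mult)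
      then have "poly_weight s x * \<bar>?fk x / \<kappa> - ?g x\<bar> \<le> poly_weight s x * (\<bar>?fk x - ?g x\<bar> * (1 / \<kappa>) + \<bar>?g x\<bar> * (1 / \<kappa> - 1))"
        by (rule mult_left_mono) (rule weight.weight_nonneg)
      also have "\<dots> = (poly_weight s x * \<bar>?fk x - ?g x\<bar>) * (1 / \<kappa>) + (poly_weight s x * \<bar>?g x\<bar>) * (1 / \<kappa> - 1)"
        by (simp only: distrib_left mult.assoc)
      also have "\<dots> \<le> (poly_weight s x * \<bar>?fk x - ?g x\<bar>) * (4 / 3) + G * (c ^ n * (real n ^ m * ?p2))"
      proof (intro add_mono mult_left_mono mult_mono r G)
        show "1 / \<kappa> - 1 \<le> c ^ n * (real n ^ m * ?p2)"
          using r(2) mult_left_mono[OF one_le_power_mult_powr[OF \<open>0 < n\<close>], of "c ^ n"] cn by linarith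
      qed (use G weight.weight_nonneg r \<open>0 < n\<close> in auto)
      also have "\<dots> \<le> (\<epsilon>1 n * ?p2) * (4 / 3) + G * (c ^ n * (real n ^ m * ?p2))"
        using elim by (intro add_right_mono mult_right_mono) auto
      also have "\<dots> = \<epsilon> n * ?p2" by (simp add: \<epsilon>_def algebra_simps)
      finally show ?case .
    qed
    have "\<exists>h\<in>borel_measurable borel. (\<forall>x. 0 \<le> h x) \<and> (AE x in lborel. h x = ?fk x / \<kappa>) \<and> (\<forall>x. poly_weight s x * \<bar>h x - ?g x\<bar> \<le> \<epsilon> n * ?p2)"
      by (rule everywhere_version[OF _ _ continuous_on_edgeworth_approx continuous_on_poly_weight weight.weight_nonneg ae]) (use m in auto)
    then obtain f where f: "f \<in> borel_measurable borel" "\<And>x. 0 \<le> f x" "AE x in lborel. f x = ?fk x / \<kappa>"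
      "\<And>x. poly_weight s x * \<bar>f x - ?g x\<bar> \<le> \<epsilon> n * ?p2" by auto
    have hf: "has_bochner_integral lborel f 1"
    proof -
      have "has_bochner_integral lborel (\<lambda>x. ?fk x / \<kappa>) (\<kappa> / \<kappa>)" by (rule has_bochner_integral_divide_zero) (use hk in auto)
      then show ?thesis using \<kappa> f(1,3) by (subst has_bochner_integral_cong_AE[of _ _ "\<lambda>x. ?fk x / \<kappa>"]) auto
    qed
    have "(\<integral>\<^sup>+x. ennreal (f x) \<partial>lborel) = ennreal (\<integral>x. f x \<partial>lborel)"
      by (rule nn_integral_eq_integral) (use hf f(2) in \<open>auto simp: has_bochner_integral_iff\<close>)
    also have "\<dots> = 1" using hf by (simp add: has_bochner_integral_iff)
    finally have pd: "prob_density f" using f by (simp add: prob_density_def)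
    have hd: "has_bochner_integral lborel (\<lambda>x. ?fk x * (1 / \<kappa> - 1) + ?fe x) (\<kappa> * (1 / \<kappa> - 1) + \<delta>)"
      by (intro has_bochner_integral_add has_bochner_integral_mult_left hk he)
    have "(\<integral>x. \<bar>f x - enn2real (dens (full n) x)\<bar> \<partial>lborel) \<le> (\<integral>x. ?fk x * (1 / \<kappa> - 1) + ?fe x \<partial>lborel)"
    proof (rule integral_mono_AE')
      show "integrable lborel (\<lambda>x. ?fk x * (1 / \<kappa> - 1) + ?fe x)" using hd by (simp add: has_bochner_integral_iff)
      show "AE x in lborel. \<bar>f x - enn2real (dens (full n) x)\<bar> \<le> ?fk x * (1 / \<kappa> - 1) + ?fe x"
        using f(3) aek aee
      proof eventually_elim
        case (elim x)
        have "enn2real (dens (full n) x) = ?fk x + ?fe x"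
          using elim by (simp add: full_eq[OF L(1)] dens_simps enn2real_plus)
        then have "f x - enn2real (dens (full n) x) = ?fk x * (1 / \<kappa> - 1) - ?fe x" using elim(1) by (simp add: algebra_simps)
        moreover have "0 \<le> ?fk x * (1 / \<kappa> - 1)" using \<kappa> k1 m by (intro mult_nonneg_nonneg) (auto simp: field_simps)
        moreover have "0 \<le> ?fe x" by simp
        ultimately show ?case by linarith
      qed
      show "AE x in lborel. 0 \<le> ?fk x * (1 / \<kappa> - 1) + ?fe x"
        using \<kappa> k1 m by (intro AE_I2 add_nonneg_nonneg mult_nonneg_nonneg) (auto simp: field_simps)
    qed
    also have "\<dots> = 2 * \<delta>" using hd \<kappa> k1 by (simp add: has_bochner_integral_iff right_diff_distrib)
    also have "\<dots> < c ^ n" using \<delta> cn by linarith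
    finally show ?case using pd f(4) unfolding approximating_density_def by blast
  qed
  then show ?thesis using lim unfolding eventually_ex by blast
qed

text \<open>Levy's uniqueness theorem and uniqueness of densities: the convolution of blocks, built
  from the densities of short sums, agrees almost everywhere with the given density of the long
  one.\<close>

lemma AE_full_eq:
  fixes f :: "real \<Rightarrow> real"
  assumes n: "N \<le> n" and f: "f \<in> borel_measurable borel" "\<And>x. 0 \<le> f x"
    and mass: "(\<integral>\<^sup>+x. ennreal (f x) \<partial>lborel) = 1"
    and ch: "\<And>t. char (density lborel (\<lambda>x. ennreal (f x))) t = char M (t / sqrt n) ^ n"
  shows "AE x in lborel. enn2real (dens (full n) x) = f x"
proof -
  have n0: "0 < n" using n N_ge_1 by simp
  have rd: "real_distribution (density lborel h)" if "h \<in> borel_measurable borel" "(\<integral>\<^sup>+x. h x \<partial>lborel) = 1" for h :: "real \<Rightarrow> ennreal"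
    using that by (intro real_distribution.intro real_distribution_axioms.intro prob_spaceI) (auto simp: emeasure_density)
  have "density lborel (dens (full n)) = density lborel (\<lambda>x. ennreal (f x))"
  proof (rule Levy_uniqueness[OF rd rd])
    show "(\<integral>\<^sup>+x. dens (full n) x \<partial>lborel) = 1" using mass_full[OF n0] by (simp add: mass_def)
    show "char (density lborel (dens (full n))) = char (density lborel (\<lambda>x. ennreal (f x)))"
      by (simp add: fun_eq_iff char_full[OF n] ch)
  qed (use f mass in auto)
  then have "AE x in lborel. dens (full n) x = ennreal (f x)"
    by (intro sigma_finite_measure.density_unique[OF sigma_finite_lborel]) (use f in auto)
  then show ?thesis by eventually_elim (simp add: f)
qed

end

section \<open>Sums of independent random variables\<close>

context prob_space
begin

text \<open>The cross terms vanish by independence and mean zero.\<close>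

lemma sum_square_expectation:
  fixes X :: "'b \<Rightarrow> 'a \<Rightarrow> real"
  assumes "finite I" and "indep_vars (\<lambda>_. borel) X I"
    and "\<And>i. i \<in> I \<Longrightarrow> integrable M (X i)" "\<And>i. i \<in> I \<Longrightarrow> integrable M (\<lambda>\<omega>. (X i \<omega>)\<^sup>2)"
    and "\<And>i. i \<in> I \<Longrightarrow> expectation (X i) = 0" "\<And>i. i \<in> I \<Longrightarrow> expectation (\<lambda>\<omega>. (X i \<omega>)\<^sup>2) = 1"
  shows "has_bochner_integral M (\<lambda>\<omega>. (\<Sum>i\<in>I. X i \<omega>)\<^sup>2) (real (card I))"
  using assms
proof (induction I rule: finite_induct)
  case (insert i I)
  let ?S = "\<lambda>\<omega>. \<Sum>i\<in>I. X i \<omega>"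
  have S: "has_bochner_integral M (\<lambda>\<omega>. (?S \<omega>)\<^sup>2) (real (card I))"
    using insert.prems by (intro insert.IH indep_vars_subset[OF insert.prems(1)]) auto
  have iS: "integrable M ?S" using insert.prems by (intro Bochner_Integration.integrable_sum) auto
  have ind: "indep_var borel (X i) borel ?S" by (rule indep_vars_sum[OF insert.hyps insert.prems(1)])
  have iX: "integrable M (X i)" using insert.prems by simp
  have cross: "has_bochner_integral M (\<lambda>\<omega>. X i \<omega> * ?S \<omega>) 0"
    using indep_var_integrable[OF ind iX iS] indep_var_lebesgue_integral[OF ind iX iS] insert.prems by (simp add: has_bochner_integral_iff)
  have sq: "has_bochner_integral M (\<lambda>\<omega>. (X i \<omega>)\<^sup>2) 1" using insert.prems by (simp add: has_bochner_integral_iff)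
  have "has_bochner_integral M (\<lambda>\<omega>. (X i \<omega>)\<^sup>2 + 2 * (X i \<omega> * ?S \<omega>) + (?S \<omega>)\<^sup>2) (1 + 2 * 0 + real (card I))"
    by (intro has_bochner_integral_add has_bochner_integral_mult_right sq cross S)
  moreover have "(\<Sum>i\<in>insert i I. X i \<omega>)\<^sup>2 = (X i \<omega>)\<^sup>2 + 2 * (X i \<omega> * ?S \<omega>) + (?S \<omega>)\<^sup>2" for \<omega>
    using insert.hyps by (simp add: power2_sum)
  ultimately show ?case using insert.hyps by simp
qed (simp add: has_bochner_integral_zero)

lemma char_normalized_sum:
  assumes "indep_vars (\<lambda>_. borel) X {1..}" and "\<And>i. i \<ge> 1 \<Longrightarrow> distr M borel (X i) = distr M borel (X 1)"
  shows "char (distr M borel (normalized_sum X n)) t = char (distr M borel (X 1)) (t / sqrt n) ^ n"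
    "char (distr M borel (\<lambda>\<omega>. \<Sum>i=1..n. X i \<omega>)) t = char (distr M borel (X 1)) t ^ n"
proof -
  have rv [measurable]: "random_variable borel (X i)" if "1 \<le> i" for i
    using assms(1) that by (simp add: indep_vars_def)
  show *: "char (distr M borel (\<lambda>\<omega>. \<Sum>i=1..n. X i \<omega>)) t = char (distr M borel (X 1)) t ^ n" for t
  proof -
    have "char (distr M borel (\<lambda>\<omega>. \<Sum>i=1..n. X i \<omega>)) t = (\<Prod>i=1..n. char (distr M borel (X i)) t)"
      by (rule char_distr_sum) (rule indep_vars_subset[OF assms(1)], auto)
    also have "\<dots> = (\<Prod>i=1..n. char (distr M borel (X 1)) t)"
    proof (rule prod.cong[OF refl])
      fix i assume "i \<in> {1..n}"
      then have "1 \<le> i" by simp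
      show "char (distr M borel (X i)) t = char (distr M borel (X 1)) t" by (subst assms(2)[OF \<open>1 \<le> i\<close>]) (rule refl)
    qed
    finally show ?thesis by simp
  qed
  have m: "(\<lambda>\<omega>. \<Sum>i=1..n. X i \<omega>) \<in> borel_measurable M" by (rule borel_measurable_sum) simp
  then have "char (distr M borel (normalized_sum X n)) t = char (distr M borel (\<lambda>\<omega>. \<Sum>i=1..n. X i \<omega>)) (t / sqrt n)"
    unfolding char_def normalized_sum_def[abs_def] by (subst (1 2) integral_distr) (auto simp: mult.commute)
  then show "char (distr M borel (normalized_sum X n)) t = char (distr M borel (X 1)) (t / sqrt n) ^ n"
    unfolding * .
qed

text \<open>Comparison with the largest term works for every s \<ge> 0; the constant is crude, but
  only integrability is at stake.\<close>

lemma abs_sum_powr_le: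
  fixes x :: "'b \<Rightarrow> real"
  assumes "finite I" "0 \<le> s"
  shows "\<bar>\<Sum>i\<in>I. x i\<bar> powr s \<le> real (card I) powr s * (\<Sum>i\<in>I. \<bar>x i\<bar> powr s)"
proof (cases "I = {}")
  case False
  define b where "b = Max ((\<lambda>i. \<bar>x i\<bar>) ` I)"
  have "b \<in> (\<lambda>i. \<bar>x i\<bar>) ` I" unfolding b_def using False assms by (intro Max_in) auto
  then obtain k where k: "k \<in> I" "b = \<bar>x k\<bar>" by auto
  have "\<bar>\<Sum>i\<in>I. x i\<bar> \<le> (\<Sum>i\<in>I. \<bar>x i\<bar>)" by (rule sum_abs)
  also have "\<dots> \<le> real (card I) * b" by (rule sum_bounded_above) (use assms in \<open>auto simp: b_def\<close>)
  finally have "\<bar>\<Sum>i\<in>I. x i\<bar> powr s \<le> (real (card I) * b) powr s" using assms by (intro powr_mono2) auto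
  also have "\<dots> = real (card I) powr s * \<bar>x k\<bar> powr s" using k by (simp add: powr_mult)
  also have "\<dots> \<le> real (card I) powr s * (\<Sum>i\<in>I. \<bar>x i\<bar> powr s)"
    using assms k by (intro mult_left_mono member_le_sum) auto
  finally show ?thesis .
qed simp

text \<open>x -> x / sqrt l undoes the normalisation of the l-th sum, because blocks are later
  rescaled by sqrt n and not by their own lengths.\<close>

lemma block_densities_of_sums:
  fixes X :: "nat \<Rightarrow> 'a \<Rightarrow> real" and r :: "nat \<Rightarrow> real \<Rightarrow> real"
  assumes indep: "indep_vars (\<lambda>_. borel) X {1..}" and id: "\<And>i. i \<ge> 1 \<Longrightarrow> distr M borel (X i) = distr M borel (X 1)"
    and mean: "expectation (X 1) = 0" and var: "expectation (\<lambda>\<omega>. (X 1 \<omega>)\<^sup>2) = 1"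
    and s: "2 \<le> s" and int: "integrable M (\<lambda>\<omega>. \<bar>X 1 \<omega>\<bar> powr s)" and m: "m = nat \<lfloor>s\<rfloor>" and N: "1 \<le> N"
    and r [measurable]: "\<And>n. r n \<in> borel_measurable borel" and r0: "\<And>n x. 0 \<le> r n x"
    and dist: "\<And>n. n \<ge> N \<Longrightarrow> distributed M lborel (normalized_sum X n) (\<lambda>x. ennreal (r n x))"
  shows "block_densities (distr M borel (X 1)) m s N (\<lambda>l x. r l (x / sqrt l) / sqrt l)"
proof -
  have rv [measurable]: "random_variable borel (X i)" if "1 \<le> i" for i
    using indep that by (simp add: indep_vars_def)
  have rvT [measurable]: "(\<lambda>\<omega>. \<Sum>i=1..l. X i \<omega>) \<in> borel_measurable M" for l by (rule borel_measurable_sum) simp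
  have ms: "real m \<le> s" "s < real m + 1" "2 \<le> m"
    using s by (simp_all add: m le_nat_iff le_floor_iff)
  have tr: "integrable M (\<lambda>\<omega>. h (X i \<omega>)) \<longleftrightarrow> integrable M (\<lambda>\<omega>. h (X 1 \<omega>))"
      "expectation (\<lambda>\<omega>. h (X i \<omega>)) = expectation (\<lambda>\<omega>. h (X 1 \<omega>))"
    if "1 \<le> i" and [measurable]: "h \<in> borel_measurable borel" for i and h :: "real \<Rightarrow> real"
    using integrable_distr_eq[of "X i" M borel h] integrable_distr_eq[of "X 1" M borel h]
      integral_distr[of "X i" M borel h] integral_distr[of "X 1" M borel h] id[OF that(1)] that(1) by simp_all
  interpret \<mu>: real_distribution "distr M borel (X 1)" by (rule real_distribution_distr) simp
  have intk: "integrable (distr M borel (X 1)) (\<lambda>x. x ^ k)" if "k \<le> m" for k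
  proof (rule powr_moment_integrable[OF \<mu>.finite_measure_axioms])
    show "integrable (distr M borel (X 1)) (\<lambda>y. \<bar>y\<bar> powr s)" using int by (subst integrable_distr_eq) auto
  qed (use that ms in auto)
  have std: "standardized_distribution (distr M borel (X 1)) m"
  proof
    show "integrable (distr M borel (X 1)) (\<lambda>x. x ^ k)" if "k \<le> m" for k by (rule intk[OF that])
    show "2 \<le> m" by (rule ms)
    show "\<mu>.expectation (\<lambda>x. x) = 0" using mean by (subst integral_distr) auto
    show "\<mu>.expectation (\<lambda>x. x\<^sup>2) = 1" using var by (subst integral_distr) auto
  qed
  have iX: "integrable M (X i)" "integrable M (\<lambda>\<omega>. (X i \<omega>)\<^sup>2)" if "1 \<le> i" for i
  proof -
    have "integrable M (\<lambda>\<omega>. X 1 \<omega> ^ k)" if "k \<le> 2" for k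
    proof -
      have "integrable (distr M borel (X 1)) (\<lambda>x. x ^ k)" using that ms by (intro intk) simp
      then show ?thesis by (subst (asm) integrable_distr_eq) auto
    qed
    from this[of 1] this[of 2] show "integrable M (X i)" "integrable M (\<lambda>\<omega>. (X i \<omega>)\<^sup>2)"
      using tr(1)[OF that, of "\<lambda>x. x"] tr(1)[OF that, of "\<lambda>x. x\<^sup>2"] by simp_all
  qed
  have EX: "expectation (X i) = 0" "expectation (\<lambda>\<omega>. (X i \<omega>)\<^sup>2) = 1" if "1 \<le> i" for i
    using tr(2)[OF that, of "\<lambda>x. x"] tr(2)[OF that, of "\<lambda>x. x\<^sup>2"] mean var by simp_all
  have law: "density lborel (\<lambda>x. ennreal (r l (x / sqrt l) / sqrt l)) = distr M borel (\<lambda>\<omega>. \<Sum>i=1..l. X i \<omega>)" if l: "N \<le> l" for l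
  proof -
    have c: "0 < sqrt (real l)" using l N by simp
    have e1: "(\<lambda>x. ennreal \<bar>sqrt (real l)\<bar> * ennreal (r l ((x * sqrt (real l) + 0) / sqrt (real l)) / sqrt (real l))) = (\<lambda>x. ennreal (r l x))"
      using c by (simp add: fun_eq_iff ennreal_mult'[symmetric])
    have e2: "(\<lambda>\<omega>. ((\<Sum>i=1..l. X i \<omega>) - 0) / sqrt (real l)) = normalized_sum X l" by (simp add: normalized_sum_def fun_eq_iff)
    have "distributed M lborel (\<lambda>\<omega>. \<Sum>i=1..l. X i \<omega>) (\<lambda>x. ennreal (r l (x / sqrt l) / sqrt l))"
    proof (rule distributed_affineI[where c = "sqrt (real l)" and t = 0])
      show "distributed M lborel (\<lambda>\<omega>. ((\<Sum>i=1..l. X i \<omega>) - 0) / sqrt (real l))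
          (\<lambda>x. ennreal \<bar>sqrt (real l)\<bar> * ennreal (r l ((x * sqrt (real l) + 0) / sqrt (real l)) / sqrt (real l)))"
        unfolding e1 e2 by (rule dist[OF l])
      show "sqrt (real l) \<noteq> 0" using c by simp
    qed
    then have "distr M lborel (\<lambda>\<omega>. \<Sum>i=1..l. X i \<omega>) = density lborel (\<lambda>x. ennreal (r l (x / sqrt l) / sqrt l))"
      by (simp add: distributed_def)
    moreover have "distr M lborel (\<lambda>\<omega>. \<Sum>i=1..l. X i \<omega>) = distr M borel (\<lambda>\<omega>. \<Sum>i=1..l. X i \<omega>)" by (rule distr_cong) auto
    ultimately show ?thesis by simp
  qed
  show ?thesis
  proof (intro block_densities.intro[OF std] block_densities_axioms.intro)
    show "real m \<le> s" "s < real m + 1" "1 \<le> N" by (fact ms N)+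
    show "(\<lambda>x. r l (x / sqrt l) / sqrt l) \<in> borel_measurable borel" for l by measurable
    show "0 \<le> r l (x / sqrt l) / sqrt l" for l x using r0 by simp
    fix l assume l: "N \<le> l"
    interpret T: prob_space "distr M borel (\<lambda>\<omega>. \<Sum>i=1..l. X i \<omega>)" by (rule prob_space_distr) measurable
    have "(\<integral>\<^sup>+x. ennreal (r l (x / sqrt l) / sqrt l) \<partial>lborel) = emeasure (density lborel (\<lambda>x. ennreal (r l (x / sqrt l) / sqrt l))) UNIV"
      by (simp add: emeasure_density)
    also have "\<dots> = 1" unfolding law[OF l] using T.emeasure_space_1 by simp
    finally show "(\<integral>\<^sup>+x. ennreal (r l (x / sqrt l) / sqrt l) \<partial>lborel) = 1" .
    show "char (density lborel (\<lambda>x. ennreal (r l (x / sqrt l) / sqrt l))) t = char (distr M borel (X 1)) t ^ l" for t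
      unfolding law[OF l] by (rule char_normalized_sum(2)[OF indep id])
    have "integrable M (\<lambda>\<omega>. \<bar>\<Sum>i=1..l. X i \<omega>\<bar> powr s)"
    proof (rule Bochner_Integration.integrable_bound)
      show "integrable M (\<lambda>\<omega>. real (card {1..l}) powr s * (\<Sum>i=1..l. \<bar>X i \<omega>\<bar> powr s))"
      proof (intro integrable_mult_right Bochner_Integration.integrable_sum)
        fix i assume "i \<in> {1..l}"
        then show "integrable M (\<lambda>\<omega>. \<bar>X i \<omega>\<bar> powr s)" using tr(1)[of i "\<lambda>x. \<bar>x\<bar> powr s"] int by simp
      qed
      show "AE \<omega> in M. norm (\<bar>\<Sum>i=1..l. X i \<omega>\<bar> powr s) \<le> norm (real (card {1..l}) powr s * (\<Sum>i=1..l. \<bar>X i \<omega>\<bar> powr s))"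
      proof (rule AE_I2)
        fix \<omega>
        have "\<bar>\<Sum>i=1..l. X i \<omega>\<bar> powr s \<le> real (card {1..l}) powr s * (\<Sum>i=1..l. \<bar>X i \<omega>\<bar> powr s)"
          by (rule abs_sum_powr_le) (use s in auto)
        then show "norm (\<bar>\<Sum>i=1..l. X i \<omega>\<bar> powr s) \<le> norm (real (card {1..l}) powr s * (\<Sum>i=1..l. \<bar>X i \<omega>\<bar> powr s))"
          unfolding real_norm_def abs_of_nonneg[OF powr_ge_zero] by (rule order_trans[OF _ abs_ge_self])
      qed
    qed measurable
    then show "integrable (density lborel (\<lambda>x. ennreal (r l (x / sqrt l) / sqrt l))) (\<lambda>y. \<bar>y\<bar> powr s)"
      unfolding law[OF l] by (subst integrable_distr_eq) auto
    have "expectation (\<lambda>\<omega>. \<Sum>i=1..l. X i \<omega>) = (\<Sum>i=1..l. expectation (X i))"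
      by (rule Bochner_Integration.integral_sum) (use iX in auto)
    also have "\<dots> = 0" using EX by (intro sum.neutral) auto
    finally show "(\<integral>y. y \<partial>density lborel (\<lambda>x. ennreal (r l (x / sqrt l) / sqrt l))) = 0"
      unfolding law[OF l] by (subst integral_distr) auto
    have "has_bochner_integral M (\<lambda>\<omega>. (\<Sum>i=1..l. X i \<omega>)\<^sup>2) (real (card {1..l}))"
    proof (rule sum_square_expectation)
      show "indep_vars (\<lambda>_. borel) X {1..l}" by (rule indep_vars_subset[OF indep]) auto
    qed (use iX EX in auto)
    then show "(\<integral>y. y\<^sup>2 \<partial>density lborel (\<lambda>x. ennreal (r l (x / sqrt l) / sqrt l))) = real l"
      unfolding law[OF l] by (subst integral_distr) (auto simp: has_bochner_integral_iff)
  qed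
qed

end

text \<open>If some given density is bounded, its index becomes the block length and the exact
  density serves for all large n, which settles b) and c) at once. Otherwise c) is void and a small
  mass may be dropped.\<close>

lemma ex_approximating_densities:
  fixes X :: "nat \<Rightarrow> 'a \<Rightarrow> real" and \<rho> :: "nat \<Rightarrow> real \<Rightarrow> real"
  assumes M: "prob_space M" and indep: "prob_space.indep_vars M (\<lambda>_. borel) X {1..}" and id: "\<And>i. i \<ge> 1 \<Longrightarrow> distr M borel (X i) = distr M borel (X 1)"
    and moments: "(\<integral>\<omega>. X 1 \<omega> \<partial>M) = 0" "(\<integral>\<omega>. (X 1 \<omega>)\<^sup>2 \<partial>M) = 1" "2 \<le> s" "integrable M (\<lambda>\<omega>. \<bar>X 1 \<omega>\<bar> powr s)" "m = nat \<lfloor>s\<rfloor>"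
    and c: "0 < c" "c < 1" and N: "1 \<le> N"
    and pd: "\<And>n. n \<ge> N \<Longrightarrow> prob_density (\<rho> n)"
    and dist: "\<And>n. n \<ge> N \<Longrightarrow> distributed M lborel (normalized_sum X n) (\<lambda>x. ennreal (\<rho> n x))"
  shows "\<exists>(\<epsilon>::nat \<Rightarrow> real) f. \<epsilon> \<longlonglongrightarrow> 0 \<and> (\<forall>\<^sub>F n in sequentially. approximating_density (distr M borel (X 1)) m s n (\<epsilon> n) (f n) \<and>
    (\<integral>x. \<bar>f n x - \<rho> n x\<bar> \<partial>lborel) < c ^ n \<and>
    ((\<exists>B. AE x in lborel. \<rho> n x \<le> B) \<longrightarrow> (AE x in lborel. f n x = \<rho> n x)))"
proof -
  let ?\<mu> = "distr M borel (X 1)"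
  have \<rho>: "\<rho> n \<in> borel_measurable borel" "0 \<le> \<rho> n x" "(\<integral>\<^sup>+x. ennreal (\<rho> n x) \<partial>lborel) = 1" if "N \<le> n" for n x
    using pd[OF that] by (auto simp: prob_density_def)
  have ch: "char (density lborel (\<lambda>x. ennreal (\<rho> n x))) t = char ?\<mu> (t / sqrt n) ^ n" if "N \<le> n" for n t
  proof -
    have "density lborel (\<lambda>x. ennreal (\<rho> n x)) = distr M lborel (normalized_sum X n)"
      using dist[OF that] by (simp add: distributed_def)
    also have "\<dots> = distr M borel (normalized_sum X n)" by (rule distr_cong) auto
    finally show ?thesis using prob_space.char_normalized_sum(1)[OF M indep id] by simp
  qed
  show ?thesis
  proof (cases "\<exists>n\<ge>N. \<exists>B. AE x in lborel. \<rho> n x \<le> B")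
    case True
    then obtain k B where k: "N \<le> k" "AE x in lborel. \<rho> k x \<le> B" by blast
    define L where "L = max B 0"
    \<comment> \<open>A bound almost everywhere becomes a bound everywhere by changing the density
      on a null set; below N the value 0 keeps the functions measurable and nonnegative.\<close>
    define r where "r n = (if n = k then (\<lambda>x. min (\<rho> k x) L) else if N \<le> n then \<rho> n else (\<lambda>_. 0))" for n
    have k1: "1 \<le> k" using k N by simp
    interpret block_densities ?\<mu> m s k "\<lambda>l x. r l (x / sqrt l) / sqrt l"
    proof (rule prob_space.block_densities_of_sums[OF M indep id moments k1])
      show "r n \<in> borel_measurable borel" for n using \<rho>(1)[of n] \<rho>(1)[OF k(1)] by (auto simp: r_def)
      show "0 \<le> r n x" for n x using \<rho>(2)[of n x] \<rho>(2)[OF k(1), of x] by (auto simp: r_def L_def)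
      fix n assume n: "k \<le> n"
      show "distributed M lborel (normalized_sum X n) (\<lambda>x. ennreal (r n x))"
      proof (cases "n = k")
        case True
        have "distributed M lborel (normalized_sum X k) (\<lambda>x. ennreal (r k x)) \<longleftrightarrow> distributed M lborel (normalized_sum X k) (\<lambda>x. ennreal (\<rho> k x))"
        proof (rule distributed_cong_density)
          show "AE x in lborel. ennreal (r k x) = ennreal (\<rho> k x)"
            using k(2) by eventually_elim (simp add: r_def L_def min_absorb1 le_max_iff_disj)
        qed (use \<rho>(1)[OF k(1)] in \<open>auto simp: r_def\<close>)
        then show ?thesis using dist[OF k(1)] True by simp
      next
        case False
        then show ?thesis using dist[of n] n k(1) by (simp add: r_def)
      qed
    qed
    have "0 \<le> L / sqrt k" by (simp add: L_def)
    moreover have "r k (x / sqrt k) / sqrt k \<le> L / sqrt k" for x by (rule divide_right_mono) (auto simp: r_def)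
    ultimately obtain \<epsilon> :: "nat \<Rightarrow> real" and f where f: "\<epsilon> \<longlonglongrightarrow> 0" "\<forall>\<^sub>F n in sequentially. approximating_density ?\<mu> m s n (\<epsilon> n) (f n) \<and>
      (AE x in lborel. f n x = enn2real (dens (full n) x))"
      using exact_density by blast
    have "\<forall>\<^sub>F n in sequentially. approximating_density ?\<mu> m s n (\<epsilon> n) (f n) \<and>
      (\<integral>x. \<bar>f n x - \<rho> n x\<bar> \<partial>lborel) < c ^ n \<and>
      ((\<exists>B. AE x in lborel. \<rho> n x \<le> B) \<longrightarrow> (AE x in lborel. f n x = \<rho> n x))"
      using f(2) eventually_ge_at_top[of k]
    proof eventually_elim
      case (elim n)
      have n: "N \<le> n" using elim(2) k by simp
      have "AE x in lborel. enn2real (dens (full n) x) = \<rho> n x"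
        by (rule AE_full_eq[OF elim(2) \<rho>[OF n] ch[OF n]])
      with conjunct2[OF elim(1)] have ae: "AE x in lborel. f n x = \<rho> n x" by eventually_elim simp
      have [measurable]: "f n \<in> borel_measurable borel" "\<rho> n \<in> borel_measurable borel"
        using elim(1) \<rho>(1)[OF n] by (auto simp: approximating_density_def prob_density_def)
      have "(\<integral>x. \<bar>f n x - \<rho> n x\<bar> \<partial>lborel) = (\<integral>x. 0 \<partial>(lborel :: real measure))"
        by (rule integral_cong_AE) (use ae in \<open>auto elim: eventually_mono\<close>)
      also have "\<dots> < c ^ n" using c by simp
      finally show ?case using elim(1) ae by blast
    qed
    then show ?thesis using f(1) by blast
  next
    case False
    define r where "r n = (if N \<le> n then \<rho> n else (\<lambda>_. 0))" for n
    interpret block_densities ?\<mu> m s N "\<lambda>l x. r l (x / sqrt l) / sqrt l"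
      by (rule prob_space.block_densities_of_sums[OF M indep id moments N]) (use \<rho> dist in \<open>auto simp: r_def\<close>)
    from approximate_density[OF c]
    obtain \<epsilon> :: "nat \<Rightarrow> real" and f where f: "\<epsilon> \<longlonglongrightarrow> 0" "\<forall>\<^sub>F n in sequentially. approximating_density ?\<mu> m s n (\<epsilon> n) (f n) \<and>
      (\<integral>x. \<bar>f n x - enn2real (dens (full n) x)\<bar> \<partial>lborel) < c ^ n"
      by blast
    have "\<forall>\<^sub>F n in sequentially. approximating_density ?\<mu> m s n (\<epsilon> n) (f n) \<and>
      (\<integral>x. \<bar>f n x - \<rho> n x\<bar> \<partial>lborel) < c ^ n \<and>
      ((\<exists>B. AE x in lborel. \<rho> n x \<le> B) \<longrightarrow> (AE x in lborel. f n x = \<rho> n x))"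
      using f(2) eventually_ge_at_top[of N]
    proof eventually_elim
      case (elim n)
      have ae: "AE x in lborel. enn2real (dens (full n) x) = \<rho> n x"
        by (rule AE_full_eq[OF elim(2) \<rho>[OF elim(2)] ch[OF elim(2)]])
      have [measurable]: "f n \<in> borel_measurable borel" "\<rho> n \<in> borel_measurable borel"
        using elim(1) \<rho>(1)[OF elim(2)] by (auto simp: approximating_density_def prob_density_def)
      have "(\<integral>x. \<bar>f n x - \<rho> n x\<bar> \<partial>lborel) = (\<integral>x. \<bar>f n x - enn2real (dens (full n) x)\<bar> \<partial>lborel)"
        by (rule integral_cong_AE) (use ae in \<open>auto elim: eventually_mono\<close>)
      then show ?case using elim False by auto
    qed
    then show ?thesis using f(1) by blast
  qed
qed

lemma one_plus_abs_powr_le: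
  assumes "0 \<le> a" "a \<le> s"
  shows "1 + \<bar>x\<bar> powr a \<le> 2 * poly_weight s x"
proof -
  have "\<bar>x\<bar> powr a \<le> (1 + \<bar>x\<bar>) powr a" using assms by (intro powr_mono2) auto
  also have "\<dots> \<le> (1 + \<bar>x\<bar>) powr s" using assms by (intro powr_mono) auto
  finally have "\<bar>x\<bar> powr a \<le> poly_weight s x" by (simp add: poly_weight_def)
  moreover have "1 \<le> poly_weight s x" unfolding poly_weight_def using assms by (intro ge_one_powr_ge_zero) auto
  ultimately show ?thesis by linarith
qed

lemma weighted_smallo_uniformly:
  fixes d :: "nat \<Rightarrow> real \<Rightarrow> real"
  assumes lim: "\<epsilon> \<longlonglongrightarrow> 0" and d: "\<forall>\<^sub>F n in sequentially. \<forall>x. poly_weight s x * \<bar>d n x\<bar> \<le> \<epsilon> n * real n powr a"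
    and w: "\<And>x. 0 \<le> w x" "\<And>x. w x \<le> 2 * poly_weight s x"
  shows "(\<lambda>(n, x). w x * d n x) \<in> o[uniformly_in_x](\<lambda>(n, x). real n powr a)"
proof (rule landau_o.smallI)
  fix e :: real assume "0 < e"
  then have "\<forall>\<^sub>F n in sequentially. \<epsilon> n < e / 2" by (intro order_tendstoD(2)[OF lim]) simp
  then show "\<forall>\<^sub>F z in uniformly_in_x. norm (case z of (n, x) \<Rightarrow> w x * d n x) \<le> e * norm (case z of (n, x) \<Rightarrow> real n powr a)"
    unfolding eventually_uniformly_in_x using d
  proof eventually_elim
    case (elim n)
    show ?case
    proof
      fix x
      have "w x * \<bar>d n x\<bar> \<le> 2 * poly_weight s x * \<bar>d n x\<bar>" using w by (intro mult_right_mono) auto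
      also have "\<dots> \<le> 2 * (\<epsilon> n * real n powr a)" using spec[OF elim(2), of x] by simp
      also have "\<dots> \<le> e * real n powr a" using mult_right_mono[of "2 * \<epsilon> n" e "real n powr a"] elim(1) by simp
      finally show "norm (case (n, x) of (n, x) \<Rightarrow> w x * d n x) \<le> e * norm (case (n, x) of (n, x) \<Rightarrow> real n powr a)"
        using w(1)[of x] by (simp add: abs_mult)
    qed
  qed
qed

lemma prob_density_std_normal: "prob_density std_normal_density"
  using prob_space.emeasure_space_1[OF prob_space_normal_density[of 1 0]]
  by (simp add: prob_density_def emeasure_density normal_density_nonneg)

theorem theorem1p2:
  fixes M :: "'a measure" and X :: "nat \<Rightarrow> 'a \<Rightarrow> real"
    and s c :: real and m N :: nat and \<rho> :: "nat \<Rightarrow> real \<Rightarrow> real"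
  assumes "prob_space M"
    and "prob_space.indep_vars M (\<lambda>_. borel) X {1..}"
    and "\<And>i. i \<ge> 1 \<Longrightarrow> distr M borel (X i) = distr M borel (X 1)"
    and "prob_space.expectation M (X 1) = 0"
    and "prob_space.expectation M (\<lambda>\<omega>. (X 1 \<omega>)\<^sup>2) = 1"
    and "s \<ge> 2"
    and "integrable M (\<lambda>\<omega>. \<bar>X 1 \<omega>\<bar> powr s)"
    and "m = nat \<lfloor>s\<rfloor>"
    and "0 < c" and "c < 1"
    and "\<And>n. n \<ge> N \<Longrightarrow> prob_density (\<rho> n)"
    and "\<And>n. n \<ge> N \<Longrightarrow> distributed M lborel (normalized_sum X n) (\<lambda>x. ennreal (\<rho> n x))"
  shows "\<exists>\<rho>' :: nat \<Rightarrow> real \<Rightarrow> real.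
    (\<forall>n. prob_density (\<rho>' n)) \<and>
    (\<lambda>(n, x). (1 + \<bar>x\<bar> ^ m) * (\<rho>' n x - edgeworth_approx (distr M borel (X 1)) m n x))
      \<in> o[uniformly_in_x](\<lambda>(n, x). real n powr (- (s - 2) / 2)) \<and>
    (\<exists>r1 r2 r3 :: nat \<times> real \<Rightarrow> real.
      r1 \<in> o[uniformly_in_x](\<lambda>(n, x). real n powr (- (s - 2) / 2)) \<and>
      r2 \<in> O[uniformly_in_x](\<lambda>(n, x). real n powr (- (real m - 1) / 2)) \<and>
      r3 \<in> o[uniformly_in_x](\<lambda>(n, x). real n powr (- (s - 2))) \<and>
      (\<forall>\<^sub>F n in sequentially. \<forall>x.
        (1 + \<bar>x\<bar> powr s) * (\<rho>' n x - edgeworth_approx (distr M borel (X 1)) m n x)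
          = r1 (n, x) + (1 + \<bar>x\<bar> powr (s - real m)) * (r2 (n, x) + r3 (n, x)))) \<and>
    (\<forall>\<^sub>F n in sequentially. (\<integral>x. \<bar>\<rho>' n x - \<rho> n x\<bar> \<partial>lborel) < c ^ n) \<and>
    (\<forall>n\<ge>N. (\<exists>B. AE x in lborel. \<rho> n x \<le> B) \<longrightarrow> (AE x in lborel. \<rho>' n x = \<rho> n x))"
proof -
  let ?e = "edgeworth_approx (distr M borel (X 1)) m"
  \<comment> \<open>Block lengths are positive, while N may be 0.\<close>
  define N' where "N' = max N 1"
  have N': "1 \<le> N'" "\<And>n. n \<ge> N' \<Longrightarrow> prob_density (\<rho> n)"
    "\<And>n. n \<ge> N' \<Longrightarrow> distributed M lborel (normalized_sum X n) (\<lambda>x. ennreal (\<rho> n x))"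
    using assms(11,12) by (auto simp: N'_def)
  from ex_approximating_densities[OF assms(1-8) assms(9,10) N']
  obtain \<epsilon> :: "nat \<Rightarrow> real" and f where lim: "\<epsilon> \<longlonglongrightarrow> 0" and f: "\<forall>\<^sub>F n in sequentially. approximating_density (distr M borel (X 1)) m s n (\<epsilon> n) (f n) \<and>
    (\<integral>x. \<bar>f n x - \<rho> n x\<bar> \<partial>lborel) < c ^ n \<and>
    ((\<exists>B. AE x in lborel. \<rho> n x \<le> B) \<longrightarrow> (AE x in lborel. f n x = \<rho> n x))"
    by blast
  from f obtain n0 where n0: "\<And>n. n \<ge> n0 \<Longrightarrow> approximating_density (distr M borel (X 1)) m s n (\<epsilon> n) (f n) \<and>
    (\<integral>x. \<bar>f n x - \<rho> n x\<bar> \<partial>lborel) < c ^ n \<and>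
    ((\<exists>B. AE x in lborel. \<rho> n x \<le> B) \<longrightarrow> (AE x in lborel. f n x = \<rho> n x))"
    unfolding eventually_sequentially by blast
  \<comment> \<open>Below n0 separate values are chosen: \<open>\<rho> n\<close> itself from N on,
    because c) is claimed for every n \<ge> N, and the normal density before N, so that each
    function is a probability density.\<close>
  define \<rho>' where "\<rho>' n = (if n0 \<le> n then f n else if N \<le> n then \<rho> n else std_normal_density)" for n
  have pd: "prob_density (\<rho>' n)" for n
    using n0[of n] assms(11)[of n] prob_density_std_normal by (simp add: \<rho>'_def approximating_density_def)
  have d: "\<forall>\<^sub>F n in sequentially. \<forall>x. poly_weight s x * \<bar>\<rho>' n x - ?e n x\<bar> \<le> \<epsilon> n * real n powr (- (s - 2) / 2)"
    using eventually_ge_at_top[of n0] by eventually_elim (use n0 in \<open>simp add: \<rho>'_def approximating_density_def\<close>)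
  have ms: "real m \<le> s" using assms(6,8) by (simp add: le_nat_iff le_floor_iff)
  have wm: "1 + \<bar>x\<bar> ^ m \<le> 2 * poly_weight s x" for x
  proof (cases "x = 0")
    case False
    then show ?thesis using one_plus_abs_powr_le[of "real m" s x] ms by (simp add: powr_realpow)
  next
    case True
    have "m \<noteq> 0" using assms(6,8) by (simp add: le_nat_iff le_floor_iff)
    then show ?thesis using True one_plus_abs_powr_le[of "real m" s x] ms by (simp add: power_0_left)
  qed
  have 1: "(\<lambda>(n, x). (1 + \<bar>x\<bar> ^ m) * (\<rho>' n x - ?e n x)) \<in> o[uniformly_in_x](\<lambda>(n, x). real n powr (- (s - 2) / 2))"
    by (rule weighted_smallo_uniformly[OF lim d]) (use wm in auto)
  have 2: "(\<lambda>(n, x). (1 + \<bar>x\<bar> powr s) * (\<rho>' n x - ?e n x)) \<in> o[uniformly_in_x](\<lambda>(n, x). real n powr (- (s - 2) / 2))"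
    by (rule weighted_smallo_uniformly[OF lim d]) (use one_plus_abs_powr_le[of s s] assms(6) in auto)
  have 4: "\<forall>\<^sub>F n in sequentially. (\<integral>x. \<bar>\<rho>' n x - \<rho> n x\<bar> \<partial>lborel) < c ^ n"
    using eventually_ge_at_top[of n0] by eventually_elim (use n0 in \<open>simp add: \<rho>'_def\<close>)
  have 5: "AE x in lborel. \<rho>' n x = \<rho> n x" if "N \<le> n" "\<exists>B. AE x in lborel. \<rho> n x \<le> B" for n
    using n0[of n] that by (cases "n0 \<le> n") (simp_all add: \<rho>'_def)
  \<comment> \<open>The first remainder takes the whole error, which is o(n^(-(s-2)/2)) even with
    the weight of order s; the other two remainders are chosen as 0.\<close>
  show ?thesis
    by (rule exI[of _ \<rho>'], intro conjI exI[of _ "\<lambda>(n, x). (1 + \<bar>x\<bar> powr s) * (\<rho>' n x - ?e n x)"] exI[of _ "\<lambda>_. 0"])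
       (use pd 1 2 4 5 in simp_all)
qed

end
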